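(* For $0<\alpha<\pi$ let $\Phi^{(m_+,m_-)}_{max}(\alpha)$ be the maximum flux of self-similar (SS) solutions of type $(m_+,m_-)$ of the steady Navier--Stokes equations in the sector $K=\{(r\cos\theta,r\sin\theta):r>0,\ -\alpha<\theta<\alpha\}$ with no-slip boundary condition (see context). Write an SS solution as $\boldsymbol u=\frac{f(\theta)}{r}\boldsymbol e_r$. (1) If $0<\alpha<\frac{\pi}{2}$ and $\Phi=\Phi^{(1,0)}_{max}(\alpha)$, then there exists an SS solution of type $(1,0)$ with flux $\Phi$ such that $f'(\alpha)=f'(-\alpha)=0$. (2) $\Phi^{(0,1)}_{max}(\alpha)=0$ if $0<\alpha\le\frac{\pi}{2}$, and $\Phi^{(0,1)}_{max}(\alpha)<\frac{\pi^2}{\alpha}-4\alpha$ if $\frac{\pi}{2}<\alpha<\pi$. (3) If $\frac{\pi}{2}<\alpha<\pi$ and $\Phi=\Phi^{(0,1)}_{max}(\alpha)$, then there exists an SS solution of type $(0,1)$ with flux $\Phi$ such that $f'(\alpha)=f'(-\alpha)=0$. (4) $\Phi^{(1,1)}_{max}(\alpha)=\Phi^{(1,0)}_{max}(\alpha)$ if $0<\alpha<\frac{\pi}{2}$, and $\Phi^{(1,1)}_{max}(\alpha)=\Phi^{(0,1)}_{max}(\alpha)$ if $\frac{\pi}{2}\le\alpha<\pi$. (5) If $m\ge2$ is an integer, $0<\alpha<\pi$ and $\Phi=\Phi^{(m,m)}_{max}(\alpha)$, then there exists an SS solution of type $(m,0)$ with flux $\Phi$ such that $f'(\alpha)=f'(-\alpha)=0$.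 (6) If $0<\alpha\le\frac{\pi}{2}$ and $\Phi=\Phi^{(1,2)}_{max}(\alpha)$, then there exists an SS solution of type $(1,2)$ with flux $\Phi$. (7) If $m\ge2$ is an integer, $0<\alpha<\pi$ and $\Phi=\Phi^{(m,m+1)}_{max}(\alpha)$, then there exists an SS solution of type $(m,m+1)$ with flux $\Phi$.
   Context: In polar coordinates put $\boldsymbol e_r=(\cos\theta,\sin\theta)$, $\boldsymbol e_\theta=(-\sin\theta,\cos\theta)$, $\boldsymbol u=u^r\boldsymbol e_r+u^\theta\boldsymbol e_\theta$. The steady Navier--Stokes equations are $-\Delta\boldsymbol u+\boldsymbol u\cdot\nabla\boldsymbol u+\nabla p=0$, $\operatorname{div}\boldsymbol u=0$ in $K$, with no-slip condition $\boldsymbol u=0$ on $\partial K\setminus\{0\}$; solutions are understood classically (smooth in $\overline K\setminus\{0\}$). A solution is self-similar (SS) if $\boldsymbol u(x)=\lambda\boldsymbol u(\lambda x)$, $p(x)=\lambda^2p(\lambda x)$ for all $x\in K$, $\lambda>0$. Every such SS solution has $u^\theta\equiv0$, so $\boldsymbol u=\frac{f(\theta)}{r}\boldsymbol e_r$ with $f=r\,u^r$ and $f(\pm\alpha)=0$. Its flux is $\Phi=\int_{-\alpha}^{\alpha}f(\theta)\,d\theta$. Type: a non-trivial SS solution is of type $(m_+,m_-)$ if the number of (maximal) intervals of $\theta\in(-\alpha,\alpha)$ where $f>0$ is $m_+$ and the number where $f<0$ is $m_-$. Maximum flux: $\Phi^{(m_+,m_-)}_{max}(\alpha)$ denotes the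 threshold such that SS solutions of type $(m_+,m_-)$ with flux $\Phi$ exist for every $\Phi<\Phi^{(m_+,m_-)}_{max}(\alpha)$ (for type $(1,0)$: for every $0<\Phi<\Phi^{(1,0)}_{max}(\alpha)$) and do not exist for any $\Phi>\Phi^{(m_+,m_-)}_{max}(\alpha)$; equivalently it is the supremum of the fluxes of SS solutions of that type. For type $(1,0)$ it is considered only for $0<\alpha<\frac{\pi}{2}$. *)

theory Defs
  imports "HOL-Analysis.Analysis"
begin

section \<open>The sector and the polar frame\<close>

definition e_r :: "real \<Rightarrow> real^2" where
  "e_r \<theta> = vector [cos \<theta>, sin \<theta>]"

definition e_theta :: "real \<Rightarrow> real^2" where
  "e_theta \<theta> = vector [- sin \<theta>, cos \<theta>]"

definition sector :: "real \<Rightarrow> (real^2) set" where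
  "sector \<alpha> = {r *\<^sub>R e_r \<theta> | r \<theta>. r > 0 \<and> - \<alpha> < \<theta> \<and> \<theta> < \<alpha>}"

section \<open>Smoothness\<close>

text \<open>Meant for open \<open>S\<close>: all directional derivatives of order at most \<open>k\<close> exist
  and are continuous.\<close>

fun Ck_on :: "nat \<Rightarrow> 'a::real_normed_vector set \<Rightarrow> ('a \<Rightarrow> 'b::real_normed_vector) \<Rightarrow> bool" where
  "Ck_on 0 S f \<longleftrightarrow> continuous_on S f"
| "Ck_on (Suc k) S f \<longleftrightarrow>
     (\<forall>x\<in>S. f differentiable (at x)) \<and>
     (\<forall>v. Ck_on k S (\<lambda>x. frechet_derivative f (at x) v))"

text \<open>Smoothness on a set that need not be open, as the restriction of a smooth function on
  an open neighbourhood; only the values of \<open>f\<close> on \<open>S\<close> matter.\<close>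

definition smooth_on :: "'a::real_normed_vector set \<Rightarrow> ('a \<Rightarrow> 'b::real_normed_vector) \<Rightarrow> bool" where
  "smooth_on S f \<longleftrightarrow>
     (\<exists>U g. open U \<and> S \<subseteq> U \<and> (\<forall>x\<in>S. g x = f x) \<and> (\<forall>k. Ck_on k U g))"

section \<open>The steady Navier--Stokes equations\<close>

definition partial :: "2 \<Rightarrow> (real^2 \<Rightarrow> real) \<Rightarrow> real^2 \<Rightarrow> real" where
  "partial i g x = frechet_derivative g (at x) (axis i 1)"

definition laplacian :: "(real^2 \<Rightarrow> real) \<Rightarrow> real^2 \<Rightarrow> real" where
  "laplacian g x = (\<Sum>j\<in>UNIV. partial j (partial j g) x)"

definition divergence :: "(real^2 \<Rightarrow> real^2) \<Rightarrow> real^2 \<Rightarrow> real" where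
  "divergence u x = (\<Sum>j\<in>UNIV. partial j (\<lambda>y. u y $ j) x)"

definition navier_stokes_at :: "(real^2 \<Rightarrow> real^2) \<Rightarrow> (real^2 \<Rightarrow> real) \<Rightarrow> real^2 \<Rightarrow> bool" where
  "navier_stokes_at u p x \<longleftrightarrow>
     (\<forall>i. - laplacian (\<lambda>y. u y $ i) x
          + (\<Sum>j\<in>UNIV. u x $ j * partial j (\<lambda>y. u y $ i) x)
          + partial i p x = 0) \<and>
     divergence u x = 0"

text \<open>The values of \<open>u\<close> and \<open>p\<close> outside \<open>closure (sector \<alpha>) - {0}\<close> are irrelevant.\<close>

definition ns_solution :: "real \<Rightarrow> (real^2 \<Rightarrow> real^2) \<Rightarrow> (real^2 \<Rightarrow> real) \<Rightarrow> bool" where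
  "ns_solution \<alpha> u p \<longleftrightarrow>
     smooth_on (closure (sector \<alpha>) - {0}) u \<and>
     smooth_on (closure (sector \<alpha>) - {0}) p \<and>
     (\<forall>x\<in>sector \<alpha>. navier_stokes_at u p x) \<and>
     (\<forall>x\<in>frontier (sector \<alpha>) - {0}. u x = 0)"

definition ss_solution :: "real \<Rightarrow> (real^2 \<Rightarrow> real^2) \<Rightarrow> (real^2 \<Rightarrow> real) \<Rightarrow> bool" where
  "ss_solution \<alpha> u p \<longleftrightarrow>
     ns_solution \<alpha> u p \<and>
     (\<forall>x\<in>sector \<alpha>. \<forall>l>0. u x = l *\<^sub>R u (l *\<^sub>R x) \<and> p x = l\<^sup>2 * p (l *\<^sub>R x))"

section \<open>Profile, flux, type and maximum flux\<close>

text \<open>The function \<open>f = r u\<^sup>r\<close>, evaluated at \<open>r = 1\<close>; by \<open>ss_solution_radial\<close> below, a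
  self-similar solution is \<open>u = (f(\<theta>) / r) e\<^sub>r\<close>.\<close>

definition profile :: "(real^2 \<Rightarrow> real^2) \<Rightarrow> real \<Rightarrow> real" where
  "profile u \<theta> = u (e_r \<theta>) \<bullet> e_r \<theta>"

definition flux :: "real \<Rightarrow> (real^2 \<Rightarrow> real^2) \<Rightarrow> real" where
  "flux \<alpha> u = integral {-\<alpha>..\<alpha>} (profile u)"

text \<open>The maximal intervals are the connected components. Finiteness is required explicitly
  because \<open>card\<close> of an infinite set is \<open>0\<close>.\<close>

definition has_type :: "real \<Rightarrow> (real^2 \<Rightarrow> real^2) \<Rightarrow> nat \<Rightarrow> nat \<Rightarrow> bool" where
  "has_type \<alpha> u mp mm \<longleftrightarrow>
     (\<exists>x\<in>sector \<alpha>. u x \<noteq> 0) \<and>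
     finite (components {\<theta> \<in> {-\<alpha><..<\<alpha>}. profile u \<theta> > 0}) \<and>
     card (components {\<theta> \<in> {-\<alpha><..<\<alpha>}. profile u \<theta> > 0}) = mp \<and>
     finite (components {\<theta> \<in> {-\<alpha><..<\<alpha>}. profile u \<theta> < 0}) \<and>
     card (components {\<theta> \<in> {-\<alpha><..<\<alpha>}. profile u \<theta> < 0}) = mm"

definition fluxes :: "real \<Rightarrow> nat \<Rightarrow> nat \<Rightarrow> real set" where
  "fluxes \<alpha> mp mm = {flux \<alpha> u | u p. ss_solution \<alpha> u p \<and> has_type \<alpha> u mp mm}"

text \<open>The supremum is taken in \<open>ereal\<close>, so that it is meaningful without first knowing that the
  set of fluxes is nonempty and bounded above.\<close>

definition max_flux :: "real \<Rightarrow> nat \<Rightarrow> nat \<Rightarrow> ereal" where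
  "max_flux \<alpha> mp mm = (SUP \<Phi>\<in>fluxes \<alpha> mp mm. ereal \<Phi>)"

text \<open>A threshold between existence and non-existence is the maximum flux. The lower bound \<open>a\<close>
  covers type \<open>(1,0)\<close>, where existence is only claimed for \<open>0 < \<Phi>\<close>.\<close>

lemma max_flux_eq_threshold:
  assumes "a < \<Phi>\<^sub>0"
    and exist: "\<And>\<Phi>. a < \<Phi> \<Longrightarrow> \<Phi> < \<Phi>\<^sub>0 \<Longrightarrow> \<Phi> \<in> fluxes \<alpha> mp mm"
    and non_exist: "\<And>\<Phi>. \<Phi>\<^sub>0 < \<Phi> \<Longrightarrow> \<Phi> \<notin> fluxes \<alpha> mp mm"
  shows "max_flux \<alpha> mp mm = ereal \<Phi>\<^sub>0"
  unfolding max_flux_def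
proof (rule antisym)
  show "(SUP \<Phi>\<in>fluxes \<alpha> mp mm. ereal \<Phi>) \<le> ereal \<Phi>\<^sub>0"
    using non_exist by (intro SUP_least) (force simp: not_less[symmetric])
  show "ereal \<Phi>\<^sub>0 \<le> (SUP \<Phi>\<in>fluxes \<alpha> mp mm. ereal \<Phi>)"
  proof (rule dense_le)
    fix y assume y: "y < ereal \<Phi>\<^sub>0"
    have "max y (ereal a) < ereal \<Phi>\<^sub>0"
      using y assms(1) by simp
    then obtain z where z: "max y (ereal a) < ereal z" "ereal z < ereal \<Phi>\<^sub>0"
      using ereal_dense2 by blast
    then have "z \<in> fluxes \<alpha> mp mm"
      using exist by simp
    then show "y \<le> (SUP \<Phi>\<in>fluxes \<alpha> mp mm. ereal \<Phi>)"
      using z(1) by (intro SUP_upper2[of z]) auto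
  qed
qed

section \<open>Self-similar solutions are radial\<close>

lemma e_r_inner [simp]: "e_r \<theta> \<bullet> e_r \<theta> = 1" "e_theta \<theta> \<bullet> e_theta \<theta> = 1"
    "e_r \<theta> \<bullet> e_theta \<theta> = 0" "e_theta \<theta> \<bullet> e_r \<theta> = 0"
  by (simp_all add: e_r_def e_theta_def inner_vec_def sum_2 flip: power2_eq_square)

lemma polar_expand: "x = (x \<bullet> e_r \<theta>) *\<^sub>R e_r \<theta> + (x \<bullet> e_theta \<theta>) *\<^sub>R e_theta \<theta>"
proof -
  have "c * (c*a + s*b) + s*(s*a - c*b) = a" "s * (c*a + s*b) - c*(s*a - c*b) = b"
    if "c\<^sup>2 + s\<^sup>2 = 1" for a b c s :: real
    using that by algebra+
  from this[OF sin_cos_squared_add2[of \<theta>], of "x$1" "x$2"] show ?thesis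
    by (simp add: e_r_def e_theta_def inner_vec_def sum_2 vec_eq_iff forall_2 algebra_simps)
qed

lemma e_r_eq_axis: "e_r \<theta> = cos \<theta> *\<^sub>R axis 1 1 + sin \<theta> *\<^sub>R axis 2 1"
  and e_theta_eq_axis: "e_theta \<theta> = (- sin \<theta>) *\<^sub>R axis 1 1 + cos \<theta> *\<^sub>R axis 2 1"
  by (simp_all add: e_r_def e_theta_def vec_eq_iff forall_2 axis_def)

lemma has_vector_derivative_e_r: "(e_r has_vector_derivative e_theta \<theta>) (at \<theta> within S)"
  and has_vector_derivative_e_theta: "(e_theta has_vector_derivative - e_r \<theta>) (at \<theta> within S)"
  unfolding e_r_eq_axis[abs_def] e_theta_eq_axis[abs_def]
  by (auto intro!: derivative_eq_intros simp: has_real_derivative_iff_has_vector_derivative[symmetric])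

lemma sectorI: "r > 0 \<Longrightarrow> - \<alpha> < \<theta> \<Longrightarrow> \<theta> < \<alpha> \<Longrightarrow> r *\<^sub>R e_r \<theta> \<in> sector \<alpha>"
  unfolding sector_def by blast

lemma mem_sector_iff_Arg:
  assumes "0 < \<alpha>" "\<alpha> < pi"
  shows "x \<in> sector \<alpha> \<longleftrightarrow>
    Complex (x$1) (x$2) \<notin> \<real>\<^sub>\<le>\<^sub>0 \<and> \<bar>Arg (Complex (x$1) (x$2))\<bar> < \<alpha>"
proof
  assume "x \<in> sector \<alpha>"
  then obtain r \<theta> where x: "x = r *\<^sub>R e_r \<theta>" "r > 0" "-\<alpha> < \<theta>" "\<theta> < \<alpha>"
    unfolding sector_def by blast
  have z: "Complex (x$1) (x$2) = rcis r \<theta>"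
    by (simp add: x e_r_def complex_eq_iff)
  have "Arg (rcis r \<theta>) = \<theta>"
    using x assms Arg_rcis by auto
  moreover have "rcis r \<theta> \<notin> \<real>\<^sub>\<le>\<^sub>0"
  proof
    assume "rcis r \<theta> \<in> \<real>\<^sub>\<le>\<^sub>0"
    then have "Re (rcis r \<theta>) \<le> 0" "Im (rcis r \<theta>) = 0"
      by (simp_all only: complex_nonpos_Reals_iff)
    moreover have "rcis r \<theta> \<noteq> 0" using x by simp
    ultimately have "Arg (rcis r \<theta>) = pi"
      by (auto simp only: Arg_eq_pi complex_eq_iff order_le_less zero_complex.sel)
    with \<open>Arg (rcis r \<theta>) = \<theta>\<close> show False using x assms by simp
  qed
  ultimately show "Complex (x$1) (x$2) \<notin> \<real>\<^sub>\<le>\<^sub>0 \<and> \<bar>Arg (Complex (x$1) (x$2))\<bar> < \<alpha>"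
    using x unfolding z by auto
next
  let ?z = "Complex (x$1) (x$2)"
  assume z: "?z \<notin> \<real>\<^sub>\<le>\<^sub>0 \<and> \<bar>Arg ?z\<bar> < \<alpha>"
  then have nz: "norm ?z > 0" by auto
  have "?z = rcis (norm ?z) (Arg ?z)" by (simp add: rcis_cmod_Arg)
  from arg_cong[OF this, of Re] arg_cong[OF this, of Im]
  have "x$1 = norm ?z * cos (Arg ?z)" "x$2 = norm ?z * sin (Arg ?z)"
    by (simp_all only: Re_rcis Im_rcis complex.sel)
  then have "x = norm ?z *\<^sub>R e_r (Arg ?z)"
    by (simp add: vec_eq_iff forall_2 e_r_def)
  then show "x \<in> sector \<alpha>"
    using sectorI[OF nz, of \<alpha> "Arg ?z"] z by auto
qed

lemma open_sector:
  assumes "0 < \<alpha>" "\<alpha> < pi"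
  shows "open (sector \<alpha>)"
proof -
  let ?c = "\<lambda>x::real^2. Complex (x$1) (x$2)"
  have "continuous_on (- \<real>\<^sub>\<le>\<^sub>0) Arg"
    using continuous_at_Arg by (simp add: continuous_at_imp_continuous_on)
  then have 1: "open (Arg -` {-\<alpha><..<\<alpha>} \<inter> - \<real>\<^sub>\<le>\<^sub>0)"
    by (subst (asm) continuous_on_open_vimage) (auto simp: open_Compl)
  have c: "continuous_on UNIV ?c"
    unfolding Complex_eq by (intro continuous_intros)
  have "sector \<alpha> = ?c -` (Arg -` {-\<alpha><..<\<alpha>} \<inter> - \<real>\<^sub>\<le>\<^sub>0)"
  proof (intro set_eqI)
    fix x :: "real^2"
    show "x \<in> sector \<alpha> \<longleftrightarrow> x \<in> ?c -` (Arg -` {-\<alpha><..<\<alpha>} \<inter> - \<real>\<^sub>\<le>\<^sub>0)"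
      unfolding mem_sector_iff_Arg[OF assms] abs_less_iff vimage_def Int_iff Compl_iff mem_Collect_eq
        greaterThanLessThan_iff by argo
  qed
  then show ?thesis
    using open_vimage[OF 1 c] by (simp only:)
qed

lemma e_r_alpha_frontier:
  assumes "0 < \<alpha>" "\<alpha> < pi"
  shows "e_r \<alpha> \<in> frontier (sector \<alpha>) - {0}"
proof -
  have "e_r \<alpha> \<notin> sector \<alpha>"
  proof -
    have "Complex (e_r \<alpha> $ 1) (e_r \<alpha> $ 2) = rcis 1 \<alpha>"
      by (simp add: e_r_def complex_eq_iff)
    moreover have "Arg (rcis 1 \<alpha>) = \<alpha>" using assms Arg_rcis by auto
    ultimately show ?thesis using mem_sector_iff_Arg[OF assms] assms by simp
  qed
  moreover have "e_r \<alpha> \<in> closure (sector \<alpha>)"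
  proof (rule Lim_in_closed_set[OF closed_closure])
    show "(e_r \<longlongrightarrow> e_r \<alpha>) (at_left \<alpha>)"
      using has_vector_derivative_continuous[OF has_vector_derivative_e_r]
      by (simp add: continuous_within)
    have "eventually (\<lambda>\<theta>. \<theta> \<in> {-\<alpha><..<\<alpha>}) (at_left \<alpha>)"
      using assms by (intro eventually_at_leftI[of "-\<alpha>"]) auto
    then show "eventually (\<lambda>\<theta>. e_r \<theta> \<in> closure (sector \<alpha>)) (at_left \<alpha>)"
      by eventually_elim (use sectorI[of 1] closure_subset in fastforce)
  qed auto
  moreover have "e_r \<alpha> \<noteq> 0" using e_r_inner(1)[of \<alpha>] by force
  ultimately show ?thesis
    using open_sector[OF assms] by (simp add: frontier_def interior_open)
qed

lemma ss_solution_radial: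
  assumes "0 < \<alpha>" "\<alpha> < pi" and ss: "ss_solution \<alpha> u p"
    and "r > 0" "-\<alpha> < \<theta>" "\<theta> < \<alpha>"
  shows "u (r *\<^sub>R e_r \<theta>) = (profile u \<theta> / r) *\<^sub>R e_r \<theta>"
proof -
  let ?S = "sector \<alpha>" and ?C = "closure (sector \<alpha>) - {0}"
  define g where "g \<phi> = u (e_r \<phi>) \<bullet> e_theta \<phi>" for \<phi>
  have er0: "e_r \<phi> \<noteq> 0" for \<phi> using e_r_inner(1)[of \<phi>] by force
  have SC: "?S \<subseteq> ?C" 
  proof
    fix x assume "x \<in> ?S"
    then obtain r \<theta> where "x = r *\<^sub>R e_r \<theta>" "r > 0" unfolding sector_def by blast
    with er0 have "x \<noteq> 0" by simp
    with \<open>x \<in> ?S\<close> show "x \<in> ?C" using closure_subset by blast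
  qed
  have ns: "ns_solution \<alpha> u p" using ss by (simp add: ss_solution_def)
  then obtain U G where G: "open U" "?C \<subseteq> U" "\<And>x. x \<in> ?C \<Longrightarrow> G x = u x" "\<And>k. Ck_on k U G"
    unfolding ns_solution_def smooth_on_def by metis
  have diffu: "u differentiable (at x)" if "x \<in> ?S" for x
  proof -
    have "G differentiable (at x)" using G(4)[of 1] G(2) SC that by auto
    then obtain D where "(G has_derivative D) (at x)" by (auto simp: differentiable_def)
    then have "(u has_derivative D) (at x)"
      by (rule has_derivative_transform_within_open[OF _ open_sector[OF assms(1,2)] that])
        (use G(3) SC in auto)
    then show ?thesis by (auto simp: differentiable_def)
  qed
  have contu: "continuous_on ?C u"
  proof (rule continuous_on_eq)
    show "continuous_on ?C G"
      using G(4)[of 0] G(2) continuous_on_subset by auto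
  qed (use G(3) in auto)
  have scale: "u x = l *\<^sub>R u (l *\<^sub>R x)" if "x \<in> ?S" "l > 0" for x l
    using ss that by (auto simp: ss_solution_def)
  have g': "(g has_vector_derivative 0) (at \<phi>)" if \<phi>: "\<phi> \<in> {-\<alpha><..<\<alpha>}" for \<phi>
  proof -
    let ?x = "e_r \<phi>"
    have x: "?x \<in> ?S" using sectorI[of 1 \<alpha> \<phi>] \<phi> by simp
    define D where "D = frechet_derivative u (at ?x)"
    have D: "(u has_derivative D) (at ?x)"
      using diffu[OF x] by (simp add: D_def frechet_derivative_works)
    have lin: "linear D" using D has_derivative_linear by blast
    have "((\<lambda>l. u (l *\<^sub>R ?x)) has_derivative (\<lambda>h. D (h *\<^sub>R ?x))) (at 1)"
      by (rule has_derivative_compose[of "\<lambda>l. l *\<^sub>R ?x" "\<lambda>h. h *\<^sub>R ?x" 1 UNIV u D])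
        (auto intro!: derivative_eq_intros simp: D)
    then have "((\<lambda>l. l *\<^sub>R u (l *\<^sub>R ?x)) has_derivative (\<lambda>h. 1 *\<^sub>R D (h *\<^sub>R ?x) + h *\<^sub>R u (1 *\<^sub>R ?x))) (at 1)"
      by (intro has_derivative_scaleR) auto
    moreover have "((\<lambda>l. l *\<^sub>R u (l *\<^sub>R ?x)) has_derivative (\<lambda>h. 0)) (at 1)"
      by (rule has_derivative_transform_within_open[OF has_derivative_const open_greaterThan[of 0]])
        (use scale[OF x] in auto)
    ultimately have "(\<lambda>h. 1 *\<^sub>R D (h *\<^sub>R ?x) + h *\<^sub>R u (1 *\<^sub>R ?x)) = (\<lambda>h. 0)"
      by (rule has_derivative_unique)
    from fun_cong[OF this, of 1] have Dx: "D ?x = - u ?x"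
      by (simp add: eq_neg_iff_add_eq_0)
    have "frechet_derivative (\<lambda>y. u y $ j) (at ?x) = (\<lambda>v. D v $ j)" for j
      by (rule frechet_derivative_at[symmetric]) (rule bounded_linear.has_derivative[OF bounded_linear_vec_nth D])
    then have "D (axis 1 1) $ 1 + D (axis 2 1) $ 2 = divergence u ?x"
      by (simp add: divergence_def partial_def sum_2)
    also have "\<dots> = 0"
      using ns x by (auto simp: ns_solution_def navier_stokes_at_def)
    finally have div: "D (axis 1 1) $ 1 + D (axis 2 1) $ 2 = 0" .
    have tr: "D (e_r \<phi>) \<bullet> e_r \<phi> + D (e_theta \<phi>) \<bullet> e_theta \<phi> = D (axis 1 1) $ 1 + D (axis 2 1) $ 2"
    proof -
      have "(c * a11 + s * a21) * c + (c * a12 + s * a22) * s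
          + (- s * a11 + c * a21) * (- s) + (- s * a12 + c * a22) * c = a11 + a22"
        if "c\<^sup>2 + s\<^sup>2 = 1" for c s a11 a12 a21 a22 :: real
      proof -
        have "(c * a11 + s * a21) * c + (c * a12 + s * a22) * s
          + (- s * a11 + c * a21) * (- s) + (- s * a12 + c * a22) * c = (c\<^sup>2 + s\<^sup>2) * (a11 + a22)"
          by (simp add: power2_eq_square algebra_simps)
        then show ?thesis by (simp add: that)
      qed
      from this[OF sin_cos_squared_add2[of \<phi>], of "D (axis 1 1) $ 1" "D (axis 2 1) $ 1"
          "D (axis 1 1) $ 2" "D (axis 2 1) $ 2"]
      show ?thesis
        unfolding e_r_eq_axis e_theta_eq_axis
        by (simp only: linear_add[OF lin] linear_scale[OF lin])
          (simp add: inner_vec_def sum_2 axis_def algebra_simps)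
    qed
    have "((\<lambda>\<phi>. u (e_r \<phi>)) has_vector_derivative D (e_theta \<phi>)) (at \<phi>)"
    proof -
      have "((\<lambda>\<phi>. u (e_r \<phi>)) has_derivative (\<lambda>h. D (h *\<^sub>R e_theta \<phi>))) (at \<phi>)"
        by (rule has_derivative_compose[OF has_vector_derivative_e_r[unfolded has_vector_derivative_def] D])
      then show ?thesis by (simp add: has_vector_derivative_def linear_scale[OF lin])
    qed
    from bounded_bilinear.has_vector_derivative[OF bounded_bilinear_inner this has_vector_derivative_e_theta]
    have "(g has_vector_derivative (u ?x \<bullet> - e_r \<phi> + D (e_theta \<phi>) \<bullet> e_theta \<phi>)) (at \<phi>)"
      unfolding g_def[abs_def] .
    moreover have "u ?x \<bullet> - e_r \<phi> + D (e_theta \<phi>) \<bullet> e_theta \<phi> = 0"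
      using tr div Dx by simp
    ultimately show ?thesis by simp
  qed
  have C: "e_r \<phi> \<in> ?C" if "\<phi> \<in> {\<theta>..\<alpha>}" for \<phi>
  proof (cases "\<phi> = \<alpha>")
    case True
    then show ?thesis using e_r_alpha_frontier[OF assms(1,2)] by (auto simp: frontier_def)
  next
    case False
    then show ?thesis using SC sectorI[of 1 \<alpha> \<phi>] that assms by auto
  qed
  have "continuous_on {\<theta>..\<alpha>} g"
    unfolding g_def[abs_def]
  proof (intro continuous_on_inner)
    have "continuous_on {\<theta>..\<alpha>} e_r"
      by (rule continuous_on_vector_derivative) (rule has_vector_derivative_e_r)
    then show "continuous_on {\<theta>..\<alpha>} (\<lambda>\<phi>. u (e_r \<phi>))"
      by (rule continuous_on_compose2[OF contu]) (intro image_subsetI C)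
    show "continuous_on {\<theta>..\<alpha>} e_theta"
      by (rule continuous_on_vector_derivative) (rule has_vector_derivative_e_theta)
  qed
  then have "g \<alpha> = g \<theta>"
    using g' assms
    by (intro DERIV_isconst_end[of \<theta> \<alpha> g])
      (auto simp: has_real_derivative_iff_has_vector_derivative)
  moreover have "g \<alpha> = 0"
    using e_r_alpha_frontier[OF assms(1,2)] ns by (simp add: g_def ns_solution_def)
  ultimately have "u (e_r \<theta>) \<bullet> e_theta \<theta> = 0"
    by (simp add: g_def)
  then have "u (e_r \<theta>) = profile u \<theta> *\<^sub>R e_r \<theta>"
    unfolding profile_def by (metis polar_expand add_0_right scaleR_zero_left)
  moreover have "u (r *\<^sub>R e_r \<theta>) = (1 / r) *\<^sub>R u ((1 / r) *\<^sub>R r *\<^sub>R e_r \<theta>)"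
    using assms by (intro scale sectorI) auto
  ultimately show ?thesis using assms(4) by simp
qed

end

theory Submission
  imports Defs
begin

text \<open>The profile of a self-similar solution satisfies \<open>f'' = K - 4 f - f\<^sup>2\<close>, hence
  \<open>f'\<^sup>2 = C + 2 K f - 4 f\<^sup>2 - 2/3 f\<^sup>3\<close>. All positive humps of a profile are congruent, and so are all
  negative ones. A hump is determined by its extremum \<open>a\<close> and the scaled squared slope
  \<open>s = 3/2 C / a\<^sup>2\<close>, and its width and flux are elliptic integrals in \<open>(a, s)\<close>. Profiles with both
  signs are parametrised by their maximum \<open>a\<close> and minimum \<open>-b\<close>, where \<open>2 b < 6 + a\<close>: for type
  \<open>(m, m)\<close> the angle \<open>\<alpha>\<close> is \<open>m\<close> half-periods, for type \<open>(m, m + 1)\<close> the half-width of a negative hump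
  is added.

  Among single humps of a given width the flux is largest for \<open>s = 0\<close>. Among the pairs \<open>(a, b)\<close> with
  a given half-period the flux is largest on the boundary \<open>a b = 0\<close>. So the maximum flux of type
  \<open>(m, m)\<close> is attained in the limit by profiles of a single sign whose humps touch zero without
  slope. For type \<open>(m, m + 1)\<close> the boundary point \<open>b = 0\<close> is not optimal, since inserting a small
  negative hump allows the positive ones to grow, and the flux becomes negative as \<open>a\<close> tends to
  infinity. A maximiser therefore exists in the interior of the parameter region.\<close>

section \<open>Smoothness of iterated directional derivatives\<close>

text \<open>Profiles with both signs are compared at a fixed half-period L through the modulus y =
  (a + b) / (6 + a - 2 b). With P the flux over a period, L (P + 4 L) is a strictly decreasing
  function R of y alone, so a large flux means a small y, and y is smallest where a or b vanishes. L
  equals pi/2 at a = b = 0, decreases in a and increases in b; hence the optimal boundary point has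
  b = 0 for L < pi/2 and a = 0 for L > pi/2. This is the origin of the threshold pi/2, and R(0) =
  pi^2 gives the bound pi^2/\<alpha> - 4 \<alpha>. For a single hump the case s > 0 is compared with
  s = 0 by a correlation inequality instead. The first integral alone also admits functions that
  rest on a plateau; these are excluded with the second-order equation, and a double root at the
  extremum by a Gronwall estimate. For type (m, m + 1) the parameter region is open; compactness
  comes from a superlevel set of the flux above the boundary value, which stays away from every
  edge.\<close>

lemma Ck_on_Suc_imp: "Ck_on (Suc k) S f \<Longrightarrow> Ck_on k S f"
proof (induction k arbitrary: f)
  case 0
  then show ?case
    by (auto intro!: continuous_at_imp_continuous_on differentiable_imp_continuous_within)
qed auto

lemma Ck_on_subset: "Ck_on k S f \<Longrightarrow> T \<subseteq> S \<Longrightarrow> Ck_on k T f"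
  by (induction k arbitrary: f) (auto intro: continuous_on_subset)

text \<open>Openness of \<open>S\<close> matters: \<open>frechet_derivative\<close> at a point sees
  a whole neighbourhood of it.\<close>

lemma Ck_on_cong:
  assumes "open S" "\<And>x. x \<in> S \<Longrightarrow> f x = g x" "Ck_on k S f"
  shows "Ck_on k S g"
  using assms(2,3)
proof (induction k arbitrary: f g)
  case 0
  then show ?case by (auto cong: continuous_on_cong)
next
  case (Suc k)
  have "g differentiable at x" if "x \<in> S" for x
    using Suc.prems that has_derivative_transform_within_open[OF _ assms(1) that]
    unfolding Ck_on.simps differentiable_def by metis
  moreover have "Ck_on k S (\<lambda>x. frechet_derivative g (at x) v)" for v
  proof (rule Suc.IH)
    show "Ck_on k S (\<lambda>x. frechet_derivative f (at x) v)"
      using Suc.prems by simp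
    fix x assume "x \<in> S"
    then show "frechet_derivative f (at x) v = frechet_derivative g (at x) v"
      using Suc.prems assms(1) by (subst frechet_derivative_transform_within_open) auto
  qed
  ultimately show ?case by simp
qed

lemma Ck_on_const: "Ck_on k S (\<lambda>x. c)"
proof (induction k arbitrary: c)
  case (Suc k)
  have "frechet_derivative (\<lambda>x. c) (at x) = (\<lambda>v. 0)" for x :: 'a
    by (rule frechet_derivative_const)
  then show ?case using Suc by simp
qed simp

lemma Ck_on_bounded_linear:
  assumes "bounded_linear f"
  shows "Ck_on k S f"
proof (cases k)
  case 0
  then show ?thesis using assms by (simp add: linear_continuous_on)
next
  case (Suc j)
  have d: "(f has_derivative f) (at x)" for x
    using assms by (rule bounded_linear_imp_has_derivative)
  then have "frechet_derivative f (at x) = f" for x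
    using frechet_derivative_at by metis
  then show ?thesis
    using d Suc by (auto simp: Ck_on_const differentiable_def)
qed

lemma Ck_on_add:
  assumes "open S" "Ck_on k S f" "Ck_on k S g"
  shows "Ck_on k S (\<lambda>x. f x + g x)"
  using assms(2,3)
proof (induction k arbitrary: f g)
  case (Suc k)
  have D: "((\<lambda>x. f x + g x) has_derivative (\<lambda>v. frechet_derivative f (at x) v
      + frechet_derivative g (at x) v)) (at x)" if "x \<in> S" for x
    using Suc.prems that by (intro has_derivative_add) (auto simp: frechet_derivative_works[symmetric])
  have "Ck_on k S (\<lambda>x. frechet_derivative (\<lambda>x. f x + g x) (at x) v)" for v
  proof (rule Ck_on_cong[OF assms(1)])
    show "Ck_on k S (\<lambda>x. frechet_derivative f (at x) v + frechet_derivative g (at x) v)"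
      using Suc.prems unfolding Ck_on.simps by (intro Suc.IH; blast)
    show "frechet_derivative f (at x) v + frechet_derivative g (at x) v =
         frechet_derivative (\<lambda>x. f x + g x) (at x) v" if "x \<in> S" for x
      using fun_cong[OF frechet_derivative_at[OF D[OF that]], of v] by simp
  qed
  then show ?case using D by (auto simp: differentiable_def)
qed (auto intro: continuous_intros)

text \<open>Stated for \<open>*\<^sub>R\<close>, so that one product rule serves real factors and
  the vector field.\<close>

lemma Ck_on_scaleR:
  fixes f :: "'a::real_normed_vector \<Rightarrow> real"
  assumes "open S" "Ck_on k S f" "Ck_on k S g"
  shows "Ck_on k S (\<lambda>x. f x *\<^sub>R g x)"
  using assms(2,3)
proof (induction k arbitrary: f g)
  case (Suc k)
  have D: "((\<lambda>x. f x *\<^sub>R g x) has_derivative (\<lambda>v. f x *\<^sub>R frechet_derivative g (at x) v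
      + frechet_derivative f (at x) v *\<^sub>R g x)) (at x)" if "x \<in> S" for x
    using Suc.prems that by (intro has_derivative_scaleR) (auto simp: frechet_derivative_works[symmetric])
  have "Ck_on k S (\<lambda>x. frechet_derivative (\<lambda>x. f x *\<^sub>R g x) (at x) v)" for v
  proof (rule Ck_on_cong[OF assms(1)])
    show "Ck_on k S (\<lambda>x. f x *\<^sub>R frechet_derivative g (at x) v
      + frechet_derivative f (at x) v *\<^sub>R g x)"
      using Suc.prems
      by (intro Ck_on_add assms(1) Suc.IH Ck_on_Suc_imp[of k S f] Ck_on_Suc_imp[of k S g])
        (simp_all only: Ck_on.simps, blast+)
    show "f x *\<^sub>R frechet_derivative g (at x) v + frechet_derivative f (at x) v *\<^sub>R g x =
         frechet_derivative (\<lambda>x. f x *\<^sub>R g x) (at x) v" if "x \<in> S" for x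
      using fun_cong[OF frechet_derivative_at[OF D[OF that]], of v] by simp
  qed
  then show ?case using D by (auto simp: differentiable_def)
qed (auto intro: continuous_intros)

lemmas Ck_on_mult = Ck_on_scaleR[where 'b = real, unfolded real_scaleR_def]

text \<open>The derivative of 1/|x|^2 in direction v is a linear function times the square of
  1/|x|^2, so the induction on the order closes on the function itself.\<close>

lemma Ck_on_inverse_inner:
  assumes "open S" "0 \<notin> S"
  shows "Ck_on k S (\<lambda>x. 1 / (x \<bullet> x))"
proof (induction k)
  case 0
  then show ?case using assms by (auto intro!: continuous_intros)
next
  case (Suc k)
  have D: "((\<lambda>x. 1 / (x \<bullet> x)) has_derivative (\<lambda>v. (- 2 * (x \<bullet> v)) * (1 / (x \<bullet> x) * (1 / (x \<bullet> x))))) (at x)"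
    if "x \<in> S" for x
  proof -
    have "x \<bullet> x \<noteq> 0" using that assms by auto
    then show ?thesis
      by (auto intro!: derivative_eq_intros simp: inner_commute field_simps)
  qed
  have "Ck_on k S (\<lambda>x. frechet_derivative (\<lambda>x. 1 / (x \<bullet> x)) (at x) v)" for v
  proof (rule Ck_on_cong[OF assms(1)])
    show "Ck_on k S (\<lambda>x. (- 2 * (x \<bullet> v)) * (1 / (x \<bullet> x) * (1 / (x \<bullet> x))))"
      by (intro Ck_on_mult assms Suc Ck_on_bounded_linear bounded_linear_intros)
    show "(- 2 * (x \<bullet> v)) * (1 / (x \<bullet> x) * (1 / (x \<bullet> x))) =
         frechet_derivative (\<lambda>x. 1 / (x \<bullet> x)) (at x) v" if "x \<in> S" for x
      using fun_cong[OF frechet_derivative_at[OF D[OF that]], of v] by simp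
  qed
  then show ?case using D by (auto simp: differentiable_def)
qed

section \<open>The polar angle\<close>

text \<open>The plane without the nonpositive real axis, where \<open>Arg\<close> is differentiable.
  For \<alpha> < pi it is an open neighbourhood of the closed sector minus the origin, as
  \<open>smooth_on\<close> asks for.\<close>

definition slit_plane :: "(real^2) set" where
  "slit_plane = {x. Complex (x$1) (x$2) \<notin> \<real>\<^sub>\<le>\<^sub>0}"

definition polar_angle :: "real^2 \<Rightarrow> real" where
  "polar_angle x = Arg (Complex (x$1) (x$2))"

lemma zero_notin_slit_plane: "0 \<notin> slit_plane"
proof -
  have "Complex 0 0 = 0" by (simp add: complex_eq_iff)
  then show ?thesis by (simp add: slit_plane_def)
qed

lemma bounded_linear_Complex: "bounded_linear (\<lambda>x::real^2. Complex (x$1) (x$2))"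
  unfolding Complex_eq
  by (intro bounded_linear_add bounded_linear_const_mult
      bounded_linear_compose[OF bounded_linear_of_real bounded_linear_vec_nth])

lemma open_slit_plane: "open slit_plane"
proof -
  have "slit_plane = (\<lambda>x::real^2. Complex (x$1) (x$2)) -` (- \<real>\<^sub>\<le>\<^sub>0)"
    by (auto simp: slit_plane_def)
  then show ?thesis
    using open_vimage[of "- \<real>\<^sub>\<le>\<^sub>0" "\<lambda>x::real^2. Complex (x$1) (x$2)"]
      linear_continuous_on[OF bounded_linear_Complex] by (simp add: open_Compl)
qed

lemma inner_eq_cart: "(x::real^2) \<bullet> x = (x$1)\<^sup>2 + (x$2)\<^sup>2"
  by (simp add: inner_vec_def sum_2 power2_eq_square)

lemma slit_plane_inner_pos: "x \<in> slit_plane \<Longrightarrow> x \<bullet> x > 0"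
  using zero_notin_slit_plane by auto

text \<open>The angle is the imaginary part of the complex logarithm, whose derivative is
  1/z.\<close>

lemma has_derivative_polar_angle:
  assumes "x \<in> slit_plane"
  shows "(polar_angle has_derivative (\<lambda>v. (x$1 * v$2 - x$2 * v$1) / (x \<bullet> x))) (at x)"
proof -
  let ?c = "\<lambda>x::real^2. Complex (x$1) (x$2)"
  have "?c x \<notin> \<real>\<^sub>\<le>\<^sub>0" using assms by (simp add: slit_plane_def)
  then have "(Ln has_derivative (\<lambda>h. inverse (?c x) * h)) (at (?c x))"
    using has_field_derivative_Ln has_field_derivative_def by blast
  from has_derivative_compose[OF bounded_linear_imp_has_derivative[OF bounded_linear_Complex] this]
  have "((\<lambda>x. Im (Ln (?c x))) has_derivative (\<lambda>v. Im (inverse (?c x) * ?c v))) (at x)"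
    by (rule bounded_linear.has_derivative[OF bounded_linear_Im])
  moreover have "Im (inverse (?c x) * ?c v) = (x$1 * v$2 - x$2 * v$1) / (x \<bullet> x)" for v
    by (simp add: inner_eq_cart complex_inverse diff_divide_distrib)
  ultimately have "((\<lambda>x. Im (Ln (?c x))) has_derivative (\<lambda>v. (x$1 * v$2 - x$2 * v$1) / (x \<bullet> x))) (at x)"
    by simp
  then show ?thesis
    by (rule has_derivative_transform_within_open[OF _ open_slit_plane assms])
      (auto simp: polar_angle_def slit_plane_def intro!: Arg_eq_Im_Ln[symmetric])
qed

lemma has_derivative_comp_polar_angle:
  assumes "x \<in> slit_plane" "(h has_real_derivative d) (at (polar_angle x))"
  shows "((\<lambda>y. h (polar_angle y)) has_derivative (\<lambda>v. d * ((x$1 * v$2 - x$2 * v$1) / (x \<bullet> x)))) (at x)"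
  by (rule has_derivative_compose[OF has_derivative_polar_angle[OF assms(1)]
        assms(2)[unfolded has_field_derivative_def]])

text \<open>The equation expresses f'' by f, so two derivatives yield all orders: differentiation
  leads from f to f' and from f' to a polynomial in f. Hence the joint induction.\<close>

lemma Ck_on_comp_polar_angle:
  assumes f: "\<And>\<theta>. (f has_real_derivative f' \<theta>) (at \<theta>)"
    and f': "\<And>\<theta>. (f' has_real_derivative K - 4 * f \<theta> - (f \<theta>)\<^sup>2) (at \<theta>)"
  shows "Ck_on k slit_plane (\<lambda>x. f (polar_angle x)) \<and> Ck_on k slit_plane (\<lambda>x. f' (polar_angle x))"
proof (induction k)
  case 0
  show ?case
    using has_derivative_comp_polar_angle[OF _ f] has_derivative_comp_polar_angle[OF _ f']
    by (auto intro!: continuous_at_imp_continuous_on dest!: has_derivative_continuous)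
next
  case (Suc k)
  have step: "Ck_on (Suc k) slit_plane (\<lambda>x. h (polar_angle x))"
    if h: "\<And>\<theta>. (h has_real_derivative h' \<theta>) (at \<theta>)" and "Ck_on k slit_plane (\<lambda>x. h' (polar_angle x))"
    for h h'
  proof -
    note D = has_derivative_comp_polar_angle[OF _ h]
    have "Ck_on k slit_plane (\<lambda>x. frechet_derivative (\<lambda>y. h (polar_angle y)) (at x) v)" for v
    proof -
      have bl: "bounded_linear (\<lambda>x::real^2. x$1 * v$2 - x$2 * v$1)"
        by (intro bounded_linear_sub bounded_linear_mult_const bounded_linear_vec_nth)
      show ?thesis
      proof (rule Ck_on_cong[OF open_slit_plane])
      show "Ck_on k slit_plane (\<lambda>x. h' (polar_angle x) * ((x$1 * v$2 - x$2 * v$1) * (1 / (x \<bullet> x))))"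
        by (rule Ck_on_mult[OF open_slit_plane that(2) Ck_on_mult[OF open_slit_plane
              Ck_on_bounded_linear[OF bl] Ck_on_inverse_inner[OF open_slit_plane zero_notin_slit_plane]]])
      fix x :: "real^2" assume "x \<in> slit_plane"
      then show "h' (polar_angle x) * ((x$1 * v$2 - x$2 * v$1) * (1 / (x \<bullet> x))) =
        frechet_derivative (\<lambda>y. h (polar_angle y)) (at x) v"
        using frechet_derivative_at[OF D, of x] by (simp add: fun_eq_iff)
      qed
    qed
    then show ?thesis using D by (auto simp: differentiable_def)
  qed
  have fk: "Ck_on k slit_plane (\<lambda>x. f (polar_angle x))" using Suc by simp
  have "Ck_on k slit_plane (\<lambda>x. K + (- 4) * f (polar_angle x) + (- 1) * (f (polar_angle x) * f (polar_angle x)))"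
    by (rule Ck_on_add[OF open_slit_plane Ck_on_add[OF open_slit_plane Ck_on_const
          Ck_on_mult[OF open_slit_plane Ck_on_const fk]] Ck_on_mult[OF open_slit_plane Ck_on_const
          Ck_on_mult[OF open_slit_plane fk fk]]])
  then have "Ck_on k slit_plane (\<lambda>x. K - 4 * f (polar_angle x) - (f (polar_angle x))\<^sup>2)"
    by (simp add: power2_eq_square)
  then have "Ck_on (Suc k) slit_plane (\<lambda>x. f' (polar_angle x))"
    by (rule step[OF f'])
  moreover have "Ck_on (Suc k) slit_plane (\<lambda>x. f (polar_angle x))"
    by (rule step[OF f conjunct2[OF Suc]])
  ultimately show ?case by (rule conjI[rotated])
qed

lemma polar_angle_e_r:
  assumes "r > 0" "- pi < \<theta>" "\<theta> \<le> pi"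
  shows "polar_angle (r *\<^sub>R e_r \<theta>) = \<theta>"
proof -
  have "Complex ((r *\<^sub>R e_r \<theta>)$1) ((r *\<^sub>R e_r \<theta>)$2) = rcis r \<theta>"
    by (simp add: e_r_def complex_eq_iff)
  then show ?thesis using Arg_rcis assms unfolding polar_angle_def by auto
qed

lemma e_r_in_slit_plane:
  assumes "r > 0" "- pi < \<theta>" "\<theta> < pi"
  shows "r *\<^sub>R e_r \<theta> \<in> slit_plane"
proof -
  have c: "Complex ((r *\<^sub>R e_r \<theta>)$1) ((r *\<^sub>R e_r \<theta>)$2) = rcis r \<theta>"
    by (simp add: e_r_def complex_eq_iff)
  have "rcis r \<theta> \<notin> \<real>\<^sub>\<le>\<^sub>0"
  proof
    assume "rcis r \<theta> \<in> \<real>\<^sub>\<le>\<^sub>0"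
    moreover have "rcis r \<theta> \<noteq> 0" using assms by simp
    ultimately have "Arg (rcis r \<theta>) = pi"
      by (auto simp only: complex_nonpos_Reals_iff Arg_eq_pi complex_eq_iff order_le_less zero_complex.sel)
    then show False using assms Arg_rcis[of \<theta> r] by auto
  qed
  then show ?thesis unfolding slit_plane_def mem_Collect_eq c .
qed

lemma norm_e_r [simp]: "norm (e_r \<theta>) = 1"
  by (simp add: norm_eq_sqrt_inner)

lemma polar_decomposition:
  assumes "x \<in> slit_plane"
  shows "x = norm x *\<^sub>R e_r (polar_angle x)"
proof -
  let ?z = "Complex (x$1) (x$2)"
  have n: "norm ?z = norm x"
    by (simp add: norm_complex_def norm_eq_sqrt_inner inner_eq_cart)
  have "?z = rcis (norm ?z) (Arg ?z)" by (simp add: rcis_cmod_Arg)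
  from arg_cong[OF this, of Re] arg_cong[OF this, of Im] show ?thesis
    by (simp add: vec_eq_iff forall_2 e_r_def polar_angle_def n)
qed

lemma sector_eq_slit_plane:
  assumes "0 < \<alpha>" "\<alpha> < pi"
  shows "sector \<alpha> = {x \<in> slit_plane. \<bar>polar_angle x\<bar> < \<alpha>}"
  using mem_sector_iff_Arg[OF assms] by (auto simp: slit_plane_def polar_angle_def)

text \<open>The points x with \<open>x = norm x *\<^sub>R e_r \<theta>\<close> for some \<theta> in
  the compact interval form a closed set, by projection along a compact factor. It contains the
  sector and hence its closure; as \<alpha> < pi, the angle can be read off again.\<close>

lemma closure_sector_subset:
  assumes "0 < \<alpha>" "\<alpha> < pi"
  shows "closure (sector \<alpha>) - {0} \<subseteq> {x \<in> slit_plane. \<bar>polar_angle x\<bar> \<le> \<alpha>}"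
proof -
  let ?T = "{(\<theta>, x). x = norm x *\<^sub>R e_r \<theta>}"
  have er: "continuous_on S e_r" for S
    by (rule continuous_on_vector_derivative) (rule has_vector_derivative_e_r)
  have "closed ?T"
    unfolding case_prod_unfold
    by (intro closed_Collect_eq continuous_intros continuous_on_compose2[OF er[of UNIV]]) auto
  then have cl: "closed {x. \<exists>\<theta>. \<theta> \<in> {-\<alpha>..\<alpha>} \<and> (\<theta>, x) \<in> ?T}"
    by (rule closed_compact_projection[OF compact_Icc])
  have "sector \<alpha> \<subseteq> {x. \<exists>\<theta>. \<theta> \<in> {-\<alpha>..\<alpha>} \<and> (\<theta>, x) \<in> ?T}"
  proof
    fix x assume "x \<in> sector \<alpha>"
    then obtain r \<theta> where x: "x = r *\<^sub>R e_r \<theta>" "r > 0" "-\<alpha> < \<theta>" "\<theta> < \<alpha>"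
      unfolding sector_def by blast
    then have "x = norm x *\<^sub>R e_r \<theta>" by simp
    moreover have "\<theta> \<in> {-\<alpha>..\<alpha>}" using x by simp
    ultimately show "x \<in> {x. \<exists>\<theta>. \<theta> \<in> {-\<alpha>..\<alpha>} \<and> (\<theta>, x) \<in> ?T}"
      by (intro CollectI exI[of _ \<theta>] conjI) simp_all
  qed
  from closure_minimal[OF this cl] show ?thesis
  proof (intro subsetI)
    fix x assume "closure (sector \<alpha>) \<subseteq> {x. \<exists>\<theta>. \<theta> \<in> {-\<alpha>..\<alpha>} \<and> (\<theta>, x) \<in> ?T}"
      and x: "x \<in> closure (sector \<alpha>) - {0}"
    then obtain \<theta> where \<theta>: "\<theta> \<in> {-\<alpha>..\<alpha>}" "x = norm x *\<^sub>R e_r \<theta>" by auto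
    have "norm x > 0" using x by simp
    then show "x \<in> {x \<in> slit_plane. \<bar>polar_angle x\<bar> \<le> \<alpha>}"
      using \<theta> assms e_r_in_slit_plane[of "norm x" \<theta>] polar_angle_e_r[of "norm x" \<theta>] by auto
  qed
qed

lemma e_r_in_closure_sector:
  assumes "0 < \<alpha>" "\<alpha> < pi" "\<theta> \<in> {-\<alpha>..\<alpha>}"
  shows "e_r \<theta> \<in> closure (sector \<alpha>) - {0}"
proof -
  have er: "continuous_on S e_r" for S
    by (rule continuous_on_vector_derivative) (rule has_vector_derivative_e_r)
  have "e_r ` closure {-\<alpha><..<\<alpha>} \<subseteq> closure (sector \<alpha>)"
    using sectorI[of 1 \<alpha>] closure_subset[of "sector \<alpha>"]
    by (intro image_closure_subset er) fastforce+
  moreover have "e_r \<theta> \<noteq> 0" using norm_e_r[of \<theta>] by force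
  ultimately show ?thesis using assms by (auto simp: closure_greaterThanLessThan)
qed

lemma frontier_sector:
  assumes "0 < \<alpha>" "\<alpha> < pi" "x \<in> frontier (sector \<alpha>) - {0}"
  shows "x \<in> slit_plane" "\<bar>polar_angle x\<bar> = \<alpha>"
  using assms closure_sector_subset[OF assms(1,2)] open_sector[OF assms(1,2)]
  by (auto simp: frontier_def interior_open sector_eq_slit_plane)

lemma e_r_frontier:
  assumes "0 < \<alpha>" "\<alpha> < pi" "\<bar>\<theta>\<bar> = \<alpha>"
  shows "e_r \<theta> \<in> frontier (sector \<alpha>) - {0}"
proof -
  have "polar_angle (1 *\<^sub>R e_r \<theta>) = \<theta>" using assms by (intro polar_angle_e_r) auto
  then have "e_r \<theta> \<notin> sector \<alpha>"
    using assms by (simp add: sector_eq_slit_plane)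
  moreover have "e_r \<theta> \<in> closure (sector \<alpha>) - {0}"
    using assms by (intro e_r_in_closure_sector) auto
  ultimately show ?thesis
    using open_sector[OF assms(1,2)] by (simp add: frontier_def interior_open)
qed

section \<open>The Navier--Stokes equations for radial fields\<close>

lemma partial_eqI:
  assumes "open V" "x \<in> V" "\<And>y. y \<in> V \<Longrightarrow> g y = h y" "(h has_derivative D) (at x)"
    "D (axis j 1) = d"
  shows "partial j g x = d"
proof -
  have "(g has_derivative D) (at x)"
    by (rule has_derivative_transform_within_open[OF assms(4,1,2)]) (simp add: assms(3))
  then show ?thesis
    using frechet_derivative_at assms(5) unfolding partial_def by metis
qed

lemma has_derivative_nth: "((\<lambda>y::real^'n. y $ i) has_derivative (\<lambda>v. v $ i)) (at x)"
  by (rule bounded_linear_imp_has_derivative[OF bounded_linear_vec_nth])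

lemma axis_2_nth: "axis (1::2) (1::real) $ 1 = 1" "axis (1::2) (1::real) $ 2 = 0"
  "axis (2::2) (1::real) $ 1 = 0" "axis (2::2) (1::real) $ 2 = 1"
  by (simp_all add: axis_def)

text \<open>Functions of the form h(angle) N / |y|^(2k) are closed under differentiation up to sums,
  with k raised by one. Velocity components, their first derivatives and the pressure are of this
  form or sums of two such terms, so the Laplacian follows by applying the rule twice.\<close>

lemma has_derivative_polar_quotient:
  fixes x :: "real^2"
  assumes x: "x \<in> slit_plane" and h: "(h has_real_derivative d) (at (polar_angle x))"
    and N: "(N has_derivative DN) (at x)"
  shows "((\<lambda>y. h (polar_angle y) * N y / (y \<bullet> y) ^ k) has_derivative
    (\<lambda>v. (d * (x$1 * v$2 - x$2 * v$1) * N x + h (polar_angle x) * DN v * (x \<bullet> x)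
          - 2 * real k * h (polar_angle x) * N x * (x \<bullet> v)) / (x \<bullet> x) ^ (k + 1))) (at x)"
proof -
  have q: "x \<bullet> x \<noteq> 0" using slit_plane_inner_pos[OF x] by simp
  have D1: "((\<lambda>y. h (polar_angle y) * N y) has_derivative
    (\<lambda>v. h (polar_angle x) * DN v + d * ((x$1 * v$2 - x$2 * v$1) / (x \<bullet> x)) * N x)) (at x)"
    by (rule has_derivative_mult[OF has_derivative_comp_polar_angle[OF x h] N])
  have D2: "((\<lambda>y. (y \<bullet> y) ^ k) has_derivative
      (\<lambda>v. real k * (2 * (x \<bullet> v)) * (x \<bullet> x) ^ (k - 1))) (at x)"
    by (auto intro!: derivative_eq_intros simp: inner_commute algebra_simps)
  \<comment> \<open>At k = 0 truncated subtraction gives k - 1 = 0; the factor \<open>real k\<close>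
    keeps the identity valid.\<close>
  have pk: "real k * (x \<bullet> x) ^ k = real k * (x \<bullet> x) ^ (k - 1) * (x \<bullet> x)"
    by (cases k) auto
  show ?thesis
  proof (rule has_derivative_eq_rhs[OF has_derivative_divide'[OF D1 D2]])
    show "(x \<bullet> x) ^ k \<noteq> 0" using q by simp
    show "(\<lambda>v. ((h (polar_angle x) * DN v + d * ((x$1 * v$2 - x$2 * v$1) / (x \<bullet> x)) * N x) * (x \<bullet> x) ^ k
         - h (polar_angle x) * N x * (real k * (2 * (x \<bullet> v)) * (x \<bullet> x) ^ (k - 1))) /
           ((x \<bullet> x) ^ k * (x \<bullet> x) ^ k)) =
     (\<lambda>v. (d * (x$1 * v$2 - x$2 * v$1) * N x + h (polar_angle x) * DN v * (x \<bullet> x)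
          - 2 * real k * h (polar_angle x) * N x * (x \<bullet> v)) / (x \<bullet> x) ^ (k + 1))"
    proof
      fix v
      define Q where "Q = x \<bullet> x"
      define P where "P = Q ^ k"
      define R where "R = Q ^ (k - 1)"
      have nz: "Q \<noteq> 0" "P \<noteq> 0" using q by (auto simp: Q_def P_def)
      have PR: "real k * P = real k * R * Q" using pk by (simp add: P_def R_def Q_def)
      have PQ: "Q ^ (k + 1) = P * Q" by (simp add: P_def)
      have "(A + d * (w / Q) * n) * P - h0 * n * (real k * (2 * z) * R)
          = (d * w * n + A * Q - 2 * real k * h0 * n * z) * P / Q" for A w n h0 z
      proof -
        have "h0 * n * (real k * (2 * z) * R) = h0 * n * 2 * z * (real k * R * Q) / Q"
          using nz by simp
        also have "\<dots> = h0 * n * 2 * z * (real k * P) / Q" by (simp only: PR)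
        finally show ?thesis using nz by (auto simp: field_simps)
      qed
      then show "((h (polar_angle x) * DN v + d * ((x$1 * v$2 - x$2 * v$1) / (x \<bullet> x)) * N x) * (x \<bullet> x) ^ k
         - h (polar_angle x) * N x * (real k * (2 * (x \<bullet> v)) * (x \<bullet> x) ^ (k - 1))) /
           ((x \<bullet> x) ^ k * (x \<bullet> x) ^ k) = (d * (x$1 * v$2 - x$2 * v$1) * N x + h (polar_angle x) * DN v * (x \<bullet> x)
          - 2 * real k * h (polar_angle x) * N x * (x \<bullet> v)) / (x \<bullet> x) ^ (k + 1)"
        unfolding Q_def[symmetric] P_def[symmetric] R_def[symmetric] PQ
        using nz by (simp add: divide_simps)
    qed
  qed
qed

lemma partial_polar_quotient:
  fixes x :: "real^2"
  assumes "open V" "V \<subseteq> slit_plane" "x \<in> V"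
    and g: "\<forall>y\<in>V. g y = h (polar_angle y) * N y / (y \<bullet> y) ^ k"
    and h: "(h has_real_derivative d) (at (polar_angle x))"
    and N: "(N has_derivative DN) (at x)"
  shows "partial 1 g x = (- d * x$2 * N x + h (polar_angle x) * DN (axis 1 1) * (x \<bullet> x)
          - 2 * real k * h (polar_angle x) * N x * x$1) / (x \<bullet> x) ^ (k + 1)" (is ?A)
    and "partial 2 g x = (d * x$1 * N x + h (polar_angle x) * DN (axis 2 1) * (x \<bullet> x)
          - 2 * real k * h (polar_angle x) * N x * x$2) / (x \<bullet> x) ^ (k + 1)" (is ?B)
proof -
  have xs: "x \<in> slit_plane" using assms by auto
  note D = has_derivative_polar_quotient[OF xs h N, of k]
  show ?A ?B
    by (rule partial_eqI[OF assms(1,3) g[rule_format] D]; simp add: axis_2_nth inner_axis)+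
qed

lemma partial_polar_quotient2:
  fixes x :: "real^2"
  assumes "open V" "V \<subseteq> slit_plane" "x \<in> V"
    and g: "\<forall>y\<in>V. g y = (h (polar_angle y) * N y + h2 (polar_angle y) * N2 y) / (y \<bullet> y) ^ k"
    and h: "(h has_real_derivative d) (at (polar_angle x))"
    and h2: "(h2 has_real_derivative d2) (at (polar_angle x))"
    and N: "(N has_derivative DN) (at x)" and N2: "(N2 has_derivative DN2) (at x)"
  shows "partial 1 g x =
      ((- d * x$2 * N x + h (polar_angle x) * DN (axis 1 1) * (x \<bullet> x) - 2 * real k * h (polar_angle x) * N x * x$1)
     + (- d2 * x$2 * N2 x + h2 (polar_angle x) * DN2 (axis 1 1) * (x \<bullet> x) - 2 * real k * h2 (polar_angle x) * N2 x * x$1))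
      / (x \<bullet> x) ^ (k + 1)" (is ?A)
    and "partial 2 g x =
      ((d * x$1 * N x + h (polar_angle x) * DN (axis 2 1) * (x \<bullet> x) - 2 * real k * h (polar_angle x) * N x * x$2)
     + (d2 * x$1 * N2 x + h2 (polar_angle x) * DN2 (axis 2 1) * (x \<bullet> x) - 2 * real k * h2 (polar_angle x) * N2 x * x$2))
      / (x \<bullet> x) ^ (k + 1)" (is ?B)
proof -
  have xs: "x \<in> slit_plane" using assms by auto
  note D = has_derivative_add[OF has_derivative_polar_quotient[OF xs h N, of k]
      has_derivative_polar_quotient[OF xs h2 N2, of k]]
  have g': "g y = h (polar_angle y) * N y / (y \<bullet> y) ^ k + h2 (polar_angle y) * N2 y / (y \<bullet> y) ^ k"
    if "y \<in> V" for y using g that by (simp add: add_divide_distrib)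
  show ?A ?B
    by (rule partial_eqI[OF assms(1,3) g' D]; simp add: axis_2_nth inner_axis add_divide_distrib)+
qed

lemma radial_field_partials:
  fixes u :: "real^2 \<Rightarrow> real^2"
  assumes V: "open V" "V \<subseteq> slit_plane" "x \<in> V"
    and u: "\<forall>y\<in>V. u y = (f (polar_angle y) / (y \<bullet> y)) *\<^sub>R y"
    and f: "(f has_real_derivative f' (polar_angle x)) (at (polar_angle x))"
  shows "partial 1 (\<lambda>y. u y $ 1) x = (f' (polar_angle x) * (- (x$1 * x$2)) + f (polar_angle x) * ((x$2)\<^sup>2 - (x$1)\<^sup>2)) / (x \<bullet> x)\<^sup>2"
    and "partial 2 (\<lambda>y. u y $ 1) x = (f' (polar_angle x) * (x$1)\<^sup>2 + f (polar_angle x) * (- 2 * (x$1 * x$2))) / (x \<bullet> x)\<^sup>2"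
    and "partial 1 (\<lambda>y. u y $ 2) x = (f' (polar_angle x) * (- (x$2)\<^sup>2) + f (polar_angle x) * (- 2 * (x$1 * x$2))) / (x \<bullet> x)\<^sup>2"
    and "partial 2 (\<lambda>y. u y $ 2) x = (f' (polar_angle x) * (x$1 * x$2) + f (polar_angle x) * ((x$1)\<^sup>2 - (x$2)\<^sup>2)) / (x \<bullet> x)\<^sup>2"
proof -
  have u': "\<forall>y\<in>V. u y $ i = f (polar_angle y) * y $ i / (y \<bullet> y) ^ 1" for i
    using u by simp
  note P = partial_polar_quotient[where k = 1 and h = f and N = "\<lambda>y. y $ 1" and g = "\<lambda>y. u y $ 1",
      OF V u' f has_derivative_nth]
    partial_polar_quotient[where k = 1 and h = f and N = "\<lambda>y. y $ 2" and g = "\<lambda>y. u y $ 2",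
      OF V u' f has_derivative_nth]
  show "partial 1 (\<lambda>y. u y $ 1) x = (f' (polar_angle x) * (- (x$1 * x$2)) + f (polar_angle x) * ((x$2)\<^sup>2 - (x$1)\<^sup>2)) / (x \<bullet> x)\<^sup>2"
    "partial 2 (\<lambda>y. u y $ 1) x = (f' (polar_angle x) * (x$1)\<^sup>2 + f (polar_angle x) * (- 2 * (x$1 * x$2))) / (x \<bullet> x)\<^sup>2"
    "partial 1 (\<lambda>y. u y $ 2) x = (f' (polar_angle x) * (- (x$2)\<^sup>2) + f (polar_angle x) * (- 2 * (x$1 * x$2))) / (x \<bullet> x)\<^sup>2"
    "partial 2 (\<lambda>y. u y $ 2) x = (f' (polar_angle x) * (x$1 * x$2) + f (polar_angle x) * ((x$1)\<^sup>2 - (x$2)\<^sup>2)) / (x \<bullet> x)\<^sup>2"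
    unfolding P by (simp_all add: axis_2_nth inner_eq_cart power2_eq_square algebra_simps)
qed

text \<open>Up to the factor |x|^-4 the Cartesian residual of the momentum equation is a combination
  of x and its rotation by a right angle, with coefficients -S (radial balance) and T (angular
  balance). Both must vanish, as the two vectors are independent. The divergence of a radial field
  of this form is always zero.\<close>

lemma navier_stokes_radial_iff:
  fixes u :: "real^2 \<Rightarrow> real^2" and p :: "real^2 \<Rightarrow> real"
  assumes V: "open V" "V \<subseteq> slit_plane" "x \<in> V"
    and u: "\<forall>y\<in>V. u y = (f (polar_angle y) / (y \<bullet> y)) *\<^sub>R y"
    and p: "\<And>y. y \<in> V \<Longrightarrow> p y = P (polar_angle y) / (y \<bullet> y)"
    and f: "\<And>y. y \<in> V \<Longrightarrow> (f has_real_derivative f' (polar_angle y)) (at (polar_angle y))"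
    and f': "(f' has_real_derivative f2) (at (polar_angle x))"
    and P: "(P has_real_derivative dP) (at (polar_angle x))"
  shows "navier_stokes_at u p x \<longleftrightarrow>
    f2 + (f (polar_angle x))\<^sup>2 + 2 * P (polar_angle x) = 0 \<and> dP = 2 * f' (polar_angle x)"
proof -
  note first = radial_field_partials[where f = f and f' = f', OF V(1,2) _ u f]
  have first_V: "\<forall>y\<in>V. partial 1 (\<lambda>y. u y $ 1) y = (f' (polar_angle y) * (- (y$1 * y$2)) + f (polar_angle y) * ((y$2)\<^sup>2 - (y$1)\<^sup>2)) / (y \<bullet> y)\<^sup>2"
    "\<forall>y\<in>V. partial 2 (\<lambda>y. u y $ 1) y = (f' (polar_angle y) * (y$1)\<^sup>2 + f (polar_angle y) * (- 2 * (y$1 * y$2))) / (y \<bullet> y)\<^sup>2"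
    "\<forall>y\<in>V. partial 1 (\<lambda>y. u y $ 2) y = (f' (polar_angle y) * (- (y$2)\<^sup>2) + f (polar_angle y) * (- 2 * (y$1 * y$2))) / (y \<bullet> y)\<^sup>2"
    "\<forall>y\<in>V. partial 2 (\<lambda>y. u y $ 2) y = (f' (polar_angle y) * (y$1 * y$2) + f (polar_angle y) * ((y$1)\<^sup>2 - (y$2)\<^sup>2)) / (y \<bullet> y)\<^sup>2"
    by ((intro ballI, rule first; assumption)+)
  note fx = f[OF V(3)]
  define a where "a = x $ 1"
  define b where "b = x $ 2"
  define F where "F = f (polar_angle x)"
  define F' where "F' = f' (polar_angle x)"
  define Q where "Q = x \<bullet> x"
  have xs: "x \<in> slit_plane" using V by auto
  have Q: "Q = a\<^sup>2 + b\<^sup>2" by (simp add: Q_def a_def b_def inner_eq_cart)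
  have Q0: "Q \<noteq> 0" using slit_plane_inner_pos[OF xs] by (simp add: Q_def)
  note folds = a_def[symmetric] b_def[symmetric] F_def[symmetric] F'_def[symmetric] Q_def[symmetric]
  have N: "((\<lambda>y::real^2. - (y$1 * y$2)) has_derivative (\<lambda>v. - (x$1 * v$2 + v$1 * x$2))) (at x)"
    "((\<lambda>y::real^2. (y$2)\<^sup>2 - (y$1)\<^sup>2) has_derivative (\<lambda>v. 2 * x$2 * v$2 - 2 * x$1 * v$1)) (at x)"
    "((\<lambda>y::real^2. (y$1)\<^sup>2) has_derivative (\<lambda>v. 2 * x$1 * v$1)) (at x)"
    "((\<lambda>y::real^2. - 2 * (y$1 * y$2)) has_derivative (\<lambda>v. - 2 * (x$1 * v$2 + v$1 * x$2))) (at x)"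
    "((\<lambda>y::real^2. - (y$2)\<^sup>2) has_derivative (\<lambda>v. - 2 * x$2 * v$2)) (at x)"
    "((\<lambda>y::real^2. y$1 * y$2) has_derivative (\<lambda>v. x$1 * v$2 + v$1 * x$2)) (at x)"
    "((\<lambda>y::real^2. (y$1)\<^sup>2 - (y$2)\<^sup>2) has_derivative (\<lambda>v. 2 * x$1 * v$1 - 2 * x$2 * v$2)) (at x)"
    by (auto intro!: derivative_eq_intros has_derivative_nth)
  have lap1: "laplacian (\<lambda>y. u y $ 1) x = (f2 * a - 2 * F' * b) / Q\<^sup>2"
  proof -
    have "partial 1 (partial 1 (\<lambda>y. u y $ 1)) x + partial 2 (partial 2 (\<lambda>y. u y $ 1)) x
      = ((f2 * a - 2 * F' * b) * Q) / Q ^ 3"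
      unfolding partial_polar_quotient2(1)[where h = f' and ?h2.0 = f and k = 2, OF V first_V(1) f' fx N(1,2)]
        partial_polar_quotient2(2)[where h = f' and ?h2.0 = f and k = 2, OF V first_V(2) f' fx N(3,4)]
        axis_2_nth folds add_divide_distrib[symmetric]
      by (simp add: Q, simp add: power2_eq_square algebra_simps)
    then show ?thesis using Q0 by (simp add: laplacian_def sum_2 power2_eq_square power3_eq_cube)
  qed
  have lap2: "laplacian (\<lambda>y. u y $ 2) x = (f2 * b + 2 * F' * a) / Q\<^sup>2"
  proof -
    have "partial 1 (partial 1 (\<lambda>y. u y $ 2)) x + partial 2 (partial 2 (\<lambda>y. u y $ 2)) x
      = ((f2 * b + 2 * F' * a) * Q) / Q ^ 3"
      unfolding partial_polar_quotient2(1)[where h = f' and ?h2.0 = f and k = 2, OF V first_V(3) f' fx N(5,4)]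
        partial_polar_quotient2(2)[where h = f' and ?h2.0 = f and k = 2, OF V first_V(4) f' fx N(6,7)]
        axis_2_nth folds add_divide_distrib[symmetric]
      by (simp add: Q, simp add: power2_eq_square algebra_simps)
    then show ?thesis using Q0 by (simp add: laplacian_def sum_2 power2_eq_square power3_eq_cube)
  qed
  have p': "\<forall>y\<in>V. p y = P (polar_angle y) * 1 / (y \<bullet> y) ^ 1"
    using p by simp
  note dp = partial_polar_quotient[where k = 1 and h = P and N = "\<lambda>y. 1", OF V p' P has_derivative_const]
  have p1: "partial 1 p x = (- dP * b - 2 * P (polar_angle x) * a) / Q\<^sup>2"
    and p2: "partial 2 p x = (dP * a - 2 * P (polar_angle x) * b) / Q\<^sup>2"
    unfolding dp folds by (simp_all add: power2_eq_square)
  note first' = first_V[rule_format, OF V(3), unfolded folds]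
  have div: "divergence u x = 0"
    unfolding divergence_def sum_2 first' by (simp add: add_divide_distrib[symmetric] algebra_simps)
  have ux: "u x $ 1 = F * a / Q" "u x $ 2 = F * b / Q"
    using u V(3) by (simp_all add: folds)
  have conv1: "(\<Sum>j\<in>UNIV. u x $ j * partial j (\<lambda>y. u y $ 1) x) = - (F\<^sup>2 * a) / Q\<^sup>2"
  proof -
    have "(\<Sum>j\<in>UNIV. u x $ j * partial j (\<lambda>y. u y $ 1) x)
      = (F * a * (F' * (- (a * b)) + F * (b\<^sup>2 - a\<^sup>2)) + F * b * (F' * a\<^sup>2 + F * (- 2 * (a * b)))) / Q ^ 3"
      unfolding sum_2 first' ux by (simp add: add_divide_distrib distrib_left power3_eq_cube power2_eq_square)
    also have "\<dots> = (- (F\<^sup>2 * a) * Q) / Q ^ 3"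
      by (rule arg_cong[where f = "\<lambda>z. z / Q ^ 3"]) (simp add: Q power2_eq_square algebra_simps)
    finally show ?thesis using Q0 by (simp add: power3_eq_cube power2_eq_square)
  qed
  have conv2: "(\<Sum>j\<in>UNIV. u x $ j * partial j (\<lambda>y. u y $ 2) x) = - (F\<^sup>2 * b) / Q\<^sup>2"
  proof -
    have "(\<Sum>j\<in>UNIV. u x $ j * partial j (\<lambda>y. u y $ 2) x)
      = (F * a * (F' * (- b\<^sup>2) + F * (- 2 * (a * b))) + F * b * (F' * (a * b) + F * (a\<^sup>2 - b\<^sup>2))) / Q ^ 3"
      unfolding sum_2 first' ux by (simp add: add_divide_distrib distrib_left power3_eq_cube power2_eq_square)
    also have "\<dots> = (- (F\<^sup>2 * b) * Q) / Q ^ 3"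
      by (rule arg_cong[where f = "\<lambda>z. z / Q ^ 3"]) (simp add: Q power2_eq_square algebra_simps)
    finally show ?thesis using Q0 by (simp add: power3_eq_cube power2_eq_square)
  qed
  define S where "S = f2 + F\<^sup>2 + 2 * P (polar_angle x)"
  define T where "T = dP - 2 * F'"
  have e1: "- laplacian (\<lambda>y. u y $ 1) x + (\<Sum>j\<in>UNIV. u x $ j * partial j (\<lambda>y. u y $ 1) x) + partial 1 p x
      = (- S * a - T * b) / Q\<^sup>2"
    unfolding lap1 conv1 p1 S_def T_def
    by (simp add: diff_divide_distrib add_divide_distrib algebra_simps)
  have e2: "- laplacian (\<lambda>y. u y $ 2) x + (\<Sum>j\<in>UNIV. u x $ j * partial j (\<lambda>y. u y $ 2) x) + partial 2 p x
      = (- S * b + T * a) / Q\<^sup>2"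
    unfolding lap2 conv2 p2 S_def T_def
    by (simp add: diff_divide_distrib add_divide_distrib algebra_simps)
  have "navier_stokes_at u p x \<longleftrightarrow> - S * a - T * b = 0 \<and> - S * b + T * a = 0"
    unfolding navier_stokes_at_def forall_2 e1 e2 div using Q0 by simp
  also have "\<dots> \<longleftrightarrow> S = 0 \<and> T = 0"
  proof
    \<comment> \<open>Inner products with x and with its rotation invert the system, whose
      determinant is |x|^2 up to sign.\<close>
    assume *: "- S * a - T * b = 0 \<and> - S * b + T * a = 0"
    have "S * Q = - (- S * a - T * b) * a - (- S * b + T * a) * b"
      "T * Q = - (- S * a - T * b) * b + (- S * b + T * a) * a"
      by (simp_all add: Q power2_eq_square algebra_simps)
    then have "S * Q = 0" "T * Q = 0"
      by (simp_all only: conjunct1[OF *] conjunct2[OF *] mult_zero_left diff_0_right minus_zero add_0_right)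
    then show "S = 0 \<and> T = 0" using Q0 by simp
  qed simp
  finally show ?thesis by (simp add: S_def T_def F_def F'_def)
qed

section \<open>Self-similar solutions and the profile equation\<close>

lemma Ck_on_compose_bounded_linear:
  assumes "open S" "bounded_linear L" "Ck_on k S f"
  shows "Ck_on k S (\<lambda>x. L (f x))"
  using assms(3)
proof (induction k arbitrary: f)
  case 0
  then show ?case using bounded_linear.continuous_on[OF assms(2)] by auto
next
  case (Suc k)
  have D: "((\<lambda>x. L (f x)) has_derivative (\<lambda>v. L (frechet_derivative f (at x) v))) (at x)" if "x \<in> S" for x
    using Suc.prems that
    by (intro bounded_linear.has_derivative[OF assms(2)]) (auto simp: frechet_derivative_works[symmetric])
  have "Ck_on k S (\<lambda>x. frechet_derivative (\<lambda>x. L (f x)) (at x) v)" for v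
  proof (rule Ck_on_cong[OF assms(1)])
    show "Ck_on k S (\<lambda>x. L (frechet_derivative f (at x) v))"
      using Suc.prems by (intro Suc.IH) simp
    show "L (frechet_derivative f (at x) v) = frechet_derivative (\<lambda>x. L (f x)) (at x) v" if "x \<in> S" for x
      using fun_cong[OF frechet_derivative_at[OF D[OF that]], of v] by simp
  qed
  then show ?case using D by (auto simp: differentiable_def)
qed

lemma has_real_derivative_comp_e_r:
  fixes h :: "real^2 \<Rightarrow> real"
  assumes "h differentiable (at (e_r \<theta>))"
  shows "((\<lambda>\<theta>. h (e_r \<theta>)) has_real_derivative
    - sin \<theta> * frechet_derivative h (at (e_r \<theta>)) (axis 1 1)
    + cos \<theta> * frechet_derivative h (at (e_r \<theta>)) (axis 2 1)) (at \<theta>)"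
proof -
  let ?D = "frechet_derivative h (at (e_r \<theta>))"
  have D: "(h has_derivative ?D) (at (e_r \<theta>))"
    using assms by (simp add: frechet_derivative_works)
  then have lin: "linear ?D" by (rule has_derivative_linear)
  have d: "((\<lambda>\<theta>. h (e_r \<theta>)) has_derivative (\<lambda>t. ?D (t *\<^sub>R e_theta \<theta>))) (at \<theta>)"
    by (rule has_derivative_compose[OF has_vector_derivative_e_r[unfolded has_vector_derivative_def] D])
  have "?D (t *\<^sub>R e_theta \<theta>) = (- sin \<theta> * ?D (axis 1 1) + cos \<theta> * ?D (axis 2 1)) * t" for t
    unfolding e_theta_eq_axis by (simp only: linear_scale[OF lin] linear_add[OF lin]) simp
  then show ?thesis
    unfolding has_field_derivative_def by (intro has_derivative_eq_rhs[OF d] ext)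
qed

text \<open>The angular balance P' = 2 f' integrates to P = 2 f + c, and the radial balance f'' +
  f^2 + 2 P = 0 becomes the profile equation with K = -2 c. Here P is the pressure on the unit
  circle, to which self-similarity reduces the problem.\<close>

lemma ss_solution_profile_equation:
  assumes \<alpha>: "0 < \<alpha>" "\<alpha> < pi" and ss: "ss_solution \<alpha> u p"
  shows "continuous_on {-\<alpha>..\<alpha>} (profile u)" "profile u \<alpha> = 0" "profile u (-\<alpha>) = 0"
    "\<exists>f' K. \<forall>\<theta>\<in>{-\<alpha><..<\<alpha>}. (profile u has_real_derivative f' \<theta>) (at \<theta>) \<and>
       (f' has_real_derivative K - 4 * profile u \<theta> - (profile u \<theta>)\<^sup>2) (at \<theta>)"
proof -
  let ?S = "sector \<alpha>" and ?C = "closure (sector \<alpha>) - {0}"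
  note S_slit = sector_eq_slit_plane[OF \<alpha>]
  have oS: "open ?S" by (rule open_sector[OF \<alpha>])
  have SC: "?S \<subseteq> ?C" using closure_subset[of ?S] zero_notin_slit_plane S_slit by auto
  have ns: "ns_solution \<alpha> u p" using ss by (simp add: ss_solution_def)
  have Ck: "Ck_on k ?S h" if sm: "smooth_on ?C h" for k and h :: "real^2 \<Rightarrow> 'b::real_normed_vector"
  proof -
    obtain U g where g: "?C \<subseteq> U" "\<And>x. x \<in> ?C \<Longrightarrow> g x = h x" "\<And>k. Ck_on k U g"
      using sm unfolding smooth_on_def by metis
    show ?thesis
      by (rule Ck_on_cong[OF oS _ Ck_on_subset[OF g(3)[of k]]]) (use g(1,2) SC in auto)
  qed
  have er: "continuous_on X e_r" for X
    by (rule continuous_on_vector_derivative) (rule has_vector_derivative_e_r)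
  have contu: "continuous_on ?C u"
  proof -
    obtain U g where g: "?C \<subseteq> U" "\<And>x. x \<in> ?C \<Longrightarrow> g x = u x" "\<And>k. Ck_on k U g"
      using ns unfolding ns_solution_def smooth_on_def by metis
    have "continuous_on ?C g" using g(3)[of 0] g(1) continuous_on_subset by auto
    then show ?thesis by (rule continuous_on_eq) (rule g(2))
  qed
  show "continuous_on {-\<alpha>..\<alpha>} (profile u)"
    unfolding profile_def[abs_def]
    by (intro continuous_intros er continuous_on_compose2[OF contu er] image_subsetI
        e_r_in_closure_sector[OF \<alpha>])
  show "profile u \<alpha> = 0" "profile u (-\<alpha>) = 0"
    using e_r_frontier[OF \<alpha>] ns \<alpha> by (auto simp: ns_solution_def profile_def)
  \<comment> \<open>On the unit circle the profile is the restriction of the scalar field u . x,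
    which is as smooth as u; this provides its two derivatives.\<close>
  define F where "F x = u x $ 1 * x $ 1 + u x $ 2 * x $ 2" for x
  define A where "A i x = frechet_derivative F (at x) (axis i 1)" for i x
  define P where "P \<theta> = p (e_r \<theta>)" for \<theta>
  have prof: "profile u = (\<lambda>\<theta>. F (e_r \<theta>))"
    by (simp add: profile_def F_def inner_vec_def sum_2 fun_eq_iff)
  have F: "Ck_on (Suc (Suc 0)) ?S F"
    unfolding F_def[abs_def] using ns
    by (intro Ck_on_add[OF oS] Ck_on_mult[OF oS] Ck_on_compose_bounded_linear[OF oS bounded_linear_vec_nth]
        Ck Ck_on_bounded_linear[OF bounded_linear_vec_nth]) (auto simp: ns_solution_def)
  have eS: "e_r \<theta> \<in> ?S" if "\<theta> \<in> {-\<alpha><..<\<alpha>}" for \<theta>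
    using sectorI[of 1 \<alpha> \<theta>] that by simp
  have T: "polar_angle (e_r \<theta>) = \<theta>" if "\<theta> \<in> {-\<alpha><..<\<alpha>}" for \<theta>
    using polar_angle_e_r[of 1 \<theta>] that \<alpha> by simp
  define f' where "f' \<theta> = - sin \<theta> * A 1 (e_r \<theta>) + cos \<theta> * A 2 (e_r \<theta>)" for \<theta>
  have f1: "(profile u has_real_derivative f' \<theta>) (at \<theta>)" if "\<theta> \<in> {-\<alpha><..<\<alpha>}" for \<theta>
    unfolding prof f'_def A_def using F eS[OF that]
    by (intro has_real_derivative_comp_e_r) simp
  have "\<exists>f2. (f' has_real_derivative f2) (at \<theta>)" if "\<theta> \<in> {-\<alpha><..<\<alpha>}" for \<theta>
  proof -
    have "A i differentiable (at (e_r \<theta>))" for i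
      using F eS[OF that] by (simp add: A_def[abs_def])
    note D = has_real_derivative_comp_e_r[OF this]
    show ?thesis
      unfolding f'_def[abs_def]
      by (rule exI) (rule derivative_eq_intros D refl)+
  qed
  then obtain f2 where f2: "\<And>\<theta>. \<theta> \<in> {-\<alpha><..<\<alpha>} \<Longrightarrow> (f' has_real_derivative f2 \<theta>) (at \<theta>)"
    by metis
  have pC: "Ck_on (Suc 0) ?S p"
    by (rule Ck) (use ns in \<open>simp add: ns_solution_def\<close>)
  have "\<exists>dP. (P has_real_derivative dP) (at \<theta>)" if "\<theta> \<in> {-\<alpha><..<\<alpha>}" for \<theta>
    unfolding P_def[abs_def] using has_real_derivative_comp_e_r[of p \<theta>] pC eS[OF that] by auto
  then obtain dP where dP: "\<And>\<theta>. \<theta> \<in> {-\<alpha><..<\<alpha>} \<Longrightarrow> (P has_real_derivative dP \<theta>) (at \<theta>)"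
    by metis
  have dec: "y = norm y *\<^sub>R e_r (polar_angle y)" "polar_angle y \<in> {-\<alpha><..<\<alpha>}" "norm y > 0" if "y \<in> ?S" for y
    using polar_decomposition[of y] that S_slit slit_plane_inner_pos[of y] by auto
  have u: "\<forall>y\<in>?S. u y = (profile u (polar_angle y) / (y \<bullet> y)) *\<^sub>R y"
  proof
    fix y assume y: "y \<in> ?S"
    let ?r = "norm y" and ?t = "polar_angle y"
    have "u (?r *\<^sub>R e_r ?t) = (profile u ?t / ?r) *\<^sub>R e_r ?t"
      using dec[OF y] by (intro ss_solution_radial[OF \<alpha> ss]) auto
    also have "\<dots> = (profile u ?t / (?r * ?r)) *\<^sub>R (?r *\<^sub>R e_r ?t)"
      using dec(3)[OF y] by simp
    finally show "u y = (profile u ?t / (y \<bullet> y)) *\<^sub>R y"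
      using dec(1)[OF y] by (metis dot_square_norm power2_eq_square)
  qed
  have p: "p y = P (polar_angle y) / (y \<bullet> y)" if y: "y \<in> ?S" for y
  proof -
    let ?r = "norm y" and ?t = "polar_angle y"
    have "p (e_r ?t) = ?r\<^sup>2 * p (?r *\<^sub>R e_r ?t)"
      using ss eS[OF dec(2)[OF y]] dec(3)[OF y] unfolding ss_solution_def by blast
    also have "\<dots> = (y \<bullet> y) * p y"
      using dec(1)[OF y] by (simp add: dot_square_norm)
    finally show ?thesis using dec(3)[OF y] by (simp add: P_def)
  qed
  have eq: "f2 \<theta> + (profile u \<theta>)\<^sup>2 + 2 * P \<theta> = 0 \<and> dP \<theta> = 2 * f' \<theta>"
    if \<theta>: "\<theta> \<in> {-\<alpha><..<\<alpha>}" for \<theta>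
  proof -
    have "navier_stokes_at u p (e_r \<theta>) \<longleftrightarrow> f2 \<theta> + (profile u (polar_angle (e_r \<theta>)))\<^sup>2
        + 2 * P (polar_angle (e_r \<theta>)) = 0 \<and> dP \<theta> = 2 * f' (polar_angle (e_r \<theta>))"
    proof (rule navier_stokes_radial_iff[OF oS _ eS[OF \<theta>] u p])
      show "?S \<subseteq> slit_plane" using S_slit by auto
    qed (use f1 f2 dP \<theta> dec(2) T in auto)
    then show ?thesis using ns eS[OF \<theta>] T[OF \<theta>] by (auto simp: ns_solution_def)
  qed
  have const: "((\<lambda>\<theta>. P \<theta> - 2 * profile u \<theta>) has_real_derivative 0) (at \<theta> within {-\<alpha><..<\<alpha>})"
    if "\<theta> \<in> {-\<alpha><..<\<alpha>}" for \<theta>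
  proof (rule has_field_derivative_at_within)
    show "((\<lambda>\<theta>. P \<theta> - 2 * profile u \<theta>) has_real_derivative 0) (at \<theta>)"
      using f1[OF that] dP[OF that] eq[OF that] by (auto intro!: derivative_eq_intros)
  qed
  have "\<exists>c. \<forall>\<theta>\<in>{-\<alpha><..<\<alpha>}. P \<theta> - 2 * profile u \<theta> = c"
    by (rule has_field_derivative_zero_constant[OF convex_real_interval(8) const])
  then obtain c where c: "\<And>\<theta>. \<theta> \<in> {-\<alpha><..<\<alpha>} \<Longrightarrow> P \<theta> - 2 * profile u \<theta> = c"
    by metis
  have "f2 \<theta> = - 2 * c - 4 * profile u \<theta> - (profile u \<theta>)\<^sup>2" if "\<theta> \<in> {-\<alpha><..<\<alpha>}" for \<theta>
    using eq[OF that] c[OF that] by simp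
  then show "\<exists>f' K. \<forall>\<theta>\<in>{-\<alpha><..<\<alpha>}. (profile u has_real_derivative f' \<theta>) (at \<theta>) \<and>
       (f' has_real_derivative K - 4 * profile u \<theta> - (profile u \<theta>)\<^sup>2) (at \<theta>)"
    using f1 f2 by metis
qed

text \<open>The pressure (2 f - K/2) / r^2 balances both components. The profile solves its equation
  on the whole line so that u and p extend smoothly to the slit plane, beyond the closed
  sector.\<close>

lemma profile_equation_ss_solution:
  assumes \<alpha>: "0 < \<alpha>" "\<alpha> < pi"
    and f: "\<And>\<theta>. (f has_real_derivative f' \<theta>) (at \<theta>)"
    and f': "\<And>\<theta>. (f' has_real_derivative K - 4 * f \<theta> - (f \<theta>)\<^sup>2) (at \<theta>)"
    and bc: "f \<alpha> = 0" "f (-\<alpha>) = 0"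
  obtains u p where "ss_solution \<alpha> u p" "\<And>\<theta>. \<theta> \<in> {-\<alpha>..\<alpha>} \<Longrightarrow> profile u \<theta> = f \<theta>"
proof -
  define u :: "real^2 \<Rightarrow> real^2" where "u y = (f (polar_angle y) / (y \<bullet> y)) *\<^sub>R y" for y
  define p :: "real^2 \<Rightarrow> real" where "p y = (2 * f (polar_angle y) - K / 2) / (y \<bullet> y)" for y
  note closure = closure_sector_subset[OF \<alpha>] and S_slit = sector_eq_slit_plane[OF \<alpha>]
  note oS = open_slit_plane
  note inv = Ck_on_inverse_inner[OF oS zero_notin_slit_plane]
  have fk: "Ck_on k slit_plane (\<lambda>x. f (polar_angle x))" for k
    using Ck_on_comp_polar_angle[OF f f'] by simp
  have "Ck_on k slit_plane (\<lambda>y. (f (polar_angle y) * (1 / (y \<bullet> y))) *\<^sub>R y)" for k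
    by (intro Ck_on_scaleR[OF oS Ck_on_mult[OF oS fk inv]] Ck_on_bounded_linear bounded_linear_ident)
  then have "Ck_on k slit_plane u" for k by (simp add: u_def[abs_def])
  then have su: "smooth_on (closure (sector \<alpha>) - {0}) u"
    unfolding smooth_on_def using oS closure by (intro exI[of _ slit_plane] exI[of _ u]) auto
  have "Ck_on k slit_plane (\<lambda>y. (2 * f (polar_angle y) + (- (K / 2))) * (1 / (y \<bullet> y)))" for k
    by (rule Ck_on_mult[OF oS Ck_on_add[OF oS Ck_on_mult[OF oS Ck_on_const fk] Ck_on_const] inv])
  then have "Ck_on k slit_plane p" for k by (simp add: p_def[abs_def])
  then have sp: "smooth_on (closure (sector \<alpha>) - {0}) p"
    unfolding smooth_on_def using oS closure by (intro exI[of _ slit_plane] exI[of _ p]) auto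
  have ns: "navier_stokes_at u p x" if "x \<in> sector \<alpha>" for x
  proof -
    have "navier_stokes_at u p x \<longleftrightarrow>
      (K - 4 * f (polar_angle x) - (f (polar_angle x))\<^sup>2) + (f (polar_angle x))\<^sup>2
        + 2 * (2 * f (polar_angle x) - K / 2) = 0 \<and> 2 * f' (polar_angle x) = 2 * f' (polar_angle x)"
    proof (rule navier_stokes_radial_iff[where V = slit_plane and P = "\<lambda>t. 2 * f t - K / 2"])
      show "((\<lambda>t. 2 * f t - K / 2) has_real_derivative 2 * f' (polar_angle x)) (at (polar_angle x))"
        using f by (auto intro!: derivative_eq_intros)
    qed (use that S_slit oS f f' in \<open>auto simp: u_def p_def\<close>)
    then show ?thesis by simp
  qed
  have bd: "u x = 0" if "x \<in> frontier (sector \<alpha>) - {0}" for x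
  proof -
    have "polar_angle x = \<alpha> \<or> polar_angle x = - \<alpha>"
      using frontier_sector(2)[OF \<alpha> that] by auto
    then show ?thesis using bc by (auto simp: u_def)
  qed
  have sim: "u x = l *\<^sub>R u (l *\<^sub>R x) \<and> p x = l\<^sup>2 * p (l *\<^sub>R x)" if xS: "x \<in> sector \<alpha>" and l: "l > 0" for x l
  proof -
    obtain r \<theta> where x: "x = r *\<^sub>R e_r \<theta>" "r > 0" "-\<alpha> < \<theta>" "\<theta> < \<alpha>"
      using xS unfolding sector_def by blast
    have "polar_angle x = \<theta>" using x \<alpha> polar_angle_e_r[of r \<theta>] by simp
    moreover have "polar_angle (l *\<^sub>R x) = \<theta>" using x \<alpha> polar_angle_e_r[of "l * r" \<theta>] l by simp
    ultimately show ?thesis using l by (simp add: u_def p_def power2_eq_square)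
  qed
  have "ss_solution \<alpha> u p"
    unfolding ss_solution_def ns_solution_def using su sp ns bd sim by blast
  moreover have "profile u \<theta> = f \<theta>" if "\<theta> \<in> {-\<alpha>..\<alpha>}" for \<theta>
    using polar_angle_e_r[of 1 \<theta>] that \<alpha> by (simp add: profile_def u_def)
  ultimately show thesis by (rule that)
qed

lemma ss_solution_nontrivial_iff:
  assumes \<alpha>: "0 < \<alpha>" "\<alpha> < pi" and ss: "ss_solution \<alpha> u p"
  shows "(\<exists>x\<in>sector \<alpha>. u x \<noteq> 0) \<longleftrightarrow> (\<exists>\<theta>\<in>{-\<alpha><..<\<alpha>}. profile u \<theta> \<noteq> 0)"
proof -
  have "(\<exists>x\<in>sector \<alpha>. u x \<noteq> 0) \<longleftrightarrow> (\<exists>r \<theta>. r > 0 \<and> -\<alpha> < \<theta> \<and> \<theta> < \<alpha> \<and> u (r *\<^sub>R e_r \<theta>) \<noteq> 0)"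
    unfolding sector_def by blast
  also have "\<dots> \<longleftrightarrow> (\<exists>r \<theta>. (r::real) > 0 \<and> -\<alpha> < \<theta> \<and> \<theta> < \<alpha> \<and> profile u \<theta> \<noteq> 0)"
  proof -
    have "e_r \<theta> \<noteq> 0" for \<theta> using norm_e_r[of \<theta>] by force
    then have "r > 0 \<and> -\<alpha> < \<theta> \<and> \<theta> < \<alpha> \<and> u (r *\<^sub>R e_r \<theta>) \<noteq> 0 \<longleftrightarrow>
        r > 0 \<and> -\<alpha> < \<theta> \<and> \<theta> < \<alpha> \<and> profile u \<theta> \<noteq> 0" for r \<theta>
      using ss_solution_radial[OF \<alpha> ss, of r \<theta>] by auto
    then show ?thesis by blast
  qed
  also have "\<dots> \<longleftrightarrow> (\<exists>\<theta>\<in>{-\<alpha><..<\<alpha>}. profile u \<theta> \<noteq> 0)"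
    using zero_less_one by (metis greaterThanLessThan_iff)
  finally show ?thesis .
qed

section \<open>Half-widths and fluxes of humps\<close>

text \<open>If \<open>f\<close> solves \<open>f'' = K - 4 f - f\<^sup>2\<close> and has the extremum \<open>a\<close> on a hump, then \<open>t = f / a\<close>
  satisfies \<open>t'\<^sup>2 = 2/3 (1 - t) (s + 6 t + a t (1 + t))\<close>, where \<open>2/3 a\<^sup>2 s\<close> is the squared slope
  of \<open>f\<close> at its zeros; the substitution \<open>t = sin\<^sup>2 \<phi>\<close> removes the
  singularity at the extremum.\<close>

definition hump_den :: "real \<Rightarrow> real \<Rightarrow> real \<Rightarrow> real" where
  "hump_den a s t = s + 6 * t + a * t * (1 + t)"

text \<open>Under t = sin^2 \<phi> one has dt = 2 sin \<phi> cos \<phi> d\<phi> and |t'| = sqrt(2/3)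
  cos \<phi> sqrt(\<open>hump_den\<close>), whence the factor sqrt 6. The value is the integral of
  g(f / a) over half a hump.\<close>

definition hump_int :: "(real \<Rightarrow> real) \<Rightarrow> real \<Rightarrow> real \<Rightarrow> real" where
  "hump_int g a s = sqrt 6 * integral {0..pi/2}
     (\<lambda>\<phi>. g ((sin \<phi>)\<^sup>2) * sin \<phi> / sqrt (hump_den a s ((sin \<phi>)\<^sup>2)))"

definition half_width :: "real \<Rightarrow> real \<Rightarrow> real" where
  "half_width a s = hump_int (\<lambda>_. 1) a s"

text \<open>The factor 2 makes this the flux of a whole hump, whereas \<open>half_width\<close>
  measures half of one: \<alpha> is half the opening of the sector.\<close>

definition hump_flux :: "real \<Rightarrow> real \<Rightarrow> real" where
  "hump_flux a s = 2 * a * hump_int (\<lambda>t. t) a s"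

text \<open>\<open>s + 6 + 2 * a\<close> is \<open>hump_den\<close> at t = 1; its positivity says
  that the extremum is a simple root of the first integral, so that the width is finite.\<close>

definition admissible :: "real \<Rightarrow> real \<Rightarrow> bool" where
  "admissible a s \<longleftrightarrow> 0 \<le> s \<and> 0 < s + 6 + 2 * a"

text \<open>For a < 0 the quadratic is concave in t and lies above its chord from s to s + 6 + 2 a.
  At t = 0 it vanishes when s = 0.\<close>

lemma hump_den_pos:
  assumes "admissible a s" "0 < t" "t \<le> 1"
  shows "0 < hump_den a s t"
proof (cases "a \<ge> 0")
  case True
  then have "0 \<le> a * t * (1 + t)" using assms by simp
  then show ?thesis using assms by (simp add: hump_den_def admissible_def)
next
  case False
  have "hump_den a s t = (1 - t) * s + t * (s + 6 + 2 * a) + (- a) * (t * (1 - t))"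
    by (simp add: hump_den_def algebra_simps)
  moreover have "0 \<le> (1 - t) * s" "0 < t * (s + 6 + 2 * a)" "0 \<le> (- a) * (t * (1 - t))"
    using assms False by (auto simp: admissible_def intro!: mult_nonpos_nonneg)
  ultimately show ?thesis by linarith
qed

lemma hump_den_pos':
  assumes "admissible a s" "0 < s" "0 \<le> t" "t \<le> 1"
  shows "0 < hump_den a s t"
  using hump_den_pos[OF assms(1)] assms by (cases "t = 0") (auto simp: hump_den_def)

lemma sin_squared_le_1: "(sin (x::real))\<^sup>2 \<le> 1"
  by (simp add: abs_square_le_1)

lemma hump_integrand_continuous:
  assumes "admissible a s" "continuous_on {0..1} g"
  shows "continuous_on {0<..pi/2} (\<lambda>\<phi>. g ((sin \<phi>)\<^sup>2) * sin \<phi> / sqrt (hump_den a s ((sin \<phi>)\<^sup>2)))"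
proof -
  have "0 < sin \<phi>" if "\<phi> \<in> {0<..pi/2}" for \<phi>
    using that sin_gt_zero[of \<phi>] by auto
  then have "hump_den a s ((sin \<phi>)\<^sup>2) > 0" if "\<phi> \<in> {0<..pi/2}" for \<phi>
    using that by (intro hump_den_pos[OF assms(1)] sin_squared_le_1 zero_less_power) blast
  then show ?thesis
    unfolding hump_den_def
    by (intro continuous_intros continuous_on_compose2[OF assms(2)])
      (fastforce simp: sin_squared_le_1)+
qed

lemma hump_integrand_zero:
  assumes "0 \<le> \<phi>" "\<phi> \<le> pi / 2" "\<phi> \<noteq> 0"
  shows "g * sin \<phi> / sqrt (hump_den a 0 ((sin \<phi>)\<^sup>2)) = g / sqrt (6 + a * (1 + (sin \<phi>)\<^sup>2))"
proof -
  have s: "sin \<phi> > 0" using assms sin_gt_zero[of \<phi>] by auto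
  have "hump_den a 0 ((sin \<phi>)\<^sup>2) = (sin \<phi>)\<^sup>2 * (6 + a * (1 + (sin \<phi>)\<^sup>2))"
    by (simp add: hump_den_def algebra_simps)
  then show ?thesis using s by (simp add: real_sqrt_mult)
qed

text \<open>For s = 0 the denominator vanishes at \<phi> = 0 together with sin \<phi>; after
  cancelling, the integrand agrees off this one point with a continuous function.\<close>

lemma hump_integrable:
  assumes "admissible a s" "continuous_on {0..1} g"
  shows "(\<lambda>\<phi>. g ((sin \<phi>)\<^sup>2) * sin \<phi> / sqrt (hump_den a s ((sin \<phi>)\<^sup>2))) integrable_on {0..pi/2}"
proof (cases "s = 0")
  case False
  then have "hump_den a s ((sin \<phi>)\<^sup>2) > 0" for \<phi>
    using assms by (intro hump_den_pos' sin_squared_le_1) (auto simp: admissible_def)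
  then show ?thesis
    unfolding hump_den_def
    by (intro integrable_continuous_interval continuous_intros continuous_on_compose2[OF assms(2)])
      (fastforce simp: sin_squared_le_1 less_imp_neq[symmetric])+
next
  case True
  have "6 + a * (1 + (sin \<phi>)\<^sup>2) > 0" for \<phi>
  proof -
    have "6 + a * (1 + (sin \<phi>)\<^sup>2) = (6 + 2 * a) * (sin \<phi>)\<^sup>2 + (6 + a) * (1 - (sin \<phi>)\<^sup>2)"
      by (simp add: algebra_simps)
    moreover have "6 + a > 0" "6 + 2 * a > 0" using assms(1) True by (auto simp: admissible_def)
    moreover have "(sin \<phi>)\<^sup>2 \<ge> 0" "1 - (sin \<phi>)\<^sup>2 \<ge> 0" "(sin \<phi>)\<^sup>2 = 0 \<or> (sin \<phi>)\<^sup>2 > 0"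
      using sin_squared_le_1[of \<phi>] by auto
    ultimately show ?thesis
      by (smt (verit) mult_nonneg_nonneg mult_pos_pos)
  qed
  then have "(\<lambda>\<phi>. g ((sin \<phi>)\<^sup>2) / sqrt (6 + a * (1 + (sin \<phi>)\<^sup>2))) integrable_on {0..pi/2}"
    by (intro integrable_continuous_interval continuous_intros continuous_on_compose2[OF assms(2)])
      (fastforce simp: sin_squared_le_1 less_imp_neq[symmetric])+
  then show ?thesis
    by (rule integrable_spike[where S = "{0}"])
      (use True hump_integrand_zero in auto)
qed

lemma hump_int_zero:
  "hump_int g a 0 = sqrt 6 * integral {0..pi/2} (\<lambda>\<phi>. g ((sin \<phi>)\<^sup>2) / sqrt (6 + a * (1 + (sin \<phi>)\<^sup>2)))"
  unfolding hump_int_def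
  by (intro arg_cong[where f = "(*) (sqrt 6)"] integral_spike[where S = "{0}"])
    (use hump_integrand_zero in auto)

text \<open>With \<psi> = arcsin(sqrt t) and X a primitive of the integrand of
  \<open>hump_int\<close>, the function - sqrt 6 X(\<psi>) is a primitive of g(t). The square root
  and the arcsine are not differentiable at the ends, so the fundamental theorem is used with
  interior derivatives only.\<close>

lemma half_hump_decreasing:
  assumes lr: "l < r" and ct: "continuous_on {l..r} t" and ends: "t l = 1" "t r = 0"
    and t: "\<And>x. x \<in> {l<..<r} \<Longrightarrow> 0 < t x \<and> t x < 1"
    and dt: "\<And>x. x \<in> {l<..<r} \<Longrightarrow> (t has_real_derivative t' x) (at x)"
    and neg: "\<And>x. x \<in> {l<..<r} \<Longrightarrow> t' x < 0"
    and sq: "\<And>x. x \<in> {l<..<r} \<Longrightarrow> (t' x)\<^sup>2 = 2 / 3 * (1 - t x) * hump_den a s (t x)"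
    and adm: "admissible a s" and g: "continuous_on {0..1} g"
  shows "((\<lambda>x. g (t x)) has_integral hump_int g a s) {l..r}"
proof -
  define k where "k \<phi> = g ((sin \<phi>)\<^sup>2) * sin \<phi> / sqrt (hump_den a s ((sin \<phi>)\<^sup>2))" for \<phi>
  define X where "X \<phi> = integral {0..\<phi>} k" for \<phi>
  define \<psi> where "\<psi> x = arcsin (sqrt (t x))" for x
  have kint: "k integrable_on {0..pi/2}"
    unfolding k_def[abs_def] by (rule hump_integrable[OF adm g])
  have kcont: "continuous_on {0<..pi/2} k"
    unfolding k_def[abs_def] by (rule hump_integrand_continuous[OF adm g])
  have Xcont: "continuous_on {0..pi/2} X"
    unfolding X_def[abs_def] by (rule indefinite_integral_continuous_1[OF kint])
  have Xder: "(X has_real_derivative k \<phi>) (at \<phi>)" if \<phi>: "\<phi> \<in> {0<..<pi/2}" for \<phi>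
  proof -
    have "continuous_on {0<..<pi/2} k" using kcont by (rule continuous_on_subset) auto
    then have "isCont k \<phi>" using \<phi> by (simp add: continuous_on_eq_continuous_at)
    then have "continuous (at \<phi> within {0..pi/2}) k" by (rule continuous_at_imp_continuous_at_within)
    then have "(X has_vector_derivative k \<phi>) (at \<phi> within {0..pi/2})"
      unfolding X_def[abs_def]
      using integral_has_vector_derivative_continuous_at[OF kint, of \<phi> "{}"] \<phi> by auto
    then have "(X has_vector_derivative k \<phi>) (at \<phi> within {0<..<pi/2})"
      by (rule has_vector_derivative_within_subset) auto
    then show ?thesis
      unfolding at_within_open[OF \<phi> open_greaterThanLessThan] has_real_derivative_iff_has_vector_derivative .
  qed
  have t01: "0 \<le> t x" "t x \<le> 1" if "x \<in> {l..r}" for x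
    using that t[of x] ends by (cases "x = l"; cases "x = r"; force)+
  have psi_range: "\<psi> x \<in> {0..pi/2}" if "x \<in> {l..r}" for x
  proof -
    have "-1 \<le> sqrt (t x)" using t01[OF that] by (auto intro: order_trans[of "-1" 0])
    then have "0 \<le> arcsin (sqrt (t x))" "arcsin (sqrt (t x)) \<le> pi / 2"
      using t01[OF that] by (auto intro!: arcsin_nonneg arcsin_ubound simp del: le_divide_eq_numeral1)
    then show ?thesis by (simp add: \<psi>_def)
  qed
  have psi_cont: "continuous_on {l..r} \<psi>"
    unfolding \<psi>_def[abs_def]
    by (intro continuous_intros ct) (use t01 in \<open>auto intro: order_trans[of "-1" 0]\<close>)
  have "((\<lambda>x. g (t x)) has_integral (- sqrt 6 * X (\<psi> r) - - sqrt 6 * X (\<psi> l))) {l..r}"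
  proof (rule fundamental_theorem_of_calculus_interior)
    show "continuous_on {l..r} (\<lambda>x. - sqrt 6 * X (\<psi> x))"
      by (intro continuous_intros continuous_on_compose2[OF Xcont psi_cont]) (use psi_range in auto)
    fix x assume x: "x \<in> {l<..<r}"
    have tx: "0 < t x" "t x < 1" using t[OF x] by auto
    have sinp: "sin (\<psi> x) = sqrt (t x)"
      unfolding \<psi>_def using tx by (intro sin_arcsin) (auto intro: order_trans[of "-1" 0])
    have psi_in: "\<psi> x \<in> {0<..<pi/2}"
    proof -
      have "sin (\<psi> x) \<noteq> sin 0" "sin (\<psi> x) \<noteq> sin (pi / 2)"
        using tx sinp by auto
      then have "\<psi> x \<noteq> 0" "\<psi> x \<noteq> pi / 2" by metis+
      then show ?thesis using psi_range[of x] x by auto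
    qed

    have dpsi: "(\<psi> has_real_derivative t' x / (2 * sqrt (t x) * sqrt (1 - t x))) (at x)"
      unfolding \<psi>_def[abs_def] using tx dt[OF x]
      by (auto intro!: derivative_eq_intros simp: less_trans[of "-1" 0] real_sqrt_lt_1_iff field_simps)
    have den: "hump_den a s (t x) > 0" using tx by (intro hump_den_pos[OF adm]) auto
    have t'x: "t' x = - (sqrt (2/3) * sqrt (1 - t x) * sqrt (hump_den a s (t x)))"
    proof -
      have "\<bar>t' x\<bar> = sqrt (2 / 3 * (1 - t x) * hump_den a s (t x))"
        using sq[OF x] by (metis real_sqrt_abs)
      also have "\<dots> = sqrt (2/3) * sqrt (1 - t x) * sqrt (hump_den a s (t x))"
        by (simp only: real_sqrt_mult)
      finally show ?thesis using neg[OF x] by linarith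
    qed
    have "((\<lambda>x. - sqrt 6 * X (\<psi> x)) has_real_derivative
        - sqrt 6 * (k (\<psi> x) * (t' x / (2 * sqrt (t x) * sqrt (1 - t x))))) (at x)"
      by (intro DERIV_cmult DERIV_chain2[OF Xder[OF psi_in] dpsi])
    also have "- sqrt 6 * (k (\<psi> x) * (t' x / (2 * sqrt (t x) * sqrt (1 - t x)))) = g (t x)"
    proof -
      have "sqrt 6 * sqrt (2/3) = sqrt (4::real)" by (simp flip: real_sqrt_mult)
      then have s: "sqrt 6 * sqrt (2/3) = (2::real)" by simp
      have "- sqrt 6 * (k (\<psi> x) * (t' x / (2 * sqrt (t x) * sqrt (1 - t x))))
        = (sqrt 6 * sqrt (2/3)) * g (t x) * sqrt (t x) * sqrt (1 - t x) * sqrt (hump_den a s (t x))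
          / (2 * sqrt (t x) * sqrt (1 - t x) * sqrt (hump_den a s (t x)))"
        unfolding k_def sinp t'x using tx by simp
      also have "\<dots> = g (t x)" unfolding s using tx den by simp
      finally show ?thesis .
    qed
    finally show "((\<lambda>x. - sqrt 6 * X (\<psi> x)) has_vector_derivative g (t x)) (at x)"
      by (simp add: has_real_derivative_iff_has_vector_derivative)
  qed (use lr in simp)
  moreover have "\<psi> l = pi / 2" "\<psi> r = 0" by (simp_all add: \<psi>_def ends)
  ultimately show ?thesis
    by (simp add: hump_int_def X_def k_def[abs_def])
qed

text \<open>The identity for t'^2 makes t' nonzero inside; being continuous and negative somewhere
  by the mean value theorem, it is negative throughout.\<close>

lemma half_hump:
  assumes lr: "l < r" and ct: "continuous_on {l..r} t" and ends: "t l = 1" "t r = 0"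
    and t: "\<And>x. x \<in> {l<..<r} \<Longrightarrow> 0 < t x \<and> t x < 1"
    and dt: "\<And>x. x \<in> {l<..<r} \<Longrightarrow> (t has_real_derivative t' x) (at x)"
    and ct': "continuous_on {l<..<r} t'"
    and sq: "\<And>x. x \<in> {l<..<r} \<Longrightarrow> (t' x)\<^sup>2 = 2 / 3 * (1 - t x) * hump_den a s (t x)"
    and adm: "admissible a s" and g: "continuous_on {0..1} g"
  shows "((\<lambda>x. g (t x)) has_integral hump_int g a s) {l..r}"
proof (rule half_hump_decreasing[OF lr ct ends t dt _ sq adm g])
  have nz: "t' x \<noteq> 0" if "x \<in> {l<..<r}" for x
    using sq[OF that] t[OF that] hump_den_pos[OF adm, of "t x"] by auto
  obtain z where z: "l < z" "z < r" "t r - t l = (r - l) * t' z"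
    using mvt_simple[OF lr] MVT[OF lr ct] dt by (metis DERIV_unique greaterThanLessThan_iff real_differentiable_def)
  then have tz: "t' z < 0" using ends lr by (smt (verit) zero_le_mult_iff)
  fix x assume x: "x \<in> {l<..<r}"
  show "t' x < 0"
  proof (rule ccontr)
    assume "\<not> t' x < 0"
    moreover have "connected (t' ` {l<..<r})"
      by (intro connected_continuous_image ct') simp
    ultimately have "0 \<in> t' ` {l<..<r}"
      using connected_contains_Icc[of "t' ` {l<..<r}" "t' z" "t' x"] tz x z by auto
    then show False using nz by auto
  qed
qed


section \<open>Humps of solutions of the profile equation\<close>

definition first_integral :: "real \<Rightarrow> real \<Rightarrow> real \<Rightarrow> real" where
  "first_integral K C x = C + 2 * K * x - 4 * x\<^sup>2 - 2 / 3 * x ^ 3"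

text \<open>By admissibility the first integral is positive between 0 and a, and a is a simple root:
  among the roots on its side it is the one next to 0.\<close>

definition extremum :: "real \<Rightarrow> real \<Rightarrow> real \<Rightarrow> bool" where
  "extremum K C a \<longleftrightarrow> a \<noteq> 0 \<and> first_integral K C a = 0 \<and> admissible a (3 / 2 * C / a\<^sup>2)"

text \<open>Division of the cubic by its root a; the root equation eliminates K, and C is traded for
  s.\<close>

lemma first_integral_factor:
  assumes "a \<noteq> 0" "first_integral K C a = 0"
  shows "first_integral K C (a * t) = 2 / 3 * a\<^sup>2 * (1 - t) * hump_den a (3 / 2 * C / a\<^sup>2) t"
proof -
  define s where "s = 3 / 2 * C / a\<^sup>2"
  have C: "C = 2 / 3 * a\<^sup>2 * s" using assms by (simp add: s_def)
  have K: "2 * K * a = 4 * a\<^sup>2 + 2 / 3 * a ^ 3 - C"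
    using assms(2) by (simp add: first_integral_def)
  have "first_integral K C (a * t) = C + (2 * K * a) * t - 4 * (a * t)\<^sup>2 - 2 / 3 * (a * t) ^ 3"
    by (simp add: first_integral_def)
  also have "\<dots> = C * (1 - t) + (4 * a\<^sup>2 + 2 / 3 * a ^ 3) * t - 4 * (a * t)\<^sup>2 - 2 / 3 * (a * t) ^ 3"
    unfolding K by (simp add: algebra_simps)
  also have "\<dots> = 2 / 3 * a\<^sup>2 * (1 - t) * hump_den a s t"
    unfolding C hump_den_def by (simp add: power2_eq_square power3_eq_cube field_simps)
  finally show ?thesis by (simp add: s_def)
qed

text \<open>A root of smaller modulus on the same side would lie where the factorised first integral
  is positive. For this reason all humps of one sign are congruent.\<close>

lemma extremum_unique:
  assumes "extremum K C a" "extremum K C b" "0 < a * b"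
  shows "a = b"
proof -
  have False if ab: "\<bar>b\<bar> < \<bar>a\<bar>" "extremum K C a" "extremum K C b" "0 < a * b" for a b
  proof -
    have t: "0 < b / a" "b / a < 1"
      using ab by (auto simp: zero_less_mult_iff zero_less_divide_iff divide_less_eq_1)
    have a: "a \<noteq> 0" "first_integral K C a = 0" "admissible a (3 / 2 * C / a\<^sup>2)"
      using ab(2) unfolding extremum_def by blast+
    have "0 < first_integral K C (a * (b / a))"
      unfolding first_integral_factor[OF a(1,2)] using t a
      by (intro mult_pos_pos hump_den_pos[OF a(3)]) auto
    then show False using ab by (auto simp: extremum_def)
  qed
  from this[of b a] this[of a b] have "\<not> \<bar>b\<bar> < \<bar>a\<bar>" "\<not> \<bar>a\<bar> < \<bar>b\<bar>"
    using assms by (auto simp: mult.commute)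
  then show ?thesis using assms(3) by (auto simp: zero_less_mult_iff)
qed

text \<open>The function y^2 exp(-2 M x) is nonincreasing and vanishes at the left end.\<close>

lemma gronwall_zero:
  fixes y :: "real \<Rightarrow> real"
  assumes "c \<le> d" "continuous_on {c..d} y" "y c = 0"
    and dy: "\<And>x. x \<in> {c<..<d} \<Longrightarrow> (y has_real_derivative y' x) (at x)"
    and le: "\<And>x. x \<in> {c<..<d} \<Longrightarrow> \<bar>y' x\<bar> \<le> M * \<bar>y x\<bar>"
  shows "y d = 0"
proof -
  have "(y d)\<^sup>2 * exp (- 2 * M * d) \<le> (y c)\<^sup>2 * exp (- 2 * M * c)"
  proof (rule DERIV_nonpos_imp_decreasing_open[OF assms(1)])
    fix x assume x: "c < x" "x < d"
    have "y x * y' x \<le> \<bar>y x\<bar> * \<bar>y' x\<bar>" by (metis abs_ge_self abs_mult)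
    also have "\<dots> \<le> \<bar>y x\<bar> * (M * \<bar>y x\<bar>)" using le[of x] x by (intro mult_left_mono) auto
    also have "\<dots> = M * (y x)\<^sup>2" by (simp add: power2_eq_square)
    finally have *: "y x * y' x \<le> M * (y x)\<^sup>2" .
    have "((\<lambda>x. (y x)\<^sup>2 * exp (- 2 * M * x)) has_real_derivative
        2 * (y x * y' x - M * (y x)\<^sup>2) * exp (- 2 * M * x)) (at x)"
      using dy[of x] x by (auto intro!: derivative_eq_intros simp: algebra_simps power2_eq_square)
    moreover have "2 * (y x * y' x - M * (y x)\<^sup>2) * exp (- 2 * M * x) \<le> 0"
    proof -
      have "y x * y' x - M * (y x)\<^sup>2 \<le> 0" using * by (simp only: diff_le_0_iff_le)
      then have "2 * (y x * y' x - M * (y x)\<^sup>2) \<le> 0" by (rule mult_nonneg_nonpos[rotated]) simp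
      then show ?thesis by (rule mult_nonpos_nonneg) simp
    qed
    ultimately show "\<exists>z. ((\<lambda>x. (y x)\<^sup>2 * exp (- 2 * M * x)) has_real_derivative z) (at x) \<and> z \<le> 0" by blast
  qed (intro continuous_intros assms)
  then have "(y d)\<^sup>2 \<le> 0" using assms(3) by (simp add: mult_le_0_iff)
  then show ?thesis by simp
qed

text \<open>\<sigma> carries the sign of the hump, so both signs are treated at once. The extremum a
  is located as the maximum of \<sigma> f; it is a root of the first integral, and f / a meets the
  hypotheses of \<open>half_hump\<close> on either side once a double root and a plateau are ruled
  out.\<close>

lemma hump:
  assumes lr: "l < r" and cf: "continuous_on {l..r} f" and ends: "f l = 0" "f r = 0"
    and sgn: "\<And>x. x \<in> {l<..<r} \<Longrightarrow> 0 < \<sigma> * f x"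
    and d1: "\<And>x. x \<in> {l<..<r} \<Longrightarrow> (f has_real_derivative f' x) (at x)"
    and d2: "\<And>x. x \<in> {l<..<r} \<Longrightarrow> (f' has_real_derivative K - 4 * f x - (f x)\<^sup>2) (at x)"
    and fi: "\<And>x. x \<in> {l<..<r} \<Longrightarrow> (f' x)\<^sup>2 = first_integral K C (f x)"
    and C: "0 \<le> C"
  obtains a where "0 < \<sigma> * a" "extremum K C a"
    "\<And>g. continuous_on {0..1} g \<Longrightarrow>
      ((\<lambda>x. g (f x / a)) has_integral 2 * hump_int g a (3 / 2 * C / a\<^sup>2)) {l..r}"
proof -
  have "continuous_on {l..r} (\<lambda>x. \<sigma> * f x)" by (intro continuous_intros cf)
  then obtain \<theta> where \<theta>: "\<theta> \<in> {l..r}" "\<And>x. x \<in> {l..r} \<Longrightarrow> \<sigma> * f x \<le> \<sigma> * f \<theta>"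
    using continuous_attains_sup[of "{l..r}" "\<lambda>x. \<sigma> * f x"] lr by auto
  define a where "a = f \<theta>"
  define s where "s = 3 / 2 * C / a\<^sup>2"
  define t where "t x = f x / a" for x
  define t' where "t' x = f' x / a" for x
  have "0 < \<sigma> * f ((l + r) / 2)" using lr by (intro sgn) auto
  also have "\<dots> \<le> \<sigma> * f \<theta>" using lr by (intro \<theta>(2)) auto
  finally have sa: "0 < \<sigma> * a" by (simp add: a_def)
  then have a0: "a \<noteq> 0" by auto
  have \<theta>in: "l < \<theta>" "\<theta> < r" using \<theta>(1) sa ends by (auto simp: a_def le_less)
  have t_eq: "t x = (\<sigma> * f x) / (\<sigma> * a)" for x using sa by (auto simp: t_def)
  have t_le: "t x \<le> 1" if "x \<in> {l..r}" for x
    unfolding t_eq divide_le_eq_1_pos[OF sa] using \<theta>(2)[OF that] by (simp only: a_def)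
  have t_pos: "0 < t x" if "x \<in> {l<..<r}" for x
    unfolding t_eq by (rule divide_pos_pos[OF sgn[OF that] sa])
  have t_ends: "t l = 0" "t r = 0" "t \<theta> = 1" using ends a0 by (auto simp: t_def a_def)
  have ct: "continuous_on X t" if "X \<subseteq> {l..r}" for X
    unfolding t_def[abs_def] using a0 continuous_on_subset[OF cf that] by (intro continuous_intros) auto
  have dt: "(t has_real_derivative t' x) (at x)" if "x \<in> {l<..<r}" for x
    unfolding t_def[abs_def] t'_def using d1[OF that] by (intro DERIV_cdivide)
  have ct': "continuous_on X t'" if "X \<subseteq> {l<..<r}" for X
    unfolding t'_def[abs_def]
    using a0 DERIV_isCont[OF d2] that by (intro continuous_intros continuous_at_imp_continuous_on) auto
  have "f' \<theta> = 0"
  proof -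
    have "t' \<theta> = 0"
      using dt[of \<theta>] \<theta>in t_le t_ends
      by (intro DERIV_local_max[of t "t' \<theta>" \<theta> "min (\<theta> - l) (r - \<theta>)"]) (auto simp: abs_less_iff)
    then show ?thesis using a0 by (simp add: t'_def)
  qed
  then have root: "first_integral K C a = 0" using fi[of \<theta>] \<theta>in by (simp add: a_def)
  have sq: "(t' x)\<^sup>2 = 2 / 3 * (1 - t x) * hump_den a s (t x)" if "x \<in> {l<..<r}" for x
  proof -
    have "(f' x)\<^sup>2 = 2 / 3 * a\<^sup>2 * (1 - t x) * hump_den a s (t x)"
      using fi[OF that] first_integral_factor[OF a0 root, of "t x"] a0 by (simp add: t_def s_def)
    then show ?thesis using a0 by (simp add: t'_def power_divide)
  qed
  have s0: "0 \<le> s" using C by (simp add: s_def)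
  \<comment> \<open>Every y in (0, 1) is a value of t by the intermediate value theorem, and there
    the square t'^2 forces the sign.\<close>
  have den_nonneg: "0 \<le> hump_den a s y" if y: "0 < y" "y < 1" for y
  proof -
    obtain x where x: "l \<le> x" "x \<le> \<theta>" "t x = y"
      using IVT'[of t l y \<theta>] y \<theta>in t_ends ct[of "{l..\<theta>}"] by auto
    have "x \<noteq> l" using x(3) y t_ends(1) by force
    then have "x \<in> {l<..<r}" using x(1,2) \<theta>in by simp
    from sq[OF this] have "0 \<le> (2 / 3 * (1 - y)) * hump_den a s y"
      by (simp only: x(3)[symmetric]) (metis zero_le_power2)
    then show ?thesis using y by (simp add: zero_le_mult_iff)
  qed
  have den1: "hump_den a s 1 = s + 6 + 2 * a" by (simp add: hump_den_def)
  have "0 \<le> hump_den a s 1"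
  proof (rule tendsto_lowerbound)
    show "(hump_den a s \<longlongrightarrow> hump_den a s 1) (at_left 1)"
      unfolding hump_den_def[abs_def] by (intro tendsto_intros)
    show "\<forall>\<^sub>F y in at_left 1. 0 \<le> hump_den a s y"
      by (rule eventually_at_leftI[of 0]) (use den_nonneg in auto)
  qed auto
  moreover have "hump_den a s 1 \<noteq> 0"
  proof
    assume z: "hump_den a s 1 = 0"
    \<comment> \<open>A zero of the quadratic at 1 splits off a second factor 1 - y. Then 1 - t
      obeys a linear differential inequality and cannot leave 0, although t has to return to 0 at
      r.\<close>
    have den: "hump_den a s y = (1 - y) * (s - a * y)" for y
    proof -
      have "hump_den a s y = (1 - y) * (s - a * y) + y * hump_den a s 1"
        by (simp add: hump_den_def algebra_simps)
      then show ?thesis using z by simp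
    qed
    define M where "M = sqrt (2 / 3 * (\<bar>s\<bar> + \<bar>a\<bar>))"
    have "(\<lambda>x. 1 - t x) r = 0"
    proof (rule gronwall_zero[of \<theta> r _ "\<lambda>x. - t' x" M])
      fix x assume x: "x \<in> {\<theta><..<r}"
      then have xl: "x \<in> {l<..<r}" using \<theta>in by auto
      show "((\<lambda>x. 1 - t x) has_real_derivative - t' x) (at x)"
        using dt[OF xl] by (auto intro!: derivative_eq_intros)
      have "(t' x)\<^sup>2 = (2 / 3 * (s - a * t x)) * (1 - t x)\<^sup>2"
        by (simp only: sq[OF xl] den power2_eq_square[of "1 - t x"] ac_simps)
      also have "\<dots> \<le> (2 / 3 * (\<bar>s\<bar> + \<bar>a\<bar>)) * (1 - t x)\<^sup>2"
      proof (intro mult_right_mono mult_left_mono)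
        have "\<bar>a * t x\<bar> \<le> \<bar>a\<bar> * 1"
          unfolding abs_mult using t_pos[OF xl] t_le[of x] xl by (intro mult_left_mono) auto
        then show "s - a * t x \<le> \<bar>s\<bar> + \<bar>a\<bar>" by linarith
      qed auto
      also have "\<dots> = (M * \<bar>1 - t x\<bar>)\<^sup>2" by (simp add: M_def power_mult_distrib)
      finally show "\<bar>- t' x\<bar> \<le> M * \<bar>1 - t x\<bar>"
        by (simp add: M_def abs_le_square_iff[symmetric] abs_mult)
    qed (use \<theta>in t_ends in \<open>auto intro!: continuous_intros ct\<close>)
    then show False using t_ends by simp
  qed
  ultimately have adm: "admissible a s" using s0 den1 by (simp add: admissible_def)
  \<comment> \<open>A second maximum point would enclose a stretch with t = 1, since an interior
    minimum below 1 contradicts the formula for t'^2. On the stretch f is constant, the second-order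
    equation fixes K, and s = - (6 + 2 a) follows, against admissibility.\<close>
  have t_less: "t x < 1" if x: "x \<in> {l<..<r}" "x \<noteq> \<theta>" for x
  proof (rule ccontr)
    assume "\<not> t x < 1"
    then have tx: "t x = 1" using t_le[of x] x by auto
    define c where "c = min x \<theta>"
    define d where "d = max x \<theta>"
    have cd: "c < d" "{c..d} \<subseteq> {l<..<r}" "t c = 1" "t d = 1" "l < c" "d < r"
      using x \<theta>in tx t_ends by (auto simp: c_def d_def min_def max_def)
    have "continuous_on {c..d} t" using cd by (intro ct) auto
    then obtain y where y: "y \<in> {c..d}" "\<And>z. z \<in> {c..d} \<Longrightarrow> t y \<le> t z"
      using continuous_attains_inf[of "{c..d}" t] cd by auto
    have "t y = 1"
    proof (rule ccontr)
      assume ty: "t y \<noteq> 1"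
      then have yin: "c < y" "y < d" using y cd by (auto simp: le_less)
      have yl: "y \<in> {l<..<r}" using y cd by auto
      have "t' y = 0"
        using dt[OF yl] yin y
        by (intro DERIV_local_min[of t "t' y" y "min (y - c) (d - y)"]) (auto simp: abs_less_iff)
      then show False
        using sq[OF yl] ty t_pos[OF yl] t_le[of y] yl hump_den_pos[OF adm, of "t y"] by auto
    qed
    then have "t z = 1" if "z \<in> {c..d}" for z using y(2)[OF that] t_le[of z] that cd by force
    then have f'0: "f' z = 0" if "z \<in> {c<..<d}" for z
      using sq[of z] that cd a0 by (force simp: t'_def)
    define m where "m = (c + d) / 2"
    have m: "m \<in> {c<..<d}" using cd by (auto simp: m_def)
    have "(f' has_real_derivative 0) (at m)"
      by (rule has_field_derivative_transform_within_open[of "\<lambda>_. 0" _ _ "{c<..<d}"])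
        (use f'0 m in auto)
    moreover have "f m = a" using \<open>\<And>z. z \<in> {c..d} \<Longrightarrow> t z = 1\<close>[of m] m a0 by (simp add: t_def)
    ultimately have K: "K - 4 * a - a\<^sup>2 = 0"
      using DERIV_unique[OF d2[of m]] m cd by force
    have "C + 2 * K * a - 4 * a\<^sup>2 - 2 / 3 * a ^ 3 = 0" using root by (simp add: first_integral_def)
    then have "C + 2 * (4 * a + a\<^sup>2) * a - 4 * a\<^sup>2 - 2 / 3 * a ^ 3 = 0" using K by (simp add: algebra_simps)
    then have "C = - (4 * a\<^sup>2 + 4 / 3 * a ^ 3)"
      by (simp add: algebra_simps power2_eq_square power3_eq_cube)
    then have "s = - (6 + 2 * a)" using a0 by (simp add: s_def field_simps power2_eq_square power3_eq_cube)
    then show False using adm by (simp add: admissible_def)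
  qed
  have int: "((\<lambda>x. g (f x / a)) has_integral 2 * hump_int g a s) {l..r}" if g: "continuous_on {0..1} g" for g
  proof -
    have R: "((\<lambda>x. g (t x)) has_integral hump_int g a s) {\<theta>..r}"
      using \<theta>in t_pos t_less t_ends dt sq
      by (intro half_hump[where t' = t', OF _ _ _ _ _ _ _ _ adm g] ct ct') auto
    \<comment> \<open>The left half is reflected, as \<open>half_hump\<close> runs from the extremum
      down to zero.\<close>
    have "((\<lambda>x. g (t (- x))) has_integral hump_int g a s) {-\<theta>..-l}"
    proof (rule half_hump[where t' = "\<lambda>x. - t' (- x)" and t = "\<lambda>x. t (- x)", OF _ _ _ _ _ _ _ _ adm g])
      show "continuous_on {- \<theta>..- l} (\<lambda>x. t (- x))"
        by (rule continuous_on_compose2[OF ct[OF subset_refl]]) (use \<theta>in in \<open>auto intro: continuous_intros\<close>)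
      show "continuous_on {- \<theta><..<- l} (\<lambda>x. - t' (- x))"
        by (intro continuous_intros continuous_on_compose2[OF ct'[OF subset_refl]])
          (use \<theta>in in auto)
      fix x assume x: "x \<in> {- \<theta><..<- l}"
      then have xl: "- x \<in> {l<..<r}" "- x \<noteq> \<theta>" using \<theta>in by auto
      show "0 < t (- x) \<and> t (- x) < 1" using t_pos t_less xl by auto
      show "((\<lambda>x. t (- x)) has_real_derivative - t' (- x)) (at x)"
        using DERIV_mirror[of t "t' (- x)" x] dt[OF xl(1)] by simp
      show "(- t' (- x))\<^sup>2 = 2 / 3 * (1 - t (- x)) * hump_den a s (t (- x))"
        using sq[OF xl(1)] by simp
    qed (use \<theta>in t_ends in auto)
    then have L: "((\<lambda>x. g (t x)) has_integral hump_int g a s) {l..\<theta>}"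
      by (simp only: has_integral_reflect_real[of "\<lambda>x. g (t x)"])
    show ?thesis
      using has_integral_combine[OF _ _ L R] \<theta>in by (simp add: t_def)
  qed
  show thesis
    by (rule that[of a]) (use sa a0 root adm int in \<open>auto simp: extremum_def s_def\<close>)
qed

section \<open>Counting humps\<close>

lemma bounded_open_connected_real:
  fixes c :: "real set"
  assumes "open c" "connected c" "c \<noteq> {}" "bounded c"
  shows "c = {Inf c<..<Sup c}"
proof
  have bd: "bdd_below c" "bdd_above c" using assms(4) by (auto simp: bounded_imp_bdd_below bounded_imp_bdd_above)
  show "c \<subseteq> {Inf c<..<Sup c}"
  proof
    fix x assume x: "x \<in> c"
    then obtain e where e: "e > 0" "cball x e \<subseteq> c"
      using assms(1) open_contains_cball by blast
    then have "x - e \<in> c" "x + e \<in> c" by (auto simp: subset_iff dist_real_def)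
    then have "Inf c \<le> x - e" "x + e \<le> Sup c" using bd by (auto intro: cInf_lower cSup_upper)
    then show "x \<in> {Inf c<..<Sup c}" using e by auto
  qed
  show "{Inf c<..<Sup c} \<subseteq> c"
  proof
    fix x assume "x \<in> {Inf c<..<Sup c}"
    then obtain y z where "y \<in> c" "z \<in> c" "y < x" "x < z"
      using cInf_less_iff[OF assms(3) bd(1)] less_cSup_iff[OF assms(3) bd(2)] by auto
    then show "x \<in> c" using connected_contains_Icc[OF assms(2), of y z] by auto
  qed
qed

text \<open>The equations are available in the open interval only, so the slopes at the walls are
  not at hand; the sign of C, which stands for their square, is recorded separately.\<close>

definition profile_solution :: "real \<Rightarrow> (real \<Rightarrow> real) \<Rightarrow> (real \<Rightarrow> real) \<Rightarrow> real \<Rightarrow> real \<Rightarrow> bool" where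
  "profile_solution \<alpha> f f' K C \<longleftrightarrow>
     continuous_on {-\<alpha>..\<alpha>} f \<and> f \<alpha> = 0 \<and> f (-\<alpha>) = 0 \<and> 0 \<le> C \<and>
     (\<forall>\<theta>\<in>{-\<alpha><..<\<alpha>}. (f has_real_derivative f' \<theta>) (at \<theta>) \<and>
        (f' has_real_derivative K - 4 * f \<theta> - (f \<theta>)\<^sup>2) (at \<theta>) \<and>
        (f' \<theta>)\<^sup>2 = first_integral K C (f \<theta>))"

lemma profile_solutionI:
  assumes \<alpha>: "0 < \<alpha>" and cf: "continuous_on {-\<alpha>..\<alpha>} f" and bc: "f \<alpha> = 0" "f (-\<alpha>) = 0"
    and d1: "\<And>\<theta>. \<theta> \<in> {-\<alpha><..<\<alpha>} \<Longrightarrow> (f has_real_derivative f' \<theta>) (at \<theta>)"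
    and d2: "\<And>\<theta>. \<theta> \<in> {-\<alpha><..<\<alpha>} \<Longrightarrow> (f' has_real_derivative K - 4 * f \<theta> - (f \<theta>)\<^sup>2) (at \<theta>)"
  shows "\<exists>C. profile_solution \<alpha> f f' K C"
proof -
  define E where "E \<theta> = (f' \<theta>)\<^sup>2 - first_integral K 0 (f \<theta>)" for \<theta>
  have dE: "(E has_real_derivative 0) (at \<theta> within {-\<alpha><..<\<alpha>})" if "\<theta> \<in> {-\<alpha><..<\<alpha>}" for \<theta>
  proof (rule has_field_derivative_at_within)
    show "(E has_real_derivative 0) (at \<theta>)"
      unfolding E_def[abs_def] first_integral_def
      by (rule derivative_eq_intros d1[OF that] d2[OF that] refl)+
        (simp add: algebra_simps power2_eq_square power3_eq_cube)
  qed
  have "\<exists>C. \<forall>\<theta>\<in>{-\<alpha><..<\<alpha>}. E \<theta> = C"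
    by (rule has_field_derivative_zero_constant[OF convex_real_interval(8) dE])
  then obtain C where C: "\<And>\<theta>. \<theta> \<in> {-\<alpha><..<\<alpha>} \<Longrightarrow> E \<theta> = C" by metis
  have fi: "first_integral K C x = C + first_integral K 0 x" for x
    by (simp add: first_integral_def)
  \<comment> \<open>The inequality f'^2 \<ge> 0 is carried to the wall by continuity of f; there f =
    0 and it reads 0 \<le> C.\<close>
  have "- first_integral K 0 (f \<alpha>) \<le> C"
  proof (rule tendsto_upperbound)
    have "(f \<longlongrightarrow> f \<alpha>) (at \<alpha> within {-\<alpha>..\<alpha>})"
      using cf \<alpha> by (auto simp: continuous_on_def)
    then have "(f \<longlongrightarrow> f \<alpha>) (at_left \<alpha>)"
      using \<alpha> by (simp add: at_within_Icc_at_left)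
    then show "((\<lambda>\<theta>. - first_integral K 0 (f \<theta>)) \<longlongrightarrow> - first_integral K 0 (f \<alpha>)) (at_left \<alpha>)"
      unfolding first_integral_def by (intro tendsto_intros)
    show "\<forall>\<^sub>F \<theta> in at_left \<alpha>. - first_integral K 0 (f \<theta>) \<le> C"
    proof (rule eventually_at_leftI[of "-\<alpha>"])
      fix \<theta> assume "\<theta> \<in> {-\<alpha><..<\<alpha>}"
      from C[OF this] show "- first_integral K 0 (f \<theta>) \<le> C"
        unfolding E_def by (smt (verit) zero_le_power2)
    qed (use \<alpha> in auto)
  qed auto
  then have "0 \<le> C" using bc by (simp add: first_integral_def)
  moreover have "(f' \<theta>)\<^sup>2 = first_integral K C (f \<theta>)" if "\<theta> \<in> {-\<alpha><..<\<alpha>}" for \<theta>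
    using C[OF that] fi[of "f \<theta>"] by (simp add: E_def)
  ultimately show ?thesis
    unfolding profile_solution_def using assms by blast
qed

text \<open>If f did not vanish at an endpoint, that endpoint would lie inside the open interval
  with \<sigma> f > 0, and adding it would enlarge the component.\<close>

lemma component_interval:
  fixes f :: "real \<Rightarrow> real"
  assumes cf: "continuous_on {-\<alpha>..\<alpha>} f" and bc: "f \<alpha> = 0" "f (-\<alpha>) = (0::real)"
    and c: "c \<in> components {\<theta> \<in> {-\<alpha><..<\<alpha>}. 0 < \<sigma> * f \<theta>}"
  obtains l r where "l < r" "-\<alpha> \<le> l" "r \<le> \<alpha>" "c = {l<..<r}" "f l = 0" "f r = 0"
    "\<And>x. x \<in> {l<..<r} \<Longrightarrow> 0 < \<sigma> * f x" "\<sigma> \<noteq> 0"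
proof -
  let ?S = "{\<theta> \<in> {-\<alpha><..<\<alpha>}. 0 < \<sigma> * f \<theta>}"
  have cS: "c \<subseteq> ?S" and cc: "connected c" and cn: "c \<noteq> {}"
    using in_components_subset[OF c] in_components_connected[OF c] in_components_nonempty[OF c] by auto
  have "continuous_on {-\<alpha><..<\<alpha>} (\<lambda>\<theta>. \<sigma> * f \<theta>)"
    by (intro continuous_on_mult continuous_on_const continuous_on_subset[OF cf]) auto
  then have "open ({-\<alpha><..<\<alpha>} \<inter> (\<lambda>\<theta>. \<sigma> * f \<theta>) -` {0<..})"
    by (rule continuous_open_preimage) auto
  also have "{-\<alpha><..<\<alpha>} \<inter> (\<lambda>\<theta>. \<sigma> * f \<theta>) -` {0<..} = ?S" by auto
  finally have oc: "open c" using open_components c by blast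
  have bc': "bounded c" using cS by (intro bounded_subset[OF bounded_closed_interval[of "-\<alpha>" \<alpha>]]) auto
  define l where "l = Inf c"
  define r where "r = Sup c"
  have ceq: "c = {l<..<r}"
    unfolding l_def r_def by (rule bounded_open_connected_real[OF oc cc cn bc'])
  then have lr: "l < r" using cn by auto
  have "c \<subseteq> {-\<alpha>..\<alpha>}" using cS by auto
  then have sub: "{l..r} \<subseteq> {-\<alpha>..\<alpha>}"
    using closure_minimal[of c "{-\<alpha>..\<alpha>}"] lr unfolding ceq by (simp add: closure_greaterThanLessThan)
  have pos: "0 < \<sigma> * f x" if "x \<in> {l<..<r}" for x using cS ceq that by auto
  have "0 < \<sigma> * f ((l + r) / 2)" using lr by (intro pos) auto
  then have s0: "\<sigma> \<noteq> 0" by auto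
  have "continuous_on {-\<alpha>..\<alpha>} (\<lambda>\<theta>. \<sigma> * f \<theta>)"
    by (intro continuous_on_mult continuous_on_const cf)
  then have cl: "closed ({-\<alpha>..\<alpha>} \<inter> (\<lambda>\<theta>. \<sigma> * f \<theta>) -` {0..})"
    by (rule continuous_closed_preimage) auto
  have "closure c \<subseteq> {-\<alpha>..\<alpha>} \<inter> (\<lambda>\<theta>. \<sigma> * f \<theta>) -` {0..}"
    by (rule closure_minimal[OF _ cl]) (use cS in force)
  then have nn: "0 \<le> \<sigma> * f x" if "x \<in> {l..r}" for x
    using that lr unfolding ceq by (auto simp: closure_greaterThanLessThan)
  have endpt: "f x = 0" if x: "x = l \<or> x = r" for x
  proof (rule ccontr)
    assume fx: "f x \<noteq> 0"
    then have "x \<noteq> \<alpha>" "x \<noteq> -\<alpha>" using bc by auto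
    then have xin: "x \<in> {-\<alpha><..<\<alpha>}" using sub x lr by auto
    have "0 < \<sigma> * f x" using nn[of x] x lr fx s0 by (auto simp: less_le)
    then have sub': "insert x c \<subseteq> ?S" using cS xin by auto
    have "insert x c = {l..<r} \<or> insert x c = {l<..r}" using x lr unfolding ceq by auto
    then have "connected (insert x c)" by (metis connected_Ico connected_Ioc)
    then have "insert x c \<subseteq> c" using components_maximal[OF c] sub' cn by blast
    then show False using x unfolding ceq by auto
  qed
  show thesis
    by (rule that[of l r]) (use lr sub ceq endpt pos s0 in auto)
qed

text \<open>As the extremum on each side is unique, the integrals depend on K, C and the sign only,
  not on the component.\<close>

lemma profile_solution_hump:
  assumes ps: "profile_solution \<alpha> f f' K C"
    and c: "c \<in> components {\<theta> \<in> {-\<alpha><..<\<alpha>}. 0 < \<sigma> * f \<theta>}"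
  shows "\<exists>a. 0 < \<sigma> * a \<and> extremum K C a"
    and "\<And>a g. 0 < \<sigma> * a \<Longrightarrow> extremum K C a \<Longrightarrow> continuous_on {0..1} g \<Longrightarrow>
       ((\<lambda>x. g (f x / a)) has_integral 2 * hump_int g a (3 / 2 * C / a\<^sup>2)) c"
    and "\<exists>l r. l < r \<and> c = {l<..<r} \<and> closure c = {l..r}"
proof -
  have cf: "continuous_on {-\<alpha>..\<alpha>} f" and bc: "f \<alpha> = 0" "f (-\<alpha>) = 0" and C: "0 \<le> C"
    using ps by (auto simp: profile_solution_def)
  obtain l r where lr: "l < r" "-\<alpha> \<le> l" "r \<le> \<alpha>" "c = {l<..<r}" "f l = 0" "f r = 0"
    "\<And>x. x \<in> {l<..<r} \<Longrightarrow> 0 < \<sigma> * f x" "\<sigma> \<noteq> 0"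
    using component_interval[OF cf bc c] by metis
  have "{l<..<r} \<subseteq> {-\<alpha><..<\<alpha>}" using lr by auto
  then obtain a where a: "0 < \<sigma> * a" "extremum K C a"
    "\<And>g. continuous_on {0..1} g \<Longrightarrow>
      ((\<lambda>x. g (f x / a)) has_integral 2 * hump_int g a (3 / 2 * C / a\<^sup>2)) {l..r}"
    using hump[of l r f \<sigma> f' K C] lr continuous_on_subset[OF cf, of "{l..r}"] C ps
    unfolding profile_solution_def by (auto simp: subset_iff)
  show "\<exists>a. 0 < \<sigma> * a \<and> extremum K C a" using a by blast
  show "\<exists>l r. l < r \<and> c = {l<..<r} \<and> closure c = {l..r}"
    using lr closure_greaterThanLessThan by blast
  fix b g assume b: "0 < \<sigma> * b" "extremum K C b" and g: "continuous_on {0..1} (g :: real \<Rightarrow> real)"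
  have "0 < a * b" using a(1) b(1) by (auto simp: zero_less_mult_iff)
  then have "b = a" using extremum_unique[OF a(2) b(2)] by simp
  then show "((\<lambda>x. g (f x / b)) has_integral 2 * hump_int g b (3 / 2 * C / b\<^sup>2)) c"
    unfolding lr(4)
    using a(3)[OF g] by (intro has_integral_open_interval[of _ _ l r, unfolded box_real, THEN iffD2]) simp
qed

lemma hump_int_cmult: "hump_int (\<lambda>t. c * g t) a s = c * hump_int g a s"
proof -
  have "(\<lambda>\<phi>. c * g ((sin \<phi>)\<^sup>2) * sin \<phi> / sqrt (hump_den a s ((sin \<phi>)\<^sup>2)))
    = (\<lambda>\<phi>. c * (g ((sin \<phi>)\<^sup>2) * sin \<phi> / sqrt (hump_den a s ((sin \<phi>)\<^sup>2))))"
    by (simp add: fun_eq_iff)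
  then show ?thesis unfolding hump_int_def by (simp only: integral_mult_right mult.left_commute)
qed

text \<open>Width and flux are summed over the components, which exhaust the interval up to a finite
  set. If a sign does not occur, its term carries the factor 0 and the corresponding parameter is
  free; hence the conditional assumptions on a and b.\<close>

lemma profile_solution_type:
  assumes \<alpha>: "0 < \<alpha>" and ps: "profile_solution \<alpha> f f' K C"
    and nontriv: "\<exists>\<theta>\<in>{-\<alpha><..<\<alpha>}. f \<theta> \<noteq> 0"
    and fin: "finite (components {\<theta> \<in> {-\<alpha><..<\<alpha>}. 0 < f \<theta>})"
       "finite (components {\<theta> \<in> {-\<alpha><..<\<alpha>}. f \<theta> < 0})"
    and card: "card (components {\<theta> \<in> {-\<alpha><..<\<alpha>}. 0 < f \<theta>}) = mp"
       "card (components {\<theta> \<in> {-\<alpha><..<\<alpha>}. f \<theta> < 0}) = mm"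
  shows "0 < mp \<Longrightarrow> \<exists>a>0. extremum K C a"
    and "0 < mm \<Longrightarrow> \<exists>b>0. extremum K C (-b)"
    and "(0 < mp \<Longrightarrow> 0 < a \<and> extremum K C a) \<Longrightarrow> (0 < mm \<Longrightarrow> 0 < b \<and> extremum K C (-b)) \<Longrightarrow>
      \<alpha> = mp * half_width a (3 / 2 * C / a\<^sup>2) + mm * half_width (-b) (3 / 2 * C / b\<^sup>2)"
    and "(0 < mp \<Longrightarrow> 0 < a \<and> extremum K C a) \<Longrightarrow> (0 < mm \<Longrightarrow> 0 < b \<and> extremum K C (-b)) \<Longrightarrow>
      integral {-\<alpha>..\<alpha>} f = mp * hump_flux a (3 / 2 * C / a\<^sup>2) + mm * hump_flux (-b) (3 / 2 * C / b\<^sup>2)"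
proof -
  define P where "P = components {\<theta> \<in> {-\<alpha><..<\<alpha>}. 0 < f \<theta>}"
  define N where "N = components {\<theta> \<in> {-\<alpha><..<\<alpha>}. f \<theta> < 0}"
  have fin: "finite P" "finite N" and card: "card P = mp" "card N = mm"
    using fin card by (simp_all add: P_def N_def)
  have UP: "\<Union>P = {\<theta> \<in> {-\<alpha><..<\<alpha>}. 0 < f \<theta>}" and UN: "\<Union>N = {\<theta> \<in> {-\<alpha><..<\<alpha>}. f \<theta> < 0}"
    by (simp_all add: P_def N_def)
  have "P = components {\<theta> \<in> {-\<alpha><..<\<alpha>}. 0 < 1 * f \<theta>}" by (simp add: P_def)
  note hP = profile_solution_hump[OF ps, of _ 1, folded this]
  have "N = components {\<theta> \<in> {-\<alpha><..<\<alpha>}. 0 < (-1) * f \<theta>}" by (simp add: N_def)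
  note hN = profile_solution_hump[OF ps, of _ "-1", folded this]
  show exP: "\<exists>a>0. extremum K C a" if mp: "0 < mp"
  proof -
    obtain c where "c \<in> P" using mp card by fastforce
    from hP(1)[OF this] show ?thesis by auto
  qed
  show exN: "\<exists>b>0. extremum K C (-b)" if mm: "0 < mm"
  proof -
    obtain c where "c \<in> N" using mm card by fastforce
    from hN(1)[OF this] obtain a where "0 < - 1 * a" "extremum K C a" by blast
    then show ?thesis by (intro exI[of _ "-a"]) auto
  qed
  have ivl: "\<exists>l r. l < r \<and> c = {l<..<r} \<and> closure c = {l..r}" if "c \<in> P \<union> N" for c
    using hP(3) hN(3) that by blast
  define E where "E = {-\<alpha>, \<alpha>} \<union> (\<Union>c\<in>P \<union> N. closure c - c)"
  have finE: "finite E"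
    unfolding E_def
  proof (intro finite_UnI finite_UN_I)
    fix c assume "c \<in> P \<union> N"
    then obtain l r where "l < r" "c = {l<..<r}" "closure c = {l..r}" using ivl by blast
    then have "closure c - c \<subseteq> {l, r}" by auto
    then show "finite (closure c - c)" by (rule finite_subset) auto
  qed (use fin in auto)
  \<comment> \<open>Any other point would have a neighbourhood on which f = 0. Then K = C = 0, the
    only nonzero root of the first integral is -6, and it is not admissible.\<close>
  have Z: "{-\<alpha>..\<alpha>} - \<Union>(P \<union> N) \<subseteq> E"
  proof
    fix z assume z: "z \<in> {-\<alpha>..\<alpha>} - \<Union>(P \<union> N)"
    show "z \<in> E"
    proof (rule ccontr)
      assume zE: "z \<notin> E"
      define V where "V = {-\<alpha><..<\<alpha>} - (\<Union>c\<in>P \<union> N. closure c)"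
      have oV: "open V" unfolding V_def using fin by (intro open_Diff closed_UN) auto
      have zV: "z \<in> V" using z zE by (auto simp: V_def E_def)
      have f0: "f x = 0" if "x \<in> V" for x
      proof (rule ccontr)
        assume "f x \<noteq> 0"
        then have "x \<in> \<Union>(P \<union> N)" using that by (auto simp: UP UN V_def Union_Un_distrib)
        then show False using that closure_subset unfolding V_def by blast
      qed
      have der0: "d = 0" if "(g has_real_derivative d) (at x)" "\<And>y. y \<in> V \<Longrightarrow> g y = 0" "x \<in> V" for g d x
      proof -
        have "(g has_real_derivative 0) (at x)"
          by (rule has_field_derivative_transform_within_open[of "\<lambda>_. 0" _ _ V])
            (use that oV in auto)
        then show ?thesis using that(1) DERIV_unique by blast
      qed
      have f'0: "f' x = 0" if "x \<in> V" for x
        using der0[of f "f' x" x] ps f0 that by (auto simp: profile_solution_def V_def)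
      have "(f' has_real_derivative K - 4 * f z - (f z)\<^sup>2) (at z)"
        using ps zV by (auto simp: profile_solution_def V_def)
      then have "K = 0"
        using der0[OF _ f'0 zV] f0[OF zV] by simp
      moreover have "(f' z)\<^sup>2 = first_integral K C (f z)"
        using ps zV by (auto simp: profile_solution_def V_def)
      then have "C = 0" using f0[OF zV] f'0[OF zV] by (simp add: first_integral_def)
      moreover have "P \<noteq> {} \<or> N \<noteq> {}"
        using nontriv UP UN by fastforce
      then obtain a where "extremum K C a" using hP(1) hN(1) by blast
      ultimately have a: "a \<noteq> 0" "- (4 * a\<^sup>2) - 2 / 3 * a ^ 3 = 0" "6 + 2 * a > 0"
        by (auto simp: extremum_def first_integral_def admissible_def)
      have "- (4 * a\<^sup>2) - 2 / 3 * a ^ 3 = - (2 / 3) * a\<^sup>2 * (6 + a)"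
        by (simp add: power2_eq_square power3_eq_cube algebra_simps)
      then have "a = - 6" using a by auto
      then show False using a by simp
    qed
  qed
  have disj: "P \<inter> N = {}"
  proof (rule ccontr)
    assume "P \<inter> N \<noteq> {}"
    then obtain c where c: "c \<in> P" "c \<in> N" by blast
    then obtain x where "x \<in> c" using in_components_nonempty P_def by blast
    then have "x \<in> \<Union>P" "x \<in> \<Union>N" using c by blast+
    then show False unfolding UP UN by simp
  qed
  have pw: "pairwise (\<lambda>S S'. negligible (S \<inter> S')) (P \<union> N)"
  proof (rule pairwiseI)
    fix c d assume cd: "c \<in> P \<union> N" "d \<in> P \<union> N" "c \<noteq> d"
    have "\<Union>P \<inter> \<Union>N = {}" unfolding UP UN by auto
    then have "c \<inter> d = {}"
      using cd components_nonoverlap[of c _ d] unfolding P_def N_def by blast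
    then show "negligible (c \<inter> d)" by simp
  qed
  have total: "(h has_integral mp * IP + mm * IN) {-\<alpha>..\<alpha>}"
    if hP: "\<And>c. c \<in> P \<Longrightarrow> (h has_integral IP) c" and hN: "\<And>c. c \<in> N \<Longrightarrow> (h has_integral IN) c"
    for h :: "real \<Rightarrow> real" and IP IN :: real
  proof -
    have "(h has_integral (\<Sum>c\<in>P \<union> N. if c \<in> P then IP else IN)) (\<Union>(P \<union> N))"
      using fin hP hN by (intro has_integral_Union pw) auto
    also have "(\<Sum>c\<in>P \<union> N. if c \<in> P then IP else IN) = (\<Sum>c\<in>P. IP) + (\<Sum>c\<in>N. IN)"
    proof -
      have "(\<Sum>c\<in>P. if c \<in> P then IP else IN) = (\<Sum>c\<in>P. IP)" by (rule sum.cong) auto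
      moreover have "(\<Sum>c\<in>N. if c \<in> P then IP else IN) = (\<Sum>c\<in>N. IN)"
        by (rule sum.cong) (use disj in auto)
      ultimately show ?thesis using fin disj by (simp add: sum.union_disjoint)
    qed
    finally have "(h has_integral mp * IP + mm * IN) (\<Union>(P \<union> N))"
      by (simp add: card)
    then show ?thesis
    proof (rule iffD1[OF has_integral_spike_set_eq, rotated 2])
      have "\<Union>(P \<union> N) \<subseteq> {-\<alpha>..\<alpha>}" unfolding Union_Un_distrib UP UN by auto
      then show "negligible {x \<in> \<Union>(P \<union> N) - {-\<alpha>..\<alpha>}. h x \<noteq> 0}"
        by (intro empty_imp_negligible) blast
      show "negligible {x \<in> {-\<alpha>..\<alpha>} - \<Union>(P \<union> N). h x \<noteq> 0}"
        by (rule negligible_subset[OF negligible_finite[OF finE]]) (use Z in auto)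
    qed
  qed
  have pos: "c \<in> P \<Longrightarrow> 0 < mp" "c \<in> N \<Longrightarrow> 0 < mm" for c
    using card fin by (auto simp: card_gt_0_iff)
  have ab: "(c \<in> P \<Longrightarrow> 0 < a \<and> extremum K C a)" "(c \<in> N \<Longrightarrow> 0 < b \<and> extremum K C (-b))"
    if "0 < mp \<Longrightarrow> 0 < a \<and> extremum K C a" "0 < mm \<Longrightarrow> 0 < b \<and> extremum K C (-b)" for a b c
    using that pos by simp_all
  {
    assume h: "0 < mp \<Longrightarrow> 0 < a \<and> extremum K C a" "0 < mm \<Longrightarrow> 0 < b \<and> extremum K C (-b)"
    have "((\<lambda>x. 1) has_integral mp * (2 * half_width a (3 / 2 * C / a\<^sup>2))
        + mm * (2 * half_width (-b) (3 / 2 * C / b\<^sup>2))) {-\<alpha>..\<alpha>}"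
    proof (rule total)
      fix c assume "c \<in> P"
      then show "((\<lambda>x. 1) has_integral 2 * half_width a (3 / 2 * C / a\<^sup>2)) c"
        using hP(2)[of c a "\<lambda>_. 1"] ab(1)[OF h] by (simp add: half_width_def)
    next
      fix c assume "c \<in> N"
      then show "((\<lambda>x. 1) has_integral 2 * half_width (-b) (3 / 2 * C / b\<^sup>2)) c"
        using hN(2)[of c "-b" "\<lambda>_. 1"] ab(2)[OF h] by (simp add: half_width_def)
    qed
    moreover have "((\<lambda>x::real. 1::real) has_integral 2 * \<alpha>) {-\<alpha>..\<alpha>}"
      using has_integral_const_real[of "1::real" "-\<alpha>" \<alpha>] \<alpha> by simp
    ultimately have "mp * (2 * half_width a (3 / 2 * C / a\<^sup>2))
        + mm * (2 * half_width (-b) (3 / 2 * C / b\<^sup>2)) = 2 * \<alpha>"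
      by (rule has_integral_unique)
    then show "\<alpha> = mp * half_width a (3 / 2 * C / a\<^sup>2) + mm * half_width (-b) (3 / 2 * C / b\<^sup>2)"
      by (simp add: algebra_simps)
    have "(f has_integral mp * hump_flux a (3 / 2 * C / a\<^sup>2) + mm * hump_flux (-b) (3 / 2 * C / b\<^sup>2)) {-\<alpha>..\<alpha>}"
    proof (rule total)
      fix c assume c: "c \<in> P"
      then have a: "0 < a" "extremum K C a" using ab(1)[OF h] by auto
      then show "(f has_integral hump_flux a (3 / 2 * C / a\<^sup>2)) c"
        using hP(2)[OF c _ a(2), of "\<lambda>t. a * t"] hump_int_cmult[of a "\<lambda>t. t"]
        by (simp add: hump_flux_def mult.assoc)
    next
      fix c assume c: "c \<in> N"
      then have b: "0 < b" "extremum K C (-b)" using ab(2)[OF h] by auto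
      then show "(f has_integral hump_flux (-b) (3 / 2 * C / b\<^sup>2)) c"
        using hN(2)[OF c _ b(2), of "\<lambda>t. (-b) * t"] hump_int_cmult[of "-b" "\<lambda>t. t"]
        by (simp add: hump_flux_def mult.assoc continuous_on_minus continuous_on_mult_left)
    qed
    then show "integral {-\<alpha>..\<alpha>} f = mp * hump_flux a (3 / 2 * C / a\<^sup>2) + mm * hump_flux (-b) (3 / 2 * C / b\<^sup>2)"
      by (rule integral_unique)
  }
qed

section \<open>The shape functions of a full period\<close>

abbreviation quarter :: "real set" where "quarter \<equiv> {0..pi/2}"

lemma quarter_less:
  fixes f g :: "real \<Rightarrow> real"
  assumes "continuous_on quarter f" "continuous_on quarter g"
    and "\<And>\<phi>. 0 < \<phi> \<Longrightarrow> \<phi> < pi / 2 \<Longrightarrow> f \<phi> < g \<phi>"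
  shows "integral quarter f < integral quarter g"
proof (intro integral_less_real assms)
  show "{0<..<pi/2} \<noteq> {}" using pi_half_gt_zero by (metis greaterThanLessThan_empty_iff not_le)
qed auto

lemma quarter_le:
  fixes f g :: "real \<Rightarrow> real"
  assumes "continuous_on quarter f" "continuous_on quarter g"
    and "\<And>\<phi>. 0 \<le> \<phi> \<Longrightarrow> \<phi> \<le> pi / 2 \<Longrightarrow> f \<phi> \<le> g \<phi>"
  shows "integral quarter f \<le> integral quarter g"
  using assms by (intro integral_le integrable_continuous_interval) auto

lemma sin_quarter: "0 < \<phi> \<Longrightarrow> \<phi> < pi / 2 \<Longrightarrow> 0 < (sin \<phi>)\<^sup>2 \<and> (sin \<phi>)\<^sup>2 < 1"
proof -
  assume "0 < \<phi>" "\<phi> < pi / 2"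
  then have "0 < (sin \<phi>)\<^sup>2" "0 < (cos \<phi>)\<^sup>2"
    using sin_gt_zero[of \<phi>] cos_gt_zero[of \<phi>] by auto
  then show ?thesis using sin_cos_squared_add[of \<phi>] by linarith
qed

text \<open>The complete elliptic integral of the first kind with parameter -y.\<close>

definition shape_U :: "real \<Rightarrow> real" where
  "shape_U y = integral quarter (\<lambda>\<phi>. 1 / sqrt (1 + y * (sin \<phi>)\<^sup>2))"

text \<open>With E the complete elliptic integral of the second kind at parameter -y, this is (E -
  \<open>shape_U y\<close>) / y for y \<noteq> 0.\<close>

definition shape_W :: "real \<Rightarrow> real" where
  "shape_W y = integral quarter (\<lambda>\<phi>. (sin \<phi>)\<^sup>2 / sqrt (1 + y * (sin \<phi>)\<^sup>2))"

text \<open>The value of L (P + 4 L), for half-period L and period flux P, as a function of the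
  modulus.\<close>

definition shape_R :: "real \<Rightarrow> real" where
  "shape_R y = 4 * (3 * y * shape_U y * shape_W y + (1 - y) * (shape_U y)\<^sup>2)"

lemma shape_den_pos:
  fixes y \<phi> :: real
  assumes "-1 < y"
  shows "0 < 1 + y * (sin \<phi>)\<^sup>2"
proof -
  have "1 + y * (sin \<phi>)\<^sup>2 = (1 - (sin \<phi>)\<^sup>2) + (1 + y) * (sin \<phi>)\<^sup>2" by (simp add: algebra_simps)
  moreover have "0 \<le> 1 - (sin \<phi>)\<^sup>2" using sin_squared_le_1[of \<phi>] by simp
  moreover have "0 \<le> (1 + y) * (sin \<phi>)\<^sup>2" using assms by simp
  moreover have "1 - (sin \<phi>)\<^sup>2 \<noteq> 0 \<or> (1 + y) * (sin \<phi>)\<^sup>2 \<noteq> 0" using assms by auto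
  ultimately show ?thesis by linarith
qed

lemma shape_continuous_intro:
  assumes "-1 < y" "continuous_on S g"
  shows "continuous_on S (\<lambda>\<phi>. g \<phi> / sqrt (1 + y * (sin \<phi>)\<^sup>2))"
    "continuous_on S (\<lambda>\<phi>. g \<phi> / ((1 + y * (sin \<phi>)\<^sup>2) * sqrt (1 + y * (sin \<phi>)\<^sup>2)))"
  using shape_den_pos[OF assms(1)]
  by (intro continuous_intros assms(2); simp add: less_imp_neq[symmetric])+

text \<open>These integrals, with the power 3/2 in the denominator, express the shape functions as
  well as their derivatives.\<close>

definition shape_moment :: "nat \<Rightarrow> real \<Rightarrow> real" where
  "shape_moment k y = integral quarter
     (\<lambda>\<phi>. ((sin \<phi>)\<^sup>2) ^ k / ((1 + y * (sin \<phi>)\<^sup>2) * sqrt (1 + y * (sin \<phi>)\<^sup>2)))"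

lemma shape_integral_derivative:
  assumes "-1 < y"
  shows "((\<lambda>y. integral quarter (\<lambda>\<phi>. ((sin \<phi>)\<^sup>2) ^ k / sqrt (1 + y * (sin \<phi>)\<^sup>2)))
    has_real_derivative - (1 / 2) * shape_moment (Suc k) y) (at y)"
proof -
  let ?f = "\<lambda>y \<phi>. ((sin \<phi>)\<^sup>2) ^ k / sqrt (1 + y * (sin \<phi>)\<^sup>2)"
  let ?f' = "\<lambda>y \<phi>. - (1 / 2) * (((sin \<phi>)\<^sup>2) ^ Suc k / ((1 + y * (sin \<phi>)\<^sup>2) * sqrt (1 + y * (sin \<phi>)\<^sup>2)))"
  have "((\<lambda>y. integral (cbox 0 (pi/2)) (?f y)) has_real_derivative
      integral (cbox 0 (pi/2)) (?f' y)) (at y within {-1<..})"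
  proof (rule leibniz_rule_field_derivative)
    fix x t :: real assume x: "x \<in> {-1<..}"
    have p: "0 < 1 + x * (sin t)\<^sup>2" using x by (intro shape_den_pos) auto
    show "((\<lambda>x. ?f x t) has_real_derivative ?f' x t) (at x within {-1<..})"
      using p by (auto intro!: derivative_eq_intros simp: field_simps power2_eq_square)
  next
    show "?f x integrable_on cbox 0 (pi/2)" if "x \<in> {-1<..}" for x
      using that unfolding box_real
      by (intro integrable_continuous_interval shape_continuous_intro continuous_intros) auto
    show "continuous_on ({-1<..} \<times> cbox 0 (pi/2)) (\<lambda>(x, t). ?f' x t)"
    proof -
      have "0 < 1 + fst z * (sin (snd z))\<^sup>2" if "z \<in> {-1<..} \<times> cbox 0 (pi/2)" for z :: "real \<times> real"
        using that by (intro shape_den_pos) auto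
      then show ?thesis
        unfolding case_prod_unfold by (intro continuous_intros) (auto simp: less_imp_neq[symmetric])
    qed
  qed (use assms in auto)
  moreover have "at y within {-1<..} = at y" using assms by (intro at_within_open) auto
  moreover have "integral (cbox 0 (pi/2)) (?f' y) = - (1 / 2) * shape_moment (Suc k) y"
    unfolding shape_moment_def box_real by (rule integral_mult_right)
  ultimately show ?thesis by (simp only: box_real)
qed

lemma shape_U_derivative:
  "-1 < y \<Longrightarrow> (shape_U has_real_derivative - (1 / 2) * shape_moment 1 y) (at y)"
  using shape_integral_derivative[of y 0] by (simp add: shape_U_def[abs_def])

lemma shape_W_derivative:
  "-1 < y \<Longrightarrow> (shape_W has_real_derivative - (1 / 2) * shape_moment 2 y) (at y)"
  using shape_integral_derivative[of y 1] by (simp add: shape_W_def[abs_def] numeral_2_eq_2)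

lemma shape_integral_eq:
  assumes "-1 < y"
  shows "integral quarter (\<lambda>\<phi>. ((sin \<phi>)\<^sup>2) ^ k / sqrt (1 + y * (sin \<phi>)\<^sup>2))
    = shape_moment k y + y * shape_moment (Suc k) y"
proof -
  have "((sin \<phi>)\<^sup>2) ^ k / sqrt (1 + y * (sin \<phi>)\<^sup>2)
    = ((sin \<phi>)\<^sup>2) ^ k / ((1 + y * (sin \<phi>)\<^sup>2) * sqrt (1 + y * (sin \<phi>)\<^sup>2))
      + y * (((sin \<phi>)\<^sup>2) ^ Suc k / ((1 + y * (sin \<phi>)\<^sup>2) * sqrt (1 + y * (sin \<phi>)\<^sup>2)))" for \<phi>
  proof -
    have D: "0 < 1 + y * (sin \<phi>)\<^sup>2" by (rule shape_den_pos[OF assms])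
    have split: "p / q = p / (D * q) + y * (s * p / (D * q))" if "D = 1 + y * s" "0 < D" "0 < q"
      for p q D s :: real
    proof -
      have "p / (D * q) + y * (s * p / (D * q)) = p * (1 + y * s) / (D * q)"
        by (simp add: add_divide_distrib algebra_simps)
      also have "\<dots> = p / q" using that(2,3) unfolding that(1)[symmetric] by simp
      finally show ?thesis by simp
    qed
    have "0 < sqrt (1 + y * (sin \<phi>)\<^sup>2)" using D by simp
    then show ?thesis unfolding power_Suc by (rule split[OF refl D])
  qed
  moreover have "(\<lambda>\<phi>. ((sin \<phi>)\<^sup>2) ^ j / ((1 + y * (sin \<phi>)\<^sup>2) * sqrt (1 + y * (sin \<phi>)\<^sup>2))) integrable_on quarter" for j
    by (intro integrable_continuous_interval shape_continuous_intro assms continuous_intros)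
  ultimately show ?thesis
    unfolding shape_moment_def
    by (simp only: integral_add integrable_on_mult_right integral_mult_right)
qed

text \<open>Integrating the derivative of \<open>sin \<phi> cos \<phi> / sqrt (1 + y sin\<^sup>2 \<phi>)\<close>.\<close>

lemma shape_moment_relation:
  assumes "-1 < y"
  shows "shape_moment 0 y - 2 * shape_moment 1 y - y * shape_moment 2 y = 0"
proof -
  let ?D = "\<lambda>\<phi>. 1 + y * (sin \<phi>)\<^sup>2"
  let ?m = "\<lambda>k \<phi>. ((sin \<phi>)\<^sup>2) ^ k / (?D \<phi> * sqrt (?D \<phi>))"
  have "((\<lambda>\<phi>. ?m 0 \<phi> - 2 * ?m 1 \<phi> - y * ?m 2 \<phi>) has_integral
      (sin (pi/2) * cos (pi/2) / sqrt (?D (pi/2)) - sin 0 * cos 0 / sqrt (?D 0))) {0..pi/2}"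
  proof (rule fundamental_theorem_of_calculus)
    fix x :: real assume "x \<in> {0..pi/2}"
    define S where "S = sin x"
    define c where "c = cos x"
    have c2: "c\<^sup>2 = 1 - S\<^sup>2" by (simp add: S_def c_def cos_squared_eq)
    define D where "D = 1 + y * S\<^sup>2"
    define q where "q = sqrt D"
    have D: "0 < D" unfolding D_def S_def by (rule shape_den_pos[OF assms])
    then have q: "0 < q" "q * q = D" by (simp_all add: q_def)
    have "((\<lambda>\<phi>. sin \<phi> * cos \<phi> / sqrt (?D \<phi>)) has_real_derivative
        ((c * c - S * S) * q - S * c * (y * (2 * S * c) / (2 * q))) / (q * q)) (at x)"
      using D unfolding S_def c_def D_def q_def
      by (auto intro!: derivative_eq_intros simp: field_simps power2_eq_square)
    also have "((c * c - S * S) * q - S * c * (y * (2 * S * c) / (2 * q))) / (q * q)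
        = ((c\<^sup>2 - S\<^sup>2) * (q * q) - y * S\<^sup>2 * c\<^sup>2) / (q * q * q)"
      using q(1) by (simp add: field_simps power2_eq_square)
    also have "\<dots> = ((1 - 2 * S\<^sup>2) * D - y * S\<^sup>2 * (1 - S\<^sup>2)) / (D * q)"
      unfolding q(2) c2 by simp
    also have "(1 - 2 * S\<^sup>2) * D - y * S\<^sup>2 * (1 - S\<^sup>2) = 1 - 2 * S\<^sup>2 - y * (S\<^sup>2)\<^sup>2"
      by (simp add: D_def algebra_simps power2_eq_square)
    also have "(1 - 2 * S\<^sup>2 - y * (S\<^sup>2)\<^sup>2) / (D * q) = ?m 0 x - 2 * ?m 1 x - y * ?m 2 x"
      by (simp add: S_def D_def q_def diff_divide_distrib)
    finally show "((\<lambda>\<phi>. sin \<phi> * cos \<phi> / sqrt (?D \<phi>)) has_vector_derivative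
        ?m 0 x - 2 * ?m 1 x - y * ?m 2 x) (at x within {0..pi/2})"
      by (simp only: has_real_derivative_iff_has_vector_derivative) (rule has_vector_derivative_at_within)
  qed auto
  then have "integral {0..pi/2} (\<lambda>\<phi>. ?m 0 \<phi> - 2 * ?m 1 \<phi> - y * ?m 2 \<phi>) = 0"
    by (simp add: integral_unique)
  moreover have i: "?m j integrable_on {0..pi/2}" for j
    by (intro integrable_continuous_interval shape_continuous_intro assms continuous_intros)
  have "integral {0..pi/2} (\<lambda>\<phi>. ?m 0 \<phi> - 2 * ?m 1 \<phi> - y * ?m 2 \<phi>)
      = integral {0..pi/2} (?m 0) - 2 * integral {0..pi/2} (?m 1) - y * integral {0..pi/2} (?m 2)"
    by (subst integral_diff | intro integrable_diff integrable_on_mult_right i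
        | subst integral_mult_right)+ (rule refl)
  ultimately show ?thesis unfolding shape_moment_def by simp
qed

lemma shape_moment_bounds:
  assumes "-1 < y"
  shows "0 < shape_moment 1 y" "shape_moment 1 y < shape_moment 0 y" "shape_moment 2 y \<le> shape_moment 1 y"
proof -
  have c: "continuous_on quarter (\<lambda>\<phi>. ((sin \<phi>)\<^sup>2) ^ k / ((1 + y * (sin \<phi>)\<^sup>2) * sqrt (1 + y * (sin \<phi>)\<^sup>2)))" for k
    by (intro shape_continuous_intro assms continuous_intros)
  have D: "0 < (1 + y * (sin \<phi>)\<^sup>2) * sqrt (1 + y * (sin \<phi>)\<^sup>2)" for \<phi>
    using shape_den_pos[OF assms, of \<phi>] by simp
  have "integral quarter (\<lambda>\<phi>. 0) < shape_moment 1 y"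
    unfolding shape_moment_def
    by (intro quarter_less c continuous_on_const divide_pos_pos D) (use sin_quarter in auto)
  then show "0 < shape_moment 1 y" by simp
  show "shape_moment 1 y < shape_moment 0 y"
    unfolding shape_moment_def
    by (intro quarter_less c divide_strict_right_mono D) (use sin_quarter in auto)
  show "shape_moment 2 y \<le> shape_moment 1 y"
    unfolding shape_moment_def
  proof (intro quarter_le c divide_right_mono less_imp_le[OF D])
    fix \<phi> :: real
    show "((sin \<phi>)\<^sup>2)\<^sup>2 \<le> ((sin \<phi>)\<^sup>2) ^ 1"
      using mult_left_mono[OF sin_squared_le_1[of \<phi>], of "(sin \<phi>)\<^sup>2"]
      by (simp add: power2_eq_square[of "(sin \<phi>)\<^sup>2"])
  qed
qed

text \<open>Let N, e, v be the moments of order 0, 1, 2. Then U = N + y e and, by the relation y v =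
  N - 2 e, W = N - e. The derivative of R collapses to 2 y (v N - 2 e N + e^2), which is negative
  because v \<le> e < N.\<close>

lemma shape_R_strict_antimono:
  assumes "0 \<le> y1" "y1 < y2"
  shows "shape_R y2 < shape_R y1"
proof -
  have dR: "(shape_R has_real_derivative
      4 * (3 * shape_U y * shape_W y + 3 * y * (- (1/2) * shape_moment 1 y) * shape_W y
        + 3 * y * shape_U y * (- (1/2) * shape_moment 2 y)
        - (shape_U y)\<^sup>2 + (1 - y) * (2 * shape_U y * (- (1/2) * shape_moment 1 y)))) (at y)"
    if "0 \<le> y" for y
  proof -
    have "(shape_U has_real_derivative - (1 / 2) * shape_moment 1 y) (at y)"
      "(shape_W has_real_derivative - (1 / 2) * shape_moment 2 y) (at y)"
      using shape_U_derivative[of y] shape_W_derivative[of y] that by simp_all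
    then show ?thesis
      unfolding shape_R_def[abs_def]
      by (auto intro!: derivative_eq_intros simp: algebra_simps)
  qed
  show ?thesis
  proof (rule DERIV_neg_imp_decreasing_open[OF assms(2)])
    fix y assume y: "y1 < y" "y < y2"
    define N where "N = shape_moment 0 y"
    define e where "e = shape_moment 1 y"
    define v where "v = shape_moment 2 y"
    have y0: "0 < y" "-1 < y" using y assms by auto
    have rel: "y * v = N - 2 * e"
      using shape_moment_relation[OF y0(2)] by (simp add: N_def e_def v_def)
    have U: "shape_U y = N + y * e"
      using shape_integral_eq[OF y0(2), of 0] by (simp add: shape_U_def N_def e_def)
    have W: "shape_W y = N - e"
      using shape_integral_eq[OF y0(2), of 1] rel
      by (simp add: shape_W_def v_def e_def numeral_2_eq_2)
    have ev: "0 < e" "e < N" "v \<le> e"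
      using shape_moment_bounds[OF y0(2)] by (auto simp: N_def e_def v_def)
    have "3 * (N + y * e) * (N - e) + 3 * y * (- (1/2) * e) * (N - e)
        + 3 * y * (N + y * e) * (- (1/2) * v) - (N + y * e)\<^sup>2 + (1 - y) * (2 * (N + y * e) * (- (1/2) * e))
      = 3 * (N + y * e) * (N - e) - 3 / 2 * y * e * (N - e)
        - 3 / 2 * (N + y * e) * (y * v) - (N + y * e)\<^sup>2 - (1 - y) * (N + y * e) * e"
      by (simp add: algebra_simps)
    also have "\<dots> = 1 / 2 * ((y * v) * N - 2 * y * e * N + y * e\<^sup>2)"
      unfolding rel by (simp add: field_simps power2_eq_square)
    also have "\<dots> = 1 / 2 * y * (v * N - 2 * e * N + e\<^sup>2)"
      by (simp add: algebra_simps)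
    also have "\<dots> < 0"
    proof -
      have "v * N \<le> e * N" using ev by (intro mult_right_mono) auto
      moreover have "0 < e * (N - e)" using ev by simp
      ultimately have "v * N - 2 * e * N + e\<^sup>2 < 0" by (simp add: algebra_simps power2_eq_square)
      then show ?thesis using y0 by (intro mult_pos_neg) auto
    qed
    finally have neg: "3 * (N + y * e) * (N - e) + 3 * y * (- (1/2) * e) * (N - e)
        + 3 * y * (N + y * e) * (- (1/2) * v) - (N + y * e)\<^sup>2 + (1 - y) * (2 * (N + y * e) * (- (1/2) * e)) < 0" .
    have "4 * (3 * shape_U y * shape_W y + 3 * y * (- (1/2) * shape_moment 1 y) * shape_W y
        + 3 * y * shape_U y * (- (1/2) * shape_moment 2 y)
        - (shape_U y)\<^sup>2 + (1 - y) * (2 * shape_U y * (- (1/2) * shape_moment 1 y))) < 0"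
      using mult_pos_neg[OF _ neg, of 4] unfolding U W N_def e_def v_def by (simp only: zero_less_numeral)
    with dR[OF less_imp_le[OF y0(1)]]
    show "\<exists>z. (shape_R has_real_derivative z) (at y) \<and> z < 0" by blast
  next
    show "continuous_on {y1..y2} shape_R"
      using DERIV_isCont[OF dR] assms by (intro continuous_at_imp_continuous_on) auto
  qed
qed

lemma shape_R_0: "shape_R 0 = pi\<^sup>2"
  by (simp add: shape_R_def shape_U_def power_divide)

lemma shape_U_pos: "-1 < y \<Longrightarrow> 0 < shape_U y"
  using quarter_less[of "\<lambda>_. 0" "\<lambda>\<phi>. 1 / sqrt (1 + y * (sin \<phi>)\<^sup>2)"] shape_den_pos[of y]
    shape_continuous_intro(1)[of y quarter "\<lambda>_. 1"]
  by (simp add: shape_U_def)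

lemma shape_U_strict_antimono:
  assumes "0 \<le> y1" "y1 < y2"
  shows "shape_U y2 < shape_U y1"
  unfolding shape_U_def
proof (intro quarter_less shape_continuous_intro continuous_intros)
  fix \<phi> :: real assume "0 < \<phi>" "\<phi> < pi / 2"
  then have "y1 * (sin \<phi>)\<^sup>2 < y2 * (sin \<phi>)\<^sup>2" using sin_quarter assms by simp
  then show "1 / sqrt (1 + y2 * (sin \<phi>)\<^sup>2) < 1 / sqrt (1 + y1 * (sin \<phi>)\<^sup>2)"
    using shape_den_pos[of y1 \<phi>] assms by (intro divide_strict_left_mono) (auto intro!: mult_pos_pos)
qed (use assms in auto)

text \<open>Pointwise in \<phi>, the quotient (1 + 2 y) / (1 + y s) with s = sin^2 \<phi> increases
  in y because s < 2.\<close>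

lemma shape_U_scaled_strict_mono:
  assumes "0 \<le> y1" "y1 < y2"
  shows "(1 + 2 * y1) * (shape_U y1)\<^sup>2 < (1 + 2 * y2) * (shape_U y2)\<^sup>2"
proof -
  have "sqrt (1 + 2 * y1) * shape_U y1 < sqrt (1 + 2 * y2) * shape_U y2"
    unfolding shape_U_def integral_mult_right[symmetric]
  proof (intro quarter_less shape_continuous_intro continuous_intros)
    fix \<phi> :: real assume phi: "0 < \<phi>" "\<phi> < pi / 2"
    define s where "s = (sin \<phi>)\<^sup>2"
    have s: "0 < s" "s < 1" using sin_quarter[OF phi] by (auto simp: s_def)
    have p: "0 < 1 + y1 * s" "0 < 1 + y2 * s" using s assms by (auto intro: add_pos_nonneg)
    have "(1 + 2 * y1) * (1 + y2 * s) < (1 + 2 * y2) * (1 + y1 * s)"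
    proof -
      have "0 < (y2 - y1) * (2 - s)" using assms s by (intro mult_pos_pos) auto
      then show ?thesis by (simp add: algebra_simps)
    qed
    then have "(1 + 2 * y1) / (1 + y1 * s) < (1 + 2 * y2) / (1 + y2 * s)"
      using p by (simp add: divide_simps mult.commute)
    then have "sqrt ((1 + 2 * y1) / (1 + y1 * s)) < sqrt ((1 + 2 * y2) / (1 + y2 * s))" by simp
    then show "sqrt (1 + 2 * y1) * (1 / sqrt (1 + y1 * (sin \<phi>)\<^sup>2))
      < sqrt (1 + 2 * y2) * (1 / sqrt (1 + y2 * (sin \<phi>)\<^sup>2))"
      by (simp add: real_sqrt_divide s_def)
  qed (use assms in auto)
  then have "(sqrt (1 + 2 * y1) * shape_U y1)\<^sup>2 < (sqrt (1 + 2 * y2) * shape_U y2)\<^sup>2"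
    using shape_U_pos[of y1] assms by (intro power_strict_mono) auto
  then show ?thesis using assms by (simp add: power_mult_distrib)
qed

section \<open>Periods and period fluxes\<close>

text \<open>The profiles oscillating between \<open>-b\<close> and \<open>a\<close> solve
  \<open>f'\<^sup>2 = 2/3 (a - f) (f + b) (f + 6 + a - b)\<close>; the substitution \<open>f = - b + (a + b) sin\<^sup>2 \<phi>\<close>
  expresses their half-period and their flux over a period.\<close>

definition period_region :: "real \<Rightarrow> real \<Rightarrow> bool" where
  "period_region a b \<longleftrightarrow> 0 \<le> a \<and> 0 \<le> b \<and> 2 * b < 6 + a"

definition period_den :: "real \<Rightarrow> real \<Rightarrow> real \<Rightarrow> real" where
  "period_den a b \<phi> = 6 + a - 2 * b + (a + b) * (sin \<phi>)\<^sup>2"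

definition half_period :: "real \<Rightarrow> real \<Rightarrow> real" where
  "half_period a b = sqrt 6 * integral quarter (\<lambda>\<phi>. 1 / sqrt (period_den a b \<phi>))"

definition period_flux :: "real \<Rightarrow> real \<Rightarrow> real" where
  "period_flux a b = 2 * sqrt 6 * integral quarter (\<lambda>\<phi>. (- b + (a + b) * (sin \<phi>)\<^sup>2) / sqrt (period_den a b \<phi>))"

lemma period_den_lower:
  "period_region a b \<Longrightarrow> 6 + a - 2 * b \<le> period_den a b \<phi>"
  by (simp add: period_den_def period_region_def)

lemma period_den_pos: "period_region a b \<Longrightarrow> 0 < period_den a b \<phi>"
  using period_den_lower[of a b \<phi>] by (simp add: period_region_def)

lemma period_den_eq: "period_den a b \<phi> = 6 + a * (1 + (sin \<phi>)\<^sup>2) - b * (2 - (sin \<phi>)\<^sup>2)"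
  by (simp add: period_den_def algebra_simps)

lemma continuous_on_half_period:
  assumes "continuous_on S f" "continuous_on S g" "\<And>x. x \<in> S \<Longrightarrow> period_region (f x) (g x)"
  shows "continuous_on S (\<lambda>x. half_period (f x) (g x))"
    and "continuous_on S (\<lambda>x. period_flux (f x) (g x))"
proof -
  let ?D = "{z. period_region (fst z) (snd z)}"
  have pos: "0 < 6 + fst (fst z) - 2 * snd (fst z) + (fst (fst z) + snd (fst z)) * (sin (snd z))\<^sup>2"
    if "z \<in> ?D \<times> {0..pi/2}" for z
    using period_den_pos[of "fst (fst z)" "snd (fst z)" "snd z"] that by (auto simp: period_den_def)
  have "continuous_on ?D (\<lambda>z. integral (cbox 0 (pi/2)) (\<lambda>\<phi>. 1 / sqrt (period_den (fst z) (snd z) \<phi>)))"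
    unfolding period_den_def
    by (rule integral_continuous_on_param, unfold case_prod_unfold box_real)
      (intro continuous_intros, use pos in \<open>auto simp: less_imp_neq[symmetric]\<close>)
  then have 1: "continuous_on ?D (\<lambda>z. half_period (fst z) (snd z))"
    unfolding half_period_def box_real by (intro continuous_intros)
  have "continuous_on ?D (\<lambda>z. integral (cbox 0 (pi/2))
      (\<lambda>\<phi>. (- snd z + (fst z + snd z) * (sin \<phi>)\<^sup>2) / sqrt (period_den (fst z) (snd z) \<phi>)))"
    unfolding period_den_def
    by (rule integral_continuous_on_param, unfold case_prod_unfold box_real)
      (intro continuous_intros, use pos in \<open>auto simp: less_imp_neq[symmetric]\<close>)
  then have 2: "continuous_on ?D (\<lambda>z. period_flux (fst z) (snd z))"
    unfolding period_flux_def box_real by (intro continuous_intros)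
  have c: "continuous_on S (\<lambda>x. (f x, g x))" by (intro continuous_intros assms)
  have sub: "(\<lambda>x. (f x, g x)) ` S \<subseteq> ?D" using assms(3) by auto
  show "continuous_on S (\<lambda>x. half_period (f x) (g x))" "continuous_on S (\<lambda>x. period_flux (f x) (g x))"
    using continuous_on_compose2[OF 1 c sub] continuous_on_compose2[OF 2 c sub] by simp_all
qed

lemma period_integrand_continuous:
  assumes "period_region a b" "continuous_on S g"
  shows "continuous_on S (\<lambda>\<phi>. g \<phi> / sqrt (period_den a b \<phi>))"
  using period_den_pos[OF assms(1)] unfolding period_den_def
  by (intro continuous_intros assms(2)) (simp add: less_imp_neq[symmetric])

lemma half_period_strict:
  assumes "period_region a b" "period_region a' b'"
    and "\<And>s. 0 < s \<Longrightarrow> s < 1 \<Longrightarrow> a' * (1 + s) - b' * (2 - s) < a * (1 + s) - b * (2 - s)"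
  shows "half_period a b < half_period a' b'"
  unfolding half_period_def
proof (intro mult_strict_left_mono quarter_less period_integrand_continuous assms continuous_intros)
  fix \<phi> :: real assume "0 < \<phi>" "\<phi> < pi / 2"
  then have "period_den a' b' \<phi> < period_den a b \<phi>"
    using assms(3)[of "(sin \<phi>)\<^sup>2"] sin_quarter[of \<phi>] unfolding period_den_eq by simp
  then show "1 / sqrt (period_den a b \<phi>) < 1 / sqrt (period_den a' b' \<phi>)"
    using period_den_pos[OF assms(1), of \<phi>] period_den_pos[OF assms(2), of \<phi>]
    by (intro divide_strict_left_mono) (auto intro!: mult_pos_pos)
qed simp

lemma half_period_strict_antimono_left:
  assumes "period_region a b" "a < a'"
  shows "half_period a' b < half_period a b"
proof (rule half_period_strict)
  fix s :: real assume "0 < s"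
  then have "a * (1 + s) < a' * (1 + s)" using assms by simp
  then show "a * (1 + s) - b * (2 - s) < a' * (1 + s) - b * (2 - s)" by simp
qed (use assms in \<open>auto simp: period_region_def\<close>)

lemma half_period_strict_mono_right:
  assumes "0 \<le> b" "b < b'" "period_region a b'"
  shows "half_period a b < half_period a b'"
proof (rule half_period_strict)
  fix s :: real assume "s < 1"
  then have "b * (2 - s) < b' * (2 - s)" using assms by simp
  then show "a * (1 + s) - b' * (2 - s) < a * (1 + s) - b * (2 - s)" by simp
qed (use assms in \<open>auto simp: period_region_def\<close>)

lemma half_period_0: "half_period 0 0 = pi / 2"
  by (simp add: half_period_def period_den_def)

lemma period_flux_0: "period_flux 0 0 = 0"
  by (simp add: period_flux_def)

lemma half_period_shape:
  assumes "period_region a b"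
  defines "n \<equiv> 6 + a - 2 * b"
  defines "y \<equiv> (a + b) / n"
  shows "0 < n" "0 \<le> y" "half_period a b = sqrt 6 * shape_U y / sqrt n"
    "period_flux a b = 2 * sqrt 6 * (- b * shape_U y + (a + b) * shape_W y) / sqrt n"
proof -
  show n: "0 < n" and y: "0 \<le> y"
    using assms(1) by (auto simp: n_def y_def period_region_def)
  have den: "sqrt (period_den a b \<phi>) = sqrt n * sqrt (1 + y * (sin \<phi>)\<^sup>2)" for \<phi>
  proof -
    have "period_den a b \<phi> = n + (n * y) * (sin \<phi>)\<^sup>2"
      using n by (simp add: y_def period_den_def n_def[symmetric])
    then have "period_den a b \<phi> = n * (1 + y * (sin \<phi>)\<^sup>2)" by (simp add: algebra_simps)
    then show ?thesis by (simp add: real_sqrt_mult)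
  qed
  have "(\<lambda>\<phi>. 1 / sqrt (period_den a b \<phi>)) = (\<lambda>\<phi>. (1 / sqrt n) * (1 / sqrt (1 + y * (sin \<phi>)\<^sup>2)))"
    unfolding den by simp
  then show "half_period a b = sqrt 6 * shape_U y / sqrt n"
    unfolding half_period_def shape_U_def by (simp only: integral_mult_right) simp
  have split: "(\<lambda>\<phi>. (- b + (a + b) * (sin \<phi>)\<^sup>2) / sqrt (period_den a b \<phi>))
    = (\<lambda>\<phi>. (- b / sqrt n) * (1 / sqrt (1 + y * (sin \<phi>)\<^sup>2))
      + ((a + b) / sqrt n) * ((sin \<phi>)\<^sup>2 / sqrt (1 + y * (sin \<phi>)\<^sup>2)))"
  proof -
    have "(- b + c * s) / (p * q) = (- b / p) * (1 / q) + (c / p) * (s / q)" for c s p q :: real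
      by (simp add: diff_divide_distrib)
    then show ?thesis unfolding den by simp
  qed
  have "(\<lambda>\<phi>. 1 / sqrt (1 + y * (sin \<phi>)\<^sup>2)) integrable_on quarter"
    "(\<lambda>\<phi>. (sin \<phi>)\<^sup>2 / sqrt (1 + y * (sin \<phi>)\<^sup>2)) integrable_on quarter"
    using y by (auto intro!: integrable_continuous_interval shape_continuous_intro continuous_intros)
  then have I: "integral quarter (\<lambda>\<phi>. (- b + (a + b) * (sin \<phi>)\<^sup>2) / sqrt (period_den a b \<phi>))
    = (- b / sqrt n) * shape_U y + ((a + b) / sqrt n) * shape_W y"
    unfolding split shape_U_def shape_W_def
    by (simp only: integral_add integrable_on_mult_right integral_mult_right)
  have "p * ((- b / q) * U + (c / q) * W) = p * (- b * U + c * W) / q" for p q U c W :: real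
    by (simp add: right_diff_distrib diff_divide_distrib)
  then show "period_flux a b = 2 * sqrt 6 * (- b * shape_U y + (a + b) * shape_W y) / sqrt n"
    unfolding period_flux_def I by blast
qed

lemma half_period_pos: "period_region a b \<Longrightarrow> 0 < half_period a b"
  using half_period_shape(1-3)[of a b] shape_U_pos by simp

text \<open>With n = 6 + a - 2 b one has a + b = y n and 6 - 3 b = (1 - y) n. The added 4 L turns
  the term with -b into a multiple of 6 - 3 b, after which n cancels.\<close>

lemma period_flux_shape:
  assumes "period_region a b"
  shows "half_period a b * (period_flux a b + 4 * half_period a b) = shape_R ((a + b) / (6 + a - 2 * b))"
proof -
  define n where "n = 6 + a - 2 * b"
  define y where "y = (a + b) / n"
  define q where "q = sqrt n"
  note sh = half_period_shape[OF assms, folded n_def, folded y_def, folded q_def]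
  have q: "0 < q" "q * q = n" using sh(1) by (simp_all add: q_def)
  have yn: "a + b = y * n" using sh(1) by (simp add: y_def)
  have b: "6 - 3 * b = n * (1 - y)" using yn by (simp add: n_def algebra_simps)
  define U where "U = shape_U y"
  define W where "W = shape_W y"
  have "sqrt 6 * U / q * (2 * sqrt 6 * (- b * U + y * n * W) / q + 4 * (sqrt 6 * U / q))
    = (sqrt 6 * sqrt 6) * U * (2 * (- b * U + y * n * W) + 4 * U) / (q * q)"
    using q(1) by (simp add: field_simps)
  also have "\<dots> = (4 * U\<^sup>2 * (6 - 3 * b) + 12 * y * U * W * n) / n"
    unfolding q(2) by (simp add: algebra_simps power2_eq_square)
  also have "\<dots> = 4 * (3 * y * U * W + (1 - y) * U\<^sup>2)"
    unfolding b using sh(1) by (simp add: field_simps)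
  finally show ?thesis
    unfolding sh(3,4) U_def[symmetric] W_def[symmetric] yn n_def[symmetric]
    using sh(1) by (simp add: shape_R_def U_def W_def)
qed

lemma shape_U_half_period:
  assumes "period_region a b"
  shows "6 * (shape_U ((a + b) / (6 + a - 2 * b)))\<^sup>2 = (half_period a b)\<^sup>2 * (6 + a - 2 * b)"
  unfolding half_period_shape(3)[OF assms] using half_period_shape(1)[OF assms]
  by (simp add: power_mult_distrib power_divide)

text \<open>\<open>shape_R\<close> is decreasing, so the order of the moduli is reversed for the
  fluxes once the half-periods agree.\<close>

lemma period_flux_le:
  assumes "period_region a b" "period_region a' b'" "half_period a b = half_period a' b'"
    and "(a' + b') / (6 + a' - 2 * b') \<le> (a + b) / (6 + a - 2 * b)"
  shows "period_flux a b \<le> period_flux a' b'"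
proof -
  have "shape_R ((a + b) / (6 + a - 2 * b)) \<le> shape_R ((a' + b') / (6 + a' - 2 * b'))"
    using shape_R_strict_antimono half_period_shape(2)[OF assms(2)] assms(4)
    by (metis order_le_less)
  then have "half_period a' b' * (period_flux a b + 4 * half_period a' b')
      \<le> half_period a' b' * (period_flux a' b' + 4 * half_period a' b')"
    using period_flux_shape[OF assms(1)] period_flux_shape[OF assms(2)] assms(3) by simp
  then show ?thesis using half_period_pos[OF assms(2)] by simp
qed

text \<open>At a fixed half-period the flux decreases with the modulus \<open>y = (a + b) / (6 + a - 2 b)\<close>,
  while \<open>a\<close> and \<open>b\<close> are \<open>(1 + 2 y) U(y)\<^sup>2\<close> and \<open>- (1 - y) U(y)\<^sup>2\<close> up to affine maps.\<close>

lemma period_flux_le_right_zero: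
  assumes "period_region a b" "0 \<le> a0" "half_period a b = half_period a0 0"
  shows "period_flux a b \<le> period_flux a0 0"
proof (rule period_flux_le[OF assms(1) _ assms(3)])
  show r0: "period_region a0 0" using assms by (simp add: period_region_def)
  define n where "n = 6 + a - 2 * b"
  define y where "y = (a + b) / n"
  define y0 where "y0 = a0 / (6 + a0)"
  have n: "0 < n" using half_period_shape(1)[OF assms(1)] by (simp add: n_def)
  have y: "0 \<le> y" using half_period_shape(2)[OF assms(1)] by (simp add: n_def y_def)
  have y0: "y0 < 1" using assms(2) by (simp add: y0_def)
  have "(1 - y) * n = 6 - 3 * b" using n by (simp add: y_def n_def field_simps)
  have U: "6 * (shape_U y)\<^sup>2 = (half_period a0 0)\<^sup>2 * n"
    using shape_U_half_period[OF assms(1)] assms(3) by (simp add: n_def y_def)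
  have U0: "6 * (shape_U y0)\<^sup>2 = (half_period a0 0)\<^sup>2 * (6 + a0)"
    using shape_U_half_period[OF r0] by (simp add: y0_def)
  show "(a0 + 0) / (6 + a0 - 2 * 0) \<le> (a + b) / (6 + a - 2 * b)"
  proof (rule ccontr)
    assume "\<not> ?thesis"
    then have lt: "y < y0" by (simp add: y_def n_def y0_def)
    \<comment> \<open>The product (1 - y) U^2 decreases in y up to y = 1 and is 6 - 3 b up to a
      common positive factor, so a smaller y would make 6 - 3 b exceed 6.\<close>
    have "(1 - y0) * (shape_U y0)\<^sup>2 < (1 - y) * (shape_U y)\<^sup>2"
      using lt y0 shape_U_strict_antimono[OF y lt] shape_U_pos[of y0] y
      by (intro mult_strict_mono power_strict_mono) auto
    then have "(1 - y0) * (6 * (shape_U y0)\<^sup>2) < (1 - y) * (6 * (shape_U y)\<^sup>2)" by simp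
    then have "(1 - y0) * (6 + a0) * (half_period a0 0)\<^sup>2 < ((1 - y) * n) * (half_period a0 0)\<^sup>2"
      unfolding U U0 by (simp add: mult.commute mult.left_commute)
    moreover have "(1 - y0) * (6 + a0) = 6" using assms(2) by (simp add: y0_def field_simps)
    ultimately show False
      using half_period_pos[OF r0] \<open>(1 - y) * n = 6 - 3 * b\<close> assms(1)
      by (simp add: period_region_def mult_less_cancel_right)
  qed
qed

lemma period_flux_le_left_zero:
  assumes "period_region a b" "period_region 0 b0" "half_period a b = half_period 0 b0"
  shows "period_flux a b \<le> period_flux 0 b0"
proof (rule period_flux_le[OF assms])
  define n where "n = 6 + a - 2 * b"
  define y where "y = (a + b) / n"
  define n0 where "n0 = 6 - 2 * b0"
  define y0 where "y0 = b0 / n0"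
  have n: "0 < n" "0 < n0"
    using half_period_shape(1)[OF assms(1)] half_period_shape(1)[OF assms(2)] by (simp_all add: n_def n0_def)
  have y: "0 \<le> y" using half_period_shape(2)[OF assms(1)] by (simp add: n_def y_def)
  have yn: "(1 + 2 * y) * n = 6 + 3 * a" "(1 + 2 * y0) * n0 = 6"
    using n by (simp_all add: y_def y0_def n_def n0_def field_simps)
  have U: "6 * (shape_U y)\<^sup>2 = (half_period 0 b0)\<^sup>2 * n"
    using shape_U_half_period[OF assms(1)] assms(3) by (simp add: n_def y_def)
  have U0: "6 * (shape_U y0)\<^sup>2 = (half_period 0 b0)\<^sup>2 * n0"
    using shape_U_half_period[OF assms(2)] by (simp add: y0_def n0_def)
  show "(0 + b0) / (6 + 0 - 2 * b0) \<le> (a + b) / (6 + a - 2 * b)"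
  proof (rule ccontr)
    assume "\<not> ?thesis"
    then have lt: "y < y0" by (simp add: y_def n_def y0_def n0_def)
    \<comment> \<open>The product (1 + 2 y) U^2 is 6 + 3 a up to a common positive factor, so a
      smaller y would make a negative.\<close>
    have "(1 + 2 * y) * (6 * (shape_U y)\<^sup>2) < (1 + 2 * y0) * (6 * (shape_U y0)\<^sup>2)"
      using shape_U_scaled_strict_mono[OF y lt] by simp
    then have "((1 + 2 * y) * n) * (half_period 0 b0)\<^sup>2 < ((1 + 2 * y0) * n0) * (half_period 0 b0)\<^sup>2"
      unfolding U U0 by (simp add: mult.commute mult.left_commute)
    then show False
      using half_period_pos[OF assms(2)] assms(1) unfolding yn
      by (simp add: period_region_def mult_less_cancel_right)
  qed
qed

text \<open>For b > 0 the modulus is positive, so R(y) < R(0) = pi^2.\<close>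

lemma period_flux_left_zero_less:
  assumes "period_region 0 b" "0 < b"
  shows "period_flux 0 b < pi\<^sup>2 / half_period 0 b - 4 * half_period 0 b"
proof -
  have "0 < b / (6 - 2 * b)" using assms by (simp add: period_region_def)
  then have "half_period 0 b * (period_flux 0 b + 4 * half_period 0 b) < pi\<^sup>2"
    using period_flux_shape[OF assms(1)] shape_R_strict_antimono[of 0 "b / (6 - 2 * b)"] shape_R_0 by simp
  then have "period_flux 0 b + 4 * half_period 0 b < pi\<^sup>2 / half_period 0 b"
    using half_period_pos[OF assms(1)] by (simp add: pos_less_divide_eq mult.commute)
  then show ?thesis by simp
qed

section \<open>Divergence of the half-period and solvability for a prescribed half-period\<close>

text \<open>The bound is uniform in c. Since sin \<phi> \<le> \<phi>, the square root is at most k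
  \<phi> for \<phi> \<ge> sqrt n, where k^2 = 1 + G; so the integral is at least ln(1 / sqrt n) /
  k.\<close>

lemma period_integral_diverges:
  fixes G X :: real
  assumes "0 \<le> G"
  obtains n0 where "0 < n0" "\<And>n c. 0 < n \<Longrightarrow> n < n0 \<Longrightarrow> 0 \<le> c \<Longrightarrow> c \<le> G \<Longrightarrow>
    X < integral quarter (\<lambda>\<phi>. 1 / sqrt (n + c * (sin \<phi>)\<^sup>2))"
proof -
  define k where "k = sqrt (1 + G)"
  have k: "0 < k" "k * k = 1 + G" using assms by (simp_all add: k_def)
  \<comment> \<open>The exponent makes - ln n / (2 k) exceed |X|, and n < 1 puts the cut sqrt n
    inside the interval of integration.\<close>
  define n0 where "n0 = min 1 (exp (- 2 * \<bar>X\<bar> * k))"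
  have "X < integral quarter (\<lambda>\<phi>. 1 / sqrt (n + c * (sin \<phi>)\<^sup>2))"
    if n: "0 < n" "n < n0" and c: "0 \<le> c" "c \<le> G" for n c
  proof -
    let ?f = "\<lambda>\<phi>. 1 / sqrt (n + c * (sin \<phi>)\<^sup>2)"
    define d where "d = sqrt n"
    have d: "0 < d" "d < 1" "d\<^sup>2 = n" using n by (auto simp: d_def n0_def)
    have pi2: "1 < pi / 2" using pi_gt3 by simp
    have pos: "0 < n + c * (sin \<phi>)\<^sup>2" for \<phi> using n c by (intro add_pos_nonneg) auto
    have fc: "continuous_on S ?f" for S
      using pos by (intro continuous_intros) (simp add: less_imp_neq[symmetric])
    have "((\<lambda>\<phi>. (1 / k) * (1 / \<phi>)) has_integral ((1 / k) * ln (pi / 2) - (1 / k) * ln d)) {d..pi/2}"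
      using d pi2 k(1)
      by (intro fundamental_theorem_of_calculus)
        (auto simp flip: has_real_derivative_iff_has_vector_derivative intro!: derivative_eq_intros)
    moreover have "integral {d..pi/2} (\<lambda>\<phi>. (1 / k) * (1 / \<phi>)) \<le> integral {d..pi/2} ?f"
    proof (rule integral_le)
      show "(\<lambda>\<phi>. (1 / k) * (1 / \<phi>)) integrable_on {d..pi/2}"
        using d k by (intro integrable_continuous_interval continuous_intros) auto
      show "?f integrable_on {d..pi/2}" by (intro integrable_continuous_interval fc)
      fix \<phi> assume phi: "\<phi> \<in> {d..pi/2}"
      have "0 \<le> sin \<phi>" using phi d by (intro sin_ge_zero) auto
      then have "(sin \<phi>)\<^sup>2 \<le> \<phi>\<^sup>2" using phi d sin_x_le_x[of \<phi>] by (intro power_mono) auto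
      then have "c * (sin \<phi>)\<^sup>2 \<le> G * \<phi>\<^sup>2" using c assms by (intro mult_mono) auto
      moreover have "d\<^sup>2 \<le> \<phi>\<^sup>2" using phi d by (intro power_mono) auto
      ultimately have "n + c * (sin \<phi>)\<^sup>2 \<le> (k * \<phi>)\<^sup>2"
        using k(2) d(3) by (simp add: power_mult_distrib power2_eq_square[of k] algebra_simps)
      then have "sqrt (n + c * (sin \<phi>)\<^sup>2) \<le> k * \<phi>"
        using phi d k by (intro real_le_lsqrt) auto
      then show "(1 / k) * (1 / \<phi>) \<le> ?f \<phi>"
        using pos[of \<phi>] phi d k by (simp add: frac_le)
    qed
    moreover have "integral {d..pi/2} ?f \<le> integral quarter ?f"
      using d pos by (intro integral_subset_le integrable_continuous_interval fc) (auto intro: less_imp_le)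
    ultimately have "(1 / k) * ln (pi / 2) - (1 / k) * ln d \<le> integral quarter ?f"
      by (simp add: integral_unique)
    moreover have "0 \<le> (1 / k) * ln (pi / 2)" using k pi2 by simp
    moreover have "ln d = ln n / 2" using n by (simp add: d_def ln_sqrt)
    moreover have "ln n < ln (exp (- 2 * \<bar>X\<bar> * k))"
      using n by (subst ln_less_cancel_iff) (auto simp: n0_def)
    then have "ln n < - 2 * \<bar>X\<bar> * k" by simp
    then have "\<bar>X\<bar> < (1 / k) * (- (ln n / 2))" using k by (simp add: field_simps)
    ultimately show ?thesis by simp
  qed
  moreover have "0 < n0" by (simp add: n0_def)
  ultimately show thesis using that by blast
qed

lemma half_period_diverges:
  assumes "0 \<le> G"
  obtains n0 where "0 < n0" "\<And>a b. period_region a b \<Longrightarrow> 6 + a - 2 * b < n0 \<Longrightarrow> a + b \<le> G \<Longrightarrow> X < half_period a b"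
proof -
  obtain n0 where n0: "0 < n0" "\<And>n c. 0 < n \<Longrightarrow> n < n0 \<Longrightarrow> 0 \<le> c \<Longrightarrow> c \<le> G \<Longrightarrow>
    \<bar>X\<bar> < integral quarter (\<lambda>\<phi>. 1 / sqrt (n + c * (sin \<phi>)\<^sup>2))"
    using period_integral_diverges[OF assms] by blast
  have "X < half_period a b" if "period_region a b" "6 + a - 2 * b < n0" "a + b \<le> G" for a b
  proof -
    let ?I = "integral quarter (\<lambda>\<phi>. 1 / sqrt (period_den a b \<phi>))"
    have I: "\<bar>X\<bar> < ?I" unfolding period_den_def using that by (intro n0) (auto simp: period_region_def)
    then have "1 * ?I \<le> sqrt 6 * ?I" by (intro mult_right_mono) auto
    then show ?thesis using I by (simp add: half_period_def)
  qed
  then show thesis using n0(1) that by blast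
qed

lemma half_period_right_zero_ex:
  assumes "0 < \<alpha>" "\<alpha> \<le> pi / 2"
  obtains a where "0 \<le> a" "half_period a 0 = \<alpha>" "\<alpha> < pi / 2 \<Longrightarrow> 0 < a"
proof -
  \<comment> \<open>Keeping only M in the denominator bounds the half-period by sqrt 6 (pi/2) / sqrt
    M = \<alpha> / 2.\<close>
  define M where "M = 6 * pi\<^sup>2 / \<alpha>\<^sup>2"
  have M: "0 < M" using assms by (simp add: M_def)
  have reg: "period_region a 0" if "0 \<le> a" for a using that by (simp add: period_region_def)
  have "integral quarter (\<lambda>\<phi>. 1 / sqrt (period_den M 0 \<phi>)) \<le> integral quarter (\<lambda>\<phi>. 1 / sqrt M)"
  proof (intro quarter_le period_integrand_continuous reg continuous_intros)
    show "1 / sqrt (period_den M 0 \<phi>) \<le> 1 / sqrt M" for \<phi>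
      using M period_den_lower[OF reg[of M], of \<phi>] by (intro divide_left_mono) auto
  qed (use M in auto)
  also have "\<dots> = pi / 2 / sqrt M" by simp
  finally have "half_period M 0 \<le> sqrt 6 * (pi / 2 / sqrt M)"
    unfolding half_period_def by (intro mult_left_mono) auto
  also have "\<dots> = \<alpha> / 2"
    using assms by (simp add: M_def real_sqrt_divide real_sqrt_mult)
  finally have low: "half_period M 0 \<le> \<alpha>" using assms by simp
  have "continuous_on {0..M} (\<lambda>a. half_period a 0)"
    by (intro continuous_on_half_period continuous_intros reg) auto
  then obtain a where a: "0 \<le> a" "a \<le> M" "half_period a 0 = \<alpha>"
    using IVT2'[of "\<lambda>a. half_period a 0" M \<alpha> 0] low assms M half_period_0 by auto
  then show thesis using that[of a] half_period_0 by (cases "a = 0") auto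
qed

lemma half_period_left_zero_ex:
  assumes "pi / 2 < \<alpha>"
  obtains b where "0 < b" "period_region 0 b" "half_period 0 b = \<alpha>"
proof -
  obtain n0 where n0: "0 < n0"
    "\<And>a b. period_region a b \<Longrightarrow> 6 + a - 2 * b < n0 \<Longrightarrow> a + b \<le> 3 \<Longrightarrow> \<alpha> < half_period a b"
    using half_period_diverges[of 3 \<alpha>] by auto
  \<comment> \<open>B < 3 keeps (0, B) in the region, and 6 - 2 B \<le> n0 / 2 brings it into the
    range where the half-period exceeds \<alpha>.\<close>
  define B where "B = 3 - min 1 (n0 / 4)"
  have B: "2 \<le> B" "B < 3" "6 - 2 * B < n0" using n0(1) by (auto simp: B_def min_def)
  have reg: "period_region 0 b" if "0 \<le> b" "b \<le> B" for b
    using that B by (simp add: period_region_def)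
  have "\<alpha> < half_period 0 B" using B by (intro n0(2) reg) auto
  moreover have "continuous_on {0..B} (half_period 0)"
    by (intro continuous_on_half_period[of _ "\<lambda>_. 0" "\<lambda>b. b"] continuous_intros reg) auto
  ultimately obtain b where b: "0 \<le> b" "b \<le> B" "half_period 0 b = \<alpha>"
    using IVT'[of "half_period 0" 0 \<alpha> B] half_period_0 assms B by auto
  then have "b \<noteq> 0" using half_period_0 assms by auto
  with b show thesis using that[of b] reg[of b] by auto
qed

text \<open>Moves a boundary point into the interior at constant half-period. Raising a by d
  shortens the half-period; raising b by 2 d as well changes the denominator by -3 d (1 - s) in
  total, with s = sin^2 \<phi>, and so lengthens it beyond the original. A value of b in between
  restores it.\<close>

lemma half_period_nearby:
  assumes "period_region a0 b0" "0 < d" "3 * d < 6 + a0 - 2 * b0"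
  obtains b where "b0 < b" "b < b0 + 2 * d" "period_region (a0 + d) b"
    "half_period (a0 + d) b = half_period a0 b0"
proof -
  have reg: "period_region (a0 + d) b" if "b0 \<le> b" "b \<le> b0 + 2 * d" for b
    using assms that by (simp add: period_region_def)
  have lo: "half_period (a0 + d) b0 < half_period a0 b0"
    by (intro half_period_strict_antimono_left assms) (use assms in auto)
  have hi: "half_period a0 b0 < half_period (a0 + d) (b0 + 2 * d)"
  proof (rule half_period_strict[OF assms(1) reg])
    fix s :: real assume "0 < s" "s < 1"
    then have "0 < 3 * d * (1 - s)" using assms by simp
    then show "(a0 + d) * (1 + s) - (b0 + 2 * d) * (2 - s) < a0 * (1 + s) - b0 * (2 - s)"
      by (simp add: algebra_simps)
  qed (use assms in auto)
  have "continuous_on {b0..b0 + 2 * d} (half_period (a0 + d))"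
    by (intro continuous_on_half_period[of _ "\<lambda>_. a0 + d" "\<lambda>b. b"] continuous_intros reg) auto
  then obtain b where b: "b0 \<le> b" "b \<le> b0 + 2 * d" "half_period (a0 + d) b = half_period a0 b0"
    using IVT'[of "half_period (a0 + d)" b0 "half_period a0 b0" "b0 + 2 * d"] lo hi assms by auto
  moreover have "b \<noteq> b0" "b \<noteq> b0 + 2 * d" using b lo hi by auto
  ultimately show thesis using that[of b] reg[of b] by auto
qed

section \<open>Estimates for humps\<close>

lemma half_width_eq: "half_width a s = sqrt 6 * integral quarter (\<lambda>\<phi>. sin \<phi> / sqrt (hump_den a s ((sin \<phi>)\<^sup>2)))"
  by (simp add: half_width_def hump_int_def)

lemma half_width_zero_eq: "half_width a 0 = sqrt 6 * integral quarter (\<lambda>\<phi>. 1 / sqrt (6 + a * (1 + (sin \<phi>)\<^sup>2)))"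
  by (simp add: half_width_def hump_int_zero)

lemma hump_flux_eq:
  "hump_flux a s = 2 * a * (sqrt 6 * integral quarter (\<lambda>\<phi>. (sin \<phi>)\<^sup>2 * sin \<phi> / sqrt (hump_den a s ((sin \<phi>)\<^sup>2))))"
  by (simp add: hump_flux_def hump_int_def)

lemma hump_flux_zero_eq:
  "hump_flux a 0 = 2 * a * (sqrt 6 * integral quarter (\<lambda>\<phi>. (sin \<phi>)\<^sup>2 / sqrt (6 + a * (1 + (sin \<phi>)\<^sup>2))))"
  by (simp add: hump_flux_def hump_int_zero)

lemma admissible_zero_den_pos:
  assumes "admissible a 0"
  shows "0 < 6 + a * (1 + (sin \<phi>)\<^sup>2)"
proof (cases "a \<ge> 0")
  case True
  then show ?thesis by (simp add: add_pos_nonneg)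
next
  case False
  then have "a * 2 \<le> a * (1 + (sin \<phi>)\<^sup>2)" using sin_squared_le_1[of \<phi>] by (intro mult_left_mono_neg) auto
  then show ?thesis using assms by (simp add: admissible_def)
qed

lemma hump_den_sin_pos:
  "admissible a s \<Longrightarrow> 0 < s \<Longrightarrow> 0 < hump_den a s ((sin \<phi>)\<^sup>2)"
  by (intro hump_den_pos' sin_squared_le_1) auto

lemma hump_continuous_intro:
  assumes "admissible a s" "0 < s" "continuous_on S g"
  shows "continuous_on S (\<lambda>\<phi>. g \<phi> / sqrt (hump_den a s ((sin \<phi>)\<^sup>2)))"
  using hump_den_sin_pos[OF assms(1,2)] unfolding hump_den_def
  by (intro continuous_intros assms(3)) (simp add: less_imp_neq[symmetric])

lemma hump_zero_continuous_intro:
  assumes "admissible a 0" "continuous_on S g"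
  shows "continuous_on S (\<lambda>\<phi>. g \<phi> / sqrt (6 + a * (1 + (sin \<phi>)\<^sup>2)))"
  using admissible_zero_den_pos[OF assms(1)]
  by (intro continuous_intros assms(2)) (simp add: less_imp_neq[symmetric])

lemma sin_nonneg_quarter: "0 \<le> \<phi> \<Longrightarrow> \<phi> \<le> pi / 2 \<Longrightarrow> 0 \<le> sin \<phi>"
  by (rule sin_ge_zero) auto

lemma cos_nonneg_quarter: "0 \<le> \<phi> \<Longrightarrow> \<phi> \<le> pi / 2 \<Longrightarrow> 0 \<le> cos \<phi>"
  by (rule cos_ge_zero) auto

section \<open>Comparison with humps of zero slope\<close>

lemma half_width_zero_strict_antimono:
  assumes "admissible a 0" "a < a'"
  shows "half_width a' 0 < half_width a 0"
proof -
  have "admissible a' 0" using assms by (simp add: admissible_def)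
  note pos = admissible_zero_den_pos[OF assms(1)] admissible_zero_den_pos[OF this]
  show ?thesis
    unfolding half_width_zero_eq
  proof (intro mult_strict_left_mono quarter_less hump_zero_continuous_intro assms \<open>admissible a' 0\<close> continuous_intros)
    fix \<phi> :: real
    have "a * (1 + (sin \<phi>)\<^sup>2) < a' * (1 + (sin \<phi>)\<^sup>2)"
      using assms(2) by (intro mult_strict_right_mono add_pos_nonneg) auto
    then show "1 / sqrt (6 + a' * (1 + (sin \<phi>)\<^sup>2)) < 1 / sqrt (6 + a * (1 + (sin \<phi>)\<^sup>2))"
      using pos[of \<phi>] by (intro divide_strict_left_mono) (auto intro!: mult_pos_pos)
  qed simp
qed

lemma half_width_less_zero:
  assumes "admissible a s" "0 < s" "admissible a' 0" "a' \<le> a"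
  shows "half_width a s < half_width a' 0"
  unfolding half_width_zero_eq half_width_eq[of a s]
proof (intro mult_strict_left_mono quarter_less hump_zero_continuous_intro hump_continuous_intro assms continuous_intros)
  fix \<phi> :: real assume phi: "0 < \<phi>" "\<phi> < pi / 2"
  have sp: "0 < sin \<phi>" using phi by (intro sin_gt_zero) auto
  define q where "q = 6 + a' * (1 + (sin \<phi>)\<^sup>2)"
  have q: "0 < q" unfolding q_def by (rule admissible_zero_den_pos[OF assms(3)])
  have "a' * (1 + (sin \<phi>)\<^sup>2) \<le> a * (1 + (sin \<phi>)\<^sup>2)" using assms(4) by (intro mult_right_mono) auto
  then have "(sin \<phi>)\<^sup>2 * q \<le> (sin \<phi>)\<^sup>2 * (6 + a * (1 + (sin \<phi>)\<^sup>2))" by (intro mult_left_mono) (auto simp: q_def)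
  also have "\<dots> < hump_den a s ((sin \<phi>)\<^sup>2)"
    using assms(2) by (simp add: hump_den_def algebra_simps)
  finally have lt: "sqrt ((sin \<phi>)\<^sup>2 * q) < sqrt (hump_den a s ((sin \<phi>)\<^sup>2))" by simp
  have sq: "sqrt ((sin \<phi>)\<^sup>2 * q) = sin \<phi> * sqrt q" using sp by (simp add: real_sqrt_mult)
  have "sin \<phi> / sqrt (hump_den a s ((sin \<phi>)\<^sup>2)) < sin \<phi> / (sin \<phi> * sqrt q)"
    using lt sp q hump_den_sin_pos[OF assms(1,2), of \<phi>] unfolding sq
    by (intro divide_strict_left_mono mult_pos_pos) auto
  also have "\<dots> = 1 / sqrt q" using sp by simp
  finally show "sin \<phi> / sqrt (hump_den a s ((sin \<phi>)\<^sup>2)) < 1 / sqrt (6 + a' * (1 + (sin \<phi>)\<^sup>2))"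
    by (simp add: q_def)
qed simp

text \<open>Both humps have the same width, so \<open>\<psi>\<close>, the difference of the two denominators, has mean
  \<open>0\<close> for the positive weight \<open>m\<close>; being increasing in \<open>t\<close>, it correlates positively with \<open>t\<close>.\<close>

lemma hump_flux_less_aux:
  assumes adm: "admissible a s" "0 < s" "admissible a' 0" and a: "a < a'"
    and eq: "half_width a s = half_width a' 0"
  shows "hump_flux a s \<le> hump_flux a' 0"
proof -
  define t where "t \<phi> = (sin \<phi>)\<^sup>2" for \<phi> :: real
  define D where "D \<phi> = hump_den a s (t \<phi>)" for \<phi>
  define q where "q \<phi> = 6 + a' * (1 + t \<phi>)" for \<phi>
  \<comment> \<open>Rationalising with the conjugate sqrt D + sin \<phi> sqrt q turns the difference
    of the two integrands into -\<psi> m with \<psi> = t q - D.\<close>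
  define m where "m \<phi> = 1 / (sqrt (D \<phi>) * sqrt (q \<phi>) * (sqrt (D \<phi>) + sin \<phi> * sqrt (q \<phi>)))" for \<phi>
  define \<delta> where "\<delta> = a' - a"
  define \<psi> where "\<psi> \<phi> = \<delta> * (t \<phi> + (t \<phi>)\<^sup>2) - s" for \<phi>
  have \<delta>: "0 < \<delta>" using a by (simp add: \<delta>_def)
  have D: "0 < D \<phi>" for \<phi> unfolding D_def t_def by (rule hump_den_sin_pos[OF adm(1,2)])
  have q: "0 < q \<phi>" for \<phi> unfolding q_def t_def by (rule admissible_zero_den_pos[OF adm(3)])
  have sum_pos: "0 < sqrt (D \<phi>) + sin \<phi> * sqrt (q \<phi>)" if "\<phi> \<in> quarter" for \<phi>
    using that D[of \<phi>] q[of \<phi>] sin_nonneg_quarter[of \<phi>] by (intro add_pos_nonneg) auto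
  have m: "0 < m \<phi>" if "\<phi> \<in> quarter" for \<phi>
    unfolding m_def using D[of \<phi>] q[of \<phi>] sum_pos[OF that] by simp
  have ct: "continuous_on S t" for S unfolding t_def[abs_def] by (intro continuous_intros)
  have cD: "continuous_on S D" for S unfolding D_def[abs_def] hump_den_def by (intro continuous_intros ct)
  have cq: "continuous_on S q" for S unfolding q_def[abs_def] by (intro continuous_intros ct)
  have cm: "continuous_on quarter m"
    unfolding m_def[abs_def] using D q sum_pos
    by (intro continuous_intros cD cq) (auto simp: less_imp_neq[symmetric])
  have c\<psi>: "continuous_on S \<psi>" for S unfolding \<psi>_def[abs_def] by (intro continuous_intros ct)
  have diff: "1 / sqrt (q \<phi>) - sin \<phi> / sqrt (D \<phi>) = - (\<psi> \<phi> * m \<phi>)" if phi: "\<phi> \<in> quarter" for \<phi>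
  proof -
    define x where "x = sqrt (D \<phi>)"
    define z where "z = sqrt (q \<phi>)"
    have xz: "0 < x" "0 < z" "0 < x + sin \<phi> * z"
      using D[of \<phi>] q[of \<phi>] sum_pos[OF phi] by (simp_all add: x_def z_def)
    have "x * x = D \<phi>" "z * z = q \<phi>"
      using D[of \<phi>] q[of \<phi>] by (simp_all add: x_def z_def)
    moreover have "\<psi> \<phi> = t \<phi> * q \<phi> - D \<phi>"
      by (simp add: \<psi>_def \<delta>_def D_def q_def hump_den_def power2_eq_square algebra_simps)
    moreover have "sin \<phi> * z * (sin \<phi> * z) = t \<phi> * (z * z)"
      by (simp add: t_def power2_eq_square)
    ultimately have \<psi>: "\<psi> \<phi> = sin \<phi> * z * (sin \<phi> * z) - x * x" by simp
    have "1 / z - sin \<phi> / x = (x - sin \<phi> * z) / (x * z)" using xz by (simp add: field_simps)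
    also have "\<dots> = ((x - sin \<phi> * z) * (x + sin \<phi> * z)) / (x * z * (x + sin \<phi> * z))" using xz by simp
    also have "(x - sin \<phi> * z) * (x + sin \<phi> * z) = - \<psi> \<phi>" unfolding \<psi> by (simp add: algebra_simps)
    finally show ?thesis by (simp add: m_def x_def[symmetric] z_def[symmetric])
  qed
  note int = integrable_continuous_interval
  have c1: "continuous_on quarter (\<lambda>\<phi>. 1 / sqrt (q \<phi>))" "continuous_on quarter (\<lambda>\<phi>. t \<phi> / sqrt (q \<phi>))"
    using q by (auto intro!: continuous_intros cq ct simp: less_imp_neq[symmetric])
  have c2: "continuous_on quarter (\<lambda>\<phi>. sin \<phi> / sqrt (D \<phi>))" "continuous_on quarter (\<lambda>\<phi>. t \<phi> * sin \<phi> / sqrt (D \<phi>))"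
    using D by (auto intro!: continuous_intros cD ct simp: less_imp_neq[symmetric])
  have mean: "integral quarter (\<lambda>\<phi>. \<psi> \<phi> * m \<phi>) = 0"
  proof -
    have "integral quarter (\<lambda>\<phi>. 1 / sqrt (q \<phi>)) - integral quarter (\<lambda>\<phi>. sin \<phi> / sqrt (D \<phi>)) = 0"
      using eq unfolding half_width_zero_eq half_width_eq[of a s] by (simp add: q_def D_def t_def)
    then have "integral quarter (\<lambda>\<phi>. 1 / sqrt (q \<phi>) - sin \<phi> / sqrt (D \<phi>)) = 0"
      by (simp add: integral_diff int c1 c2)
    also have "integral quarter (\<lambda>\<phi>. 1 / sqrt (q \<phi>) - sin \<phi> / sqrt (D \<phi>)) = integral quarter (\<lambda>\<phi>. - (\<psi> \<phi> * m \<phi>))"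
      by (rule integral_cong) (rule diff)
    finally show ?thesis by simp
  qed
  \<comment> \<open>The nonnegative root of \<psi> as a quadratic in t; it may exceed 1. Since
    \<psi> has the sign of t - T, the product (t - T) \<psi> is nonnegative.\<close>
  define T where "T = (- 1 + sqrt (1 + 4 * s / \<delta>)) / 2"
  have T: "0 \<le> T" "\<delta> * (T + T\<^sup>2) = s"
  proof -
    have p: "0 \<le> s / \<delta>" using adm(2) \<delta> by simp
    then show "0 \<le> T" by (simp add: T_def)
    have "(sqrt (1 + 4 * s / \<delta>))\<^sup>2 = 1 + 4 * s / \<delta>" using p by (intro real_sqrt_pow2) simp
    moreover have "sqrt (1 + 4 * s / \<delta>) = 2 * T + 1" by (simp add: T_def diff_divide_distrib)
    ultimately have "(2 * T + 1)\<^sup>2 = 1 + 4 * s / \<delta>" by simp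
    moreover have "(2 * T + 1)\<^sup>2 = 1 + 4 * (T + T\<^sup>2)" by (simp add: power2_eq_square algebra_simps)
    ultimately have "1 + 4 * (T + T\<^sup>2) = 1 + 4 * s / \<delta>" by metis
    then have "T + T\<^sup>2 = s / \<delta>" by simp
    then show "\<delta> * (T + T\<^sup>2) = s" using \<delta> by simp
  qed
  have cor: "0 \<le> integral quarter (\<lambda>\<phi>. t \<phi> * (\<psi> \<phi> * m \<phi>))"
  proof -
    have "integral quarter (\<lambda>\<phi>. T * (\<psi> \<phi> * m \<phi>)) \<le> integral quarter (\<lambda>\<phi>. t \<phi> * (\<psi> \<phi> * m \<phi>))"
    proof (rule quarter_le)
      fix \<phi> :: real assume phi: "0 \<le> \<phi>" "\<phi> \<le> pi / 2"
      have "\<psi> \<phi> = \<delta> * (t \<phi> - T) * (1 + t \<phi> + T)"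
        unfolding \<psi>_def using T(2) by (simp add: algebra_simps power2_eq_square)
      then have "(t \<phi> - T) * (\<psi> \<phi> * m \<phi>) = \<delta> * (t \<phi> - T)\<^sup>2 * ((1 + t \<phi> + T) * m \<phi>)"
        by (simp add: power2_eq_square)
      also have "\<dots> \<ge> 0"
        using \<delta> T(1) m[of \<phi>] phi by (intro mult_nonneg_nonneg) (auto simp: t_def less_imp_le)
      finally show "T * (\<psi> \<phi> * m \<phi>) \<le> t \<phi> * (\<psi> \<phi> * m \<phi>)" by (simp add: left_diff_distrib)
    qed (intro continuous_intros ct cm c\<psi>)+
    then show ?thesis using mean by simp
  qed
  \<comment> \<open>The conditional is the positive part of a + a'. For negative humps a + a' is
    negative, and the correlation \<open>cor\<close> allows it to be replaced by 0.\<close>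
  have sum_ge: "(if 0 \<le> a + a' then a + a' else 0) * integral quarter (\<lambda>\<phi>. t \<phi> * (\<psi> \<phi> * m \<phi>))
      \<le> \<delta> * integral quarter (\<lambda>\<phi>. t \<phi> * (1 / sqrt (q \<phi>) + sin \<phi> / sqrt (D \<phi>)))"
    unfolding integral_mult_right[symmetric]
  proof (rule quarter_le)
    fix \<phi> :: real assume phi: "0 \<le> \<phi>" "\<phi> \<le> pi / 2"
    then have phi': "\<phi> \<in> quarter" by simp
    define x where "x = sqrt (D \<phi>)"
    define z where "z = sqrt (q \<phi>)"
    have sn: "0 \<le> sin \<phi>" using phi by (rule sin_nonneg_quarter)
    have t0: "0 \<le> t \<phi>" by (simp add: t_def)
    have xz: "0 < x" "0 < z" "0 < x + sin \<phi> * z" "x * x = D \<phi>" "z * z = q \<phi>"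
      using D[of \<phi>] q[of \<phi>] sum_pos[OF phi'] by (simp_all add: x_def z_def)
    have "1 / z + sin \<phi> / x = (x + sin \<phi> * z) / (x * z)" using xz by (simp add: field_simps)
    also have "\<dots> = (x + sin \<phi> * z)\<^sup>2 / (x * z * (x + sin \<phi> * z))"
      using xz by (simp add: power2_eq_square)
    finally have sum: "1 / z + sin \<phi> / x = (x + sin \<phi> * z)\<^sup>2 * m \<phi>"
      by (simp add: m_def x_def[symmetric] z_def[symmetric])
    have "(x + sin \<phi> * z)\<^sup>2 = x * x + (sin \<phi>)\<^sup>2 * (z * z) + 2 * x * sin \<phi> * z"
      by (simp add: power2_eq_square algebra_simps)
    then have ge: "D \<phi> + t \<phi> * q \<phi> \<le> (x + sin \<phi> * z)\<^sup>2"
      using xz sn by (simp add: t_def)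
    have "(if 0 \<le> a + a' then a + a' else 0) * \<psi> \<phi> \<le> \<delta> * (x + sin \<phi> * z)\<^sup>2"
    proof (cases "0 \<le> a + a'")
      case True
      \<comment> \<open>The terms with t + t^2 cancel in this difference, and the rest is
        nonnegative for a + a' \<ge> 0.\<close>
      have "\<delta> * (D \<phi> + t \<phi> * q \<phi>) - (a + a') * \<psi> \<phi> = \<delta> * (s + 12 * t \<phi>) + (a + a') * s"
        by (simp add: D_def q_def \<psi>_def hump_den_def power2_eq_square algebra_simps)
      also have "\<dots> \<ge> 0" using \<delta> adm(2) True t0 by simp
      finally have "(a + a') * \<psi> \<phi> \<le> \<delta> * (D \<phi> + t \<phi> * q \<phi>)" by simp
      also have "\<dots> \<le> \<delta> * (x + sin \<phi> * z)\<^sup>2" using ge \<delta> by (intro mult_left_mono) auto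
      finally show ?thesis using True by simp
    qed (use \<delta> in simp)
    then have "((if 0 \<le> a + a' then a + a' else 0) * \<psi> \<phi>) * (t \<phi> * m \<phi>)
        \<le> (\<delta> * (x + sin \<phi> * z)\<^sup>2) * (t \<phi> * m \<phi>)"
      using t0 m[OF phi'] by (intro mult_right_mono) auto
    also have "\<dots> = \<delta> * (t \<phi> * (1 / z + sin \<phi> / x))" unfolding sum by simp
    finally show "(if 0 \<le> a + a' then a + a' else 0) * (t \<phi> * (\<psi> \<phi> * m \<phi>))
        \<le> \<delta> * (t \<phi> * (1 / sqrt (q \<phi>) + sin \<phi> / sqrt (D \<phi>)))"
      by (simp add: x_def z_def ac_simps)
  qed (intro continuous_on_mult continuous_on_add continuous_on_const ct cm c\<psi> c1 c2)+
  define J where "J = integral quarter (\<lambda>\<phi>. t \<phi> / sqrt (q \<phi>))"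
  define I where "I = integral quarter (\<lambda>\<phi>. t \<phi> * sin \<phi> / sqrt (D \<phi>))"
  have S: "integral quarter (\<lambda>\<phi>. t \<phi> * (1 / sqrt (q \<phi>) + sin \<phi> / sqrt (D \<phi>))) = J + I"
    unfolding J_def I_def using integral_add[OF int[OF c1(2)] int[OF c2(2)]]
    by (simp add: distrib_left)
  have R: "integral quarter (\<lambda>\<phi>. t \<phi> * (\<psi> \<phi> * m \<phi>)) = I - J"
  proof -
    have "integral quarter (\<lambda>\<phi>. t \<phi> * (\<psi> \<phi> * m \<phi>)) = integral quarter (\<lambda>\<phi>. t \<phi> * sin \<phi> / sqrt (D \<phi>) - t \<phi> / sqrt (q \<phi>))"
    proof (rule integral_cong)
      fix \<phi> assume "\<phi> \<in> quarter"
      from diff[OF this] have "\<psi> \<phi> * m \<phi> = sin \<phi> / sqrt (D \<phi>) - 1 / sqrt (q \<phi>)" by simp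
      then show "t \<phi> * (\<psi> \<phi> * m \<phi>) = t \<phi> * sin \<phi> / sqrt (D \<phi>) - t \<phi> / sqrt (q \<phi>)"
        by (simp add: right_diff_distrib)
    qed
    then show ?thesis unfolding I_def J_def using integral_diff[OF int[OF c2(2)] int[OF c1(2)]] by simp
  qed
  have "a * I \<le> a' * J"
  proof -
    \<comment> \<open>Splits the difference of the fluxes into the gain from the larger amplitude
      and the loss from the correlation.\<close>
    have "2 * (a' * J - a * I) = \<delta> * (J + I) - (a + a') * (I - J)"
      by (simp add: \<delta>_def algebra_simps)
    moreover
    have "(a + a') * (I - J) \<le> (if 0 \<le> a + a' then a + a' else 0) * (I - J)"
      using cor unfolding R by (intro mult_right_mono) auto
    from order_trans[OF this sum_ge[unfolded S R]] have "0 \<le> \<delta> * (J + I) - (a + a') * (I - J)" by simp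
    ultimately have "0 \<le> 2 * (a' * J - a * I)" by metis
    then show ?thesis by simp
  qed
  then have "(2 * sqrt 6) * (a * I) \<le> (2 * sqrt 6) * (a' * J)" by (intro mult_left_mono) auto
  then show ?thesis
    unfolding hump_flux_zero_eq hump_flux_eq[of a s] by (simp add: I_def J_def q_def D_def t_def ac_simps)
qed

text \<open>Positive slope and larger amplitude both narrow a hump. Equality of the widths therefore
  forces a < a' for s > 0, and a = a' for s = 0.\<close>

lemma hump_flux_le_zero_slope:
  assumes "admissible a s" "admissible a' 0" "half_width a s = half_width a' 0"
  shows "hump_flux a s \<le> hump_flux a' 0"
proof (cases "s = 0")
  case True
  then have "a = a'"
    using half_width_zero_strict_antimono[of a a'] half_width_zero_strict_antimono[of a' a] assms
    by (cases a a' rule: linorder_cases) auto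
  then show ?thesis using True by simp
next
  case False
  then have s: "0 < s" using assms(1) by (simp add: admissible_def)
  then have "a < a'" using half_width_less_zero[OF assms(1) s assms(2)] assms(3) by force
  then show ?thesis by (rule hump_flux_less_aux[OF assms(1) s assms(2) _ assms(3)])
qed

section \<open>Asymptotic bounds for widths and fluxes\<close>

lemma integral_quarter_sin: "integral quarter sin = 1" and integral_quarter_cos: "integral quarter cos = 1"
proof -
  have "(sin has_integral (- cos (pi/2) - - cos 0)) quarter"
    by (rule fundamental_theorem_of_calculus)
      (auto simp flip: has_real_derivative_iff_has_vector_derivative intro!: derivative_eq_intros)
  then show "integral quarter sin = 1" by (simp add: integral_unique)
  have "(cos has_integral (sin (pi/2) - sin 0)) quarter"
    by (rule fundamental_theorem_of_calculus)
      (auto simp flip: has_real_derivative_iff_has_vector_derivative intro!: derivative_eq_intros)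
  then show "integral quarter cos = 1" by (simp add: integral_unique)
qed

text \<open>\<open>hump_den\<close> is at least c: for a < 0 it is concave in t and smallest at an
  end of [0, 1], for a \<ge> 0 it is smallest at 0. The resulting bound is integrated against sin
  \<phi>, whose integral is 1.\<close>

lemma half_width_le:
  assumes adm: "admissible a s" and c: "0 < c" "c \<le> s" "a < 0 \<Longrightarrow> c \<le> s + 6 + 2 * a"
  shows "half_width a s \<le> sqrt 6 / sqrt c"
proof -
  have s: "0 < s" using c by simp
  have den: "c \<le> hump_den a s ((sin \<phi>)\<^sup>2)" for \<phi>
  proof (cases "a < 0")
    case False
    then have "0 \<le> a * (sin \<phi>)\<^sup>2 * (1 + (sin \<phi>)\<^sup>2)" by simp
    then show ?thesis using c by (simp add: hump_den_def add_increasing2)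
  next
    case True
    let ?t = "(sin \<phi>)\<^sup>2"
    have t: "0 \<le> ?t" "0 \<le> 1 - ?t" using sin_squared_le_1[of \<phi>] by auto
    have "hump_den a s ?t = (1 - ?t) * s + ?t * (s + 6 + 2 * a) + (- a) * (?t * (1 - ?t))"
      by (simp add: hump_den_def algebra_simps)
    moreover have "0 \<le> (- a) * (?t * (1 - ?t))" using t True by (intro mult_nonneg_nonneg) auto
    moreover have "(1 - ?t) * c \<le> (1 - ?t) * s" using t c by (intro mult_left_mono) auto
    moreover have "?t * c \<le> ?t * (s + 6 + 2 * a)" using t c True by (intro mult_left_mono) auto
    moreover have "(1 - ?t) * c + ?t * c = c" by (simp add: algebra_simps)
    ultimately show ?thesis by linarith
  qed
  have "integral quarter (\<lambda>\<phi>. sin \<phi> / sqrt (hump_den a s ((sin \<phi>)\<^sup>2))) \<le> integral quarter (\<lambda>\<phi>. (1 / sqrt c) * sin \<phi>)"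
  proof (intro quarter_le hump_continuous_intro adm s continuous_intros)
    fix \<phi> :: real assume "0 \<le> \<phi>" "\<phi> \<le> pi / 2"
    then have "sin \<phi> / sqrt (hump_den a s ((sin \<phi>)\<^sup>2)) \<le> sin \<phi> / sqrt c"
      using den[of \<phi>] c(1) by (intro divide_left_mono sin_nonneg_quarter) auto
    then show "sin \<phi> / sqrt (hump_den a s ((sin \<phi>)\<^sup>2)) \<le> (1 / sqrt c) * sin \<phi>" by simp
  qed
  also have "\<dots> = 1 / sqrt c" by (simp only: integral_mult_right integral_quarter_sin mult_1_right)
  finally have "half_width a s \<le> sqrt 6 * (1 / sqrt c)"
    unfolding half_width_eq by (intro mult_left_mono) auto
  then show ?thesis by simp
qed

lemma half_width_ge:
  assumes adm: "admissible (-b) s" "0 < s" "0 \<le> b"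
  shows "sqrt 6 / sqrt (s + 6) \<le> half_width (-b) s"
proof -
  have "1 / sqrt (s + 6) = integral quarter (\<lambda>\<phi>. (1 / sqrt (s + 6)) * sin \<phi>)"
    by (simp only: integral_mult_right integral_quarter_sin mult_1_right)
  also have "\<dots> \<le> integral quarter (\<lambda>\<phi>. sin \<phi> / sqrt (hump_den (-b) s ((sin \<phi>)\<^sup>2)))"
  proof (intro quarter_le hump_continuous_intro adm continuous_intros)
    fix \<phi> :: real assume phi: "0 \<le> \<phi>" "\<phi> \<le> pi / 2"
    have "0 \<le> b * (sin \<phi>)\<^sup>2 * (1 + (sin \<phi>)\<^sup>2)" using adm by simp
    then have "hump_den (-b) s ((sin \<phi>)\<^sup>2) \<le> s + 6"
      using sin_squared_le_1[of \<phi>] by (simp add: hump_den_def)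
    then have "sin \<phi> / sqrt (s + 6) \<le> sin \<phi> / sqrt (hump_den (-b) s ((sin \<phi>)\<^sup>2))"
      using hump_den_sin_pos[OF adm(1,2), of \<phi>] adm(2) phi
      by (intro divide_left_mono sin_nonneg_quarter mult_pos_pos) auto
    then show "(1 / sqrt (s + 6)) * sin \<phi> \<le> sin \<phi> / sqrt (hump_den (-b) s ((sin \<phi>)\<^sup>2))" by simp
  qed
  finally have "sqrt 6 * (1 / sqrt (s + 6)) \<le> half_width (-b) s"
    unfolding half_width_eq by (intro mult_left_mono) auto
  then show ?thesis by simp
qed

text \<open>Only a sin^2 \<phi> is kept of the denominator; the bounds are uniform in s and serve
  for large a.\<close>

lemma positive_hump_bounds:
  assumes "0 < a" "0 < s"
  shows "half_width a s \<le> sqrt 6 * (pi / 2) / sqrt a" "hump_flux a s \<le> sqrt 6 * pi * sqrt a"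
proof -
  have adm: "admissible a s" using assms by (simp add: admissible_def)
  have le: "sin \<phi> / sqrt (hump_den a s ((sin \<phi>)\<^sup>2)) \<le> 1 / sqrt a" if phi: "0 \<le> \<phi>" "\<phi> \<le> pi / 2" for \<phi>
  proof -
    define D where "D = hump_den a s ((sin \<phi>)\<^sup>2)"
    have D: "0 < D" unfolding D_def by (rule hump_den_sin_pos[OF adm assms(2)])
    have "a * (sin \<phi>)\<^sup>2 * 1 \<le> a * (sin \<phi>)\<^sup>2 * (1 + (sin \<phi>)\<^sup>2)" using assms by (intro mult_left_mono) auto
    moreover have "D = s + 6 * (sin \<phi>)\<^sup>2 + a * (sin \<phi>)\<^sup>2 * (1 + (sin \<phi>)\<^sup>2)"
      by (simp add: D_def hump_den_def)
    moreover have "0 \<le> 6 * (sin \<phi>)\<^sup>2" by simp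
    ultimately have "a * (sin \<phi>)\<^sup>2 \<le> D" using assms by linarith
    then have "sqrt (a * (sin \<phi>)\<^sup>2) \<le> sqrt D" by simp
    then have "sqrt a * sin \<phi> \<le> sqrt D" using sin_nonneg_quarter[OF phi] by (simp add: real_sqrt_mult)
    then show ?thesis using D assms(1) unfolding D_def[symmetric] by (simp add: field_simps)
  qed
  have "integral quarter (\<lambda>\<phi>. sin \<phi> / sqrt (hump_den a s ((sin \<phi>)\<^sup>2))) \<le> integral quarter (\<lambda>\<phi>. 1 / sqrt a)"
    by (intro quarter_le hump_continuous_intro adm assms continuous_intros le)
      (use assms in auto)
  also have "\<dots> = (pi / 2) / sqrt a" by simp
  finally have "half_width a s \<le> sqrt 6 * ((pi / 2) / sqrt a)"
    unfolding half_width_eq by (intro mult_left_mono) auto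
  then show "half_width a s \<le> sqrt 6 * (pi / 2) / sqrt a" by simp
  have "integral quarter (\<lambda>\<phi>. (sin \<phi>)\<^sup>2 * sin \<phi> / sqrt (hump_den a s ((sin \<phi>)\<^sup>2))) \<le> integral quarter (\<lambda>\<phi>. 1 / sqrt a)"
  proof (intro quarter_le hump_continuous_intro adm assms continuous_intros)
    fix \<phi> :: real assume phi: "0 \<le> \<phi>" "\<phi> \<le> pi / 2"
    have "(sin \<phi>)\<^sup>2 * (sin \<phi> / sqrt (hump_den a s ((sin \<phi>)\<^sup>2))) \<le> 1 * (1 / sqrt a)"
      using le[OF phi] sin_squared_le_1[of \<phi>] sin_nonneg_quarter[OF phi] hump_den_sin_pos[OF adm assms(2), of \<phi>]
      by (intro mult_mono) auto
    then show "(sin \<phi>)\<^sup>2 * sin \<phi> / sqrt (hump_den a s ((sin \<phi>)\<^sup>2)) \<le> 1 / sqrt a" by simp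
  qed
  also have "\<dots> = (pi / 2) / sqrt a" by simp
  finally have "hump_flux a s \<le> 2 * a * (sqrt 6 * ((pi / 2) / sqrt a))"
    unfolding hump_flux_eq using assms by (intro mult_left_mono) auto
  also have "\<dots> = sqrt 6 * pi * (a / sqrt a)" by simp
  also have "a / sqrt a = sqrt a" using assms by (simp add: real_div_sqrt)
  finally show "hump_flux a s \<le> sqrt 6 * pi * sqrt a" .
qed

text \<open>Since the denominator is at least b sin^2 \<phi> cos^2 \<phi>, the area between the hump
  and the level -b is at most 2 sqrt 6 sqrt b: a deep hump is close to a rectangle. The other two
  bounds reflect -b \<le> f \<le> 0.\<close>

lemma negative_hump_flux_bounds:
  assumes adm: "admissible (-b) s" "0 < s" "0 < b"
  shows "hump_flux (-b) s \<le> - 2 * b * half_width (-b) s + 2 * sqrt 6 * sqrt b"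
    and "- 2 * b * half_width (-b) s \<le> hump_flux (-b) s"
    and "hump_flux (-b) s \<le> 0"
proof -
  let ?D = "\<lambda>\<phi>. hump_den (-b) s ((sin \<phi>)\<^sup>2)"
  define I where "I = integral quarter (\<lambda>\<phi>. sin \<phi> / sqrt (?D \<phi>))"
  define J where "J = integral quarter (\<lambda>\<phi>. (sin \<phi>)\<^sup>2 * sin \<phi> / sqrt (?D \<phi>))"
  have D: "0 < ?D \<phi>" for \<phi> by (rule hump_den_sin_pos[OF adm(1,2)])
  have c: "continuous_on quarter (\<lambda>\<phi>. sin \<phi> / sqrt (?D \<phi>))"
    "continuous_on quarter (\<lambda>\<phi>. (sin \<phi>)\<^sup>2 * sin \<phi> / sqrt (?D \<phi>))"
    "continuous_on quarter (\<lambda>\<phi>. (cos \<phi>)\<^sup>2 * sin \<phi> / sqrt (?D \<phi>))"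
    by (intro hump_continuous_intro adm continuous_intros)+
  have "I - J = integral quarter (\<lambda>\<phi>. (cos \<phi>)\<^sup>2 * sin \<phi> / sqrt (?D \<phi>))"
  proof -
    have "(cos \<phi>)\<^sup>2 * sin \<phi> / sqrt (?D \<phi>) = sin \<phi> / sqrt (?D \<phi>) - (sin \<phi>)\<^sup>2 * sin \<phi> / sqrt (?D \<phi>)" for \<phi>
      by (simp add: cos_squared_eq left_diff_distrib diff_divide_distrib)
    then show ?thesis
      unfolding I_def J_def using integral_diff[OF c(1,2)[THEN integrable_continuous_interval]] by simp
  qed
  also have "\<dots> \<le> integral quarter (\<lambda>\<phi>. (1 / sqrt b) * cos \<phi>)"
  proof (intro quarter_le c continuous_intros)
    fix \<phi> :: real assume phi: "0 \<le> \<phi>" "\<phi> \<le> pi / 2"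
    let ?t = "(sin \<phi>)\<^sup>2"
    have t: "0 \<le> ?t" "0 \<le> 1 - ?t" using sin_squared_le_1[of \<phi>] by auto
    have "?D \<phi> = (1 - ?t) * s + ?t * (s + 6 + 2 * (-b)) + b * (?t * (1 - ?t))"
      by (simp add: hump_den_def algebra_simps)
    moreover have "0 \<le> (1 - ?t) * s" "0 \<le> ?t * (s + 6 + 2 * (-b))"
      using t adm by (auto simp: admissible_def)
    ultimately have "b * (?t * (1 - ?t)) \<le> ?D \<phi>" by linarith
    then have "sqrt (b * (?t * (cos \<phi>)\<^sup>2)) \<le> sqrt (?D \<phi>)" by (simp add: cos_squared_eq)
    then have "sqrt b * (sin \<phi> * cos \<phi>) \<le> sqrt (?D \<phi>)"
      using sin_nonneg_quarter[OF phi] cos_nonneg_quarter[OF phi] by (simp add: real_sqrt_mult)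
    then have "sin \<phi> * cos \<phi> / sqrt (?D \<phi>) \<le> 1 / sqrt b"
      using D[of \<phi>] adm(3) by (simp add: field_simps)
    then have "cos \<phi> * (sin \<phi> * cos \<phi> / sqrt (?D \<phi>)) \<le> cos \<phi> * (1 / sqrt b)"
      using cos_nonneg_quarter[OF phi] by (rule mult_left_mono)
    then show "(cos \<phi>)\<^sup>2 * sin \<phi> / sqrt (?D \<phi>) \<le> (1 / sqrt b) * cos \<phi>"
      by (simp add: power2_eq_square ac_simps)
  qed
  also have "\<dots> = 1 / sqrt b" by (simp only: integral_mult_right integral_quarter_cos mult_1_right)
  finally have IJ: "I - J \<le> 1 / sqrt b" .
  have "J \<le> I"
    unfolding I_def J_def
  proof (intro quarter_le c divide_right_mono)
    fix \<phi> :: real assume "0 \<le> \<phi>" "\<phi> \<le> pi / 2"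
    then show "(sin \<phi>)\<^sup>2 * sin \<phi> \<le> sin \<phi>"
      using mult_right_mono[OF sin_squared_le_1[of \<phi>] sin_nonneg_quarter[of \<phi>]] by simp
    show "0 \<le> sqrt (?D \<phi>)" using D[of \<phi>] by simp
  qed
  have J0: "0 \<le> J"
    unfolding J_def using D sin_nonneg_quarter
    by (intro integral_nonneg integrable_continuous_interval c) (auto intro!: divide_nonneg_nonneg mult_nonneg_nonneg simp: less_imp_le)
  have F: "hump_flux (-b) s = - (2 * b * sqrt 6) * J" and A: "half_width (-b) s = sqrt 6 * I"
    unfolding hump_flux_eq half_width_eq I_def J_def by simp_all
  have p: "0 \<le> 2 * b * sqrt 6" using adm by simp
  show "hump_flux (-b) s \<le> 0" unfolding F using mult_nonneg_nonneg[OF p J0] by simp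
  show "- 2 * b * half_width (-b) s \<le> hump_flux (-b) s"
    unfolding F A using mult_left_mono[OF \<open>J \<le> I\<close> p] by simp
  have "(2 * b * sqrt 6) * (I - J) \<le> (2 * b * sqrt 6) * (1 / sqrt b)"
    using IJ p by (rule mult_left_mono)
  also have "\<dots> = 2 * sqrt 6 * (b / sqrt b)" by simp
  also have "b / sqrt b = sqrt b" using adm by (simp add: real_div_sqrt)
  finally show "hump_flux (-b) s \<le> - 2 * b * half_width (-b) s + 2 * sqrt 6 * sqrt b"
    unfolding F A by (simp add: algebra_simps)
qed

text \<open>Restricted to s > 0, where the integrands are jointly continuous up to \<phi> =
  0.\<close>

lemma continuous_on_hump:
  assumes "continuous_on S f" "continuous_on S g"
    and "\<And>x. x \<in> S \<Longrightarrow> admissible (f x) (g x) \<and> 0 < g x"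
  shows "continuous_on S (\<lambda>x. half_width (f x) (g x))" "continuous_on S (\<lambda>x. hump_flux (f x) (g x))"
proof -
  let ?D = "{z. admissible (fst z) (snd z) \<and> 0 < snd z}"
  have pos: "0 < snd (fst z) + 6 * (sin (snd z))\<^sup>2 + fst (fst z) * (sin (snd z))\<^sup>2 * (1 + (sin (snd z))\<^sup>2)"
    if "z \<in> ?D \<times> {0..pi/2}" for z
    using hump_den_sin_pos[of "fst (fst z)" "snd (fst z)" "snd z"] that by (auto simp: hump_den_def)
  have "continuous_on ?D (\<lambda>z. integral (cbox 0 (pi/2)) (\<lambda>\<phi>. sin \<phi> / sqrt (hump_den (fst z) (snd z) ((sin \<phi>)\<^sup>2))))"
    unfolding hump_den_def
    by (rule integral_continuous_on_param, unfold case_prod_unfold box_real)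
      (intro continuous_intros, use pos in \<open>auto simp: less_imp_neq[symmetric]\<close>)
  then have 1: "continuous_on ?D (\<lambda>z. half_width (fst z) (snd z))"
    unfolding half_width_eq box_real by (intro continuous_intros)
  have "continuous_on ?D (\<lambda>z. integral (cbox 0 (pi/2))
      (\<lambda>\<phi>. (sin \<phi>)\<^sup>2 * sin \<phi> / sqrt (hump_den (fst z) (snd z) ((sin \<phi>)\<^sup>2))))"
    unfolding hump_den_def
    by (rule integral_continuous_on_param, unfold case_prod_unfold box_real)
      (intro continuous_intros, use pos in \<open>auto simp: less_imp_neq[symmetric]\<close>)
  then have 2: "continuous_on ?D (\<lambda>z. hump_flux (fst z) (snd z))"
    unfolding hump_flux_eq box_real by (intro continuous_intros)
  have c: "continuous_on S (\<lambda>x. (f x, g x))" by (intro continuous_intros assms)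
  have sub: "(\<lambda>x. (f x, g x)) ` S \<subseteq> ?D" using assms(3) by auto
  show "continuous_on S (\<lambda>x. half_width (f x) (g x))" "continuous_on S (\<lambda>x. hump_flux (f x) (g x))"
    using continuous_on_compose2[OF 1 c sub] continuous_on_compose2[OF 2 c sub] by simp_all
qed

lemma half_width_nonneg:
  assumes "admissible a s" "0 < s"
  shows "0 \<le> half_width a s"
proof -
  have "0 \<le> integral quarter (\<lambda>\<phi>. sin \<phi> / sqrt (hump_den a s ((sin \<phi>)\<^sup>2)))"
    using sin_nonneg_quarter hump_den_sin_pos[OF assms]
    by (intro integral_nonneg integrable_continuous_interval hump_continuous_intro assms continuous_intros)
      (auto intro!: divide_nonneg_nonneg simp: less_imp_le)
  then show ?thesis by (simp add: half_width_eq)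
qed

section \<open>Periodic profiles\<close>

text \<open>The parameter s of the positive hump, that is 3/2 C / a^2 with C =
  \<open>period_C a b\<close>; \<open>slope_neg\<close> is the same with b^2 for a^2.\<close>

definition slope_pos :: "real \<Rightarrow> real \<Rightarrow> real" where
  "slope_pos a b = b * (6 + a - b) / a"

definition slope_neg :: "real \<Rightarrow> real \<Rightarrow> real" where
  "slope_neg a b = a * (6 + a - b) / b"

text \<open>\<open>period_K\<close> and \<open>period_C\<close> are the coefficients of the cubic
  with roots a, -b and -(6 + a - b). The third root is forced, because the quadratic coefficient -4
  fixes the sum of the roots at -6.\<close>

definition period_K :: "real \<Rightarrow> real \<Rightarrow> real" where
  "period_K a b = (a * b + (a - b) * (6 + a - b)) / 3"

definition period_C :: "real \<Rightarrow> real \<Rightarrow> real" where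
  "period_C a b = 2 / 3 * (a * b * (6 + a - b))"

lemma first_integral_period:
  "first_integral (period_K a b) (period_C a b) x = 2 / 3 * ((a - x) * (x + b) * (x + 6 + a - b))"
  by (simp add: first_integral_def period_K_def period_C_def field_simps power2_eq_square power3_eq_cube)

lemma slope_pos_eq: "0 < a \<Longrightarrow> 3 / 2 * period_C a b / a\<^sup>2 = slope_pos a b"
  by (simp add: period_C_def slope_pos_def field_simps power2_eq_square)

lemma slope_neg_eq: "0 < b \<Longrightarrow> 3 / 2 * period_C a b / b\<^sup>2 = slope_neg a b"
  by (simp add: period_C_def slope_neg_def field_simps power2_eq_square)

lemma period_third_root_pos: "period_region a b \<Longrightarrow> 0 < 6 + a - b"
  by (auto simp: period_region_def)

lemma period_C_nonneg: "period_region a b \<Longrightarrow> 0 \<le> period_C a b"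
  using period_third_root_pos[of a b] by (simp add: period_C_def period_region_def)

text \<open>Links admissibility at the extremum -b with the condition 2 b < 6 + a of the
  region.\<close>

lemma slope_neg_den:
  "0 < b \<Longrightarrow> slope_neg a b + 6 + 2 * (- b) = (a + b) * (6 + a - 2 * b) / b"
  by (simp add: slope_neg_def field_simps)

lemma admissible_slope_pos: "period_region a b \<Longrightarrow> 0 < a \<Longrightarrow> admissible a (slope_pos a b)"
  using period_third_root_pos[of a b]
  by (simp add: admissible_def slope_pos_def period_region_def add_nonneg_pos)

lemma admissible_slope_neg:
  assumes "period_region a b" "0 < b"
  shows "admissible (-b) (slope_neg a b)"
proof -
  have "0 < (a + b) * (6 + a - 2 * b) / b"
    using assms by (simp add: period_region_def)
  then show ?thesis
    using assms period_third_root_pos[OF assms(1)] slope_neg_den[OF assms(2), of a]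
    by (simp add: admissible_def slope_neg_def period_region_def)
qed

lemma extremum_pos: "period_region a b \<Longrightarrow> 0 < a \<Longrightarrow> extremum (period_K a b) (period_C a b) a"
  using admissible_slope_pos[of a b] slope_pos_eq[of a b]
  by (simp add: extremum_def first_integral_period)

lemma extremum_neg: "period_region a b \<Longrightarrow> 0 < b \<Longrightarrow> extremum (period_K a b) (period_C a b) (-b)"
  using admissible_slope_neg[of a b] slope_neg_eq[of b a]
  by (simp add: extremum_def first_integral_period)

text \<open>In the application \<Theta> is an incomplete elliptic integral and \<open>am\<close> its
  inverse, the Jacobi amplitude. The lower bound c makes \<Theta> grow at least linearly, hence
  surjective.\<close>

lemma increasing_antiderivative:
  fixes w :: "real \<Rightarrow> real"
  assumes cw: "continuous_on UNIV w" and w: "\<And>x. c \<le> w x" and c: "0 < c"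
  obtains \<Theta> am where "\<And>x. (\<Theta> has_real_derivative w x) (at x)" "\<Theta> 0 = 0" "strict_mono \<Theta>"
    "\<And>x. am (\<Theta> x) = x" "\<And>y. \<Theta> (am y) = y" "\<And>y. (am has_real_derivative 1 / w (am y)) (at y)"
proof -
  have "\<exists>F. \<forall>x::real. -\<infinity> < ereal x \<longrightarrow> ereal x < \<infinity> \<longrightarrow> (F has_vector_derivative w x) (at x)"
    using cw by (intro einterval_antiderivative) (auto simp: continuous_on_eq_continuous_at)
  then obtain F where F: "\<And>x. (F has_vector_derivative w x) (at x)" by auto
  define \<Theta> where "\<Theta> x = F x - F 0" for x
  have d: "(\<Theta> has_real_derivative w x) (at x)" for x
    using F[of x] unfolding \<Theta>_def[abs_def] has_real_derivative_iff_has_vector_derivative[symmetric]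
    by (auto intro!: derivative_eq_intros)
  have wpos: "0 < w x" for x using w[of x] c by simp
  have mono: "strict_mono \<Theta>"
    using d wpos by (intro strict_monoI) (metis DERIV_pos_imp_increasing)
  have cont: "continuous_on S \<Theta>" for S
    using DERIV_isCont[OF d] by (simp add: continuous_at_imp_continuous_on)
  have growth: "c * (y - x) \<le> \<Theta> y - \<Theta> x" if "x \<le> y" for x y
  proof -
    have "\<Theta> x - c * x \<le> \<Theta> y - c * y"
    proof (rule DERIV_nonneg_imp_nondecreasing[OF that])
      show "\<exists>z. ((\<lambda>x. \<Theta> x - c * x) has_real_derivative z) (at u) \<and> 0 \<le> z" for u
        using w[of u] by (intro exI[of _ "w u - c"]) (auto intro!: derivative_eq_intros d)
    qed
    then show ?thesis by (simp add: algebra_simps)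
  qed
  have T0: "\<Theta> 0 = 0" by (simp add: \<Theta>_def)
  have "\<exists>x. \<Theta> x = y" for y
  proof -
    define M where "M = \<bar>y\<bar> / c"
    have M: "0 \<le> M" "c * M = \<bar>y\<bar>" using c by (simp_all add: M_def)
    have "\<Theta> (-M) \<le> y" "y \<le> \<Theta> M"
      using growth[of "-M" 0] growth[of 0 M] M T0 by auto
    then show ?thesis using IVT'[of \<Theta> "-M" y M] cont M(1) by auto
  qed
  then have "surj \<Theta>" by (metis surjI)
  define am where "am = inv \<Theta>"
  have inv1: "am (\<Theta> x) = x" for x
    unfolding am_def by (rule inv_f_f[OF strict_mono_imp_inj_on[OF mono]])
  have inv2: "\<Theta> (am y) = y" for y
    unfolding am_def by (rule surj_f_inv_f[OF \<open>surj \<Theta>\<close>])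
  have "isCont am (\<Theta> x)" for x
    by (rule isCont_inverse_function[of 1]) (use inv1 DERIV_isCont[OF d] in auto)
  then have "isCont am y" for y using inv2 by metis
  then have "(am has_real_derivative inverse (w (am y))) (at y)" for y
    using wpos[of "am y"] inv2 d
    by (intro DERIV_inverse_function[where f = \<Theta> and a = "y - 1" and b = "y + 1"]) auto
  then show thesis
    using that[of \<Theta> am] d T0 mono inv1 inv2 by (simp add: inverse_eq_divide)
qed

lemma sin_squared_shift_pi: "(sin (x + of_int j * pi))\<^sup>2 = (sin x)\<^sup>2"
proof -
  have s: "sin (of_int j * pi) = 0"
    by (metis sin_zero_iff_int2)
  then have "(cos (of_int j * pi))\<^sup>2 = 1"
    using sin_cos_squared_add[of "of_int j * pi"] by simp
  then show ?thesis by (simp add: sin_add s power_mult_distrib)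
qed

lemma sin_squared_diff: "(sin x)\<^sup>2 - (sin y)\<^sup>2 = sin (x - y) * sin (x + y)" for x y :: real
proof -
  have "sin (x - y) * sin (x + y) = (sin x)\<^sup>2 * (cos y)\<^sup>2 - (cos x)\<^sup>2 * (sin y)\<^sup>2"
    by (simp add: sin_add sin_diff power2_eq_square algebra_simps)
  then show ?thesis by (simp add: cos_squared_eq algebra_simps)
qed

text \<open>The identity sin^2 x - sin^2 y = sin(x - y) sin(x + y) settles the sign on the listed
  intervals. Every other x is congruent to y or -y modulo pi and gives equality, so by trichotomy
  both implications reverse.\<close>

lemma sin_squared_compare:
  assumes y: "0 \<le> y" "y \<le> pi / 2"
  shows "(sin y)\<^sup>2 < (sin x)\<^sup>2 \<longleftrightarrow> (\<exists>j::int. of_int j * pi + y < x \<and> x < of_int j * pi + (pi - y))" (is "?A = ?P")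
    and "(sin x)\<^sup>2 < (sin y)\<^sup>2 \<longleftrightarrow> (\<exists>j::int. of_int j * pi - y < x \<and> x < of_int j * pi + y)" (is "?B = ?N")
proof -
  have P: "?A" if pp: ?P
  proof -
    obtain j :: int where j: "of_int j * pi + y < x" "x < of_int j * pi + (pi - y)" using pp by blast
    define r where "r = x - of_int j * pi"
    have "0 < sin (r - y) * sin (r + y)" using j y by (intro mult_pos_pos sin_gt_zero) (auto simp: r_def)
    then have "0 < (sin r)\<^sup>2 - (sin y)\<^sup>2" by (simp only: sin_squared_diff)
    moreover have "x = r + of_int j * pi" by (simp add: r_def)
    ultimately show ?thesis by (simp add: sin_squared_shift_pi)
  qed
  have N: "?B" if nn: ?N
  proof -
    obtain j :: int where j: "of_int j * pi - y < x" "x < of_int j * pi + y" using nn by blast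
    define r where "r = x - of_int j * pi"
    have "0 < sin (y - r) * sin (y + r)" using j y by (intro mult_pos_pos sin_gt_zero) (auto simp: r_def)
    then have "0 < (sin y)\<^sup>2 - (sin r)\<^sup>2" by (simp only: sin_squared_diff)
    moreover have "x = r + of_int j * pi" by (simp add: r_def)
    ultimately show ?thesis by (simp add: sin_squared_shift_pi)
  qed
  have E: "(sin x)\<^sup>2 = (sin y)\<^sup>2" if nP: "\<not> ?P" and nN: "\<not> ?N"
  proof -
    define j where "j = \<lfloor>x / pi\<rfloor>"
    have "of_int j \<le> x / pi" "x / pi < of_int j + 1" unfolding j_def by linarith+
    then have j: "of_int j * pi \<le> x" "x < of_int j * pi + pi" by (simp_all add: field_simps)
    have "x = of_int j * pi + y \<or> x = of_int j * pi + (pi - y)"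
    proof (rule ccontr)
      assume ne: "\<not> ?thesis"
      have 1: "\<not> (of_int j * pi + y < x \<and> x < of_int j * pi + (pi - y))"
        and 2: "\<not> (of_int j * pi - y < x \<and> x < of_int j * pi + y)"
        and 3: "\<not> (of_int (j + 1) * pi - y < x \<and> x < of_int (j + 1) * pi + y)"
        using nP nN by blast+
      have "of_int (j + 1) * pi = of_int j * pi + pi" by (simp add: algebra_simps)
      with 1 2 3 ne j y show False by (cases "y = 0") auto
    qed
    then show ?thesis
    proof
      assume "x = of_int j * pi + y"
      then show ?thesis using sin_squared_shift_pi[of y j] by (simp add: add.commute)
    next
      assume "x = of_int j * pi + (pi - y)"
      then show ?thesis using sin_squared_shift_pi[of "pi - y" j] by (simp add: add.commute)
    qed
  qed
  show "?A = ?P" "?B = ?N" using P N E by force+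
qed

text \<open>Neighbouring intervals may share an endpoint, as the humps of a profile touching zero
  do; they are still distinct components.\<close>

lemma card_components_intervals:
  fixes l r :: "nat \<Rightarrow> real"
  assumes ne: "\<And>j. j < n \<Longrightarrow> l j < r j" and ord: "\<And>j k. j < k \<Longrightarrow> k < n \<Longrightarrow> r j \<le> l k"
    and S: "S = (\<Union>j<n. {l j<..<r j})"
  shows "finite (components S) \<and> card (components S) = n"
proof -
  let ?I = "\<lambda>j. {l j<..<r j}"
  have disj: "?I j \<inter> ?I k = {}" if "j < n" "k < n" "j \<noteq> k" for j k
    using ord[of j k] ord[of k j] that by (cases "j < k") auto
  have nemp: "?I j \<noteq> {}" if "j < n" for j using ne[OF that] by auto
  have inj: "inj_on ?I {..<n}"
  proof (rule inj_onI)
    fix j k assume jk: "j \<in> {..<n}" "k \<in> {..<n}" and eq: "?I j = ?I k"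
    show "j = k"
    proof (rule ccontr)
      assume "j \<noteq> k"
      then have "?I j \<inter> ?I k = {}" using disj jk by simp
      then show False using eq nemp[of j] jk by simp
    qed
  qed
  have "components S = ?I ` {..<n}"
  proof (rule components_open_unique)
    show "pairwise disjnt (?I ` {..<n})"
    proof (rule pairwiseI)
      fix X Y assume XY: "X \<in> ?I ` {..<n}" "Y \<in> ?I ` {..<n}" "X \<noteq> Y"
      then obtain j k where "j < n" "k < n" "X = ?I j" "Y = ?I k" by auto
      moreover then have "j \<noteq> k" using XY by auto
      ultimately show "disjnt X Y" using disj by (simp add: disjnt_def)
    qed
    show "\<Union>(?I ` {..<n}) = S" by (simp add: S)
    fix X assume "X \<in> ?I ` {..<n}"
    then show "open X \<and> connected X \<and> X \<noteq> {}" using nemp by auto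
  qed
  then show ?thesis using card_image[OF inj] by simp
qed

text \<open>\<Theta> sends the phase \<phi> to the angle \<theta>, and in the phase the profile is -
  b + (a + b) sin^2 \<phi>. The condition 0 < a + b excludes the zero profile.\<close>

locale periodic_profile =
  fixes a b :: real and \<Theta> am :: "real \<Rightarrow> real"
  assumes region: "period_region a b" and ab: "0 < a + b"
    and d\<Theta>: "\<And>\<phi>. (\<Theta> has_real_derivative sqrt 6 / sqrt (period_den a b \<phi>)) (at \<phi>)"
    and \<Theta>0: "\<Theta> 0 = 0" and mono\<Theta>: "strict_mono \<Theta>"
    and am\<Theta> [simp]: "\<And>\<phi>. am (\<Theta> \<phi>) = \<phi>" and \<Theta>am [simp]: "\<And>\<theta>. \<Theta> (am \<theta>) = \<theta>"
    and dam: "\<And>\<theta>. (am has_real_derivative sqrt (period_den a b (am \<theta>)) / sqrt 6) (at \<theta>)"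
begin

definition prof :: "real \<Rightarrow> real" where
  "prof \<theta> = - b + (a + b) * (sin (am \<theta>))\<^sup>2"

definition prof' :: "real \<Rightarrow> real" where
  "prof' \<theta> = 2 * (a + b) * (sin (am \<theta>) * cos (am \<theta>)) * (sqrt (period_den a b (am \<theta>)) / sqrt 6)"

text \<open>The phase of the first zero of the profile; it is 0 for b = 0 and pi/2 for a =
  0.\<close>

definition \<psi>0 :: real where
  "\<psi>0 = arcsin (sqrt (b / (a + b)))"

lemma a_nonneg: "0 \<le> a" and b_nonneg: "0 \<le> b"
  using region by (auto simp: period_region_def)

lemma am_less_iff: "am x < am y \<longleftrightarrow> x < y"
  using mono\<Theta> by (metis \<Theta>am strict_mono_less)

lemma prof_derivative: "(prof has_real_derivative prof' \<theta>) (at \<theta>)"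
  unfolding prof_def[abs_def] prof'_def
  by (rule derivative_eq_intros dam refl)+ simp

lemma prof'_derivative:
  "(prof' has_real_derivative period_K a b - 4 * prof \<theta> - (prof \<theta>)\<^sup>2) (at \<theta>)"
proof -
  define S where "S = sin (am \<theta>)"
  define c where "c = cos (am \<theta>)"
  define D where "D = period_den a b (am \<theta>)"
  define p where "p = sqrt D / sqrt 6"
  have D: "0 < D" unfolding D_def by (rule period_den_pos[OF region])
  have p2: "p * p = D / 6" using D by (simp add: p_def)
  have dp: "((\<lambda>\<theta>. sqrt (period_den a b (am \<theta>)) / sqrt 6) has_real_derivative
      ((a + b) * (2 * S * (c * p)) / (2 * sqrt D)) / sqrt 6) (at \<theta>)"
  proof -
    have "((\<lambda>\<theta>. period_den a b (am \<theta>)) has_real_derivative (a + b) * (2 * S * (c * p))) (at \<theta>)"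
      unfolding period_den_def[abs_def]
      by (rule derivative_eq_intros dam refl)+ (simp add: S_def c_def p_def D_def)
    from DERIV_cdivide[OF DERIV_chain2[OF DERIV_real_sqrt[OF D[unfolded D_def]] this], of "sqrt 6"]
    show ?thesis by (simp add: D_def inverse_eq_divide)
  qed
  have "((a + b) * (2 * S * (c * p)) / (2 * sqrt D)) / sqrt 6 = (a + b) * S * c / 6"
    using D by (simp add: p_def field_simps)
  note dp = dp[unfolded this]
  have dsc: "((\<lambda>\<theta>. sin (am \<theta>) * cos (am \<theta>)) has_real_derivative (c * c - S * S) * p) (at \<theta>)"
    by (auto intro!: derivative_eq_intros dam simp: S_def c_def p_def D_def algebra_simps)
  have "(prof' has_real_derivative
      2 * (a + b) * ((c * c - S * S) * p) * p + (a + b) * S * c / 6 * (2 * (a + b) * (S * c))) (at \<theta>)"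
    unfolding prof'_def[abs_def]
    using DERIV_mult[OF DERIV_cmult[OF dsc, of "2 * (a + b)"] dp] by (simp add: S_def c_def p_def D_def)
  moreover have "2 * (a + b) * ((c * c - S * S) * p) * p + (a + b) * S * c / 6 * (2 * (a + b) * (S * c))
      = period_K a b - 4 * prof \<theta> - (prof \<theta>)\<^sup>2"
  proof -
    have c2: "c * c = 1 - S\<^sup>2" using sin_cos_squared_add[of "am \<theta>"] by (simp add: S_def c_def power2_eq_square)
    have "2 * (a + b) * ((c * c - S * S) * p) * p + (a + b) * S * c / 6 * (2 * (a + b) * (S * c))
      = 2 * (a + b) * (c * c - S * S) * (p * p) + (a + b)\<^sup>2 * S\<^sup>2 * (c * c) / 3"
      by (simp add: power2_eq_square field_simps)
    also have "\<dots> = (a + b) * (1 - 2 * S\<^sup>2) * D / 3 + (a + b)\<^sup>2 * S\<^sup>2 * (1 - S\<^sup>2) / 3"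
      unfolding p2 c2 by (simp add: power2_eq_square field_simps)
    also have "\<dots> = period_K a b - 4 * prof \<theta> - (prof \<theta>)\<^sup>2"
      unfolding D_def period_den_def prof_def S_def[symmetric] period_K_def
      by (simp add: field_simps power2_eq_square)
    finally show ?thesis .
  qed
  ultimately show ?thesis by simp
qed

lemma prof_first_integral:
  "(prof' \<theta>)\<^sup>2 = first_integral (period_K a b) (period_C a b) (prof \<theta>)"
proof -
  define x where "x = (sin (am \<theta>))\<^sup>2"
  define D where "D = period_den a b (am \<theta>)"
  have D: "0 < D" unfolding D_def by (rule period_den_pos[OF region])
  have "(prof' \<theta>)\<^sup>2 = 4 * (a + b)\<^sup>2 * (x * (1 - x)) * (D / 6)"
  proof -
    have eq: "(2 * k * (S * c) * (r / q))\<^sup>2 = 4 * k\<^sup>2 * (S\<^sup>2 * c\<^sup>2) * (r\<^sup>2 / q\<^sup>2)" for k S c r q :: real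
      by (simp add: power_mult_distrib power_divide)
    show ?thesis
      unfolding prof'_def x_def D_def[symmetric] cos_squared_eq[symmetric] eq using D by simp
  qed
  also have "\<dots> = 2 / 3 * ((a - prof \<theta>) * (prof \<theta> + b) * (prof \<theta> + 6 + a - b))"
  proof -
    have "a - prof \<theta> = (a + b) * (1 - x)" "prof \<theta> + b = (a + b) * x" "prof \<theta> + 6 + a - b = D"
      by (simp_all add: prof_def x_def D_def period_den_def algebra_simps)
    then show ?thesis by (simp add: power2_eq_square)
  qed
  finally show ?thesis by (simp add: first_integral_period)
qed

lemma sin_\<psi>0: "(sin \<psi>0)\<^sup>2 = b / (a + b)" and \<psi>0_range: "0 \<le> \<psi>0" "\<psi>0 \<le> pi / 2"
  and \<psi>0_pos: "0 < b \<Longrightarrow> 0 < \<psi>0" and \<psi>0_less: "0 < a \<Longrightarrow> \<psi>0 < pi / 2"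
  and \<psi>0_b0: "b = 0 \<Longrightarrow> \<psi>0 = 0"
proof -
  define z where "z = sqrt (b / (a + b))"
  have q: "0 \<le> b / (a + b)" "b / (a + b) \<le> 1" using a_nonneg b_nonneg ab by auto
  then have z: "0 \<le> z" "z \<le> 1" "-1 \<le> z"
    using order_trans[of "-1" 0 z] by (auto simp: z_def)
  have s: "sin \<psi>0 = z" unfolding \<psi>0_def z_def[symmetric] using z by (intro sin_arcsin)
  then show s2: "(sin \<psi>0)\<^sup>2 = b / (a + b)" using q by (simp add: z_def)
  show "0 \<le> \<psi>0" unfolding \<psi>0_def z_def[symmetric] using z by (intro arcsin_nonneg) auto
  moreover show "\<psi>0 \<le> pi / 2" unfolding \<psi>0_def z_def[symmetric] using z by (intro arcsin_ubound)
  moreover have "\<psi>0 \<noteq> 0" if "0 < b"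
  proof
    assume "\<psi>0 = 0"
    then have "b / (a + b) = 0" using s2 by simp
    then show False using that ab by simp
  qed
  moreover have "\<psi>0 \<noteq> pi / 2" if "0 < a"
  proof
    assume h: "\<psi>0 = pi / 2"
    have "(sin \<psi>0)\<^sup>2 = 1" unfolding h by simp
    then have "b / (a + b) = 1" using s2 by simp
    then show False using that ab by simp
  qed
  ultimately show "0 < b \<Longrightarrow> 0 < \<psi>0" "0 < a \<Longrightarrow> \<psi>0 < pi / 2" by fastforce+
  show "b = 0 \<Longrightarrow> \<psi>0 = 0" unfolding \<psi>0_def by simp
qed

lemma prof_eq: "prof \<theta> = (a + b) * ((sin (am \<theta>))\<^sup>2 - (sin \<psi>0)\<^sup>2)"
  unfolding sin_\<psi>0 prof_def using ab by (simp add: right_diff_distrib)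

lemma continuous_prof: "continuous_on S prof" and continuous_prof': "continuous_on S prof'"
  using DERIV_isCont[OF prof_derivative] DERIV_isCont[OF prof'_derivative]
  by (auto simp: continuous_at_imp_continuous_on)

lemma scaled_first_integral:
  assumes "extremum (period_K a b) (period_C a b) e"
  shows "(prof' \<theta> / e)\<^sup>2 = 2 / 3 * (1 - prof \<theta> / e) * hump_den e (3 / 2 * period_C a b / e\<^sup>2) (prof \<theta> / e)"
proof -
  have e: "e \<noteq> 0" "first_integral (period_K a b) (period_C a b) e = 0"
    using assms unfolding extremum_def by blast+
  then have "(prof' \<theta>)\<^sup>2 = 2 / 3 * e\<^sup>2 * (1 - prof \<theta> / e) * hump_den e (3 / 2 * period_C a b / e\<^sup>2) (prof \<theta> / e)"
    using first_integral_factor[OF e, of "prof \<theta> / e"] prof_first_integral[of \<theta>] by simp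
  then show ?thesis using e by (simp add: power_divide)
qed

lemma sin_squared_strict_mono:
  assumes "0 \<le> x" "x < y" "y \<le> pi / 2"
  shows "(sin x)\<^sup>2 < (sin y)\<^sup>2"
proof -
  have "0 \<le> sin x" using assms by (intro sin_ge_zero) auto
  moreover have "sin x < sin y" using assms by (intro sin_monotone_2pi) auto
  ultimately show ?thesis by (intro power_strict_mono) auto
qed

text \<open>From the minimum at phase 0 to the zero at phase \<open>\<psi>0\<close> the profile runs
  through half a negative hump, in the direction that \<open>half_hump\<close> expects.\<close>

lemma negative_quarter:
  assumes b: "0 < b" and g: "continuous_on {0..1} g"
  shows "((\<lambda>\<theta>. g (prof \<theta> / (-b))) has_integral hump_int g (-b) (slope_neg a b)) {0..\<Theta> \<psi>0}"
proof (rule half_hump[where t' = "\<lambda>\<theta>. prof' \<theta> / (-b)"])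
  show "0 < \<Theta> \<psi>0" using \<psi>0_pos[OF b] mono\<Theta> \<Theta>0 by (metis strict_mono_less)
  have am0: "am 0 = 0" using am\<Theta>[of 0] \<Theta>0 by simp
  show "prof 0 / (-b) = 1" "prof (\<Theta> \<psi>0) / (-b) = 0"
    using b am0 by (simp_all add: prof_def[of 0] prof_eq[of "\<Theta> \<psi>0"])
  show "continuous_on {0..\<Theta> \<psi>0} (\<lambda>\<theta>. prof \<theta> / (-b))"
    "continuous_on {0<..<\<Theta> \<psi>0} (\<lambda>\<theta>. prof' \<theta> / (-b))"
    using b by (intro continuous_intros continuous_prof continuous_prof'; simp)+
  show "admissible (-b) (slope_neg a b)" by (rule admissible_slope_neg[OF region b])
  show "continuous_on {0..1} g" by (rule g)
  fix x assume x: "x \<in> {0<..<\<Theta> \<psi>0}"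
  then have ax: "0 < am x" "am x < \<psi>0" using am_less_iff[of 0 x] am_less_iff[of x "\<Theta> \<psi>0"] am0 by auto
  have "0 < (sin (am x))\<^sup>2" "(sin (am x))\<^sup>2 < (sin \<psi>0)\<^sup>2"
    using sin_squared_strict_mono[of 0 "am x"] sin_squared_strict_mono[of "am x" \<psi>0] ax \<psi>0_range by auto
  then have "0 < (a + b) * (sin (am x))\<^sup>2" "(a + b) * ((sin (am x))\<^sup>2 - (sin \<psi>0)\<^sup>2) < 0"
    using ab by (intro mult_pos_pos mult_pos_neg; simp)+
  then have "0 < prof x + b" "prof x < 0" unfolding prof_eq[symmetric] by (simp_all add: prof_def)
  then show "0 < prof x / (-b) \<and> prof x / (-b) < 1" using b by (simp add: field_simps)
  show "((\<lambda>\<theta>. prof \<theta> / (-b)) has_real_derivative prof' x / (-b)) (at x)"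
    by (intro DERIV_cdivide prof_derivative)
  show "(prof' x / (-b))\<^sup>2 = 2 / 3 * (1 - prof x / (-b)) * hump_den (-b) (slope_neg a b) (prof x / (-b))"
    using scaled_first_integral[OF extremum_neg[OF region b], of x] slope_neg_eq[OF b, of a] by simp
qed

text \<open>Here the zero comes first and the maximum, at phase pi/2, last; the interval is
  therefore reflected.\<close>

lemma positive_quarter:
  assumes a: "0 < a" and g: "continuous_on {0..1} g"
  shows "((\<lambda>\<theta>. g (prof \<theta> / a)) has_integral hump_int g a (slope_pos a b)) {\<Theta> \<psi>0..\<Theta> (pi/2)}"
proof -
  have "((\<lambda>\<theta>. g (prof (- \<theta>) / a)) has_integral hump_int g a (slope_pos a b)) {- \<Theta> (pi/2)..- \<Theta> \<psi>0}"
  proof (rule half_hump[where t' = "\<lambda>\<theta>. - (prof' (- \<theta>) / a)"])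
    show "- \<Theta> (pi/2) < - \<Theta> \<psi>0" using \<psi>0_less[OF a] mono\<Theta> by (simp add: strict_mono_less)
    show "prof (- (- \<Theta> (pi/2))) / a = 1" "prof (- (- \<Theta> \<psi>0)) / a = 0"
      using a by (simp_all add: prof_def[of "\<Theta> (pi/2)"] prof_eq[of "\<Theta> \<psi>0"])
    show "continuous_on {- \<Theta> (pi/2)..- \<Theta> \<psi>0} (\<lambda>\<theta>. prof (- \<theta>) / a)"
      "continuous_on {- \<Theta> (pi/2)<..<- \<Theta> \<psi>0} (\<lambda>\<theta>. - (prof' (- \<theta>) / a))"
      using a by (intro continuous_intros continuous_on_compose2[OF continuous_prof[of UNIV]]
          continuous_on_compose2[OF continuous_prof'[of UNIV]]; simp)+
    show "admissible a (slope_pos a b)" by (rule admissible_slope_pos[OF region a])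
    show "continuous_on {0..1} g" by (rule g)
    fix x assume x: "x \<in> {- \<Theta> (pi/2)<..<- \<Theta> \<psi>0}"
    then have ax: "\<psi>0 < am (- x)" "am (- x) < pi / 2"
      using am_less_iff[of "\<Theta> \<psi>0" "- x"] am_less_iff[of "- x" "\<Theta> (pi/2)"] by auto
    have "(sin \<psi>0)\<^sup>2 < (sin (am (- x)))\<^sup>2" "(sin (am (- x)))\<^sup>2 < (sin (pi / 2))\<^sup>2"
      using sin_squared_strict_mono[of \<psi>0 "am (- x)"] sin_squared_strict_mono[of "am (- x)" "pi / 2"] ax \<psi>0_range
      by auto
    then have "0 < prof (- x)" "(a + b) * (sin (am (- x)))\<^sup>2 < (a + b) * 1"
      using ab by (auto simp: prof_eq[of "- x"])
    then have "0 < prof (- x)" "prof (- x) < a" by (auto simp: prof_def[of "- x"])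
    then show "0 < prof (- x) / a \<and> prof (- x) / a < 1" using a by simp
    show "((\<lambda>\<theta>. prof (- \<theta>) / a) has_real_derivative - (prof' (- x) / a)) (at x)"
      using DERIV_cdivide[OF DERIV_mirror[THEN iffD1, OF prof_derivative[of "- x"]], of a] by simp
    show "(- (prof' (- x) / a))\<^sup>2 = 2 / 3 * (1 - prof (- x) / a) * hump_den a (slope_pos a b) (prof (- x) / a)"
      using scaled_first_integral[OF extremum_pos[OF region a], of "- x"] slope_pos_eq[OF a, of b] by simp
  qed
  then show ?thesis by (simp only: has_integral_reflect_real[of "\<lambda>x. g (prof x / a)"])
qed

text \<open>The phases from 0 to pi/2 make up half a period. Length and flux of this piece are
  computed once in the phase and once in the angle, where it is cut at the zero of the
  profile.\<close>

lemma quarter_integrals: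
  shows "half_period a b = (if 0 < a then half_width a (slope_pos a b) else 0)
      + (if 0 < b then half_width (-b) (slope_neg a b) else 0)"
    and "period_flux a b = (if 0 < a then hump_flux a (slope_pos a b) else 0)
      + (if 0 < b then hump_flux (-b) (slope_neg a b) else 0)"
proof -
  have le: "0 \<le> \<Theta> \<psi>0" "\<Theta> \<psi>0 \<le> \<Theta> (pi/2)"
    using \<psi>0_range mono\<Theta> \<Theta>0 by (metis strict_mono_less_eq)+
  have b0: "\<Theta> \<psi>0 = 0" if "\<not> 0 < b" using \<psi>0_b0 b_nonneg that \<Theta>0 by auto
  have a0: "\<Theta> \<psi>0 = \<Theta> (pi/2)" if "\<not> 0 < a"
  proof -
    have "a = 0" using a_nonneg that by simp
    then have "b / (a + b) = 1" using ab by simp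
    then show ?thesis by (simp only: \<psi>0_def real_sqrt_one arcsin_1)
  qed
  have N1: "((\<lambda>\<theta>. 1) has_integral (if 0 < b then half_width (-b) (slope_neg a b) else 0)) {0..\<Theta> \<psi>0}"
    using negative_quarter[of "\<lambda>_. 1"] b0 by (auto simp: half_width_def)
  have P1: "((\<lambda>\<theta>. 1) has_integral (if 0 < a then half_width a (slope_pos a b) else 0)) {\<Theta> \<psi>0..\<Theta> (pi/2)}"
    using positive_quarter[of "\<lambda>_. 1"] a0 by (auto simp: half_width_def)
  have N2: "(prof has_integral (if 0 < b then hump_flux (-b) (slope_neg a b) else 0) / 2) {0..\<Theta> \<psi>0}"
  proof (cases "0 < b")
    case True
    have "((\<lambda>\<theta>. (-b) * (prof \<theta> / (-b))) has_integral hump_int (\<lambda>t. (-b) * t) (-b) (slope_neg a b)) {0..\<Theta> \<psi>0}"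
      by (rule negative_quarter[OF True]) (intro continuous_intros)
    then show ?thesis using True unfolding hump_int_cmult by (simp add: hump_flux_def)
  qed (use b0 in auto)
  have P2: "(prof has_integral (if 0 < a then hump_flux a (slope_pos a b) else 0) / 2) {\<Theta> \<psi>0..\<Theta> (pi/2)}"
  proof (cases "0 < a")
    case True
    have "((\<lambda>\<theta>. a * (prof \<theta> / a)) has_integral hump_int (\<lambda>t. a * t) a (slope_pos a b)) {\<Theta> \<psi>0..\<Theta> (pi/2)}"
      by (rule positive_quarter[OF True]) (intro continuous_intros)
    then show ?thesis using True unfolding hump_int_cmult by (simp add: hump_flux_def)
  qed (use a0 in auto)
  have w: "((\<lambda>\<phi>. sqrt 6 / sqrt (period_den a b \<phi>)) has_integral (\<Theta> (pi/2) - \<Theta> 0)) {0..pi/2}"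
    by (rule fundamental_theorem_of_calculus)
      (auto intro!: has_field_derivative_at_within d\<Theta> simp flip: has_real_derivative_iff_has_vector_derivative)
  have cd: "continuous_on S (\<lambda>\<phi>. g \<phi> / sqrt (period_den a b \<phi>))" if "continuous_on S g" for g S
    by (rule period_integrand_continuous[OF region that])
  have L: "half_period a b = \<Theta> (pi/2)"
  proof -
    have "half_period a b = integral quarter (\<lambda>\<phi>. sqrt 6 * (1 / sqrt (period_den a b \<phi>)))"
      unfolding half_period_def by (rule integral_mult_right[symmetric])
    then show ?thesis using integral_unique[OF w] \<Theta>0 by simp
  qed
  show "half_period a b = (if 0 < a then half_width a (slope_pos a b) else 0)
      + (if 0 < b then half_width (-b) (slope_neg a b) else 0)"
    using has_integral_unique[OF has_integral_combine[OF le N1 P1] has_integral_const_real[of 1 0 "\<Theta> (pi/2)"]] le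
    unfolding L by simp
  have "((\<lambda>\<phi>. (sqrt 6 / sqrt (period_den a b \<phi>)) *\<^sub>R prof (\<Theta> \<phi>)) has_integral
      (integral {\<Theta> 0..\<Theta> (pi/2)} prof)) {0..pi/2}"
  proof (rule has_integral_substitution[where c = 0 and d = "\<Theta> (pi/2)"])
    show "\<Theta> ` {0..pi/2} \<subseteq> {0..\<Theta> (pi/2)}"
      using strict_mono_mono[OF mono\<Theta>] \<Theta>0 by (auto simp: mono_def) (metis monoD strict_mono_mono[OF mono\<Theta>])
    show "continuous_on {0..\<Theta> (pi / 2)} prof" by (rule continuous_prof)
  qed (use le \<Theta>0 in \<open>auto intro: has_field_derivative_at_within d\<Theta>\<close>)
  then have "integral {0..\<Theta> (pi/2)} prof = integral quarter (\<lambda>\<phi>. sqrt 6 * ((- b + (a + b) * (sin \<phi>)\<^sup>2) / sqrt (period_den a b \<phi>)))"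
    using \<Theta>0 by (simp add: prof_def integral_unique)
  also have "\<dots> = sqrt 6 * integral quarter (\<lambda>\<phi>. (- b + (a + b) * (sin \<phi>)\<^sup>2) / sqrt (period_den a b \<phi>))"
    by (rule integral_mult_right)
  finally have "period_flux a b = 2 * integral {0..\<Theta> (pi/2)} prof"
    by (simp add: period_flux_def)
  then show "period_flux a b = (if 0 < a then hump_flux a (slope_pos a b) else 0)
      + (if 0 < b then hump_flux (-b) (slope_neg a b) else 0)"
    using integral_unique[OF has_integral_combine[OF le N2 P2]] by simp
qed

text \<open>Zeros of the profile are at \<open>\<Theta> (j \<pi> - \<psi>0)\<close> and \<open>\<Theta> (j \<pi> + \<psi>0)\<close>; the profile is negative
  around \<open>\<Theta> (j \<pi>)\<close>. Taking a window from \<open>\<Theta> (- \<psi>0)\<close> to \<open>\<Theta> (m \<pi> \<mp> \<psi>0)\<close> gives \<open>m\<close> positive and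
  \<open>m\<close> or \<open>m + 1\<close> negative humps.\<close>

lemma window_types:
  assumes wt: "\<sigma> = -1 \<and> nn = m \<or> \<sigma> = 1 \<and> nn = Suc m" and am0: "0 < a \<or> m = 0"
    and ne: "0 < m \<or> 0 < b \<and> \<sigma> = 1"
  defines "e \<equiv> real m * pi + \<sigma> * \<psi>0"
  defines "c \<equiv> (\<Theta> e + \<Theta> (- \<psi>0)) / 2" and "L \<equiv> (\<Theta> e - \<Theta> (- \<psi>0)) / 2"
  defines "F \<equiv> \<lambda>\<theta>. prof (\<theta> + c)"
  shows "0 < L" "F L = 0" "F (- L) = 0"
    "finite (components {\<theta> \<in> {-L<..<L}. 0 < F \<theta>}) \<and> card (components {\<theta> \<in> {-L<..<L}. 0 < F \<theta>}) = m"
    "finite (components {\<theta> \<in> {-L<..<L}. F \<theta> < 0}) \<and>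
       card (components {\<theta> \<in> {-L<..<L}. F \<theta> < 0}) = (if 0 < b then nn else 0)"
proof -
  have e_gt: "- \<psi>0 < e"
  proof (cases "0 < m")
    case True
    then have "pi \<le> real m * pi" "0 < real m * pi" by simp_all
    moreover have "\<psi>0 < pi / 2" using \<psi>0_less am0 True by auto
    ultimately show ?thesis
      using wt \<psi>0_range unfolding e_def by (elim disjE conjE; hypsubst; linarith)
  qed (use ne \<psi>0_pos in \<open>auto simp: e_def\<close>)
  then show L: "0 < L" using mono\<Theta> by (simp add: L_def strict_mono_less)
  have ends: "L + c = \<Theta> e" "- L + c = \<Theta> (- \<psi>0)" by (simp_all add: L_def c_def field_simps)
  have "(sin e)\<^sup>2 = (sin \<psi>0)\<^sup>2"
    using sin_squared_shift_pi[of "\<sigma> * \<psi>0" "int m"] wt by (auto simp: e_def add.commute)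
  then show "F L = 0" "F (- L) = 0" unfolding F_def ends by (simp_all add: prof_eq)
  have win: "\<theta> \<in> {-L<..<L} \<longleftrightarrow> - \<psi>0 < am (\<theta> + c) \<and> am (\<theta> + c) < e" for \<theta>
  proof -
    have "\<theta> \<in> {-L<..<L} \<longleftrightarrow> \<Theta> (- \<psi>0) < \<theta> + c \<and> \<theta> + c < \<Theta> e"
      unfolding ends[symmetric] by auto
    also have "\<dots> \<longleftrightarrow> - \<psi>0 < am (\<theta> + c) \<and> am (\<theta> + c) < e"
      using am_less_iff[of "\<Theta> (- \<psi>0)" "\<theta> + c"] am_less_iff[of "\<theta> + c" "\<Theta> e"] by simp
    finally show ?thesis .
  qed
  have ivl: "\<theta> \<in> {\<Theta> x - c<..<\<Theta> y - c} \<longleftrightarrow> x < am (\<theta> + c) \<and> am (\<theta> + c) < y" for x y \<theta>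
    using am_less_iff[of "\<Theta> x" "\<theta> + c"] am_less_iff[of "\<theta> + c" "\<Theta> y"] by auto
  have sgn: "0 < F \<theta> \<longleftrightarrow> (sin \<psi>0)\<^sup>2 < (sin (am (\<theta> + c)))\<^sup>2" "F \<theta> < 0 \<longleftrightarrow> (sin (am (\<theta> + c)))\<^sup>2 < (sin \<psi>0)\<^sup>2" for \<theta>
    unfolding F_def prof_eq using ab by (auto simp: zero_less_mult_iff mult_less_0_iff)
  have natpi: "real j * pi \<le> real k * pi" if "j \<le> k" for j k using that by simp
  \<comment> \<open>The index j of the enclosing interval is an arbitrary integer at first; the ends
    of the window confine it to 0, ..., m - 1.\<close>
  have pos_set: "{\<theta> \<in> {-L<..<L}. 0 < F \<theta>} =
      (\<Union>j<m. {\<Theta> (real j * pi + \<psi>0) - c<..<\<Theta> (real j * pi + (pi - \<psi>0)) - c})" (is "?A = ?B")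
  proof (intro set_eqI iffI)
    fix \<theta> assume "\<theta> \<in> ?A"
    then have w: "- \<psi>0 < am (\<theta> + c)" "am (\<theta> + c) < e" and "0 < F \<theta>" using win by auto
    then obtain j :: int where j: "of_int j * pi + \<psi>0 < am (\<theta> + c)" "am (\<theta> + c) < of_int j * pi + (pi - \<psi>0)"
      using sin_squared_compare(1)[OF \<psi>0_range] sgn(1) by auto
    have "- pi < of_int j * pi" using w(1) j(2) by linarith
    then have "- 1 * pi < of_int j * pi" by simp
    then have "- 1 < real_of_int j" by (simp only: mult_less_cancel_right_pos[OF pi_gt_zero])
    then have j0: "0 \<le> j" by linarith
    have "of_int j * pi + \<psi>0 < real m * pi + \<psi>0"
      using w(2) j(1) wt \<psi>0_range unfolding e_def by (elim disjE conjE; hypsubst; linarith)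
    then have "of_int j * pi < real m * pi" by simp
    then have "real_of_int j < real m" by simp
    then have "nat j < m" using j0 by linarith
    moreover have "real (nat j) = of_int j" using j0 by simp
    ultimately show "\<theta> \<in> ?B" using j ivl by (intro UN_I[of "nat j"]) auto
  next
    fix \<theta> assume "\<theta> \<in> ?B"
    then obtain j where j: "j < m" "real j * pi + \<psi>0 < am (\<theta> + c)" "am (\<theta> + c) < real j * pi + (pi - \<psi>0)"
      using ivl by auto
    have "0 < F \<theta>"
      unfolding sgn(1) sin_squared_compare(1)[OF \<psi>0_range] by (rule exI[of _ "int j"]) (use j in auto)
    moreover have "0 \<le> real j * pi" by simp
    then have "- \<psi>0 < am (\<theta> + c)" using j(2) \<psi>0_range by linarith
    moreover have "real (Suc j) * pi \<le> real m * pi" using j(1) by (intro natpi) simp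
    then have "real j * pi + (pi - \<psi>0) \<le> real m * pi - \<psi>0" by (simp add: algebra_simps)
    then have "am (\<theta> + c) < e"
      using j(3) wt \<psi>0_range unfolding e_def by (elim disjE conjE; hypsubst; linarith)
    ultimately show "\<theta> \<in> ?A" unfolding mem_Collect_eq win by blast
  qed
  show "finite (components {\<theta> \<in> {-L<..<L}. 0 < F \<theta>}) \<and> card (components {\<theta> \<in> {-L<..<L}. 0 < F \<theta>}) = m"
  proof (rule card_components_intervals[OF _ _ pos_set])
    fix j assume "j < m"
    then have "\<psi>0 < pi / 2" using \<psi>0_less am0 by auto
    then have "\<psi>0 < pi - \<psi>0" by simp
    then show "\<Theta> (real j * pi + \<psi>0) - c < \<Theta> (real j * pi + (pi - \<psi>0)) - c"
      using mono\<Theta> by (simp add: strict_mono_less)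
  next
    fix j k assume "j < k" "k < m"
    then have "real (Suc j) * pi \<le> real k * pi" by (intro natpi) simp
    then have "real j * pi + (pi - \<psi>0) \<le> real k * pi + \<psi>0" using \<psi>0_range by (simp add: algebra_simps)
    then show "\<Theta> (real j * pi + (pi - \<psi>0)) - c \<le> \<Theta> (real k * pi + \<psi>0) - c"
      using mono\<Theta> by (simp add: strict_mono_less_eq)
  qed
  show "finite (components {\<theta> \<in> {-L<..<L}. F \<theta> < 0}) \<and>
       card (components {\<theta> \<in> {-L<..<L}. F \<theta> < 0}) = (if 0 < b then nn else 0)"
  proof (cases "0 < b")
    \<comment> \<open>For b = 0 the two zeros around each multiple of pi merge and no negative hump
      is left between them.\<close>
    case False
    then have "(sin \<psi>0)\<^sup>2 = 0" using b_nonneg \<psi>0_b0 by auto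
    then have "{\<theta> \<in> {-L<..<L}. F \<theta> < 0} = {}" using sgn(2) by auto
    then show ?thesis using False by (simp only:) simp
  next
    case True
    have neg_set: "{\<theta> \<in> {-L<..<L}. F \<theta> < 0} =
      (\<Union>j<nn. {\<Theta> (real j * pi - \<psi>0) - c<..<\<Theta> (real j * pi + \<psi>0) - c})" (is "?A = ?B")
    proof (intro set_eqI iffI)
      fix \<theta> assume "\<theta> \<in> ?A"
      then have w: "- \<psi>0 < am (\<theta> + c)" "am (\<theta> + c) < e" and "F \<theta> < 0" using win by auto
      then obtain j :: int where j: "of_int j * pi - \<psi>0 < am (\<theta> + c)" "am (\<theta> + c) < of_int j * pi + \<psi>0"
        using sin_squared_compare(2)[OF \<psi>0_range] sgn(2) by auto
      have "- pi < of_int j * pi" using w(1) j(2) \<psi>0_range by linarith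
      then have "- 1 * pi < of_int j * pi" by simp
      then have "- 1 < real_of_int j" by (simp only: mult_less_cancel_right_pos[OF pi_gt_zero])
      then have j0: "0 \<le> j" by linarith
      have "of_int j * pi < real nn * pi"
      proof -
        have "real (Suc m) * pi = real m * pi + pi" by (simp add: algebra_simps)
        then show ?thesis
          using w(2) j(1) wt \<psi>0_range unfolding e_def by (elim disjE conjE; hypsubst; linarith)
      qed
      then have "real_of_int j < real nn" by simp
      then have "nat j < nn" using j0 by linarith
      moreover have "real (nat j) = of_int j" using j0 by simp
      ultimately show "\<theta> \<in> ?B" using j ivl by (intro UN_I[of "nat j"]) auto
    next
      fix \<theta> assume "\<theta> \<in> ?B"
      then obtain j where j: "j < nn" "real j * pi - \<psi>0 < am (\<theta> + c)" "am (\<theta> + c) < real j * pi + \<psi>0"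
        using ivl by auto
      have "F \<theta> < 0"
        unfolding sgn(2) sin_squared_compare(2)[OF \<psi>0_range] by (rule exI[of _ "int j"]) (use j in auto)
      moreover have "0 \<le> real j * pi" by simp
      then have "- \<psi>0 < am (\<theta> + c)" using j(2) by linarith
      moreover have "am (\<theta> + c) < e"
        using wt
      proof
        assume *: "\<sigma> = - 1 \<and> nn = m"
        then have "real (Suc j) * pi \<le> real m * pi" using j(1) by (intro natpi) simp
        then have "real j * pi + pi \<le> real m * pi" by (simp add: algebra_simps)
        moreover have "2 * \<psi>0 \<le> pi" using \<psi>0_range by simp
        ultimately show ?thesis using j(3) * by (simp add: e_def)
      next
        assume *: "\<sigma> = 1 \<and> nn = Suc m"
        then have "real j * pi \<le> real m * pi" using j(1) by (intro natpi) simp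
        then show ?thesis using j(3) unfolding e_def * [THEN conjunct1] by linarith
      qed
      ultimately show "\<theta> \<in> ?A" unfolding mem_Collect_eq win by blast
    qed
    have "finite (components {\<theta> \<in> {-L<..<L}. F \<theta> < 0}) \<and> card (components {\<theta> \<in> {-L<..<L}. F \<theta> < 0}) = nn"
    proof (rule card_components_intervals[OF _ _ neg_set])
      fix j assume "j < nn"
      show "\<Theta> (real j * pi - \<psi>0) - c < \<Theta> (real j * pi + \<psi>0) - c"
        using mono\<Theta> \<psi>0_pos[OF True] by (simp add: strict_mono_less)
    next
      fix j k assume "j < k" "k < nn"
      then have "real (Suc j) * pi \<le> real k * pi" by (intro natpi) simp
      then have "real j * pi + \<psi>0 \<le> real k * pi - \<psi>0" using \<psi>0_range by (simp add: algebra_simps)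
      then show "\<Theta> (real j * pi + \<psi>0) - c \<le> \<Theta> (real k * pi - \<psi>0) - c"
        using mono\<Theta> by (simp add: strict_mono_less_eq)
    qed
    then show ?thesis using True by simp
  qed
qed

end

section \<open>Parametrisation of the self-similar solutions\<close>

lemma periodic_profile_ex:
  assumes region: "period_region a b" and ab: "0 < a + b"
  obtains \<Theta> am where "periodic_profile a b \<Theta> am"
proof -
  let ?w = "\<lambda>\<phi>. sqrt 6 / sqrt (period_den a b \<phi>)"
  have den: "0 < period_den a b \<phi>" "period_den a b \<phi> \<le> 6 + 2 * a - b" for \<phi>
    using period_den_pos[OF region, of \<phi>] mult_left_mono[OF sin_squared_le_1[of \<phi>] less_imp_le[OF ab]]
    by (simp_all add: period_den_def)
  have c: "0 < 6 + 2 * a - b" using den[of 0] by linarith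
  have "continuous_on UNIV ?w"
    by (intro period_integrand_continuous region continuous_intros)
  moreover have "sqrt 6 / sqrt (6 + 2 * a - b) \<le> ?w \<phi>" for \<phi>
    using den[of \<phi>] c by (intro divide_left_mono) auto
  moreover have "0 < sqrt 6 / sqrt (6 + 2 * a - b)" using c by simp
  ultimately obtain \<Theta> am where
    "\<And>x. (\<Theta> has_real_derivative ?w x) (at x)" "\<Theta> 0 = 0" "strict_mono \<Theta>"
    "\<And>x. am (\<Theta> x) = x" "\<And>y. \<Theta> (am y) = y" "\<And>y. (am has_real_derivative 1 / ?w (am y)) (at y)"
    using increasing_antiderivative[of ?w] by metis
  then have "periodic_profile a b \<Theta> am"
    using region ab by unfold_locales simp_all
  then show thesis by (rule that)
qed

lemma half_period_split:
  assumes "period_region a b" "0 < a + b"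
  shows "half_period a b = (if 0 < a then half_width a (slope_pos a b) else 0)
      + (if 0 < b then half_width (-b) (slope_neg a b) else 0)"
    and "period_flux a b = (if 0 < a then hump_flux a (slope_pos a b) else 0)
      + (if 0 < b then hump_flux (-b) (slope_neg a b) else 0)"
proof -
  obtain \<Theta> am where "periodic_profile a b \<Theta> am" using periodic_profile_ex[OF assms] .
  then show "half_period a b = (if 0 < a then half_width a (slope_pos a b) else 0)
      + (if 0 < b then half_width (-b) (slope_neg a b) else 0)"
    and "period_flux a b = (if 0 < a then hump_flux a (slope_pos a b) else 0)
      + (if 0 < b then hump_flux (-b) (slope_neg a b) else 0)"
    by (rule periodic_profile.quarter_integrals)+
qed

text \<open>The profile is a window of the periodic one, shifted to be symmetric about 0. Its
  half-length L is found indirectly: \<open>profile_solution_type\<close>, applied to the window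
  itself, returns the sum of the half-widths, which is \<alpha> by assumption.\<close>

lemma ss_solution_exists:
  fixes m nn :: nat
  assumes region: "period_region a b" and ab: "0 < a + b"
    and nn: "nn = m \<or> nn = Suc m" and a: "0 < a \<or> m = 0" and ne: "0 < m \<or> 0 < b \<and> nn = Suc m"
    and mm: "mm = (if 0 < b then nn else 0)"
    and \<alpha>: "\<alpha> = real m * half_width a (slope_pos a b) + real mm * half_width (-b) (slope_neg a b)"
    and pi: "\<alpha> < pi"
  obtains u p where "ss_solution \<alpha> u p" "has_type \<alpha> u m mm"
    "flux \<alpha> u = real m * hump_flux a (slope_pos a b) + real mm * hump_flux (-b) (slope_neg a b)"
    "a * b = 0 \<Longrightarrow> (profile u has_real_derivative 0) (at \<alpha> within {-\<alpha>..\<alpha>}) \<and>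
      (profile u has_real_derivative 0) (at (-\<alpha>) within {-\<alpha>..\<alpha>})"
proof -
  obtain \<Theta> am where "periodic_profile a b \<Theta> am" using periodic_profile_ex[OF region ab] .
  then interpret periodic_profile a b \<Theta> am .
  define \<sigma> :: real where "\<sigma> = (if nn = m then -1 else 1)"
  have wt: "\<sigma> = -1 \<and> nn = m \<or> \<sigma> = 1 \<and> nn = Suc m" and ne': "0 < m \<or> 0 < b \<and> \<sigma> = 1"
    using nn ne by (auto simp: \<sigma>_def)
  define e where "e = real m * pi + \<sigma> * \<psi>0"
  define c where "c = (\<Theta> e + \<Theta> (- \<psi>0)) / 2"
  define L where "L = (\<Theta> e - \<Theta> (- \<psi>0)) / 2"
  define F where "F \<theta> = prof (\<theta> + c)" for \<theta>
  define F' where "F' \<theta> = prof' (\<theta> + c)" for \<theta>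
  note win = window_types[OF wt a ne', folded e_def, folded c_def L_def, folded F_def]
  have comp: "finite (components {\<theta> \<in> {-L<..<L}. 0 < F \<theta>})" "card (components {\<theta> \<in> {-L<..<L}. 0 < F \<theta>}) = m"
    "finite (components {\<theta> \<in> {-L<..<L}. F \<theta> < 0})" "card (components {\<theta> \<in> {-L<..<L}. F \<theta> < 0}) = mm"
    using win(4,5) mm by simp_all
  have dF: "(F has_real_derivative F' \<theta>) (at \<theta>)" for \<theta>
    unfolding F_def[abs_def] F'_def by (rule DERIV_shift[THEN iffD1, OF prof_derivative])
  have dF': "(F' has_real_derivative period_K a b - 4 * F \<theta> - (F \<theta>)\<^sup>2) (at \<theta>)" for \<theta>
    unfolding F_def F'_def[abs_def] by (rule DERIV_shift[THEN iffD1, OF prof'_derivative])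
  have fi: "(F' \<theta>)\<^sup>2 = first_integral (period_K a b) (period_C a b) (F \<theta>)" for \<theta>
    unfolding F_def F'_def by (rule prof_first_integral)
  have contF: "continuous_on S F" for S
    using DERIV_isCont[OF dF] by (simp add: continuous_at_imp_continuous_on)
  have ps: "profile_solution L F F' (period_K a b) (period_C a b)"
    unfolding profile_solution_def
    using contF win(2,3) period_C_nonneg[OF region] dF dF' fi by blast
  have nontriv: "\<exists>\<theta>\<in>{-L<..<L}. F \<theta> \<noteq> 0"
  proof (rule ccontr)
    assume "\<not> ?thesis"
    then have "{\<theta> \<in> {-L<..<L}. 0 < F \<theta>} = {}" "{\<theta> \<in> {-L<..<L}. F \<theta> < 0} = {}" by force+
    then have "m = 0" "mm = 0" using comp(2,4) by (simp_all only:) simp_all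
    then show False using ne mm by auto
  qed
  have pe: "0 < m \<Longrightarrow> 0 < a \<and> extremum (period_K a b) (period_C a b) a"
    using a extremum_pos[OF region] by auto
  have nege: "0 < mm \<Longrightarrow> 0 < b \<and> extremum (period_K a b) (period_C a b) (-b)"
    using mm extremum_neg[OF region] by (auto split: if_splits)
  note ty = profile_solution_type[OF win(1) ps nontriv comp(1,3,2,4)]
  have eqs: "real m * h a (3 / 2 * period_C a b / a\<^sup>2) = real m * h a (slope_pos a b)"
    "real mm * h (-b) (3 / 2 * period_C a b / b\<^sup>2) = real mm * h (-b) (slope_neg a b)" for h :: "real \<Rightarrow> real \<Rightarrow> real"
    using slope_pos_eq[of a b] slope_neg_eq[of b a] pe nege by (cases "m = 0"; cases "mm = 0"; simp)+
  have L: "L = \<alpha>" using ty(3)[OF pe nege] unfolding eqs \<alpha> .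
  have flux: "integral {-L..L} F = real m * hump_flux a (slope_pos a b) + real mm * hump_flux (-b) (slope_neg a b)"
    using ty(4)[OF pe nege] unfolding eqs .
  have \<alpha>0: "0 < \<alpha>" using win(1) L by simp
  obtain u p where u: "ss_solution \<alpha> u p" "\<And>\<theta>. \<theta> \<in> {-\<alpha>..\<alpha>} \<Longrightarrow> profile u \<theta> = F \<theta>"
    using profile_equation_ss_solution[OF \<alpha>0 pi dF dF'] win(2,3) unfolding L by metis
  have sets: "{\<theta> \<in> {-\<alpha><..<\<alpha>}. profile u \<theta> > 0} = {\<theta> \<in> {-L<..<L}. 0 < F \<theta>}"
    "{\<theta> \<in> {-\<alpha><..<\<alpha>}. profile u \<theta> < 0} = {\<theta> \<in> {-L<..<L}. F \<theta> < 0}"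
    using u(2) unfolding L by auto
  have "\<exists>\<theta>\<in>{-\<alpha><..<\<alpha>}. profile u \<theta> \<noteq> 0" using nontriv u(2) unfolding L by auto
  then have "\<exists>x\<in>sector \<alpha>. u x \<noteq> 0" using ss_solution_nontrivial_iff[OF \<alpha>0 pi u(1)] by simp
  then have type: "has_type \<alpha> u m mm" unfolding has_type_def sets using comp by blast
  have "flux \<alpha> u = integral {-L..L} F"
    unfolding flux_def L by (rule integral_cong) (rule u(2))
  then have fl: "flux \<alpha> u = real m * hump_flux a (slope_pos a b) + real mm * hump_flux (-b) (slope_neg a b)"
    using flux by simp
  have "(profile u has_real_derivative 0) (at \<theta> within {-\<alpha>..\<alpha>})"
    if "a * b = 0" "\<theta> = \<alpha> \<or> \<theta> = - \<alpha>" for \<theta>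
  proof -
    have "F \<theta> = 0" using that(2) win(2,3) L by auto
    \<comment> \<open>For a b = 0 the first integral has no constant term, so f' = 0 wherever f =
      0.\<close>
    moreover have "period_C a b = 0" using that(1) by (auto simp: period_C_def)
    ultimately have "F' \<theta> = 0" using fi[of \<theta>] by (simp add: first_integral_def)
    then have "(F has_real_derivative 0) (at \<theta> within {-\<alpha>..\<alpha>})"
      using has_field_derivative_at_within[OF dF[of \<theta>], of "{-\<alpha>..\<alpha>}"] by simp
    then show ?thesis
      by (rule has_field_derivative_transform_within[of _ _ _ _ 1]) (use that u(2) \<alpha>0 in auto)
  qed
  then show thesis using that[OF u(1) type fl] by simp
qed

lemma ss_solution_humps:
  assumes \<alpha>: "0 < \<alpha>" "\<alpha> < pi" and ss: "ss_solution \<alpha> u p" and ty: "has_type \<alpha> u mp mm"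
  shows "\<exists>K C a b. (0 < mp \<longrightarrow> 0 < a \<and> extremum K C a) \<and> (0 < mm \<longrightarrow> 0 < b \<and> extremum K C (-b)) \<and>
    \<alpha> = mp * half_width a (3 / 2 * C / a\<^sup>2) + mm * half_width (-b) (3 / 2 * C / b\<^sup>2) \<and>
    flux \<alpha> u = mp * hump_flux a (3 / 2 * C / a\<^sup>2) + mm * hump_flux (-b) (3 / 2 * C / b\<^sup>2)"
proof -
  note pe = ss_solution_profile_equation[OF \<alpha> ss]
  obtain f' K where f': "\<And>\<theta>. \<theta> \<in> {-\<alpha><..<\<alpha>} \<Longrightarrow> (profile u has_real_derivative f' \<theta>) (at \<theta>)"
    "\<And>\<theta>. \<theta> \<in> {-\<alpha><..<\<alpha>} \<Longrightarrow> (f' has_real_derivative K - 4 * profile u \<theta> - (profile u \<theta>)\<^sup>2) (at \<theta>)"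
    using pe(4) by blast
  obtain C where ps: "profile_solution \<alpha> (profile u) f' K C"
    using profile_solutionI[OF \<alpha>(1) pe(1-3) f'] by blast
  have nontriv: "\<exists>\<theta>\<in>{-\<alpha><..<\<alpha>}. profile u \<theta> \<noteq> 0"
    using ty ss_solution_nontrivial_iff[OF \<alpha> ss] by (simp add: has_type_def)
  have comp: "finite (components {\<theta> \<in> {-\<alpha><..<\<alpha>}. 0 < profile u \<theta>})"
    "finite (components {\<theta> \<in> {-\<alpha><..<\<alpha>}. profile u \<theta> < 0})"
    "card (components {\<theta> \<in> {-\<alpha><..<\<alpha>}. 0 < profile u \<theta>}) = mp"
    "card (components {\<theta> \<in> {-\<alpha><..<\<alpha>}. profile u \<theta> < 0}) = mm"
    using ty unfolding has_type_def by blast+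
  note t = profile_solution_type[OF \<alpha>(1) ps nontriv comp]
  have "\<exists>a. 0 < mp \<longrightarrow> 0 < a \<and> extremum K C a" using t(1) by blast
  moreover have "\<exists>b. 0 < mm \<longrightarrow> 0 < b \<and> extremum K C (-b)" using t(2) by blast
  ultimately obtain a b where ab: "0 < mp \<longrightarrow> 0 < a \<and> extremum K C a" "0 < mm \<longrightarrow> 0 < b \<and> extremum K C (-b)"
    by blast
  have "\<alpha> = mp * half_width a (3 / 2 * C / a\<^sup>2) + mm * half_width (-b) (3 / 2 * C / b\<^sup>2)"
    "flux \<alpha> u = mp * hump_flux a (3 / 2 * C / a\<^sup>2) + mm * hump_flux (-b) (3 / 2 * C / b\<^sup>2)"
    using ab t(3,4)[of a b] by (auto simp: flux_def)
  with ab show ?thesis by blast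
qed

text \<open>Two roots determine the cubic: eliminating K from the root equations gives C =
  \<open>period_C a b\<close>. Admissibility at -b then gives 2 b < 6 + a.\<close>

lemma two_extrema:
  assumes a: "0 < a" "extremum K C a" and b: "0 < b" "extremum K C (-b)"
  shows "period_region a b" "3 / 2 * C / a\<^sup>2 = slope_pos a b" "3 / 2 * C / b\<^sup>2 = slope_neg a b"
proof -
  have ra: "C + 2 * K * a = 4 * a\<^sup>2 + 2 / 3 * a ^ 3" and rb: "C - 2 * K * b = 4 * b\<^sup>2 - 2 / 3 * b ^ 3"
    using a b by (simp_all add: extremum_def first_integral_def)
  have "(a + b) * C = b * (C + 2 * K * a) + a * (C - 2 * K * b)" by (simp add: algebra_simps)
  also have "\<dots> = (a + b) * (2 / 3 * (a * b * (6 + a - b)))"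
    unfolding ra rb by (simp add: field_simps power2_eq_square power3_eq_cube)
  finally have C: "C = period_C a b" using a b by (simp add: period_C_def)
  show sa: "3 / 2 * C / a\<^sup>2 = slope_pos a b" and sb: "3 / 2 * C / b\<^sup>2 = slope_neg a b"
    unfolding C using slope_pos_eq[OF a(1)] slope_neg_eq[OF b(1)] by blast+
  have "admissible (-b) (slope_neg a b)" using b(2) sb by (simp add: extremum_def)
  then have "0 < slope_neg a b + 6 + 2 * (- b)" by (simp add: admissible_def)
  then have "0 < (a + b) * (6 + a - 2 * b) / b" using slope_neg_den[OF b(1), of a] by simp
  then show "period_region a b"
    using a b by (simp add: period_region_def zero_less_divide_iff zero_less_mult_iff)
qed

text \<open>\<open>real nn - real m\<close> is 0 or 1 and switches the extra negative hump on. The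
  order of the humps along the angle is immaterial because humps of one sign are congruent, so one
  arrangement realises every flux.\<close>

lemma fluxes_two_signs:
  fixes m nn :: nat
  assumes \<alpha>: "0 < \<alpha>" "\<alpha> < pi" and m: "0 < m" and nn: "nn = m \<or> nn = Suc m"
  shows "\<Phi> \<in> fluxes \<alpha> m nn \<longleftrightarrow> (\<exists>a b. 0 < a \<and> 0 < b \<and> period_region a b \<and>
    \<alpha> = m * half_period a b + (real nn - real m) * half_width (-b) (slope_neg a b) \<and>
    \<Phi> = m * period_flux a b + (real nn - real m) * hump_flux (-b) (slope_neg a b))"
proof
  assume "\<Phi> \<in> fluxes \<alpha> m nn"
  then obtain u p where u: "ss_solution \<alpha> u p" "has_type \<alpha> u m nn" "\<Phi> = flux \<alpha> u"
    unfolding fluxes_def by blast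
  obtain K C a b where ab: "0 < m \<longrightarrow> 0 < a \<and> extremum K C a" "0 < nn \<longrightarrow> 0 < b \<and> extremum K C (-b)"
    "\<alpha> = m * half_width a (3 / 2 * C / a\<^sup>2) + nn * half_width (-b) (3 / 2 * C / b\<^sup>2)"
    "flux \<alpha> u = m * hump_flux a (3 / 2 * C / a\<^sup>2) + nn * hump_flux (-b) (3 / 2 * C / b\<^sup>2)"
    using ss_solution_humps[OF \<alpha> u(1,2)] by blast
  have pos: "0 < a" "extremum K C a" "0 < b" "extremum K C (-b)" using ab(1,2) m nn by auto
  note te = two_extrema[OF pos]
  have "half_period a b = half_width a (slope_pos a b) + half_width (-b) (slope_neg a b)"
    "period_flux a b = hump_flux a (slope_pos a b) + hump_flux (-b) (slope_neg a b)"
    using half_period_split[OF te(1)] pos by simp_all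
  then have "\<alpha> = m * half_period a b + (real nn - real m) * half_width (-b) (slope_neg a b)"
    "\<Phi> = m * period_flux a b + (real nn - real m) * hump_flux (-b) (slope_neg a b)"
    using ab(3,4) u(3) unfolding te(2,3) by (simp_all add: algebra_simps)
  then show "\<exists>a b. 0 < a \<and> 0 < b \<and> period_region a b \<and>
    \<alpha> = m * half_period a b + (real nn - real m) * half_width (-b) (slope_neg a b) \<and>
    \<Phi> = m * period_flux a b + (real nn - real m) * hump_flux (-b) (slope_neg a b)"
    using pos te(1) by blast
next
  assume "\<exists>a b. 0 < a \<and> 0 < b \<and> period_region a b \<and>
    \<alpha> = m * half_period a b + (real nn - real m) * half_width (-b) (slope_neg a b) \<and>
    \<Phi> = m * period_flux a b + (real nn - real m) * hump_flux (-b) (slope_neg a b)"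
  then obtain a b where ab: "0 < a" "0 < b" "period_region a b"
    "\<alpha> = m * half_period a b + (real nn - real m) * half_width (-b) (slope_neg a b)"
    "\<Phi> = m * period_flux a b + (real nn - real m) * hump_flux (-b) (slope_neg a b)" by blast
  have "half_period a b = half_width a (slope_pos a b) + half_width (-b) (slope_neg a b)"
    "period_flux a b = hump_flux a (slope_pos a b) + hump_flux (-b) (slope_neg a b)"
    using half_period_split[OF ab(3)] ab by simp_all
  then have \<alpha>': "\<alpha> = m * half_width a (slope_pos a b) + nn * half_width (-b) (slope_neg a b)"
    and \<Phi>': "\<Phi> = m * hump_flux a (slope_pos a b) + nn * hump_flux (-b) (slope_neg a b)"
    using ab(4,5) by (simp_all add: algebra_simps)
  obtain u p where "ss_solution \<alpha> u p" "has_type \<alpha> u m nn"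
    "flux \<alpha> u = m * hump_flux a (slope_pos a b) + nn * hump_flux (-b) (slope_neg a b)"
    by (rule ss_solution_exists[OF ab(3) _ nn _ _ _ \<alpha>' \<alpha>(2)]) (use ab m in auto)
  then show "\<Phi> \<in> fluxes \<alpha> m nn"
    using \<Phi>' unfolding fluxes_def by (intro CollectI exI[of _ u] exI[of _ p]) simp
qed

lemma fluxes_one_sign:
  assumes \<alpha>: "0 < \<alpha>" "\<alpha> < pi"
  shows "\<Phi> \<in> fluxes \<alpha> 1 0 \<Longrightarrow> \<exists>a s. 0 < a \<and> admissible a s \<and> half_width a s = \<alpha> \<and> hump_flux a s = \<Phi>"
    and "\<Phi> \<in> fluxes \<alpha> 0 1 \<Longrightarrow> \<exists>b s. 0 < b \<and> admissible (-b) s \<and> half_width (-b) s = \<alpha> \<and> hump_flux (-b) s = \<Phi>"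
proof -
  assume "\<Phi> \<in> fluxes \<alpha> 1 0"
  then obtain u p where u: "ss_solution \<alpha> u p" "has_type \<alpha> u 1 0" "\<Phi> = flux \<alpha> u"
    unfolding fluxes_def by blast
  have "\<exists>K C a. 0 < a \<and> extremum K C a \<and> \<alpha> = half_width a (3 / 2 * C / a\<^sup>2) \<and>
      flux \<alpha> u = hump_flux a (3 / 2 * C / a\<^sup>2)"
    using ss_solution_humps[OF \<alpha> u(1,2)] by auto
  then obtain K C a where "0 < a" "extremum K C a" "\<alpha> = half_width a (3 / 2 * C / a\<^sup>2)"
    "flux \<alpha> u = hump_flux a (3 / 2 * C / a\<^sup>2)" by blast
  then show "\<exists>a s. 0 < a \<and> admissible a s \<and> half_width a s = \<alpha> \<and> hump_flux a s = \<Phi>"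
    using u(3) by (intro exI[of _ a] exI[of _ "3 / 2 * C / a\<^sup>2"]) (simp add: extremum_def)
next
  assume "\<Phi> \<in> fluxes \<alpha> 0 1"
  then obtain u p where u: "ss_solution \<alpha> u p" "has_type \<alpha> u 0 1" "\<Phi> = flux \<alpha> u"
    unfolding fluxes_def by blast
  have "\<exists>K C b. 0 < b \<and> extremum K C (-b) \<and> \<alpha> = half_width (-b) (3 / 2 * C / b\<^sup>2) \<and>
      flux \<alpha> u = hump_flux (-b) (3 / 2 * C / b\<^sup>2)"
    using ss_solution_humps[OF \<alpha> u(1,2)] by auto
  then obtain K C b where "0 < b" "extremum K C (-b)" "\<alpha> = half_width (-b) (3 / 2 * C / b\<^sup>2)"
    "flux \<alpha> u = hump_flux (-b) (3 / 2 * C / b\<^sup>2)" by blast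
  then show "\<exists>b s. 0 < b \<and> admissible (-b) s \<and> half_width (-b) s = \<alpha> \<and> hump_flux (-b) s = \<Phi>"
    using u(3) by (intro exI[of _ b] exI[of _ "3 / 2 * C / b\<^sup>2"]) (simp add: extremum_def)
qed

lemma max_flux_eqI:
  assumes "\<And>\<Phi>. \<Phi> \<in> fluxes \<alpha> mp mm \<Longrightarrow> \<Phi> \<le> M"
    and "\<And>\<epsilon>. 0 < \<epsilon> \<Longrightarrow> \<exists>\<Phi>\<in>fluxes \<alpha> mp mm. M - \<epsilon> < \<Phi>"
  shows "max_flux \<alpha> mp mm = ereal M"
  unfolding max_flux_def
proof (rule antisym)
  show "(SUP \<Phi>\<in>fluxes \<alpha> mp mm. ereal \<Phi>) \<le> ereal M"
    using assms(1) by (intro SUP_least) simp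
  show "ereal M \<le> (SUP \<Phi>\<in>fluxes \<alpha> mp mm. ereal \<Phi>)"
  proof (rule ereal_le_epsilon2)
    fix \<epsilon> :: real assume "0 < \<epsilon>"
    then obtain \<Phi> where \<Phi>: "\<Phi> \<in> fluxes \<alpha> mp mm" "M - \<epsilon> < \<Phi>" using assms(2) by blast
    then have "ereal M \<le> ereal \<Phi> + ereal \<epsilon>" by simp
    also have "\<dots> \<le> (SUP \<Phi>\<in>fluxes \<alpha> mp mm. ereal \<Phi>) + ereal \<epsilon>"
      by (intro add_right_mono SUP_upper \<Phi>(1))
    finally show "ereal M \<le> (SUP \<Phi>\<in>fluxes \<alpha> mp mm. ereal \<Phi>) + ereal \<epsilon>" .
  qed
qed

lemma max_flux_attained:
  assumes "\<And>\<Phi>. \<Phi> \<in> fluxes \<alpha> mp mm \<Longrightarrow> \<Phi> \<le> M" "M \<in> fluxes \<alpha> mp mm"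
  shows "max_flux \<alpha> mp mm = ereal M"
  using assms by (intro max_flux_eqI) force+

section \<open>Profiles with one more negative than positive hump\<close>

definition extra_width :: "nat \<Rightarrow> real \<Rightarrow> real \<Rightarrow> real" where
  "extra_width m a b = real m * half_period a b + half_width (-b) (slope_neg a b)"

definition extra_flux :: "nat \<Rightarrow> real \<Rightarrow> real \<Rightarrow> real" where
  "extra_flux m a b = real m * period_flux a b + hump_flux (-b) (slope_neg a b)"

definition extra_set :: "nat \<Rightarrow> real \<Rightarrow> (real \<times> real) set" where
  "extra_set m \<alpha> = {(a, b). 0 < a \<and> 0 < b \<and> period_region a b \<and> extra_width m a b = \<alpha>}"

lemma slope_neg_pos: "period_region a b \<Longrightarrow> 0 < a \<Longrightarrow> 0 < b \<Longrightarrow> 0 < slope_neg a b"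
  using period_third_root_pos[of a b] by (simp add: slope_neg_def)

lemma slope_pos_pos: "period_region a b \<Longrightarrow> 0 < a \<Longrightarrow> 0 < b \<Longrightarrow> 0 < slope_pos a b"
  using period_third_root_pos[of a b] by (simp add: slope_pos_def)

lemma continuous_on_extra:
  fixes f g :: "'a::topological_space \<Rightarrow> real"
  assumes "continuous_on S f" "continuous_on S g"
    and pos: "\<And>x. x \<in> S \<Longrightarrow> 0 < f x \<and> 0 < g x \<and> period_region (f x) (g x)"
  shows "continuous_on S (\<lambda>x. half_width (- g x) (slope_neg (f x) (g x)))"
    "continuous_on S (\<lambda>x. extra_width m (f x) (g x))" "continuous_on S (\<lambda>x. extra_flux m (f x) (g x))"
proof -
  have "continuous_on S (\<lambda>x. slope_neg (f x) (g x))"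
    unfolding slope_neg_def using pos by (intro continuous_intros assms) force
  moreover have "admissible (- g x) (slope_neg (f x) (g x)) \<and> 0 < slope_neg (f x) (g x)" if "x \<in> S" for x
    using admissible_slope_neg slope_neg_pos pos[OF that] by blast
  ultimately have h: "continuous_on S (\<lambda>x. half_width (- g x) (slope_neg (f x) (g x)))"
    "continuous_on S (\<lambda>x. hump_flux (- g x) (slope_neg (f x) (g x)))"
    by (intro continuous_on_hump continuous_on_minus assms; blast)+
  have p: "continuous_on S (\<lambda>x. half_period (f x) (g x))" "continuous_on S (\<lambda>x. period_flux (f x) (g x))"
    using pos by (intro continuous_on_half_period assms; blast)+
  show "continuous_on S (\<lambda>x. half_width (- g x) (slope_neg (f x) (g x)))" by (rule h)
  show "continuous_on S (\<lambda>x. extra_width m (f x) (g x))" "continuous_on S (\<lambda>x. extra_flux m (f x) (g x))"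
    unfolding extra_width_def extra_flux_def
    by (intro continuous_on_add continuous_on_mult continuous_on_const h p)+
qed

text \<open>For b \<le> 1 the factor 6 + a - b is at least 5, so the slope parameter is at least 5 a
  / b and the negative hump narrows like sqrt(b / a).\<close>

lemma half_width_slope_neg_le:
  assumes "0 < a" "0 < b" "b \<le> 1"
  shows "half_width (-b) (slope_neg a b) \<le> 2 * sqrt (b / a)"
proof -
  have region: "period_region a b" using assms by (simp add: period_region_def)
  have s: "5 * a / b \<le> slope_neg a b"
    unfolding slope_neg_def using assms by (intro divide_right_mono) auto
  have "half_width (-b) (slope_neg a b) \<le> sqrt 6 / sqrt (5 * a / b)"
    using assms s by (intro half_width_le admissible_slope_neg region) auto
  also have "\<dots> = sqrt (6 / 5 * (b / a))"
    by (simp flip: real_sqrt_divide)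
  also have "\<dots> \<le> sqrt (4 * (b / a))" using assms by (intro real_sqrt_le_mono mult_right_mono) auto
  also have "\<dots> = 2 * sqrt (b / a)" by (simp only: real_sqrt_mult) simp
  finally show ?thesis .
qed

text \<open>The counterpart for the positive hump, which disappears as a tends to 0 with b
  fixed.\<close>

lemma half_width_slope_pos_le:
  assumes "period_region a b" "0 < a" "0 < b"
  shows "half_width a (slope_pos a b) \<le> sqrt 6 * sqrt a / sqrt (b * (6 + a - b))"
proof -
  have "half_width a (slope_pos a b) \<le> sqrt 6 / sqrt (slope_pos a b)"
    using slope_pos_pos[OF assms] assms by (intro half_width_le admissible_slope_pos) auto
  then show ?thesis by (simp add: slope_pos_def real_sqrt_divide)
qed

text \<open>The integrand changes by at most d / 6 because both denominators are at least 6; as sqrt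
  6 (pi/2) / 6 \<le> 1, the Lipschitz constant is 1.\<close>

lemma half_period_right_zero_lipschitz:
  assumes "0 \<le> a" "0 \<le> d"
  shows "half_period a 0 - d \<le> half_period (a + d) 0"
proof -
  have r: "period_region a 0" "period_region (a + d) 0" using assms by (simp_all add: period_region_def)
  have "integral quarter (\<lambda>\<phi>. 1 / sqrt (period_den a 0 \<phi>)) \<le> integral quarter (\<lambda>\<phi>. 1 / sqrt (period_den (a + d) 0 \<phi>) + d / 6)"
  proof (intro quarter_le period_integrand_continuous continuous_on_add r continuous_on_const)
    fix \<phi> :: real
    define x where "x = sqrt (period_den a 0 \<phi>)"
    define y where "y = sqrt (period_den (a + d) 0 \<phi>)"
    have px: "6 \<le> period_den a 0 \<phi>" "6 \<le> period_den (a + d) 0 \<phi>"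
      using period_den_lower[OF r(1), of \<phi>] period_den_lower[OF r(2), of \<phi>] assms by linarith+
    have "2 * 2 \<le> period_den a 0 \<phi>" "2 * 2 \<le> period_den (a + d) 0 \<phi>" using px by auto
    then have xy: "2 \<le> x" "2 \<le> y" unfolding x_def y_def by (auto intro!: real_le_rsqrt simp: power2_eq_square)
    have sq: "x * x = period_den a 0 \<phi>" "y * y = period_den (a + d) 0 \<phi>"
      using px by (simp_all add: x_def y_def)
    have diff: "y * y - x * x = d * (1 + (sin \<phi>)\<^sup>2)" unfolding sq by (simp add: period_den_def algebra_simps)
    have "y * y - x * x \<le> d * 2" unfolding diff using assms sin_squared_le_1[of \<phi>] by (intro mult_left_mono) auto
    moreover have "(y - x) * (y + x) = y * y - x * x" by (simp add: algebra_simps)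
    ultimately have 1: "(y - x) * (y + x) \<le> 2 * d" by simp
    have "0 \<le> d * (1 + (sin \<phi>)\<^sup>2)" using assms by simp
    then have "0 \<le> (y - x) * (y + x)" unfolding diff[symmetric] by (simp add: algebra_simps)
    then have yx: "0 \<le> y - x" using xy by (simp add: zero_le_mult_iff)
    have "(y - x) * 4 \<le> (y - x) * (y + x)" using yx xy by (intro mult_left_mono) auto
    then have 2: "y - x \<le> d / 2" using 1 by simp
    have "x * y \<ge> 6"
    proof -
      have "6 * 6 \<le> period_den a 0 \<phi> * period_den (a + d) 0 \<phi>" using px by (intro mult_mono) auto
      then have "6\<^sup>2 \<le> (x * y)\<^sup>2" unfolding sq[symmetric] by (simp add: power2_eq_square ac_simps)
      then show ?thesis using xy by (intro power2_le_imp_le[of 6 "x * y"]) auto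
    qed
    have "1 / x - 1 / y = (y - x) / (x * y)" using xy by (simp add: field_simps)
    also have "\<dots> \<le> (d / 2) / 6" using 2 yx \<open>6 \<le> x * y\<close> assms by (intro frac_le) auto
    also have "\<dots> \<le> d / 6" using assms by simp
    finally show "1 / sqrt (period_den a 0 \<phi>) \<le> 1 / sqrt (period_den (a + d) 0 \<phi>) + d / 6"
      by (simp add: x_def y_def)
  qed
  also have "\<dots> = integral quarter (\<lambda>\<phi>. 1 / sqrt (period_den (a + d) 0 \<phi>)) + (pi / 2) * (d / 6)"
    by (subst integral_add) (auto intro!: integrable_continuous_interval period_integrand_continuous r)
  finally have "sqrt 6 * integral quarter (\<lambda>\<phi>. 1 / sqrt (period_den a 0 \<phi>)) \<le>
      sqrt 6 * (integral quarter (\<lambda>\<phi>. 1 / sqrt (period_den (a + d) 0 \<phi>)) + (pi / 2) * (d / 6))"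
    by (intro mult_left_mono) auto
  then have "half_period a 0 \<le> half_period (a + d) 0 + sqrt 6 * (pi / 2) * (d / 6)"
    by (simp add: half_period_def distrib_left)
  moreover have "sqrt 6 * (pi / 2) * (d / 6) \<le> 3 * 2 * (d / 6)"
  proof (intro mult_right_mono mult_mono)
    show "sqrt 6 \<le> 3" by (rule real_le_lsqrt) auto
    show "pi / 2 \<le> 2" using pi_less_4 by simp
  qed (use assms in auto)
  ultimately show ?thesis by simp
qed

text \<open>Lowering the minimum from 0 to -b costs at most b / 2 in the integrand, as the
  denominator is at least 4; in the term with a the smaller denominator only helps. The constant 6
  bounds sqrt 6 (pi/2).\<close>

lemma period_flux_lower:
  assumes "0 \<le> a" "0 \<le> b" "b \<le> 1"
  shows "period_flux a 0 - 6 * b \<le> period_flux a b"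
proof -
  have r: "period_region a 0" "period_region a b" using assms by (simp_all add: period_region_def)
  have "integral quarter (\<lambda>\<phi>. (- 0 + (a + 0) * (sin \<phi>)\<^sup>2) / sqrt (period_den a 0 \<phi>) + (- (b / 2)))
      \<le> integral quarter (\<lambda>\<phi>. (- b + (a + b) * (sin \<phi>)\<^sup>2) / sqrt (period_den a b \<phi>))"
  proof (intro quarter_le period_integrand_continuous r continuous_intros)
    fix \<phi> :: real
    define t where "t = (sin \<phi>)\<^sup>2"
    have t: "0 \<le> t" "t \<le> 1" using sin_squared_le_1[of \<phi>] by (auto simp: t_def)
    define x where "x = sqrt (period_den a b \<phi>)"
    have den: "4 \<le> period_den a b \<phi>" using period_den_lower[OF r(2), of \<phi>] assms by linarith
    then have x: "2 \<le> x" unfolding x_def by (auto intro!: real_le_rsqrt)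
    have "period_den a b \<phi> \<le> period_den a 0 \<phi>"
    proof -
      have "0 \<le> b * (2 - t)" using assms t by simp
      then show ?thesis unfolding period_den_eq t_def[symmetric] by simp
    qed
    then have "x \<le> sqrt (period_den a 0 \<phi>)" by (simp add: x_def)
    then have "a * t / sqrt (period_den a 0 \<phi>) \<le> a * t / x"
      using x t assms period_den_pos[OF r(1), of \<phi>] by (intro divide_left_mono mult_pos_pos) auto
    moreover have "b * (1 - t) / x \<le> b / 2"
      using x t assms by (intro frac_le) (auto intro: mult_left_le)
    moreover have "(- b + (a + b) * t) / x = a * t / x - b * (1 - t) / x"
      by (simp add: diff_divide_distrib[symmetric] algebra_simps)
    ultimately show "(- 0 + (a + 0) * (sin \<phi>)\<^sup>2) / sqrt (period_den a 0 \<phi>) + (- (b / 2))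
        \<le> (- b + (a + b) * (sin \<phi>)\<^sup>2) / sqrt (period_den a b \<phi>)"
      by (simp add: x_def t_def)
  qed
  also have "integral quarter (\<lambda>\<phi>. (- 0 + (a + 0) * (sin \<phi>)\<^sup>2) / sqrt (period_den a 0 \<phi>) + (- (b / 2)))
      = integral quarter (\<lambda>\<phi>. (- 0 + (a + 0) * (sin \<phi>)\<^sup>2) / sqrt (period_den a 0 \<phi>)) - (pi / 2) * (b / 2)"
    by (subst integral_add)
      (auto intro!: integrable_continuous_interval period_integrand_continuous r continuous_intros)
  finally have "2 * sqrt 6 * (integral quarter (\<lambda>\<phi>. (- 0 + (a + 0) * (sin \<phi>)\<^sup>2) / sqrt (period_den a 0 \<phi>)) - (pi / 2) * (b / 2))
    \<le> period_flux a b"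
    unfolding period_flux_def by (intro mult_left_mono) auto
  then have "period_flux a 0 - sqrt 6 * (pi / 2) * b \<le> period_flux a b"
    by (simp add: period_flux_def right_diff_distrib ac_simps)
  moreover have "sqrt 6 * (pi / 2) * b \<le> 3 * 2 * b"
  proof (intro mult_right_mono mult_mono)
    show "sqrt 6 \<le> 3" by (rule real_le_lsqrt) auto
    show "pi / 2 \<le> 2" using pi_less_4 by simp
  qed (use assms in auto)
  ultimately show ?thesis by simp
qed

text \<open>When a grows by d, half of d pays for the larger denominator in a t / sqrt(6 + a (1 +
  t)), and the other half remains as gain. \<open>w\<close> bounds this square root for d \<le>
  1.\<close>

lemma period_flux_right_zero_growth:
  assumes "0 \<le> a0"
  obtains c where "0 < c" "\<And>d. 0 \<le> d \<Longrightarrow> d \<le> 1 \<Longrightarrow> period_flux a0 0 + c * d \<le> period_flux (a0 + d) 0"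
proof -
  define w where "w = sqrt (8 + 2 * a0)"
  define I where "I = integral quarter (\<lambda>\<phi>. (sin \<phi>)\<^sup>2)"
  define c where "c = sqrt 6 * I / w"
  have w: "0 < w" using assms by (simp add: w_def)
  have "integral quarter (\<lambda>\<phi>. 0) < I"
    unfolding I_def by (intro quarter_less continuous_intros) (use sin_quarter in auto)
  then have "0 < c" using w by (simp add: c_def)
  moreover have "period_flux a0 0 + c * d \<le> period_flux (a0 + d) 0" if d: "0 \<le> d" "d \<le> 1" for d
  proof -
    have r: "period_region a0 0" "period_region (a0 + d) 0" using assms d by (simp_all add: period_region_def)
    have "integral quarter (\<lambda>\<phi>. (- 0 + (a0 + 0) * (sin \<phi>)\<^sup>2) / sqrt (period_den a0 0 \<phi>) + (d / (2 * w)) * (sin \<phi>)\<^sup>2)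
      \<le> integral quarter (\<lambda>\<phi>. (- 0 + (a0 + d + 0) * (sin \<phi>)\<^sup>2) / sqrt (period_den (a0 + d) 0 \<phi>))"
    proof (intro quarter_le period_integrand_continuous continuous_on_add r continuous_intros)
      fix \<phi> :: real
      define t where "t = (sin \<phi>)\<^sup>2"
      have t: "0 \<le> t" "t \<le> 1" using sin_squared_le_1[of \<phi>] by (auto simp: t_def)
      define A0 where "A0 = period_den a0 0 \<phi>"
      define A where "A = period_den (a0 + d) 0 \<phi>"
      have A0: "A0 = 6 + a0 * (1 + t)" and A: "A = A0 + d * (1 + t)"
        by (simp_all add: A0_def A_def period_den_eq t_def algebra_simps)
      have pos: "0 < A0" "0 < A" unfolding A0_def A_def by (rule period_den_pos[OF r(1)], rule period_den_pos[OF r(2)])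
      have "a0\<^sup>2 * A \<le> (a0 + d / 2)\<^sup>2 * A0"
      proof -
        have "(a0 + d / 2)\<^sup>2 * A0 - a0\<^sup>2 * A = a0 * d * (A0 - a0 * (1 + t)) + d\<^sup>2 / 4 * A0"
          unfolding A by (simp add: power2_eq_square field_simps)
        also have "\<dots> = a0 * d * 6 + d\<^sup>2 / 4 * A0" by (simp add: A0)
        also have "\<dots> \<ge> 0" using assms d pos by simp
        finally show ?thesis by simp
      qed
      then have "sqrt (a0\<^sup>2 * A) \<le> sqrt ((a0 + d / 2)\<^sup>2 * A0)" by simp
      then have "a0 * sqrt A \<le> (a0 + d / 2) * sqrt A0" using assms d by (simp add: real_sqrt_mult)
      then have "a0 / sqrt A0 \<le> (a0 + d / 2) / sqrt A" using pos by (simp add: divide_simps mult.commute)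
      then have "a0 / sqrt A0 + (d / 2) / sqrt A \<le> (a0 + d) / sqrt A"
        using pos by (simp add: add_divide_distrib)
      moreover have "(d / 2) / w \<le> (d / 2) / sqrt A"
      proof (intro divide_left_mono)
        have "(a0 + d) * (1 + t) \<le> (a0 + 1) * 2" using assms d t by (intro mult_mono) auto
        then show "sqrt A \<le> w" unfolding w_def A A0 by (simp add: algebra_simps)
      qed (use d pos w in auto)
      ultimately have "a0 / sqrt A0 + (d / 2) / w \<le> (a0 + d) / sqrt A" by linarith
      then have "(a0 / sqrt A0 + (d / 2) / w) * t \<le> (a0 + d) / sqrt A * t" using t by (intro mult_right_mono) auto
      then show "(- 0 + (a0 + 0) * (sin \<phi>)\<^sup>2) / sqrt (period_den a0 0 \<phi>) + (d / (2 * w)) * (sin \<phi>)\<^sup>2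
          \<le> (- 0 + (a0 + d + 0) * (sin \<phi>)\<^sup>2) / sqrt (period_den (a0 + d) 0 \<phi>)"
        by (simp add: A0_def A_def t_def distrib_right)
    qed
    also have "integral quarter (\<lambda>\<phi>. (- 0 + (a0 + 0) * (sin \<phi>)\<^sup>2) / sqrt (period_den a0 0 \<phi>) + (d / (2 * w)) * (sin \<phi>)\<^sup>2)
        = integral quarter (\<lambda>\<phi>. (- 0 + (a0 + 0) * (sin \<phi>)\<^sup>2) / sqrt (period_den a0 0 \<phi>)) + (d / (2 * w)) * I"
      unfolding I_def integral_mult_right[symmetric]
      by (intro integral_add integrable_continuous_interval period_integrand_continuous r continuous_intros)
    finally have "2 * sqrt 6 * (integral quarter (\<lambda>\<phi>. (- 0 + (a0 + 0) * (sin \<phi>)\<^sup>2) / sqrt (period_den a0 0 \<phi>)) + (d / (2 * w)) * I)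
        \<le> period_flux (a0 + d) 0"
      unfolding period_flux_def by (intro mult_left_mono) auto
    moreover have "2 * sqrt 6 * ((d / (2 * w)) * I) = c * d" using w by (simp add: c_def)
    ultimately show ?thesis by (simp add: period_flux_def distrib_left)
  qed
  ultimately show thesis by (rule that)
qed

lemma period_flux_right_zero_nonneg:
  assumes "0 \<le> a"
  shows "0 \<le> period_flux a 0"
proof -
  have r: "period_region a 0" using assms by (simp add: period_region_def)
  have "0 \<le> integral quarter (\<lambda>\<phi>. (- 0 + (a + 0) * (sin \<phi>)\<^sup>2) / sqrt (period_den a 0 \<phi>))"
    using assms period_den_pos[OF r]
    by (intro integral_nonneg integrable_continuous_interval period_integrand_continuous r continuous_intros)
      (auto simp: less_imp_le)
  then show ?thesis unfolding period_flux_def by simp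
qed

lemma half_period_right_zero_le:
  assumes "period_region a b"
  shows "half_period a 0 \<le> half_period a b"
proof (cases "b = 0")
  case False
  then have "0 < b" using assms by (simp add: period_region_def)
  then show ?thesis using half_period_strict_mono_right[of 0 b a] assms by simp
qed simp

text \<open>Starting from the positive profile with amplitude \<open>a0\<close>, an extra negative hump of depth
  \<open>b = O(d)\<close> compensates an increase of the amplitude by \<open>d\<close>, since its width is of order
  \<open>sqrt b\<close>; the flux of the positive humps grows linearly in \<open>d\<close>.\<close>

lemma extra_flux_improves:
  assumes m: "0 < m" and a0: "0 \<le> a0"
  defines "\<alpha> \<equiv> real m * half_period a0 0"
  obtains a b where "(a, b) \<in> extra_set m \<alpha>" "real m * period_flux a0 0 < extra_flux m a b"
proof -
  obtain c where c: "0 < c" "\<And>d. 0 \<le> d \<Longrightarrow> d \<le> 1 \<Longrightarrow> period_flux a0 0 + c * d \<le> period_flux (a0 + d) 0"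
    by (rule period_flux_right_zero_growth[OF a0]) blast
  have r0: "period_region a0 0" using a0 by (simp add: period_region_def)
  have \<alpha>: "0 < \<alpha>" using half_period_pos[OF r0] m by (simp add: \<alpha>_def)
  \<comment> \<open>A hump of depth b costs at most b (6 m + 2 \<alpha>) in flux, while the
    amplitude step d gains m c d; for b \<le> \<kappa> d the gain exceeds the cost.\<close>
  define \<kappa> where "\<kappa> = min 1 (real m * c / (2 * (6 * real m + 2 * \<alpha>)))"
  have \<kappa>: "0 < \<kappa>" "\<kappa> \<le> 1" "\<kappa> * (6 * real m + 2 * \<alpha>) < real m * c"
  proof -
    have p: "0 < 6 * real m + 2 * \<alpha>" using m \<alpha> by simp
    show "0 < \<kappa>" "\<kappa> \<le> 1" using p c(1) m by (auto simp: \<kappa>_def)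
    have "\<kappa> * (6 * real m + 2 * \<alpha>) \<le> real m * c / (2 * (6 * real m + 2 * \<alpha>)) * (6 * real m + 2 * \<alpha>)"
      using p by (intro mult_right_mono) (auto simp: \<kappa>_def)
    also have "\<dots> = real m * c / 2"
    proof -
      have "x / (2 * P) * P = x / 2" if "0 < P" for x P :: real using that by simp
      then show ?thesis using p by blast
    qed
    also have "\<dots> < real m * c" using c(1) m by simp
    finally show "\<kappa> * (6 * real m + 2 * \<alpha>) < real m * c" .
  qed
  \<comment> \<open>Bounds d (s + 6) for the slope parameter s at depth
    \<open>b2 = \<kappa> * d\<close>, which is of order 1 / d.\<close>
  define B where "B = (a0 + 1) * (a0 + 7) / \<kappa> + 6"
  have B: "0 < B" using \<kappa> a0 by (simp add: B_def add_pos_pos)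
  \<comment> \<open>Makes the half-width at depth \<open>b2\<close>, at least sqrt 6 / sqrt(s + 6),
    exceed m d, which bounds the loss of the m half-periods.\<close>
  define d where "d = min 1 (3 / ((real m)\<^sup>2 * B))"
  have d: "0 < d" "d \<le> 1" "(real m)\<^sup>2 * (d * B) < 6"
  proof -
    have p: "0 < (real m)\<^sup>2 * B" using B m by simp
    show "0 < d" "d \<le> 1" using p by (auto simp: d_def)
    have "(real m)\<^sup>2 * (d * B) = d * ((real m)\<^sup>2 * B)" by simp
    also have "\<dots> \<le> 3 / ((real m)\<^sup>2 * B) * ((real m)\<^sup>2 * B)" using p by (intro mult_right_mono) (auto simp: d_def)
    also have "\<dots> = 3"
    proof -
      have "3 / P * P = 3" if "0 < P" for P :: real using that by simp
      from this[OF p] show ?thesis .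
    qed
    finally show "(real m)\<^sup>2 * (d * B) < 6" by simp
  qed
  define a where "a = a0 + d"
  define b2 where "b2 = \<kappa> * d"
  have a: "0 < a" using a0 d by (simp add: a_def)
  have b2: "0 < b2" "b2 \<le> 1" "b2 \<le> d" using \<kappa> d by (auto simp: b2_def mult_le_one)
  have reg: "period_region a b" if "0 \<le> b" "b \<le> 1" for b using that a by (simp add: period_region_def)
  have hi: "\<alpha> < extra_width m a b2"
  proof -
    define s where "s = slope_neg a b2"
    have s0: "0 < s" unfolding s_def using b2 a by (intro slope_neg_pos reg) auto
    have "s \<le> (a0 + 1) * (a0 + 7) / b2"
      unfolding s_def slope_neg_def using b2 a0 d by (intro divide_right_mono mult_mono) (auto simp: a_def)
    then have "d * (s + 6) \<le> d * ((a0 + 1) * (a0 + 7) / b2 + 6)" using d by (intro mult_left_mono) auto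
    also have "\<dots> = (a0 + 1) * (a0 + 7) / \<kappa> + 6 * d" using d \<kappa> by (simp add: b2_def field_simps)
    also have "\<dots> \<le> B" using d by (simp add: B_def)
    finally have ds: "d * (s + 6) \<le> B" .
    have "(real m * d)\<^sup>2 * (s + 6) = (real m)\<^sup>2 * (d * (d * (s + 6)))" by (simp add: power2_eq_square)
    also have "\<dots> \<le> (real m)\<^sup>2 * (d * B)" using ds d by (intro mult_left_mono) auto
    also have "\<dots> < 6" by (rule d)
    finally have "sqrt ((real m * d)\<^sup>2 * (s + 6)) < sqrt 6" by simp
    then have "real m * d * sqrt (s + 6) < sqrt 6" using d by (simp add: real_sqrt_mult)
    then have "real m * d < sqrt 6 / sqrt (s + 6)" using s0 by (simp add: pos_less_divide_eq)
    also have "\<dots> \<le> half_width (-b2) s"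
      using s0 b2 unfolding s_def by (intro half_width_ge admissible_slope_neg reg) auto
    finally have "real m * d < half_width (-b2) s" .
    moreover have "real m * (half_period a0 0 - d) \<le> real m * half_period a b2"
      using half_period_right_zero_lipschitz[OF a0, of d] half_period_right_zero_le[OF reg[of b2]] b2 d
      by (intro mult_left_mono) (auto simp: a_def)
    ultimately show ?thesis by (simp add: extra_width_def \<alpha>_def s_def algebra_simps)
  qed
  \<comment> \<open>The majorant U is continuous up to b = 0, where it lies below \<alpha> because a
    exceeds \<open>a0\<close>. This yields a small depth at which the total width is too small, and
    the intermediate value theorem applies up to \<open>b2\<close>.\<close>
  obtain b1 where b1: "0 < b1" "b1 < b2" "extra_width m a b1 < \<alpha>"
  proof -
    define U where "U b = real m * half_period a b + 2 * sqrt (b / a)" for b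
    have "continuous_on {0..b2} U"
      unfolding U_def[abs_def] using b2 a
      by (intro continuous_intros continuous_on_half_period(1)[of _ "\<lambda>_. a" "\<lambda>b. b"] reg) auto
    then have "(U \<longlongrightarrow> U 0) (at 0 within {0..b2})" using b2 by (auto simp: continuous_on_def)
    then have lim: "(U \<longlongrightarrow> U 0) (at_right 0)" using b2 by (simp add: at_within_Icc_at_right)
    have "half_period a 0 < half_period a0 0"
      unfolding a_def using d by (intro half_period_strict_antimono_left r0) auto
    then have "U 0 < \<alpha>" using m by (simp add: U_def \<alpha>_def)
    then have "eventually (\<lambda>b. U b < \<alpha>) (at_right 0)" using lim by (rule order_tendstoD(2)[rotated])
    moreover have "eventually (\<lambda>b. b \<in> {0<..<b2}) (at_right 0)"
      using b2 by (intro eventually_at_right_real)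
    ultimately have "eventually (\<lambda>b. U b < \<alpha> \<and> b \<in> {0<..<b2}) (at_right 0)" by eventually_elim simp
    then obtain b where b: "U b < \<alpha>" "b \<in> {0<..<b2}" using eventually_happens'[OF trivial_limit_at_right_real] by blast
    have "extra_width m a b \<le> U b"
      using half_width_slope_neg_le[of a b] a b b2 by (simp add: extra_width_def U_def)
    then show thesis using that[of b] b by auto
  qed
  have "continuous_on {b1..b2} (extra_width m a)"
    using b1 b2 a by (intro continuous_on_extra(2)[of _ "\<lambda>_. a" "\<lambda>b. b"] continuous_intros) (auto intro!: reg)
  then obtain b where b: "b1 \<le> b" "b \<le> b2" "extra_width m a b = \<alpha>"
    using IVT'[of "extra_width m a" b1 \<alpha> b2] b1 hi by auto
  have b01: "0 < b" "b \<le> 1" using b b1 b2 by auto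
  have region: "period_region a b" using b01 by (intro reg) auto
  have mem: "(a, b) \<in> extra_set m \<alpha>" using a b01 b(3) region by (simp add: extra_set_def)
  have adm: "admissible (-b) (slope_neg a b)" by (rule admissible_slope_neg[OF region b01(1)])
  note sp = slope_neg_pos[OF region a b01(1)]
  have "half_width (-b) (slope_neg a b) \<le> \<alpha>"
    using b(3) half_period_pos[OF region] unfolding extra_width_def
    by (smt (verit) mult_nonneg_nonneg of_nat_0_le_iff)
  then have "- (2 * b * \<alpha>) \<le> - 2 * b * half_width (-b) (slope_neg a b)" using b01 by simp
  also have "\<dots> \<le> hump_flux (-b) (slope_neg a b)" by (rule negative_hump_flux_bounds(2)[OF adm sp b01(1)])
  finally have F: "- (2 * b * \<alpha>) \<le> hump_flux (-b) (slope_neg a b)" .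
  have "period_flux a0 0 + c * d - 6 * b \<le> period_flux a b"
    using c(2)[of d] period_flux_lower[of a b] d a b01 by (simp add: a_def)
  then have "real m * (period_flux a0 0 + c * d - 6 * b) \<le> real m * period_flux a b" by (intro mult_left_mono) auto
  then have ge: "real m * period_flux a0 0 + (d * (real m * c) - b * (6 * real m + 2 * \<alpha>)) \<le> extra_flux m a b"
    using F by (simp add: extra_flux_def algebra_simps)
  have "b * (6 * real m + 2 * \<alpha>) \<le> (\<kappa> * d) * (6 * real m + 2 * \<alpha>)"
    using b(2) m \<alpha> by (intro mult_right_mono) (auto simp: b2_def)
  also have "\<dots> = d * (\<kappa> * (6 * real m + 2 * \<alpha>))" by simp
  also have "\<dots> < d * (real m * c)" using \<kappa>(3) d(1) by (rule mult_strict_left_mono)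
  finally have "real m * period_flux a0 0 < extra_flux m a b" using ge by simp
  with mem show thesis by (rule that)
qed

lemma extra_set_split:
  assumes "(a, b) \<in> extra_set m \<alpha>"
  shows "0 < a" "0 < b" "period_region a b"
    "\<alpha> = real m * half_period a b + half_width (-b) (slope_neg a b)"
    "\<alpha> = (real m + 1) * half_period a b - half_width a (slope_pos a b)"
    "extra_flux m a b = real m * hump_flux a (slope_pos a b) + (real m + 1) * hump_flux (-b) (slope_neg a b)"
    "0 \<le> half_width (-b) (slope_neg a b)" "0 \<le> half_width a (slope_pos a b)"
proof -
  show pos: "0 < a" "0 < b" and region: "period_region a b"
    and 1: "\<alpha> = real m * half_period a b + half_width (-b) (slope_neg a b)"
    using assms by (auto simp: extra_set_def extra_width_def)
  have split: "half_period a b = half_width a (slope_pos a b) + half_width (-b) (slope_neg a b)"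
    "period_flux a b = hump_flux a (slope_pos a b) + hump_flux (-b) (slope_neg a b)"
    using half_period_split[OF region] pos by simp_all
  show "\<alpha> = (real m + 1) * half_period a b - half_width a (slope_pos a b)"
    using 1 split(1) by (simp add: algebra_simps)
  show "extra_flux m a b = real m * hump_flux a (slope_pos a b) + (real m + 1) * hump_flux (-b) (slope_neg a b)"
    unfolding extra_flux_def split(2) by (simp add: algebra_simps)
  show "0 \<le> half_width (-b) (slope_neg a b)" "0 \<le> half_width a (slope_pos a b)"
    using pos region by (auto intro!: half_width_nonneg admissible_slope_neg admissible_slope_pos slope_neg_pos slope_pos_pos)
qed

section \<open>Existence of a maximiser for types (m, m + 1)\<close>

text \<open>For large a the prescribed width keeps 6 + a - 2 b bounded, so b is comparable with a.
  The positive humps are then narrow with flux O(sqrt a); the negative ones take at least half of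
  the width, with flux of order -a, and the total becomes negative.\<close>

lemma extra_amplitude_bounded:
  assumes m: "0 < m" and \<alpha>: "0 < \<alpha>"
  obtains M where "\<And>a b. (a, b) \<in> extra_set m \<alpha> \<Longrightarrow> 0 \<le> extra_flux m a b \<Longrightarrow> a \<le> M"
proof -
  \<comment> \<open>The bound on n = 6 + a - 2 b that follows from 6 U^2 = L^2 n, U \<le> pi/2 and
    \<alpha> \<le> (m + 1) L.\<close>
  define N where "N = 6 * (pi / 2)\<^sup>2 * (real m + 1)\<^sup>2 / \<alpha>\<^sup>2"
  define k0 where "k0 = real m * sqrt 6 * pi / \<alpha>"
  define k1 where "k1 = real m * sqrt 6 * pi + 2 * sqrt 6 * (real m + 1)"
  \<comment> \<open>Beyond 6 and 2 N one has a/4 \<le> b \<le> a; beyond k0^2 the positive humps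
    take at most \<alpha>/2; beyond the last bound -a \<alpha>/4 outweighs k1 sqrt a.\<close>
  define M where "M = max (max 6 (2 * N)) (max (k0\<^sup>2) ((4 * k1 / \<alpha>)\<^sup>2))"
  have k: "0 \<le> k0" "0 \<le> k1" using \<alpha> by (simp_all add: k0_def k1_def)
  have "a \<le> M" if ab: "(a, b) \<in> extra_set m \<alpha>" and fl: "0 \<le> extra_flux m a b" for a b
  proof (rule ccontr)
    assume "\<not> a \<le> M"
    then have aM: "6 < a" "2 * N < a" "k0\<^sup>2 < a" "(4 * k1 / \<alpha>)\<^sup>2 < a" by (auto simp: M_def)
    note sp = extra_set_split[OF ab]
    define n where "n = 6 + a - 2 * b"
    define Ap where "Ap = half_width a (slope_pos a b)"
    define An where "An = half_width (-b) (slope_neg a b)"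
    define r where "r = sqrt a"
    have r: "0 < r" "r * r = a" using sp(1) by (simp_all add: r_def)
    have rk: "k0 < r" "4 * k1 / \<alpha> < r"
      unfolding r_def using k \<alpha> aM by (auto intro!: real_less_rsqrt)
    have L: "0 < half_period a b" by (rule half_period_pos[OF sp(3)])
    have "\<alpha> \<le> (real m + 1) * half_period a b" using sp(5,8) by linarith
    then have "\<alpha>\<^sup>2 \<le> ((real m + 1) * half_period a b)\<^sup>2" using \<alpha> by (intro power_mono) auto
    then have "\<alpha>\<^sup>2 * n \<le> ((real m + 1) * half_period a b)\<^sup>2 * n"
      using half_period_shape(1)[OF sp(3)] by (intro mult_right_mono) (auto simp: n_def)
    also have "\<dots> = (real m + 1)\<^sup>2 * (6 * (shape_U ((a + b) / n))\<^sup>2)"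
      using shape_U_half_period[OF sp(3)] by (simp add: n_def power_mult_distrib)
    also have "\<dots> \<le> (real m + 1)\<^sup>2 * (6 * (pi / 2)\<^sup>2)"
    proof -
      have y: "0 \<le> (a + b) / n" using half_period_shape(2)[OF sp(3)] by (simp add: n_def)
      have "shape_U 0 = pi / 2" by (simp add: shape_U_def)
      then have "shape_U ((a + b) / n) \<le> pi / 2"
        using shape_U_strict_antimono[of 0 "(a + b) / n"] y by (cases "(a + b) / n = 0") auto
      moreover have "0 < shape_U ((a + b) / n)" using y by (intro shape_U_pos) simp
      ultimately show ?thesis by (intro mult_left_mono power_mono) auto
    qed
    also have "\<dots> = \<alpha>\<^sup>2 * N" using \<alpha> by (simp add: N_def)
    finally have n: "n \<le> N" using \<alpha> by (simp add: mult_le_cancel_left)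
    then have b: "a / 4 \<le> b" "b \<le> a"
      using aM sp(3) unfolding n_def period_region_def by linarith+
    have Ap: "real m * Ap \<le> \<alpha> / 2"
    proof -
      have "Ap \<le> sqrt 6 * (pi / 2) / r"
        unfolding Ap_def r_def by (intro positive_hump_bounds slope_pos_pos sp)
      then have "real m * Ap \<le> real m * (sqrt 6 * (pi / 2) / r)" by (intro mult_left_mono) auto
      also have "\<dots> = (k0 * \<alpha>) / (2 * r)" using \<alpha> by (simp add: k0_def)
      also have "\<dots> \<le> \<alpha> / 2" using rk(1) r(1) \<alpha> by (simp add: field_simps)
      finally show ?thesis .
    qed
    have "\<alpha> = real m * Ap + (real m + 1) * An"
      using sp(4,5) unfolding Ap_def An_def by (simp add: algebra_simps)
    then have An: "\<alpha> / 2 \<le> (real m + 1) * An" using Ap by linarith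
    have Fn: "hump_flux (-b) (slope_neg a b) \<le> - 2 * b * An + 2 * sqrt 6 * r"
    proof -
      have "hump_flux (-b) (slope_neg a b) \<le> - 2 * b * An + 2 * sqrt 6 * sqrt b"
        unfolding An_def by (intro negative_hump_flux_bounds admissible_slope_neg slope_neg_pos sp)
      also have "2 * sqrt 6 * sqrt b \<le> 2 * sqrt 6 * r"
        unfolding r_def using b by (intro mult_left_mono real_sqrt_le_mono) auto
      finally show ?thesis by simp
    qed
    have Fp: "hump_flux a (slope_pos a b) \<le> sqrt 6 * pi * r"
      unfolding r_def by (intro positive_hump_bounds slope_pos_pos sp)
    have "extra_flux m a b \<le> real m * (sqrt 6 * pi * r) + (real m + 1) * (- 2 * b * An + 2 * sqrt 6 * r)"
      unfolding sp(6) using Fn Fp by (intro add_mono mult_left_mono) auto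
    also have "\<dots> = k1 * r - 2 * b * ((real m + 1) * An)"
      by (simp add: k1_def algebra_simps)
    also have "\<dots> \<le> k1 * r - 2 * b * (\<alpha> / 2)"
      using An sp(2) by (intro diff_left_mono mult_left_mono) auto
    also have "\<dots> \<le> k1 * r - 2 * (a / 4) * (\<alpha> / 2)"
      using b(1) \<alpha> by (intro diff_left_mono mult_right_mono mult_left_mono) auto
    also have "\<dots> = r * (k1 - r * \<alpha> / 4)" unfolding r(2)[symmetric] by (simp add: algebra_simps)
    also have "\<dots> < 0"
    proof -
      have "k1 - r * \<alpha> / 4 < 0" using rk(2) \<alpha> by (simp add: field_simps)
      then show ?thesis using r(1) by (rule mult_pos_neg[rotated])
    qed
    finally show False using fl by simp
  qed
  then show thesis by (rule that)
qed

text \<open>The superlevel set of the flux at a level X above the edge value at (\<open>a0\<close>,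
  0) is compact, because a limit point on an edge is impossible. Where 6 + a - 2 b tends to 0 the
  half-period diverges. At b = 0 the extra hump vanishes, so a = \<open>a0\<close> and the flux is
  below X. At a = 0 the positive humps vanish, and m + 1 half-periods of at least pi/2 do not fit
  into \<alpha> \<le> m pi/2.\<close>

lemma extra_flux_max:
  assumes m: "0 < m" and a0: "0 \<le> a0"
  defines "\<alpha> \<equiv> real m * half_period a0 0"
  obtains a b where "(a, b) \<in> extra_set m \<alpha>"
    "\<And>a' b'. (a', b') \<in> extra_set m \<alpha> \<Longrightarrow> extra_flux m a' b' \<le> extra_flux m a b"
proof -
  obtain a1 b1 where p1: "(a1, b1) \<in> extra_set m \<alpha>" "real m * period_flux a0 0 < extra_flux m a1 b1"
    using extra_flux_improves[OF m a0] unfolding \<alpha>_def by metis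
  define X where "X = extra_flux m a1 b1"
  have r0: "period_region a0 0" using a0 by (simp add: period_region_def)
  have \<alpha>: "0 < \<alpha>" using half_period_pos[OF r0] m by (simp add: \<alpha>_def)
  have "0 \<le> real m * period_flux a0 0" using period_flux_right_zero_nonneg[OF a0] by simp
  then have X: "real m * period_flux a0 0 < X" "0 \<le> X" using p1(2) by (auto simp: X_def)
  define S where "S = {p \<in> extra_set m \<alpha>. X \<le> extra_flux m (fst p) (snd p)}"
  obtain M where M: "\<And>a b. (a, b) \<in> extra_set m \<alpha> \<Longrightarrow> 0 \<le> extra_flux m a b \<Longrightarrow> a \<le> M"
    by (rule extra_amplitude_bounded[OF m \<alpha>]) blast
  have inS: "0 < a" "0 < b" "period_region a b" "a \<le> M" "b \<le> 3 + M / 2" "(a, b) \<in> extra_set m \<alpha>" "X \<le> extra_flux m a b"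
    if "(a, b) \<in> S" for a b
    using that M[of a b] X(2) extra_set_split(1-3)[of a b m \<alpha>]
    by (auto simp: S_def period_region_def)
  have "(a1, b1) \<in> S" using p1 by (simp add: S_def X_def)
  then have M0: "0 < M" using inS(1,4)[of a1 b1] by simp
  obtain n0 where n0: "0 < n0"
    "\<And>a b. period_region a b \<Longrightarrow> 6 + a - 2 * b < n0 \<Longrightarrow> a + b \<le> M + (3 + M / 2) \<Longrightarrow> \<alpha> < half_period a b"
    by (rule half_period_diverges[of "M + (3 + M / 2)" \<alpha>]) (use M0 in auto)
  have n_ge: "n0 \<le> 6 + a - 2 * b" if "(a, b) \<in> S" for a b
  proof (rule ccontr)
    assume "\<not> ?thesis"
    then have "\<alpha> < half_period a b" using inS[OF that] by (intro n0(2)) auto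
    moreover have "1 * half_period a b \<le> real m * half_period a b"
      using m half_period_pos[OF inS(3)[OF that]] by (intro mult_right_mono) auto
    ultimately show False using extra_set_split(4,7)[OF inS(6)[OF that]] by linarith
  qed
  have lim_mem: "l \<in> S" if f: "\<And>n. f n \<in> S" and l: "f \<longlonglongrightarrow> l" for f :: "nat \<Rightarrow> real \<times> real" and l
  proof -
    define a where "a n = fst (f n)" for n
    define b where "b n = snd (f n)" for n
    define u where "u = fst l"
    define v where "v = snd l"
    have au: "a \<longlonglongrightarrow> u" and bv: "b \<longlonglongrightarrow> v"
      using l unfolding a_def[abs_def] b_def[abs_def] u_def v_def by (auto intro: tendsto_fst tendsto_snd)
    have S: "(a n, b n) \<in> S" for n using f[of n] by (simp add: a_def b_def)
    note T = inS[OF S]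
    note sp = extra_set_split[OF T(6)]
    have u0: "0 \<le> u" by (rule tendsto_lowerbound[OF au]) (use T(1) in \<open>auto intro: less_imp_le always_eventually\<close>)
    have v0: "0 \<le> v" by (rule tendsto_lowerbound[OF bv]) (use T(2) in \<open>auto intro: less_imp_le always_eventually\<close>)
    have "(\<lambda>n. 6 + a n - 2 * b n) \<longlonglongrightarrow> 6 + u - 2 * v" by (intro tendsto_intros au bv)
    then have "n0 \<le> 6 + u - 2 * v"
      by (rule tendsto_lowerbound) (use n_ge[OF S] in \<open>auto intro: always_eventually\<close>)
    then have region: "period_region u v" using u0 v0 n0(1) by (simp add: period_region_def)
    let ?R = "{z. period_region (fst z) (snd z)}"
    have ab: "(\<lambda>n. (a n, b n)) \<longlonglongrightarrow> (u, v)" by (intro tendsto_Pair au bv)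
    have "continuous_on ?R (\<lambda>z. half_period (fst z) (snd z))" "continuous_on ?R (\<lambda>z. period_flux (fst z) (snd z))"
      by (intro continuous_on_half_period continuous_intros; simp)+
    from this[THEN continuous_on_tendsto_compose, OF ab]
    have L: "(\<lambda>n. half_period (a n) (b n)) \<longlonglongrightarrow> half_period u v"
      and P: "(\<lambda>n. period_flux (a n) (b n)) \<longlonglongrightarrow> period_flux u v"
      using region T(3) by auto
    have mL: "real m * half_period u v \<le> \<alpha>"
    proof (rule tendsto_upperbound)
      show "(\<lambda>n. real m * half_period (a n) (b n)) \<longlonglongrightarrow> real m * half_period u v"
        by (intro tendsto_intros L)
      show "\<forall>\<^sub>F n in sequentially. real m * half_period (a n) (b n) \<le> \<alpha>"
        using sp(4,7) by (intro always_eventually allI) (smt (verit))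
    qed simp
    have half0: "half_period a0 0 \<le> pi / 2"
      using half_period_0 half_period_strict_antimono_left[of 0 0 a0] a0
      by (cases "a0 = 0") (auto simp: period_region_def)
    have v_pos: "0 < v"
    proof (rule ccontr)
      assume "\<not> 0 < v"
      then have v: "v = 0" using v0 by simp
      have "u = a0"
      proof (cases "u = 0")
        \<comment> \<open>At the corner there is no control of the ratio b / a; there the
          half-period pi/2 by itself forces \<open>a0 = 0\<close>.\<close>
        case True
        then have "real m * (pi / 2) \<le> real m * half_period a0 0" using mL v half_period_0 by (simp add: \<alpha>_def)
        then have "pi / 2 \<le> half_period a0 0" using m by simp
        then show ?thesis
          using True half_period_strict_antimono_left[of 0 0 a0] a0 half_period_0
          by (cases "a0 = 0") (auto simp: period_region_def)
      next
        case False
        have "(\<lambda>n. real m * half_period (a n) (b n) + 2 * sqrt (b n / a n)) \<longlonglongrightarrow> real m * half_period u v + 2 * sqrt (v / u)"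
          by (intro tendsto_intros L au bv False)
        moreover have "\<forall>\<^sub>F n in sequentially. \<alpha> \<le> real m * half_period (a n) (b n) + 2 * sqrt (b n / a n)"
        proof -
          have "\<forall>\<^sub>F n in sequentially. b n < 1" using bv v by (intro order_tendstoD(2)) auto
          then show ?thesis
          proof eventually_elim
            case (elim n)
            then show ?case
              using half_width_slope_neg_le[OF T(1) T(2), of n] sp(4)[of n] by simp
          qed
        qed
        ultimately have "\<alpha> \<le> real m * half_period u v + 2 * sqrt (v / u)"
          by (rule tendsto_lowerbound) simp
        then have "real m * half_period u 0 = real m * half_period a0 0" using mL v by (simp add: \<alpha>_def)
        then have "half_period u 0 = half_period a0 0" using m by simp
        then show ?thesis
          using half_period_strict_antimono_left[of u 0 a0] half_period_strict_antimono_left[of a0 0 u] u0 a0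
          by (cases u a0 rule: linorder_cases) (auto simp: period_region_def)
      qed
      have "X \<le> real m * period_flux u v"
      proof (rule tendsto_lowerbound)
        show "(\<lambda>n. real m * period_flux (a n) (b n)) \<longlonglongrightarrow> real m * period_flux u v"
          by (intro tendsto_intros P)
        have "X \<le> real m * period_flux (a n) (b n)" for n
          using T(7)[of n] negative_hump_flux_bounds(3)[OF admissible_slope_neg[OF T(3) T(2)] slope_neg_pos[OF T(3) T(1) T(2)] T(2), of n]
          by (simp add: extra_flux_def)
        then show "\<forall>\<^sub>F n in sequentially. X \<le> real m * period_flux (a n) (b n)" by simp
      qed simp
      then show False using X(1) v \<open>u = a0\<close> by simp
    qed
    have u_pos: "0 < u"
    proof (rule ccontr)
      assume "\<not> 0 < u"
      then have u: "u = 0" using u0 by simp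
      have nz: "sqrt (v * (6 + u - v)) \<noteq> 0" using v_pos region u by (simp add: period_region_def)
      have "(\<lambda>n. (real m + 1) * half_period (a n) (b n) - sqrt 6 * sqrt (a n) / sqrt (b n * (6 + a n - b n)))
        \<longlonglongrightarrow> (real m + 1) * half_period u v - sqrt 6 * sqrt u / sqrt (v * (6 + u - v))"
        by (intro tendsto_intros L au bv nz)
      moreover have "(real m + 1) * half_period (a n) (b n) - sqrt 6 * sqrt (a n) / sqrt (b n * (6 + a n - b n)) \<le> \<alpha>" for n
        using half_width_slope_pos_le[OF T(3) T(1) T(2), of n] sp(5)[of n] by simp
      ultimately have "(real m + 1) * half_period u v - sqrt 6 * sqrt u / sqrt (v * (6 + u - v)) \<le> \<alpha>"
        by (intro tendsto_upperbound[of _ _ sequentially]) auto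
      then have "(real m + 1) * half_period 0 v \<le> \<alpha>" by (simp add: u)
      also have "\<dots> \<le> real m * (pi / 2)" unfolding \<alpha>_def using half0 by (intro mult_left_mono) auto
      also have "\<dots> < (real m + 1) * (pi / 2)" by (simp add: distrib_right)
      finally have "half_period 0 v < pi / 2" using m by (simp add: mult_less_cancel_left)
      moreover have "half_period 0 0 < half_period 0 v"
        using v_pos region u by (intro half_period_strict_mono_right) auto
      ultimately show False using half_period_0 by simp
    qed
    let ?E = "{z. 0 < fst z \<and> 0 < snd z \<and> period_region (fst z) (snd z)}"
    have "continuous_on ?E (\<lambda>z. extra_width m (fst z) (snd z))" "continuous_on ?E (\<lambda>z. extra_flux m (fst z) (snd z))"
      by (intro continuous_on_extra continuous_intros; simp)+
    from this[THEN continuous_on_tendsto_compose, OF ab]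
    have W: "(\<lambda>n. extra_width m (a n) (b n)) \<longlonglongrightarrow> extra_width m u v"
      and F: "(\<lambda>n. extra_flux m (a n) (b n)) \<longlonglongrightarrow> extra_flux m u v"
      using region T(1-3) u_pos v_pos by auto
    have "extra_width m (a n) (b n) = \<alpha>" for n using T(6)[of n] by (simp add: extra_set_def)
    then have "extra_width m u v = \<alpha>" using W by (simp add: LIMSEQ_const_iff)
    moreover have "X \<le> extra_flux m u v"
      by (rule tendsto_lowerbound[OF F]) (use T(7) in auto)
    ultimately show "l \<in> S"
      using region u_pos v_pos by (auto simp: S_def extra_set_def u_def v_def case_prod_unfold)
  qed
  have "closed S" unfolding closed_sequential_limits using lim_mem by blast
  moreover have "bounded S"
  proof (rule bounded_subset)
    show "bounded ({0..M} \<times> {0..3 + M / 2})" by (intro bounded_Times bounded_closed_interval)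
    show "S \<subseteq> {0..M} \<times> {0..3 + M / 2}" using inS by (auto simp: less_imp_le)
  qed
  ultimately have "compact S" by (simp add: compact_eq_bounded_closed)
  moreover have "continuous_on S (\<lambda>z. extra_flux m (fst z) (snd z))"
    using inS(1-3) by (intro continuous_on_extra continuous_intros) auto
  moreover have "S \<noteq> {}" using \<open>(a1, b1) \<in> S\<close> by auto
  ultimately have "\<exists>p\<in>S. \<forall>q\<in>S. extra_flux m (fst q) (snd q) \<le> extra_flux m (fst p) (snd p)"
    by (intro continuous_attains_sup)
  then obtain p where p: "p \<in> S" "\<And>q. q \<in> S \<Longrightarrow> extra_flux m (fst q) (snd q) \<le> extra_flux m (fst p) (snd p)"
    by blast
  show thesis
  proof (rule that[of "fst p" "snd p"])
    show "(fst p, snd p) \<in> extra_set m \<alpha>" using p(1) by (simp add: S_def)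
    fix a' b' assume q: "(a', b') \<in> extra_set m \<alpha>"
    show "extra_flux m a' b' \<le> extra_flux m (fst p) (snd p)"
    proof (cases "X \<le> extra_flux m a' b'")
      case True
      then show ?thesis using p(2)[of "(a', b')"] q by (simp add: S_def)
    next
      case False
      then show ?thesis using p(1) by (simp add: S_def)
    qed
  qed
qed

section \<open>The maximum fluxes\<close>

lemma right_zero_hump:
  assumes "0 < a"
  shows "admissible a 0" "half_width a 0 = half_period a 0" "hump_flux a 0 = period_flux a 0"
  using half_period_split[of a 0] assms by (simp_all add: admissible_def period_region_def slope_pos_def)

lemma left_zero_hump:
  assumes "0 < b" "period_region 0 b"
  shows "admissible (-b) 0" "half_width (-b) 0 = half_period 0 b" "hump_flux (-b) 0 = period_flux 0 b"
  using half_period_split[OF assms(2)] assms by (simp_all add: admissible_def period_region_def slope_neg_def)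

lemma ss_solution_right_zero:
  assumes "0 < a" "0 < m" "\<alpha> = real m * half_period a 0" "\<alpha> < pi"
  obtains u p where "ss_solution \<alpha> u p" "has_type \<alpha> u m 0" "flux \<alpha> u = real m * period_flux a 0"
    "(profile u has_real_derivative 0) (at \<alpha> within {-\<alpha>..\<alpha>})"
    "(profile u has_real_derivative 0) (at (-\<alpha>) within {-\<alpha>..\<alpha>})"
proof -
  have s: "slope_pos a 0 = 0" by (simp add: slope_pos_def)
  show thesis
    by (rule ss_solution_exists[of a 0 m m 0 \<alpha>])
      (use assms right_zero_hump[OF assms(1)] that in \<open>auto simp: s period_region_def\<close>)
qed

lemma ss_solution_left_zero:
  assumes "0 < b" "period_region 0 b" "\<alpha> = half_period 0 b" "\<alpha> < pi"
  obtains u p where "ss_solution \<alpha> u p" "has_type \<alpha> u 0 1" "flux \<alpha> u = period_flux 0 b"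
    "(profile u has_real_derivative 0) (at \<alpha> within {-\<alpha>..\<alpha>})"
    "(profile u has_real_derivative 0) (at (-\<alpha>) within {-\<alpha>..\<alpha>})"
proof -
  have s: "slope_neg 0 b = 0" by (simp add: slope_neg_def)
  show thesis
    by (rule ss_solution_exists[of 0 b 1 0 1 \<alpha>])
      (use assms left_zero_hump[OF assms(1,2)] that in \<open>auto simp: s\<close>)
qed

lemma max_flux_one_positive:
  assumes "0 < a" "\<alpha> = half_period a 0" "\<alpha> < pi"
  shows "max_flux \<alpha> 1 0 = ereal (period_flux a 0)"
proof (rule max_flux_attained)
  have \<alpha>: "0 < \<alpha>" using assms by (simp add: half_period_pos period_region_def)
  obtain u p where "ss_solution \<alpha> u p" "has_type \<alpha> u 1 0" "flux \<alpha> u = real 1 * period_flux a 0"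
    by (rule ss_solution_right_zero[of a 1 \<alpha>]) (use assms in auto)
  then show "period_flux a 0 \<in> fluxes \<alpha> 1 0" unfolding fluxes_def by (auto intro!: exI[of _ u])
  fix \<Phi> assume "\<Phi> \<in> fluxes \<alpha> 1 0"
  then obtain a' s where "admissible a' s" "half_width a' s = \<alpha>" "hump_flux a' s = \<Phi>"
    using fluxes_one_sign(1)[OF \<alpha> assms(3)] by blast
  then show "\<Phi> \<le> period_flux a 0"
    using hump_flux_le_zero_slope[of a' s a] right_zero_hump[OF assms(1)] assms(2) by simp
qed

lemma max_flux_one_negative:
  assumes "0 < b" "period_region 0 b" "\<alpha> = half_period 0 b" "\<alpha> < pi"
  shows "max_flux \<alpha> 0 1 = ereal (period_flux 0 b)"
proof (rule max_flux_attained)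
  have \<alpha>: "0 < \<alpha>" using assms by (simp add: half_period_pos)
  obtain u p where "ss_solution \<alpha> u p" "has_type \<alpha> u 0 1" "flux \<alpha> u = period_flux 0 b"
    using ss_solution_left_zero[OF assms] by blast
  then show "period_flux 0 b \<in> fluxes \<alpha> 0 1" unfolding fluxes_def by (auto intro!: exI[of _ u])
  fix \<Phi> assume "\<Phi> \<in> fluxes \<alpha> 0 1"
  then obtain b' s where "admissible (-b') s" "half_width (-b') s = \<alpha>" "hump_flux (-b') s = \<Phi>"
    using fluxes_one_sign(2)[OF \<alpha> assms(4)] by blast
  then show "\<Phi> \<le> period_flux 0 b"
    using hump_flux_le_zero_slope[of "-b'" s "-b"] left_zero_hump[OF assms(1,2)] assms(3) by simp
qed

text \<open>The depth b is fixed and the width is tuned by the maximum a of the surrounding periodic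
  profile. As a tends to 0 the half-width approaches the half-period at (0, b), which exceeds pi/2;
  as a grows it tends to 0.\<close>

lemma negative_hump_of_width_ex:
  assumes \<alpha>: "0 < \<alpha>" "\<alpha> \<le> pi / 2" and b: "0 < b" "b \<le> 1"
  obtains a where "0 < a" "half_width (-b) (slope_neg a b) = \<alpha>"
proof -
  let ?h = "\<lambda>a. half_width (-b) (slope_neg a b)"
  \<comment> \<open>A lower bound for the half-width that is continuous up to a = 0.\<close>
  let ?g = "\<lambda>a. half_period a b - sqrt 6 * sqrt a / sqrt (b * (6 + a - b))"
  have region: "period_region a b" if "0 \<le> a" for a using that b by (simp add: period_region_def)
  have "continuous_on {0..} ?g"
  proof (intro continuous_on_diff continuous_on_half_period)
    show "continuous_on {0..} (\<lambda>a. sqrt 6 * sqrt a / sqrt (b * (6 + a - b)))"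
      using b by (intro continuous_intros) auto
  qed (use region in \<open>auto intro: continuous_intros\<close>)
  then have "(?g \<longlongrightarrow> ?g 0) (at 0 within {0..})" unfolding continuous_on by (rule bspec) simp
  moreover have "pi / 2 < ?g 0"
    using half_period_strict_mono_right[of 0 b 0] b region[of 0] half_period_0 by simp
  ultimately have "\<forall>\<^sub>F a in at 0 within {0..}. pi / 2 < ?g a" by (rule order_tendstoD(1))
  then obtain d where d: "0 < d" "\<And>a. 0 \<le> a \<Longrightarrow> a \<noteq> 0 \<Longrightarrow> dist a 0 < d \<Longrightarrow> pi / 2 < ?g a"
    unfolding eventually_at by auto
  define a1 where "a1 = d / 2"
  have a1: "0 < a1" using d by (simp add: a1_def)
  have "pi / 2 < ?g a1" using d a1 by (intro d(2)) (auto simp: a1_def dist_real_def)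
  moreover have "?g a1 \<le> ?h a1"
    using half_width_slope_pos_le[of a1 b] half_period_split(1)[of a1 b] a1 b region[of a1] by simp
  ultimately have 1: "\<alpha> \<le> ?h a1" using \<alpha> by linarith
  \<comment> \<open>At this a the bound 2 sqrt(b / a) on the half-width is at most \<alpha>.\<close>
  define a2 where "a2 = max a1 (4 * b / \<alpha>\<^sup>2)"
  have a2: "0 < a2" "a1 \<le> a2" using a1 by (auto simp: a2_def)
  have "4 * b / \<alpha>\<^sup>2 \<le> a2" by (simp add: a2_def)
  then have "b / a2 \<le> (\<alpha> / 2)\<^sup>2" using a2 \<alpha> by (simp add: field_simps power2_eq_square)
  then have "sqrt (b / a2) \<le> \<alpha> / 2" using \<alpha> by (intro real_le_lsqrt) auto
  then have 2: "?h a2 \<le> \<alpha>" using half_width_slope_neg_le[OF a2(1) b] by linarith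
  have "continuous_on {a1..a2} ?h"
    by (rule continuous_on_extra(1)[where f = "\<lambda>a. a" and g = "\<lambda>_. b"])
      (use a1 b region in \<open>auto intro: continuous_intros\<close>)
  then obtain a where "a1 \<le> a" "?h a = \<alpha>"
    using IVT2'[of ?h a2 \<alpha> a1] 1 2 a2 by blast
  then show thesis using that[of a] a1 by simp
qed

text \<open>Negative humps without slope have half-width above pi/2, so here s > 0 and the flux is
  at most 0. A hump of depth b has flux at least -2 b \<alpha>, and arbitrarily shallow humps of
  this width exist.\<close>

lemma max_flux_one_negative_narrow:
  assumes \<alpha>: "0 < \<alpha>" "\<alpha> \<le> pi / 2"
  shows "max_flux \<alpha> 0 1 = ereal 0"
proof (rule max_flux_eqI)
  have pi: "\<alpha> < pi" using \<alpha> pi_gt_zero by linarith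
  fix \<Phi> assume "\<Phi> \<in> fluxes \<alpha> 0 1"
  then obtain b s where b: "0 < b" "admissible (-b) s" "half_width (-b) s = \<alpha>" "hump_flux (-b) s = \<Phi>"
    using fluxes_one_sign(2)[OF \<alpha>(1) pi] by blast
  have "s \<noteq> 0"
  proof
    assume s: "s = 0"
    then have r: "period_region 0 b" using b by (simp add: admissible_def period_region_def)
    then have "pi / 2 < half_period 0 b"
      using half_period_strict_mono_right[of 0 b 0] b half_period_0 by simp
    then show False using left_zero_hump[OF b(1) r] s b(3) \<alpha> by simp
  qed
  then have "0 < s" using b(2) by (simp add: admissible_def)
  then show "\<Phi> \<le> 0" using negative_hump_flux_bounds(3)[OF b(2) _ b(1)] b(4) by simp
next
  have pi: "\<alpha> < pi" using \<alpha> pi_gt_zero by linarith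
  fix \<epsilon> :: real assume \<epsilon>: "0 < \<epsilon>"
  \<comment> \<open>Depth at most \<epsilon> / (4 \<alpha>) gives 2 b \<alpha> \<le> \<epsilon> /
    2.\<close>
  define b where "b = min 1 (\<epsilon> / (4 * \<alpha>))"
  have b: "0 < b" "b \<le> 1" using \<epsilon> \<alpha> by (auto simp: b_def)
  have "b \<le> \<epsilon> / (4 * \<alpha>)" by (simp add: b_def)
  then have b\<epsilon>: "2 * b * \<alpha> < \<epsilon>" using \<alpha> \<epsilon> by (simp add: field_simps)
  obtain a where a: "0 < a" "half_width (-b) (slope_neg a b) = \<alpha>"
    using negative_hump_of_width_ex[OF \<alpha> b] .
  have region: "period_region a b" using a b by (simp add: period_region_def)
  \<comment> \<open>With m = 0 the window holds just the negative hump around phase 0; a enters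
    through its slope.\<close>
  obtain u p where u: "ss_solution \<alpha> u p" "has_type \<alpha> u 0 1" "flux \<alpha> u = hump_flux (-b) (slope_neg a b)"
    by (rule ss_solution_exists[of a b 1 0 1 \<alpha>]) (use region a b pi in auto)
  have "- 2 * b * \<alpha> \<le> flux \<alpha> u"
    using negative_hump_flux_bounds(2)[OF admissible_slope_neg[OF region b(1)] slope_neg_pos[OF region a(1) b(1)] b(1)]
      a(2) u(3) by simp
  then show "\<exists>\<Phi>\<in>fluxes \<alpha> 0 1. 0 - \<epsilon> < \<Phi>"
    using u(1,2) b\<epsilon> by (intro bexI[of _ "flux \<alpha> u"]) (auto simp: fluxes_def)
qed

text \<open>The boundary comparison gives the upper bound. It is approached because the boundary
  point is a limit of interior ones with the same half-period and the flux is continuous up to the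
  boundary. The corner a0 = b0 = 0 is included and serves the half-period pi/2.\<close>

lemma max_flux_equal_numbers:
  assumes m: "0 < m" and region: "period_region a0 b0" and zero: "a0 = 0 \<or> b0 = 0"
    and \<alpha>: "\<alpha> = real m * half_period a0 b0" "\<alpha> < pi"
  shows "max_flux \<alpha> m m = ereal (real m * period_flux a0 b0)"
proof (rule max_flux_eqI)
  have \<alpha>0: "0 < \<alpha>" using half_period_pos[OF region] m \<alpha>(1) by simp
  note two_signs = fluxes_two_signs[OF \<alpha>0 \<alpha>(2) m disjI1[OF refl], simplified]
  {
    fix \<Phi> assume "\<Phi> \<in> fluxes \<alpha> m m"
    then obtain a b where ab: "period_region a b" "\<alpha> = real m * half_period a b" "\<Phi> = real m * period_flux a b"
      unfolding two_signs by blast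
    have "half_period a b = half_period a0 b0" using ab(2) \<alpha>(1) m by simp
    then have "period_flux a b \<le> period_flux a0 b0"
      using zero region period_flux_le_right_zero[OF ab(1)] period_flux_le_left_zero[OF ab(1)]
      by (auto simp: period_region_def)
    then show "\<Phi> \<le> real m * period_flux a0 b0" unfolding ab(3) by (intro mult_left_mono) auto
  }
  fix \<epsilon> :: real assume \<epsilon>: "0 < \<epsilon>"
  let ?R = "{z. period_region (fst z) (snd z)}"
  have cont: "continuous_on ?R (\<lambda>z. period_flux (fst z) (snd z))"
    by (intro continuous_on_half_period continuous_intros) simp
  have mem: "(a0, b0) \<in> ?R" "0 < \<epsilon> / real m" using region \<epsilon> m by simp_all
  have "\<exists>\<delta>>0. \<forall>z\<in>?R. dist z (a0, b0) < \<delta> \<longrightarrow>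
      dist (period_flux (fst z) (snd z)) (period_flux (fst (a0, b0)) (snd (a0, b0))) < \<epsilon> / real m"
    by (rule cont[unfolded continuous_on_iff, rule_format, OF mem])
  then obtain \<delta> where \<delta>: "0 < \<delta>" "\<And>z. z \<in> ?R \<Longrightarrow> dist z (a0, b0) < \<delta> \<Longrightarrow>
      dist (period_flux (fst z) (snd z)) (period_flux a0 b0) < \<epsilon> / real m"
    unfolding fst_conv snd_conv by blast
  define n where "n = 6 + a0 - 2 * b0"
  \<comment> \<open>The nearby point is at distance below 3 d, hence below \<delta>, and 3 d < n
    keeps it in the region.\<close>
  define d where "d = min (\<delta> / 4) (n / 6)"
  have n: "0 < n" using region by (simp add: n_def period_region_def)
  have d: "0 < d" "4 * d \<le> \<delta>" "3 * d < n" using \<delta>(1) n by (auto simp: d_def min_def)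
  obtain b where b: "b0 < b" "b < b0 + 2 * d" "period_region (a0 + d) b" "half_period (a0 + d) b = half_period a0 b0"
    using half_period_nearby[OF region d(1)] d(3) unfolding n_def by blast
  have "dist (a0 + d, b) (a0, b0) \<le> \<bar>d\<bar> + \<bar>b - b0\<bar>"
    unfolding dist_Pair_Pair dist_real_def using sqrt_sum_squares_le_sum_abs[of d "b - b0"] by simp
  also have "\<dots> < \<delta>" using b d by simp
  finally have "dist (period_flux (a0 + d) b) (period_flux a0 b0) < \<epsilon> / real m"
    using \<delta>(2)[of "(a0 + d, b)"] b(3) by simp
  then have "period_flux a0 b0 - \<epsilon> / real m < period_flux (a0 + d) b" by (simp add: dist_real_def)
  then have "real m * (period_flux a0 b0 - \<epsilon> / real m) < real m * period_flux (a0 + d) b"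
    using m by (intro mult_strict_left_mono) auto
  moreover have "real m * (period_flux a0 b0 - \<epsilon> / real m) = real m * period_flux a0 b0 - \<epsilon>"
    using m by (simp add: right_diff_distrib)
  moreover have "real m * period_flux (a0 + d) b \<in> fluxes \<alpha> m m"
    unfolding two_signs using region b d \<alpha>(1)
    by (intro exI[of _ "a0 + d"] exI[of _ b] conjI) (auto simp: period_region_def)
  ultimately show "\<exists>\<Phi>\<in>fluxes \<alpha> m m. real m * period_flux a0 b0 - \<epsilon> < \<Phi>" by auto
qed

text \<open>The condition \<alpha> \<le> m pi/2 writes \<alpha> as m half-periods of a profile with
  b = 0 and maximum \<open>a0\<close>, the edge point that the maximiser has to beat.\<close>

lemma max_flux_attained_extra_negative:
  assumes m: "0 < m" and \<alpha>: "0 < \<alpha>" "\<alpha> \<le> real m * (pi / 2)" "\<alpha> < pi"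
  shows "\<exists>u p. ss_solution \<alpha> u p \<and> has_type \<alpha> u m (Suc m) \<and> ereal (flux \<alpha> u) = max_flux \<alpha> m (Suc m)"
proof -
  have "\<alpha> / real m \<le> pi / 2" using \<alpha>(2) m by (simp add: field_simps)
  then obtain a0 where a0: "0 \<le> a0" "half_period a0 0 = \<alpha> / real m"
    using half_period_right_zero_ex[of "\<alpha> / real m"] \<alpha>(1) m by auto
  have \<alpha>_eq: "real m * half_period a0 0 = \<alpha>" using a0(2) m by simp
  obtain a b where ab: "(a, b) \<in> extra_set m \<alpha>"
    "\<And>a' b'. (a', b') \<in> extra_set m \<alpha> \<Longrightarrow> extra_flux m a' b' \<le> extra_flux m a b"
    using extra_flux_max[OF m a0(1)] unfolding \<alpha>_eq by blast
  have fl: "\<Phi> \<in> fluxes \<alpha> m (Suc m) \<longleftrightarrow> (\<exists>a b. (a, b) \<in> extra_set m \<alpha> \<and> \<Phi> = extra_flux m a b)" for \<Phi>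
    using fluxes_two_signs[OF \<alpha>(1,3) m disjI2[OF refl], of \<Phi>]
    by (auto simp: extra_set_def extra_width_def extra_flux_def)
  then have mem: "extra_flux m a b \<in> fluxes \<alpha> m (Suc m)" using ab(1) by blast
  have "max_flux \<alpha> m (Suc m) = ereal (extra_flux m a b)"
    using ab(2) by (intro max_flux_attained mem) (auto simp: fl)
  then show ?thesis using mem unfolding fluxes_def by auto
qed

theorem theorem7p1:
  fixes \<alpha> :: real
  assumes "0 < \<alpha>" and "\<alpha> < pi"
  shows
    "(\<alpha> < pi / 2 \<longrightarrow>
        (\<exists>u p. ss_solution \<alpha> u p \<and> has_type \<alpha> u 1 0 \<and> ereal (flux \<alpha> u) = max_flux \<alpha> 1 0 \<and>
           (profile u has_real_derivative 0) (at \<alpha> within {-\<alpha>..\<alpha>}) \<and>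
           (profile u has_real_derivative 0) (at (-\<alpha>) within {-\<alpha>..\<alpha>})))
     \<and> (\<alpha> \<le> pi / 2 \<longrightarrow> max_flux \<alpha> 0 1 = 0)
     \<and> (pi / 2 < \<alpha> \<longrightarrow> max_flux \<alpha> 0 1 < ereal (pi\<^sup>2 / \<alpha> - 4 * \<alpha>))
     \<and> (pi / 2 < \<alpha> \<longrightarrow>
        (\<exists>u p. ss_solution \<alpha> u p \<and> has_type \<alpha> u 0 1 \<and> ereal (flux \<alpha> u) = max_flux \<alpha> 0 1 \<and>
           (profile u has_real_derivative 0) (at \<alpha> within {-\<alpha>..\<alpha>}) \<and>
           (profile u has_real_derivative 0) (at (-\<alpha>) within {-\<alpha>..\<alpha>})))
     \<and> (\<alpha> < pi / 2 \<longrightarrow> max_flux \<alpha> 1 1 = max_flux \<alpha> 1 0)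
     \<and> (pi / 2 \<le> \<alpha> \<longrightarrow> max_flux \<alpha> 1 1 = max_flux \<alpha> 0 1)
     \<and> (\<forall>m::nat. 2 \<le> m \<longrightarrow>
        (\<exists>u p. ss_solution \<alpha> u p \<and> has_type \<alpha> u m 0 \<and> ereal (flux \<alpha> u) = max_flux \<alpha> m m \<and>
           (profile u has_real_derivative 0) (at \<alpha> within {-\<alpha>..\<alpha>}) \<and>
           (profile u has_real_derivative 0) (at (-\<alpha>) within {-\<alpha>..\<alpha>})))
     \<and> (\<alpha> \<le> pi / 2 \<longrightarrow>
        (\<exists>u p. ss_solution \<alpha> u p \<and> has_type \<alpha> u 1 2 \<and> ereal (flux \<alpha> u) = max_flux \<alpha> 1 2))
     \<and> (\<forall>m::nat. 2 \<le> m \<longrightarrow>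
        (\<exists>u p. ss_solution \<alpha> u p \<and> has_type \<alpha> u m (m + 1) \<and>
           ereal (flux \<alpha> u) = max_flux \<alpha> m (m + 1)))"
proof -
  note \<alpha> = assms
  have pi2: "pi / 2 < pi" using pi_gt_zero by linarith
  have 1: "\<exists>u p. ss_solution \<alpha> u p \<and> has_type \<alpha> u m 0 \<and> ereal (flux \<alpha> u) = ereal (real m * period_flux a 0) \<and>
      (profile u has_real_derivative 0) (at \<alpha> within {-\<alpha>..\<alpha>}) \<and>
      (profile u has_real_derivative 0) (at (-\<alpha>) within {-\<alpha>..\<alpha>})"
    if "0 < a" "0 < m" "\<alpha> = real m * half_period a 0" for a m
    by (rule ss_solution_right_zero[OF that \<alpha>(2)]) fastforce
  have narrow: "\<exists>a>0. \<alpha> = real 1 * half_period a 0" if "\<alpha> < pi / 2"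
    by (rule half_period_right_zero_ex[OF \<alpha>(1) less_imp_le[OF that]]) (use that in auto)
  have wide: "\<exists>b>0. period_region 0 b \<and> \<alpha> = half_period 0 b" if "pi / 2 < \<alpha>"
    by (rule half_period_left_zero_ex[OF that]) auto
  show ?thesis
  proof (intro conjI impI allI)
    assume "\<alpha> < pi / 2"
    then obtain a where a: "0 < a" "\<alpha> = real 1 * half_period a 0" using narrow by blast
    then show "\<exists>u p. ss_solution \<alpha> u p \<and> has_type \<alpha> u 1 0 \<and> ereal (flux \<alpha> u) = max_flux \<alpha> 1 0 \<and>
        (profile u has_real_derivative 0) (at \<alpha> within {-\<alpha>..\<alpha>}) \<and>
        (profile u has_real_derivative 0) (at (-\<alpha>) within {-\<alpha>..\<alpha>})"
      using 1[of a 1] max_flux_one_positive[OF a(1) _ \<alpha>(2)] by simp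
    show "max_flux \<alpha> 1 1 = max_flux \<alpha> 1 0"
      using max_flux_equal_numbers[of 1 a 0 \<alpha>] max_flux_one_positive[OF a(1) _ \<alpha>(2)] a \<alpha>
      by (simp add: period_region_def)
  next
    assume "\<alpha> \<le> pi / 2"
    then show "max_flux \<alpha> 0 1 = 0"
      using max_flux_one_negative_narrow[OF \<alpha>(1)] by (simp add: zero_ereal_def)
  next
    assume "pi / 2 < \<alpha>"
    then obtain b where b: "0 < b" "period_region 0 b" "\<alpha> = half_period 0 b" using wide by blast
    note max = max_flux_one_negative[OF b \<alpha>(2)]
    show "max_flux \<alpha> 0 1 < ereal (pi\<^sup>2 / \<alpha> - 4 * \<alpha>)"
      using period_flux_left_zero_less[OF b(2,1)] unfolding max b(3)[symmetric] by simp
    show "\<exists>u p. ss_solution \<alpha> u p \<and> has_type \<alpha> u 0 1 \<and> ereal (flux \<alpha> u) = max_flux \<alpha> 0 1 \<and>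
        (profile u has_real_derivative 0) (at \<alpha> within {-\<alpha>..\<alpha>}) \<and>
        (profile u has_real_derivative 0) (at (-\<alpha>) within {-\<alpha>..\<alpha>})"
      unfolding max by (rule ss_solution_left_zero[OF b \<alpha>(2)]) fastforce
  next
    assume wide_or_half: "pi / 2 \<le> \<alpha>"
    show "max_flux \<alpha> 1 1 = max_flux \<alpha> 0 1"
    proof (cases "\<alpha> = pi / 2")
      \<comment> \<open>The boundary point is the corner a = b = 0, whose flux 0 is also the maximum
        flux of type (0, 1) in narrow sectors.\<close>
      case True
      then show ?thesis
        using max_flux_equal_numbers[of 1 0 0 \<alpha>] max_flux_one_negative_narrow[OF \<alpha>(1)] \<alpha>
        by (simp add: half_period_0 period_flux_0 period_region_def)
    next
      case False
      then obtain b where b: "0 < b" "period_region 0 b" "\<alpha> = half_period 0 b"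
        using wide wide_or_half by auto
      then show ?thesis
        using max_flux_equal_numbers[of 1 0 b \<alpha>] max_flux_one_negative[OF b \<alpha>(2)] \<alpha>(2) by simp
    qed
  next
    fix m :: nat assume m: "2 \<le> m"
    \<comment> \<open>As \<alpha> < pi, this holds for every m \<ge> 2: the boundary point then has
      b = 0 for each \<alpha>, and type (m, m + 1) falls under the case \<alpha> \<le> m
      pi/2.\<close>
    have m\<alpha>: "\<alpha> / real m < pi / 2"
    proof -
      have "\<alpha> / real m \<le> \<alpha> / 2" using m \<alpha> by (intro divide_left_mono) auto
      then show ?thesis using \<alpha>(2) by linarith
    qed
    obtain a where a: "0 < a" "half_period a 0 = \<alpha> / real m"
      using half_period_right_zero_ex[of "\<alpha> / real m"] m m\<alpha> \<alpha> by auto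
    have eq: "\<alpha> = real m * half_period a 0" using a(2) m by simp
    have "max_flux \<alpha> m m = ereal (real m * period_flux a 0)"
      using max_flux_equal_numbers[of m a 0 \<alpha>] a(1) m \<alpha>(2) eq by (simp add: period_region_def)
    then show "\<exists>u p. ss_solution \<alpha> u p \<and> has_type \<alpha> u m 0 \<and> ereal (flux \<alpha> u) = max_flux \<alpha> m m \<and>
        (profile u has_real_derivative 0) (at \<alpha> within {-\<alpha>..\<alpha>}) \<and>
        (profile u has_real_derivative 0) (at (-\<alpha>) within {-\<alpha>..\<alpha>})"
      using 1[OF a(1) _ eq] m by simp
    have "\<alpha> \<le> real m * (pi / 2)" using m\<alpha> m by (simp add: field_simps)
    then show "\<exists>u p. ss_solution \<alpha> u p \<and> has_type \<alpha> u m (m + 1) \<and> ereal (flux \<alpha> u) = max_flux \<alpha> m (m + 1)"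
      using max_flux_attained_extra_negative[of m \<alpha>] m \<alpha> by simp
  next
    assume "\<alpha> \<le> pi / 2"
    then show "\<exists>u p. ss_solution \<alpha> u p \<and> has_type \<alpha> u 1 2 \<and> ereal (flux \<alpha> u) = max_flux \<alpha> 1 2"
      using max_flux_attained_extra_negative[of 1 \<alpha>] \<alpha> by (simp add: numeral_2_eq_2)
  qed
qed

end
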